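(* Let $k\in\mathbb N$, $k\ge2$, $f\in\mathcal C^{k+1}(\mathbb R)$, $g\in\mathcal C^k(\mathbb R)$ and $(\sigma,\underline u_-,\underline u_+)\in\mathbb R^3$ with $\underline u_+\neq\underline u_-$ satisfy (equilibrium) $g(\underline u_+)=0$ and $g(\underline u_-)=0$; (Rankine–Hugoniot) $f(\underline u_+)-f(\underline u_-)=\sigma(\underline u_+-\underline u_-)$; (strict Oleinik condition) $\sigma>f'(\underline u_+)$, $f'(\underline u_-)>\sigma$, and for every $\tau\in(0,1)$, with $w_\tau=\tau\underline u_-+(1-\tau)\underline u_+$, $$\frac{f(w_\tau)-f(\underline u_-)}{w_\tau-\underline u_-}>\frac{f(w_\tau)-f(\underline u_+)}{w_\tau-\underline u_+};$$ (spectral stability) $g'(\underline u_+)<0$ and $g'(\underline u_-)<0$. Let $\underline U(x)=\underline u_-$ if $x<0$ and $\underline U(x)=\underline u_+$ if $x>0$. Then there exist $\epsilon>0$ and $C_k>0$ such that for any $\psi_0\in\mathbb R$ and any $\tilde v_0\in BUC^k(\mathbb R^\star)$ satisfying $$\|\tilde v_0\|_{L^\infty(\mathbb R^\star)}\le\epsilon\quad\text{and}\quad\|\partial_x\tilde v_0\|_{L^\infty(\mathbb R^\star)}\le\epsilon,$$ there exist $\psi\in\mathcal C^{k+1}([0,\infty))$ and $u\in BUC^k(\Omega^\psi)$ with initial data $\psi(0)=\psi_0$ and $u(0,\cdot)=(\underline U+\tilde v_0)(\cdot-\psi_0)$ such that $u$ is an entropy solution to $\partial_tu+\partial_x(f(u))=g(u)$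 and satisfies, for any $t\ge0$, any $j\in\{0,\dots,k\}$ and each choice of sign $\pm$, $$\|u(t,\cdot+\psi(t))-\underline u_\pm\|_{W^{j,\infty}(\mathbb R^\pm)}\le\|\tilde v_0\|_{W^{j,\infty}(\mathbb R^\pm)}\,C_k\,e^{g'(\underline u_\pm)t},$$ $$\Big|\frac{d^j}{dt^j}\big(\psi'(t)-\sigma\big)\Big|\le\|\tilde v_0\|_{W^{j,\infty}(\mathbb R^\star)}\,C_k\,e^{\max\{g'(\underline u_+),g'(\underline u_-)\}t}.$$
   Context: Notation: $\mathbb R^\star=\mathbb R\setminus\{0\}$; as spatial domains $\mathbb R^+=(0,\infty)$, $\mathbb R^-=(-\infty,0)$. $\Omega^\psi=\big([0,\infty)\times\mathbb R\big)\setminus\{(t,\psi(t)):t\ge0\}$. $BUC^k$ denotes the set of $\mathcal C^k$ functions whose derivatives up to order $k$ are bounded and uniformly continuous. For a set $\Omega$ with several connected components, $BUC^k(\Omega)$ (resp. $W^{k,\infty}(\Omega)$) is the space of functions whose restriction to each connected component $\check\Omega$ of $\Omega$ belongs to $BUC^k(\check\Omega)$ (resp. $W^{k,\infty}(\check\Omega)$), with the corresponding norm. For piecewise smooth $u$, spatial derivatives are the classical derivatives away from the discontinuity curve. Entropy solutions are taken in the sense of Kruzhkov. *)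

theory Defs
  imports "HOL-Analysis.Analysis" "HOL-Probability.Essential_Supremum"
begin

text \<open>
  Derivatives are taken within the domain \<open>S\<close>. The domains of interest are open sets, half-lines
  \<open>[0,\<infinity>)\<close> and relatively open subsets of \<open>[0,\<infinity>) \<times> \<real>\<close>; on these the derivative within \<open>S\<close> is
  unique, and it is the one-sided derivative in \<open>t\<close> at the boundary \<open>t = 0\<close>.
\<close>

definition pderiv_within ::
    "'a::euclidean_space set \<Rightarrow> 'a \<Rightarrow> ('a \<Rightarrow> real) \<Rightarrow> 'a \<Rightarrow> real" where
  "pderiv_within S b f x = frechet_derivative f (at x within S) b"

primrec iter_pderiv ::
    "'a::euclidean_space set \<Rightarrow> 'a list \<Rightarrow> ('a \<Rightarrow> real) \<Rightarrow> 'a \<Rightarrow> real" where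
  "iter_pderiv S [] f = f"
| "iter_pderiv S (b # bs) f = pderiv_within S b (iter_pderiv S bs f)"

definition nderiv :: "real set \<Rightarrow> nat \<Rightarrow> (real \<Rightarrow> real) \<Rightarrow> real \<Rightarrow> real" where
  "nderiv S n f = iter_pderiv S (replicate n 1) f"

definition Ck_on :: "nat \<Rightarrow> 'a::euclidean_space set \<Rightarrow> ('a \<Rightarrow> real) \<Rightarrow> bool" where
  "Ck_on k S f \<longleftrightarrow>
     (\<forall>bs\<in>lists Basis. length bs < k \<longrightarrow> iter_pderiv S bs f differentiable_on S) \<and>
     (\<forall>bs\<in>lists Basis. length bs \<le> k \<longrightarrow> continuous_on S (iter_pderiv S bs f))"

text \<open>On a disconnected domain, uniform continuity is only required on each component.\<close>

definition BUC :: "nat \<Rightarrow> 'a::euclidean_space set \<Rightarrow> ('a \<Rightarrow> real) \<Rightarrow> bool" where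
  "BUC k S f \<longleftrightarrow>
     (\<forall>C\<in>components S. Ck_on k C f \<and>
        (\<forall>bs\<in>lists Basis. length bs \<le> k \<longrightarrow>
           bounded (iter_pderiv C bs f ` C) \<and> uniformly_continuous_on C (iter_pderiv C bs f)))"

definition Linf_norm :: "real set \<Rightarrow> (real \<Rightarrow> real) \<Rightarrow> ereal" where
  "Linf_norm S v = esssup (lebesgue_on S) (\<lambda>x. ereal \<bar>v x\<bar>)"

text \<open>
  Classical derivatives are used; the norm is only applied to functions that are $C^j$ on the open
  set \<open>S\<close>, for which they agree with the weak derivatives on \<open>S\<close>.
\<close>

definition Wkinf_norm :: "nat \<Rightarrow> real set \<Rightarrow> (real \<Rightarrow> real) \<Rightarrow> ereal" where
  "Wkinf_norm j S v = (\<Sum>i\<le>j. Linf_norm S (nderiv S i v))"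

text \<open>Functions of \<open>(t, x)\<close> are functions on \<open>real \<times> real\<close>, time being the first coordinate.\<close>

definition test_function :: "(real \<times> real \<Rightarrow> real) \<Rightarrow> bool" where
  "test_function \<phi> \<longleftrightarrow>
     (\<forall>n. Ck_on n UNIV \<phi>) \<and> compact (closure {p. \<phi> p \<noteq> 0}) \<and>
     closure {p. \<phi> p \<noteq> 0} \<subseteq> {0<..} \<times> UNIV"

text \<open>
  Kruzhkov's definition, for the Cauchy problem
  \<open>\<partial>\<^sub>t u + \<partial>\<^sub>x (f(u)) = g(u)\<close>, \<open>u(0,\<cdot>) = u0\<close> on \<open>(0,\<infinity>) \<times> \<real>\<close>: \<open>u\<close> is bounded and
  measurable, satisfies the entropy inequality for all constants \<open>\<kappa>\<close> and all nonnegative test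
  functions, and attains the initial datum in $L^1_{loc}$ as \<open>t \<rightarrow> 0\<close> outside a null set of times.
  The measurability requirements ensure that the integrals are those of integrable functions
  (Bochner integrals of non-integrable functions being 0 by convention).
\<close>

definition entropy_solution ::
    "(real \<Rightarrow> real) \<Rightarrow> (real \<Rightarrow> real) \<Rightarrow> (real \<Rightarrow> real) \<Rightarrow> (real \<times> real \<Rightarrow> real) \<Rightarrow> bool" where
  "entropy_solution f g u0 u \<longleftrightarrow>
     u \<in> borel_measurable (lebesgue_on ({0<..} \<times> UNIV)) \<and>
     (\<exists>M. AE p in lebesgue_on ({0<..} \<times> UNIV). \<bar>u p\<bar> \<le> M) \<and>
     (\<forall>\<kappa> \<phi>. test_function \<phi> \<and> (\<forall>p. \<phi> p \<ge> 0) \<longrightarrow>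
        set_lebesgue_integral lebesgue ({0<..} \<times> UNIV)
          (\<lambda>p. \<bar>u p - \<kappa>\<bar> * pderiv_within UNIV (1, 0) \<phi> p
             + sgn (u p - \<kappa>) * (f (u p) - f \<kappa>) * pderiv_within UNIV (0, 1) \<phi> p
             + sgn (u p - \<kappa>) * g (u p) * \<phi> p) \<ge> 0) \<and>
     u0 \<in> borel_measurable lebesgue \<and>
     (\<exists>M. AE x in lebesgue. \<bar>u0 x\<bar> \<le> M) \<and>
     (\<exists>E\<in>null_sets lebesgue.
        (\<forall>t\<in>{0<..} - E. (\<lambda>x. u (t, x)) \<in> borel_measurable lebesgue \<and>
           (\<exists>M. AE x in lebesgue. \<bar>u (t, x)\<bar> \<le> M)) \<and>
        (\<forall>r>0. ((\<lambda>t. set_lebesgue_integral lebesgue {-r..r} (\<lambda>x. \<bar>u (t, x) - u0 x\<bar>)) \<longlongrightarrow> 0)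
           (at 0 within ({0<..} - E))))"

text \<open>The value at \<open>x = 0\<close> is arbitrary.\<close>

definition shock_profile :: "real \<Rightarrow> real \<Rightarrow> real \<Rightarrow> real" where
  "shock_profile um up x = (if x < 0 then um else up)"

definition Omega :: "(real \<Rightarrow> real) \<Rightarrow> (real \<times> real) set" where
  "Omega \<psi> = ({0..} \<times> UNIV) - {(t, \<psi> t) | t. t \<ge> 0}"

definition strict_Oleinik ::
    "(real \<Rightarrow> real) \<Rightarrow> real \<Rightarrow> real \<Rightarrow> real \<Rightarrow> bool" where
  "strict_Oleinik f \<sigma> um up \<longleftrightarrow>
     \<sigma> > deriv f up \<and> deriv f um > \<sigma> \<and>
     (\<forall>\<tau>\<in>{0<..<1}. let w = \<tau> * um + (1 - \<tau>) * up in
        (f w - f um) / (w - um) > (f w - f up) / (w - up))"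

end

theory Submission
  imports Defs
begin

text \<open>
Away from the shock the solution is explicit. Let \<open>u\<close> be one of the two end states and \<open>lam = g'(u) < 0\<close>.
A local coordinate \<open>h\<close> with \<open>h u = 0\<close> and \<open>lam * h = h' * g\<close> linearises the reaction: along a
characteristic with initial value \<open>a\<close> the solution is \<open>q (exp (lam * t) * h a)\<close>, where \<open>q\<close> inverts \<open>h\<close>
(lemma \<open>straightening\<close>). If moreover \<open>\<beta>' * g = f'(u) - f'\<close>, then the time integral of the
characteristic speed is \<open>f'(u) * t + \<beta>(a) - \<beta>(q (exp (lam * t) * h a))\<close>, so that characteristics are
explicit too and no differential equation has to be solved on either side. Since the perturbation and
its first derivative are small, the map from the foot point to the position is close to a translation;
inverting it gives the solution on either side (locale \<open>side_global\<close>). The data on a half-line are first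
continued by a constant beyond the origin, so that both one-sided solutions are defined for all \<open>x\<close>.

The shock curve then solves the scalar equation given by the Rankine-Hugoniot condition, whose right
hand side is bounded and Lipschitz (lemma \<open>shock_curve_exists\<close>). By Lax's inequalities the
characteristics starting at the origin run into the shock, so that on its own side of the curve each
one-sided solution only sees genuine data, not the continued ones. The glued function is an entropy
solution because Kruzhkov's inequality reduces, by integration by parts on each side of the curve, to an
inequality for the traces (locales \<open>kruzhkov_side\<close>, \<open>piecewise_solution\<close>), and this inequality is the
chord condition of Oleinik, which persists under small perturbations of the two states
(lemma \<open>Oleinik_perturbation\<close>).

The delicate point is that only the sup norms of the perturbation and of its first derivative are small,
while the estimates of order \<open>j\<close> must be linear in the \<open>W\<^sup>j\<close> norm with a constant which does not depend
on the data. Derivatives of compositions contain products of lower order derivatives. If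
\<open>M\<^sub>j\<close> is the norm of order \<open>j\<close>, Landau's inequality gives \<open>M\<^sub>i\<^sup>2 \<le> 16 * M\<^sub>i\<^sub>-\<^sub>1 * M\<^sub>i\<^sub>+\<^sub>1\<close>, hence the
weights \<open>N\<^sub>j = M\<^sub>j\<^sub>+\<^sub>1 / M\<^sub>1\<close> satisfy \<open>N\<^sub>a * N\<^sub>b \<le> L * N\<^sub>a\<^sub>+\<^sub>b\<close> with an absolute \<open>L\<close> (lemma
\<open>weight_properties\<close>). For such weights the functions all of whose derivatives of order \<open>j\<close> are bounded by
a multiple of \<open>N\<^sub>j\<close> form an algebra stable under composition, with constants depending only on \<open>L\<close> and
on the number of derivatives (lemma \<open>WB_compose\<close>, locale \<open>weights\<close>). The foot point satisfies an implicit
equation which gains one derivative at each pass, so its bounds follow by induction on the order (lemma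
\<open>xi_step\<close>), and every derivative of the solution carries a factor \<open>exp (lam * t)\<close>, because
\<open>exp (lam * t)\<close> enters the solution only through its product with \<open>h a\<close>.
\<close>

section \<open>Derivatives bounded by a sequence of weights\<close>

text \<open>
\<open>WB n N S F\<close>: on \<open>S\<close> the function \<open>F\<close> has uniformly continuous derivatives up to order \<open>n\<close>, those of
order \<open>j\<close> being bounded by \<open>N j\<close>. Only the existence of derivatives is asked for, so that the notion makes
sense on any set; the functions \<open>D\<close> are determined on the sets of interest.
\<close>

fun WB :: "nat \<Rightarrow> (nat \<Rightarrow> real) \<Rightarrow> 'a::euclidean_space set \<Rightarrow> ('a \<Rightarrow> real) \<Rightarrow> bool" where
  "WB 0 N S F \<longleftrightarrow> uniformly_continuous_on S F \<and> (\<forall>x\<in>S. \<bar>F x\<bar> \<le> N 0)"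
| "WB (Suc n) N S F \<longleftrightarrow> uniformly_continuous_on S F \<and> (\<forall>x\<in>S. \<bar>F x\<bar> \<le> N 0) \<and>
     (\<exists>D. (\<forall>x\<in>S. (F has_derivative D x) (at x within S)) \<and>
          (\<forall>b\<in>Basis. WB n (\<lambda>j. N (Suc j)) S (\<lambda>x. D x b)))"

lemma uniformly_continuous_on_subset:
  fixes F :: "'a::metric_space \<Rightarrow> 'b::metric_space"
  shows "uniformly_continuous_on T F \<Longrightarrow> S \<subseteq> T \<Longrightarrow> uniformly_continuous_on S F"
  unfolding uniformly_continuous_on_def subset_eq by metis

lemma uniformly_continuous_on_comp:
  fixes g :: "'b::metric_space \<Rightarrow> 'c::metric_space" and F :: "'a::metric_space \<Rightarrow> 'b"
  assumes "uniformly_continuous_on T g" "uniformly_continuous_on S F" "F ` S \<subseteq> T"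
  shows "uniformly_continuous_on S (\<lambda>x. g (F x))"
  by (rule uniformly_continuous_on_compose[OF assms(2) uniformly_continuous_on_subset[OF assms(1,3)]])

lemma uniformly_continuous_on_Pair:
  fixes F :: "'a::metric_space \<Rightarrow> 'b::metric_space" and G :: "'a \<Rightarrow> 'c::metric_space"
  assumes F: "uniformly_continuous_on S F" and G: "uniformly_continuous_on S G"
  shows "uniformly_continuous_on S (\<lambda>x. (F x, G x))"
  unfolding uniformly_continuous_on_def
proof (intro allI impI)
  fix e :: real assume "e > 0"
  then have e: "e / 2 > 0" by simp
  obtain d1 where d1: "d1 > 0"
    "\<forall>x\<in>S. \<forall>x'\<in>S. dist x' x < d1 \<longrightarrow> dist (F x') (F x) < e/2"
    using F[unfolded uniformly_continuous_on_def, rule_format, OF e] by auto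
  obtain d2 where d2: "d2 > 0"
    "\<forall>x\<in>S. \<forall>x'\<in>S. dist x' x < d2 \<longrightarrow> dist (G x') (G x) < e/2"
    using G[unfolded uniformly_continuous_on_def, rule_format, OF e] by auto
  have "dist (F x', G x') (F x, G x) < e" if "x \<in> S" "x' \<in> S" "dist x' x < min d1 d2" for x x'
  proof -
    have "dist (F x') (F x) < e/2" "dist (G x') (G x) < e/2" using d1(2) d2(2) that by auto
    then show ?thesis
      using sqrt_sum_squares_le_sum[of "dist (F x') (F x)" "dist (G x') (G x)"]
      by (simp add: dist_Pair_Pair)
  qed
  then show "\<exists>d>0. \<forall>x\<in>S. \<forall>x'\<in>S. dist x' x < d \<longrightarrow> dist (F x', G x') (F x, G x) < e"
    using d1(1) d2(1) by (intro exI[of _ "min d1 d2"]) simp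
qed

lemma WB_uc: "WB n N S F \<Longrightarrow> uniformly_continuous_on S F"
  by (cases n) auto

lemma WB_bound: "WB n N S F \<Longrightarrow> x \<in> S \<Longrightarrow> \<bar>F x\<bar> \<le> N 0"
  by (cases n) auto

lemma WB_cont: "WB n N S F \<Longrightarrow> continuous_on S F"
  by (rule uniformly_continuous_imp_continuous[OF WB_uc])

lemma WB_mono: "WB n N S F \<Longrightarrow> (\<And>j. j \<le> n \<Longrightarrow> N j \<le> N' j) \<Longrightarrow> WB n N' S F"
proof (induction n arbitrary: N N' F)
  case 0
  have "N 0 \<le> N' 0" using 0(2) by simp
  with 0(1) show ?case by fastforce
next
  case (Suc n)
  from Suc.prems(1) obtain D where D: "\<forall>x\<in>S. (F has_derivative D x) (at x within S)"
    "\<forall>b\<in>Basis. WB n (\<lambda>j. N (Suc j)) S (\<lambda>x. D x b)" by auto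
  have "\<forall>b\<in>Basis. WB n (\<lambda>j. N' (Suc j)) S (\<lambda>x. D x b)"
    using D(2) by (auto intro: Suc.IH Suc.prems(2))
  moreover have "\<forall>x\<in>S. \<bar>F x\<bar> \<le> N' 0"
    using Suc.prems by (meson WB_bound le0 order_trans)
  ultimately show ?case using D(1) Suc.prems(1) by auto
qed

lemma WB_order_le: "WB n N S F \<Longrightarrow> m \<le> n \<Longrightarrow> WB m N S F"
proof (induction n arbitrary: N F m)
  case (Suc n)
  show ?case
  proof (cases m)
    case 0 then show ?thesis using Suc.prems by auto
  next
    case m: (Suc m')
    from Suc.prems(1) obtain D where D: "\<forall>x\<in>S. (F has_derivative D x) (at x within S)"
      "\<forall>b\<in>Basis. WB n (\<lambda>j. N (Suc j)) S (\<lambda>x. D x b)" by auto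
    have "\<forall>b\<in>Basis. WB m' (\<lambda>j. N (Suc j)) S (\<lambda>x. D x b)"
      using D(2) Suc.IH Suc.prems(2) m by blast
    then show ?thesis using D(1) Suc.prems(1) m by auto
  qed
qed simp

lemma WB_cong: "WB n N S F \<Longrightarrow> (\<And>x. x \<in> S \<Longrightarrow> F x = G x) \<Longrightarrow> WB n N S G"
proof (induction n arbitrary: N F G)
  case 0 then show ?case by (auto simp: uniformly_continuous_on_def)
next
  case (Suc n)
  from Suc.prems(1) obtain D where D: "\<forall>x\<in>S. (F has_derivative D x) (at x within S)"
    "\<forall>b\<in>Basis. WB n (\<lambda>j. N (Suc j)) S (\<lambda>x. D x b)" by auto
  have "\<forall>x\<in>S. (G has_derivative D x) (at x within S)"
    using D(1) Suc.prems(2) by (metis has_derivative_transform)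
  then show ?case using Suc.prems D(2) by (auto simp: uniformly_continuous_on_def)
qed

lemma WB_SucI:
  assumes "uniformly_continuous_on S F" "\<And>x. x \<in> S \<Longrightarrow> \<bar>F x\<bar> \<le> N 0"
    "\<And>x. x \<in> S \<Longrightarrow> (F has_derivative D x) (at x within S)"
    "\<And>b. b \<in> Basis \<Longrightarrow> WB n (\<lambda>j. N (Suc j)) S (\<lambda>x. D x b)"
  shows "WB (Suc n) N S F"
  using assms by auto

lemma WB_1D_SucI:
  fixes F :: "real \<Rightarrow> real"
  assumes "uniformly_continuous_on S F" "\<And>x. x \<in> S \<Longrightarrow> \<bar>F x\<bar> \<le> N 0"
    "\<And>x. x \<in> S \<Longrightarrow> (F has_real_derivative F' x) (at x within S)"
    "WB n (\<lambda>j. N (Suc j)) S F'"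
  shows "WB (Suc n) N S F"
  by (rule WB_SucI[where D="\<lambda>x d. F' x * d"]) (use assms in \<open>auto simp: has_field_derivative_def\<close>)

lemma WB_1D_SucE:
  fixes F :: "real \<Rightarrow> real"
  assumes "WB (Suc n) N S F"
  obtains F' where "\<And>x. x \<in> S \<Longrightarrow> (F has_real_derivative F' x) (at x within S)"
    "WB n (\<lambda>j. N (Suc j)) S F'"
proof -
  from assms obtain D where D: "\<forall>x\<in>S. (F has_derivative D x) (at x within S)"
    "\<forall>b\<in>Basis. WB n (\<lambda>j. N (Suc j)) S (\<lambda>x. D x b)" by auto
  show ?thesis
  proof (rule that[of "\<lambda>x. D x 1"])
    fix x assume "x \<in> S"
    then have d: "(F has_derivative D x) (at x within S)" using D by auto
    have "D x y = D x 1 * y" for y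
      using linear_cmul[OF bounded_linear.linear[OF has_derivative_bounded_linear[OF d]], of y 1]
      by (simp add: mult.commute)
    then have "D x = times (D x 1)" by (intro ext)
    with d show "(F has_real_derivative D x 1) (at x within S)"
      by (simp add: has_field_derivative_def)
  qed (use D in auto)
qed

lemma uc_mult:
  fixes F G :: "'a::metric_space \<Rightarrow> real"
  assumes F: "uniformly_continuous_on S F" and G: "uniformly_continuous_on S G"
    and bF: "\<And>x. x \<in> S \<Longrightarrow> \<bar>F x\<bar> \<le> A" and bG: "\<And>x. x \<in> S \<Longrightarrow> \<bar>G x\<bar> \<le> B"
  shows "uniformly_continuous_on S (\<lambda>x. F x * G x)"
proof -
  have "uniformly_continuous_on S (\<lambda>x. (F x, G x))"
    using F G by (rule uniformly_continuous_on_Pair)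
  moreover have "(F x, G x) \<in> {-A..A} \<times> {-B..B}" if "x \<in> S" for x
    using bF[OF that] bG[OF that] by (simp add: abs_le_iff)
  then have "(\<lambda>x. (F x, G x)) ` S \<subseteq> {-A..A} \<times> {-B..B}" by blast
  moreover have "compact ({-A..A} \<times> {-B..B})" by (intro compact_Times compact_Icc)
  then have "uniformly_continuous_on ({-A..A} \<times> {-B..B}) (\<lambda>p. fst p * snd p :: real)"
    by (intro compact_uniformly_continuous continuous_intros)
  ultimately have "uniformly_continuous_on S (\<lambda>x. (\<lambda>p. fst p * snd p) (F x, G x))"
    by (rule uniformly_continuous_on_comp[rotated])
  then show ?thesis by simp
qed

lemma WB_add:
  "WB n N S F \<Longrightarrow> WB n M S G \<Longrightarrow> WB n (\<lambda>j. N j + M j) S (\<lambda>x. F x + G x)"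
proof (induction n arbitrary: N M F G)
  case 0
  have "\<bar>F x + G x\<bar> \<le> N 0 + M 0" if "x \<in> S" for x
    using WB_bound[OF 0(1) that] WB_bound[OF 0(2) that] by linarith
  then show ?case using 0 by (simp add: uniformly_continuous_on_add)
next
  case (Suc n)
  from Suc.prems(1) obtain D where D: "\<forall>x\<in>S. (F has_derivative D x) (at x within S)"
    "\<forall>b\<in>Basis. WB n (\<lambda>j. N (Suc j)) S (\<lambda>x. D x b)" by auto
  from Suc.prems(2) obtain D' where D': "\<forall>x\<in>S. (G has_derivative D' x) (at x within S)"
    "\<forall>b\<in>Basis. WB n (\<lambda>j. M (Suc j)) S (\<lambda>x. D' x b)" by auto
  show ?case
  proof (rule WB_SucI[where D="\<lambda>x d. D x d + D' x d"])
    show "uniformly_continuous_on S (\<lambda>x. F x + G x)"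
      by (rule uniformly_continuous_on_add[OF WB_uc[OF Suc.prems(1)] WB_uc[OF Suc.prems(2)]])
    show "\<bar>F x + G x\<bar> \<le> N 0 + M 0" if "x \<in> S" for x
      using WB_bound[OF Suc.prems(1) that] WB_bound[OF Suc.prems(2) that] by linarith
    show "((\<lambda>x. F x + G x) has_derivative (\<lambda>d. D x d + D' x d)) (at x within S)" if "x \<in> S" for x
      using D(1) D'(1) that by (simp add: has_derivative_add)
    show "WB n (\<lambda>j. N (Suc j) + M (Suc j)) S (\<lambda>x. D x b + D' x b)" if "b \<in> Basis" for b
      using Suc.IH D(2) D'(2) that by simp
  qed
qed

text \<open>
By Leibniz' rule a product of a derivative of order \<open>a\<close> and one of order \<open>b\<close> has order \<open>a + b\<close>, and
submultiplicativity of the weights is what bounds it by the weight of that order.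
\<close>

lemma WB_mult:
  assumes "WB n N S F" "WB n M S G" "\<And>a b. a + b \<le> n \<Longrightarrow> N a * M b \<le> K (a + b)"
    "\<And>j. j \<le> n \<Longrightarrow> N j \<ge> 0" "\<And>j. j \<le> n \<Longrightarrow> M j \<ge> 0"
  shows "WB n (\<lambda>j. 2 ^ j * K j) S (\<lambda>x. F x * G x)"
  using assms
proof (induction n arbitrary: N M K F G)
  case 0
  have "\<bar>F x * G x\<bar> \<le> K 0" if "x \<in> S" for x
    using WB_bound[OF 0(1) that] WB_bound[OF 0(2) that]
      mult_mono[of "\<bar>F x\<bar>" "N 0" "\<bar>G x\<bar>" "M 0"] 0(3)[of 0 0] 0(4)[of 0]
    by (simp add: abs_mult)
  moreover have "uniformly_continuous_on S (\<lambda>x. F x * G x)"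
    by (rule uc_mult[OF WB_uc[OF 0(1)] WB_uc[OF 0(2)] WB_bound[OF 0(1)] WB_bound[OF 0(2)]])
  ultimately show ?case by simp
next
  case (Suc n)
  from Suc.prems(1) obtain D where D: "\<And>x. x\<in>S \<Longrightarrow> (F has_derivative D x) (at x within S)"
    "\<And>b. b\<in>Basis \<Longrightarrow> WB n (\<lambda>j. N (Suc j)) S (\<lambda>x. D x b)" by auto
  from Suc.prems(2) obtain D' where D': "\<And>x. x\<in>S \<Longrightarrow> (G has_derivative D' x) (at x within S)"
    "\<And>b. b\<in>Basis \<Longrightarrow> WB n (\<lambda>j. M (Suc j)) S (\<lambda>x. D' x b)" by auto
  have bd: "\<bar>F x * G x\<bar> \<le> K 0" if "x \<in> S" for x
    using WB_bound[OF Suc.prems(1) that] WB_bound[OF Suc.prems(2) that]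
      mult_mono[of "\<bar>F x\<bar>" "N 0" "\<bar>G x\<bar>" "M 0"] Suc.prems(3)[of 0 0] Suc.prems(4)[of 0]
    by (simp add: abs_mult)
  have uc: "uniformly_continuous_on S (\<lambda>x. F x * G x)"
    by (rule uc_mult[OF WB_uc[OF Suc.prems(1)] WB_uc[OF Suc.prems(2)]
          WB_bound[OF Suc.prems(1)] WB_bound[OF Suc.prems(2)]])
  have 1: "WB n (\<lambda>j. 2 ^ j * K (Suc j)) S (\<lambda>x. F x * D' x b)" if "b \<in> Basis" for b
    by (rule Suc.IH[OF WB_order_le[OF Suc.prems(1)] D'(2)[OF that]])
      (use Suc.prems(3)[of _ "Suc _"] Suc.prems(4,5) in auto)
  have 2: "WB n (\<lambda>j. 2 ^ j * K (Suc j)) S (\<lambda>x. D x b * G x)" if "b \<in> Basis" for b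
    by (rule Suc.IH[OF D(2)[OF that] WB_order_le[OF Suc.prems(2)]])
      (use Suc.prems(3)[of "Suc _"] Suc.prems(4,5) in auto)
  show ?case
  proof (rule WB_SucI[where D="\<lambda>x d. F x * D' x d + D x d * G x"])
    fix b :: 'a assume b: "b \<in> Basis"
    show "WB n (\<lambda>j. 2 ^ Suc j * K (Suc j)) S (\<lambda>x. F x * D' x b + D x b * G x)"
      using WB_add[OF 1[OF b] 2[OF b]] by (rule WB_mono) simp
  next
    show "((\<lambda>x. F x * G x) has_derivative (\<lambda>d. F x * D' x d + D x d * G x)) (at x within S)"
      if "x \<in> S" for x
      using has_derivative_mult[OF D(1)[OF that] D'(1)[OF that]] .
  qed (use uc bd in auto)
qed

lemma WB_const: "0 \<le> N 0 \<Longrightarrow> \<bar>c\<bar> \<le> N 0 \<Longrightarrow> (\<And>j. j \<le> n \<Longrightarrow> 0 \<le> N j) \<Longrightarrow> WB n N S (\<lambda>_. c)"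
proof (induction n arbitrary: N c)
  case 0 then show ?case by (auto simp: uniformly_continuous_on_const)
next
  case (Suc n)
  show ?case
  proof (rule WB_SucI[where D="\<lambda>x d. 0"])
    show "WB n (\<lambda>j. N (Suc j)) S (\<lambda>x. 0)" by (rule Suc.IH) (use Suc.prems in auto)
  qed (use Suc.prems in \<open>auto simp: uniformly_continuous_on_const\<close>)
qed

text \<open>
The bound is linear in the weight \<open>G\<close> of the outer function: the derivative of \<open>g (F x)\<close> is a product
of \<open>g' (F x)\<close>, whose weight is \<open>G\<close> shifted by one, and of a derivative of \<open>F\<close>, so that each order costs one
use of \<open>G a * N b \<le> L * G (a + b)\<close>. A derivative of \<open>F\<close> of order \<open>j + 1\<close> is measured by \<open>N j\<close>, which
keeps the total order right.
\<close>

lemma WB_compose: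
  fixes g :: "real \<Rightarrow> real" and F :: "'a::euclidean_space \<Rightarrow> real"
  assumes g: "WB n G T g" and FT: "F ` S \<subseteq> T" and uc: "uniformly_continuous_on S F"
    and DF: "n > 0 \<Longrightarrow> \<forall>x\<in>S. (F has_derivative D x) (at x within S)"
      "\<And>b. n > 0 \<Longrightarrow> b \<in> Basis \<Longrightarrow> WB (n - 1) N S (\<lambda>x. D x b)"
    and GN: "\<And>a b. G a * N b \<le> L * G (a + b)"
    and pos: "\<And>j. G j \<ge> 0" "\<And>j. N j \<ge> 0" "L \<ge> 1"
  shows "WB n (\<lambda>j. (2 ^ n * L) ^ n * G j) S (\<lambda>x. g (F x))"
  using g DF GN pos(1)
proof (induction n arbitrary: g G)
  case 0
  have "uniformly_continuous_on S (\<lambda>x. g (F x))"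
    using uniformly_continuous_on_comp[OF WB_uc[OF 0(1)] uc FT] .
  then show ?case using 0 FT by auto
next
  case (Suc n)
  from WB_1D_SucE[OF Suc.prems(1)] obtain g' where g':
    "\<And>x. x \<in> T \<Longrightarrow> (g has_real_derivative g' x) (at x within T)"
    "WB n (\<lambda>j. G (Suc j)) T g'" by metis
  have uc': "uniformly_continuous_on S (\<lambda>x. g (F x))"
    using uniformly_continuous_on_comp[OF WB_uc[OF Suc.prems(1)] uc FT] .
  define c where "c = (2 ^ n * L) ^ n"
  have c1: "c \<ge> 1" "c \<ge> 0" unfolding c_def using pos(3)
    by (smt (verit) mult_le_cancel_left1 one_le_power)+
  have IH: "WB n (\<lambda>j. c * G (Suc j)) S (\<lambda>x. g' (F x))" unfolding c_def
  proof (rule Suc.IH[OF g'(2)])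
    show "\<forall>x\<in>S. (F has_derivative D x) (at x within S)" using Suc.prems(2) by auto
    show "WB (n - 1) N S (\<lambda>x. D x b)" if "b \<in> Basis" for b
      using Suc.prems(3)[OF _ that] WB_order_le by fastforce
    show "G (Suc a) * N b \<le> L * G (Suc (a + b))" for a b
      using Suc.prems(4)[of "Suc a" b] by simp
  qed (use Suc.prems in auto)
  have P: "WB n (\<lambda>j. 2 ^ j * (c * L * G (Suc j))) S (\<lambda>x. g' (F x) * D x b)" if "b \<in> Basis" for b
  proof (rule WB_mult[OF IH, of N])
    show "WB n N S (\<lambda>x. D x b)" using Suc.prems(3)[OF _ that] by simp
    fix a b show "c * G (Suc a) * N b \<le> c * L * G (Suc (a + b))"
      using mult_left_mono[OF Suc.prems(4)[of "Suc a" b] c1(2)] by (simp add: algebra_simps)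
  qed (use Suc.prems pos c1 in auto)
  have bound: "2 ^ j * (c * L) \<le> (2 ^ Suc n * L) ^ Suc n" if "j \<le> n" for j
  proof -
    have "2 ^ j * (c * L) \<le> 2 ^ n * (c * L)"
      using that c1 pos by (intro mult_right_mono power_increasing) auto
    also have "\<dots> = (2 ^ n * L) ^ Suc n" by (simp add: c_def algebra_simps)
    also have "\<dots> \<le> (2 ^ Suc n * L) ^ Suc n"
      using pos by (intro power_mono mult_right_mono) auto
    finally show ?thesis .
  qed
  show ?case
  proof (rule WB_SucI[where D="\<lambda>x d. g' (F x) * D x d"])
    fix x assume x: "x \<in> S"
    have "\<bar>g (F x)\<bar> \<le> G 0" using WB_bound[OF Suc.prems(1)] FT x by auto
    also have "\<dots> \<le> (2 ^ Suc n * L) ^ Suc n * G 0"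
    proof -
      have "(1::real) \<le> (2 ^ Suc n * L)" using pos(3)
        by (smt (verit) mult_le_cancel_left1 one_le_power)
      then have "(1::real) \<le> (2 ^ Suc n * L) ^ Suc n" by (rule one_le_power)
      then show ?thesis using Suc.prems(5)[of 0] mult_right_mono by fastforce
    qed
    finally show "\<bar>g (F x)\<bar> \<le> (2 ^ Suc n * L) ^ Suc n * G 0" .
    have "(F has_derivative D x) (at x within S)" using Suc.prems(2) x by auto
    moreover have "(g has_derivative times (g' y)) (at y within T)" if "y \<in> T" for y
      using g'(1)[OF that] by (simp add: has_field_derivative_def)
    ultimately show "((\<lambda>x. g (F x)) has_derivative (\<lambda>d. g' (F x) * D x d)) (at x within S)"
      using has_derivative_in_compose2[of T g "\<lambda>y. times (g' y)" F S x "D x"] FT x by auto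
  next
    fix b :: 'a assume b: "b \<in> Basis"
    show "WB n (\<lambda>j. (2 ^ Suc n * L) ^ Suc n * G (Suc j)) S (\<lambda>x. g' (F x) * D x b)"
    proof (rule WB_mono[OF P[OF b]])
      fix j assume "j \<le> n"
      show "2 ^ j * (c * L * G (Suc j)) \<le> (2 ^ Suc n * L) ^ Suc n * G (Suc j)"
        using mult_right_mono[OF bound[OF \<open>j \<le> n\<close>] Suc.prems(5)[of "Suc j"]] by (simp add: algebra_simps)
    qed
  qed (rule uc')
qed

text \<open>
Here the outer function has plain bounds, and the composition inherits the weights of the inner one.
\<close>

lemma WB_compose_bounded:
  fixes g :: "real \<Rightarrow> real" and F :: "'a::euclidean_space \<Rightarrow> real"
  assumes g: "WB n (\<lambda>_. K) T g" and FT: "F ` S \<subseteq> T" and F: "WB n N S F"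
    and NN: "\<And>a b. N a * N b \<le> L * N (a + b)"
    and pos: "\<And>j. N j \<ge> 1" "L \<ge> 1" "K \<ge> 0"
  shows "WB n (\<lambda>j. (2 ^ n * L) ^ n * K * N j) S (\<lambda>x. g (F x))"
  using g F
proof (induction n arbitrary: g)
  case 0
  have "uniformly_continuous_on S (\<lambda>x. g (F x))"
    using uniformly_continuous_on_comp[OF WB_uc[OF 0(1)] WB_uc[OF 0(2)] FT] .
  moreover have "\<bar>g (F x)\<bar> \<le> K * N 0" if "x \<in> S" for x
    using WB_bound[OF 0(1), of "F x"] FT that pos mult_left_mono[of 1 "N 0" K] by force
  ultimately show ?case by auto
next
  case (Suc n)
  from WB_1D_SucE[OF Suc.prems(1)] obtain g' where g':
    "\<And>x. x \<in> T \<Longrightarrow> (g has_real_derivative g' x) (at x within T)"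
    "WB n (\<lambda>j. K) T g'" by metis
  from Suc.prems(2) obtain D where D: "\<And>x. x\<in>S \<Longrightarrow> (F has_derivative D x) (at x within S)"
    "\<And>b. b\<in>Basis \<Longrightarrow> WB n (\<lambda>j. N (Suc j)) S (\<lambda>x. D x b)" by auto
  have uc': "uniformly_continuous_on S (\<lambda>x. g (F x))"
    using uniformly_continuous_on_comp[OF WB_uc[OF Suc.prems(1)] WB_uc[OF Suc.prems(2)] FT] .
  have N0: "N j \<ge> 0" for j using pos(1)[of j] by simp
  define c where "c = (2 ^ n * L) ^ n * K"
  have c1: "c \<ge> 0" unfolding c_def using pos by auto
  have IH: "WB n (\<lambda>j. c * N j) S (\<lambda>x. g' (F x))" unfolding c_def
    by (rule Suc.IH[OF g'(2) WB_order_le[OF Suc.prems(2)]]) simp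
  have P: "WB n (\<lambda>j. 2 ^ j * (c * L * N (Suc j))) S (\<lambda>x. g' (F x) * D x b)" if "b \<in> Basis" for b
  proof (rule WB_mult[OF IH D(2)[OF that]])
    fix a b show "c * N a * N (Suc b) \<le> c * L * N (Suc (a + b))"
      using mult_left_mono[OF NN[of a "Suc b"] c1] by (simp add: algebra_simps)
  qed (use c1 N0 in auto)
  have bound: "2 ^ j * (c * L) \<le> (2 ^ Suc n * L) ^ Suc n * K" if "j \<le> n" for j
  proof -
    have "2 ^ j * (c * L) \<le> 2 ^ n * (c * L)"
      using that c1 pos by (intro mult_right_mono power_increasing) auto
    also have "\<dots> = (2 ^ n * L) ^ Suc n * K" by (simp add: c_def algebra_simps)
    also have "\<dots> \<le> (2 ^ Suc n * L) ^ Suc n * K"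
      using pos by (intro power_mono mult_right_mono) auto
    finally show ?thesis .
  qed
  show ?case
  proof (rule WB_SucI[where D="\<lambda>x d. g' (F x) * D x d"])
    fix x assume x: "x \<in> S"
    have "\<bar>g (F x)\<bar> \<le> K" using WB_bound[OF Suc.prems(1)] FT x by auto
    also have "\<dots> \<le> (2 ^ Suc n * L) ^ Suc n * K * N 0"
    proof -
      have "(1::real) \<le> (2 ^ Suc n * L)" using pos(2)
        by (smt (verit) mult_le_cancel_left1 one_le_power)
      then have "(1::real) \<le> (2 ^ Suc n * L) ^ Suc n" by (rule one_le_power)
      then have "1 * (K * 1) \<le> (2 ^ Suc n * L) ^ Suc n * (K * N 0)"
        using pos by (intro mult_mono) auto
      then show ?thesis by (simp add: mult.assoc)
    qed
    finally show "\<bar>g (F x)\<bar> \<le> (2 ^ Suc n * L) ^ Suc n * K * N 0" .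
    have "(F has_derivative D x) (at x within S)" using D x by auto
    moreover have "(g has_derivative times (g' y)) (at y within T)" if "y \<in> T" for y
      using g'(1)[OF that] by (simp add: has_field_derivative_def)
    ultimately show "((\<lambda>x. g (F x)) has_derivative (\<lambda>d. g' (F x) * D x d)) (at x within S)"
      using has_derivative_in_compose2[of T g "\<lambda>y. times (g' y)" F S x "D x"] FT x by auto
  next
    fix b :: 'a assume b: "b \<in> Basis"
    show "WB n (\<lambda>j. (2 ^ Suc n * L) ^ Suc n * K * N (Suc j)) S (\<lambda>x. g' (F x) * D x b)"
    proof (rule WB_mono[OF P[OF b]])
      fix j assume "j \<le> n"
      show "2 ^ j * (c * L * N (Suc j)) \<le> (2 ^ Suc n * L) ^ Suc n * K * N (Suc j)"
        using mult_right_mono[OF bound[OF \<open>j \<le> n\<close>] N0[of "Suc j"]] by (simp add: algebra_simps)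
    qed
  qed (rule uc')
qed

text \<open>
Sets in which every coordinate direction can be entered from every point: on these the derivative
within the set is unique, so that the iterated derivatives of the statement can be computed.
\<close>

definition nondegenerate :: "'a::euclidean_space set \<Rightarrow> bool" where
  "nondegenerate S \<longleftrightarrow> (\<forall>x\<in>S. \<forall>i\<in>Basis. \<forall>e>0. \<exists>d. 0 < \<bar>d\<bar> \<and> \<bar>d\<bar> < e \<and> x + d *\<^sub>R i \<in> S)"

lemma nondegenerate_open: "open S \<Longrightarrow> nondegenerate S"
  unfolding nondegenerate_def
proof (intro ballI allI impI)
  fix x i :: 'a and e :: real assume S: "open S" "x \<in> S" "i \<in> Basis" "e > 0"
  then obtain r where r: "r > 0" "ball x r \<subseteq> S" by (meson openE)
  define d where "d = min r e / 2"
  have "d > 0" "d < r" "d < e" using r S by (auto simp: d_def)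
  moreover then have "x + d *\<^sub>R i \<in> ball x r" using S by (simp add: dist_norm)
  ultimately show "\<exists>d. 0 < \<bar>d\<bar> \<and> \<bar>d\<bar> < e \<and> x + d *\<^sub>R i \<in> S" using r by (intro exI[of _ d]) auto
qed

lemma nondegenerate_real:
  assumes "\<And>x e. x \<in> S \<Longrightarrow> e > 0 \<Longrightarrow> \<exists>d. 0 < \<bar>d\<bar> \<and> \<bar>d\<bar> < e \<and> x + d \<in> (S :: real set)"
  shows "nondegenerate S"
  using assms unfolding nondegenerate_def by simp

lemma nondegenerate_halfline: "nondegenerate {a::real..}" "nondegenerate {..a::real}"
proof -
  show "nondegenerate {a..}"
    by (rule nondegenerate_real) (rule_tac x="e/2" in exI, auto)
  show "nondegenerate {..a}"
    by (rule nondegenerate_real) (rule_tac x="-e/2" in exI, auto)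
qed

lemma has_derivative_pderiv_within:
  assumes "nondegenerate S" "x \<in> S" "(F has_derivative D) (at x within S)"
  shows "pderiv_within S b F x = D b"
proof -
  have "(F has_derivative frechet_derivative F (at x within S)) (at x within S)"
    using assms(3) frechet_derivative_works differentiable_def by blast
  then have "frechet_derivative F (at x within S) = D"
    using frechet_derivative_unique_within[OF _ assms(3)] assms(1,2)
    unfolding nondegenerate_def by blast
  then show ?thesis by (simp add: pderiv_within_def)
qed

lemma pderiv_within_cong:
  assumes "\<And>y. y \<in> S \<Longrightarrow> F y = G y" "x \<in> S"
  shows "pderiv_within S b F x = pderiv_within S b G x"
proof -
  have "(F has_derivative D) (at x within S) \<longleftrightarrow> (G has_derivative D) (at x within S)" for D
    using assms has_derivative_transform by metis
  then show ?thesis by (simp add: pderiv_within_def frechet_derivative_def)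
qed

lemma iter_pderiv_cong:
  "(\<And>y. y \<in> S \<Longrightarrow> F y = G y) \<Longrightarrow> x \<in> S \<Longrightarrow> iter_pderiv S bs F x = iter_pderiv S bs G x"
proof (induction bs arbitrary: x)
  case (Cons b bs)
  then show ?case using pderiv_within_cong[of S "iter_pderiv S bs F" "iter_pderiv S bs G" x b] by simp
qed simp

lemma iter_pderiv_snoc: "iter_pderiv S (bs @ [b]) F = iter_pderiv S bs (pderiv_within S b F)"
  by (induction bs) auto

lemma WB_iter_pderiv:
  assumes "nondegenerate S" "WB n N S F" "set bs \<subseteq> Basis" "length bs \<le> n"
  shows "WB (n - length bs) (\<lambda>j. N (j + length bs)) S (iter_pderiv S bs F)"
  using assms(2-)
proof (induction bs arbitrary: n N F rule: rev_induct)
  case Nil then show ?case by simp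
next
  case (snoc b bs)
  then obtain n' where n: "n = Suc n'" by (cases n) auto
  from snoc.prems(1)[unfolded n] obtain D where D: "\<forall>x\<in>S. (F has_derivative D x) (at x within S)"
    "\<forall>b\<in>Basis. WB n' (\<lambda>j. N (Suc j)) S (\<lambda>x. D x b)" by auto
  have "WB n' (\<lambda>j. N (Suc j)) S (\<lambda>x. D x b)" using D(2) snoc.prems by auto
  then have "WB n' (\<lambda>j. N (Suc j)) S (pderiv_within S b F)"
    by (rule WB_cong) (use has_derivative_pderiv_within[OF assms(1)] D in auto)
  then have "WB (n' - length bs) (\<lambda>j. N (Suc (j + length bs))) S (iter_pderiv S bs (pderiv_within S b F))"
    using snoc.prems n by (intro snoc.IH) auto
  then show ?case by (simp add: n iter_pderiv_snoc)
qed

lemma WB_iter_bound: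
  assumes "nondegenerate S" "WB n N S F" "set bs \<subseteq> Basis" "length bs \<le> n" "x \<in> S"
  shows "\<bar>iter_pderiv S bs F x\<bar> \<le> N (length bs)"
  using WB_bound[OF WB_iter_pderiv[OF assms(1-4)] assms(5)] by simp

lemma WB_imp_differentiable: "WB (Suc n) N S F \<Longrightarrow> F differentiable_on S"
  unfolding differentiable_on_def differentiable_def by auto

lemma WB_Ck_on:
  assumes "nondegenerate S" "WB n N S F" shows "Ck_on n S F"
  unfolding Ck_on_def
proof (intro conjI ballI impI)
  fix bs :: "'a list" assume bs: "bs \<in> lists Basis"
  { assume "length bs < n"
    then obtain m where "n - length bs = Suc m" by (metis Suc_diff_Suc)
    then show "iter_pderiv S bs F differentiable_on S"
      using WB_iter_pderiv[OF assms, of bs] bs \<open>length bs < n\<close> WB_imp_differentiable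
      by (metis in_listsD less_imp_le subsetI) }
  { assume "length bs \<le> n"
    then show "continuous_on S (iter_pderiv S bs F)"
      using WB_cont[OF WB_iter_pderiv[OF assms, of bs]] bs by auto }
qed

text \<open>
Together with \<open>WB_iter_bound\<close> this makes the inductive predicate equivalent to bounds on all iterated
partial derivatives.
\<close>

lemma WB_of_iter_pderiv:
  assumes "\<And>bs. set bs \<subseteq> Basis \<Longrightarrow> length bs < n \<Longrightarrow> iter_pderiv S bs F differentiable_on S"
    "\<And>bs. set bs \<subseteq> Basis \<Longrightarrow> length bs \<le> n \<Longrightarrow> uniformly_continuous_on S (iter_pderiv S bs F)"
    "\<And>bs x. set bs \<subseteq> Basis \<Longrightarrow> length bs \<le> n \<Longrightarrow> x \<in> S \<Longrightarrow> \<bar>iter_pderiv S bs F x\<bar> \<le> N (length bs)"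
  shows "WB n N S F"
  using assms
proof (induction n arbitrary: F N)
  case 0
  then show ?case using 0(2,3)[of "[]"] by simp
next
  case (Suc n)
  show ?case
  proof (rule WB_SucI[where D="\<lambda>x. frechet_derivative F (at x within S)"])
    show "uniformly_continuous_on S F" using Suc.prems(2)[of "[]"] by simp
    show "\<bar>F x\<bar> \<le> N 0" if "x \<in> S" for x using Suc.prems(3)[of "[]" x] that by simp
    show "(F has_derivative frechet_derivative F (at x within S)) (at x within S)" if "x \<in> S" for x
      using Suc.prems(1)[of "[]"] that frechet_derivative_works by (auto simp: differentiable_on_def)
    fix b :: 'a assume b: "b \<in> Basis"
    have "WB n (\<lambda>j. N (Suc j)) S (pderiv_within S b F)"
    proof (rule Suc.IH)
      fix bs :: "'a list" assume bs: "set bs \<subseteq> Basis"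
      { assume "length bs < n" then show "iter_pderiv S bs (pderiv_within S b F) differentiable_on S"
          using Suc.prems(1)[of "bs @ [b]"] bs b by (simp add: iter_pderiv_snoc) }
      { assume "length bs \<le> n" then show "uniformly_continuous_on S (iter_pderiv S bs (pderiv_within S b F))"
          using Suc.prems(2)[of "bs @ [b]"] bs b by (simp add: iter_pderiv_snoc) }
      { fix x assume "length bs \<le> n" "x \<in> S" then show "\<bar>iter_pderiv S bs (pderiv_within S b F) x\<bar> \<le> N (Suc (length bs))"
          using Suc.prems(3)[of "bs @ [b]"] bs b by (simp add: iter_pderiv_snoc) }
    qed
    then show "WB n (\<lambda>j. N (Suc j)) S (\<lambda>x. frechet_derivative F (at x within S) b)"
      by (rule WB_cong) (simp add: pderiv_within_def)
  qed
qed

lemma Ck_on_Suc_UNIV: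
  fixes f :: "real \<Rightarrow> real"
  assumes "Ck_on (Suc n) UNIV f"
  shows "(f has_real_derivative deriv f x) (at x)" "Ck_on n UNIV (deriv f)"
proof -
  have "f differentiable_on UNIV" using assms unfolding Ck_on_def
    by (metis iter_pderiv.simps(1) list.size(3) lists.Nil zero_less_Suc)
  then have diff: "f differentiable (at x)" for x by (simp add: differentiable_on_def)
  show d: "(f has_real_derivative deriv f x) (at x)" for x
    using diff[of x] DERIV_deriv_iff_real_differentiable by blast
  have eq: "pderiv_within UNIV 1 f = deriv f"
    using has_derivative_pderiv_within[OF nondegenerate_open[OF open_UNIV], of _ f _ 1] d
    by (fastforce simp: has_field_derivative_def)
  show "Ck_on n UNIV (deriv f)"
    using assms unfolding Ck_on_def eq[symmetric] iter_pderiv_snoc[symmetric]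
    by auto
qed

lemma Ck_on_le: "Ck_on n S f \<Longrightarrow> m \<le> n \<Longrightarrow> Ck_on m S f"
  unfolding Ck_on_def by auto

lemma Ck_on_continuous: "Ck_on n S f \<Longrightarrow> continuous_on S f"
  unfolding Ck_on_def by (metis iter_pderiv.simps(1) le0 list.size(3) lists.Nil)

text \<open>
The class of functions with bounded, uniformly continuous derivatives, on one connected piece.
\<close>

definition BU :: "nat \<Rightarrow> 'a::euclidean_space set \<Rightarrow> ('a \<Rightarrow> real) \<Rightarrow> bool" where
  "BU n S F \<longleftrightarrow> (\<exists>K. WB n (\<lambda>_. K) S F)"

lemma BU_I: "WB n N S F \<Longrightarrow> BU n S F"
  unfolding BU_def
  by (rule exI[of _ "Max (N ` {..n})"], erule WB_mono) (auto intro: Max_ge)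

lemma BU_nonneg: assumes "BU n S F" obtains K where "K \<ge> 1" "WB n (\<lambda>_. K) S F"
proof -
  from assms obtain K where K: "WB n (\<lambda>_. K) S F" unfolding BU_def by auto
  have "WB n (\<lambda>_. max K 1) S F" by (rule WB_mono[OF K]) simp
  then show ?thesis by (rule that[rotated]) simp
qed

lemma BU_mult: assumes "BU n S F" "BU n S G" shows "BU n S (\<lambda>x. F x * G x)"
proof -
  obtain K where K: "K \<ge> 1" "WB n (\<lambda>_. K) S F" using assms(1) BU_nonneg by metis
  obtain M where M: "M \<ge> 1" "WB n (\<lambda>_. M) S G" using assms(2) BU_nonneg by metis
  have "WB n (\<lambda>j. 2 ^ j * (K * M)) S (\<lambda>x. F x * G x)"
    by (rule WB_mult[OF K(2) M(2)]) (use K M in auto)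
  then show ?thesis by (rule BU_I)
qed

lemma BU_const: "BU n S (\<lambda>_. c)"
  unfolding BU_def by (rule exI[of _ "\<bar>c\<bar>"]) (rule WB_const, auto)

lemma BU_uminus: assumes "BU n S F" shows "BU n S (\<lambda>x. - F x)"
  using BU_mult[OF BU_const[of n S "-1"] assms] by simp

lemma BU_compose:
  fixes g :: "real \<Rightarrow> real"
  assumes "BU n T g" "BU n S F" "F ` S \<subseteq> T" shows "BU n S (\<lambda>x. g (F x))"
proof -
  obtain K where K: "K \<ge> 1" "WB n (\<lambda>_. K) T g" using assms(1) BU_nonneg by metis
  obtain M where M: "M \<ge> 1" "WB n (\<lambda>_. M) S F" using assms(2) BU_nonneg by metis
  have "WB n (\<lambda>j. (2 ^ n * M) ^ n * K * M) S (\<lambda>x. g (F x))"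
    by (rule WB_compose_bounded[OF K(2) assms(3) M(2)]) (use K M in auto)
  then show ?thesis by (rule BU_I)
qed

lemma BU_cong: "BU n S F \<Longrightarrow> (\<And>x. x \<in> S \<Longrightarrow> F x = G x) \<Longrightarrow> BU n S G"
  unfolding BU_def using WB_cong by blast

lemma BU_le: "BU n S F \<Longrightarrow> m \<le> n \<Longrightarrow> BU m S F"
  unfolding BU_def using WB_order_le by blast

lemma BU_0_compact: "continuous_on S F \<Longrightarrow> compact S \<Longrightarrow> BU 0 S F"
  using compact_uniformly_continuous[of S F] compact_imp_bounded[OF compact_continuous_image, of S F]
  unfolding BU_def by (auto simp: bounded_iff)

lemma BU_1D_SucI:
  fixes F :: "real \<Rightarrow> real"
  assumes "\<And>x. x \<in> S \<Longrightarrow> (F has_real_derivative F' x) (at x within S)" "BU n S F'" "compact S"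
  shows "BU (Suc n) S F"
proof -
  have c: "continuous_on S F" using assms(1) DERIV_continuous_on by blast
  obtain K where K: "WB 0 (\<lambda>_. K) S F" using BU_0_compact[OF c assms(3)] unfolding BU_def by auto
  obtain M where M: "WB n (\<lambda>_. M) S F'" using assms(2) unfolding BU_def by auto
  have "WB (Suc n) (\<lambda>_. max K M) S F"
    by (rule WB_1D_SucI[OF _ _ assms(1)]) (use K M in \<open>auto intro: WB_mono\<close>)
  then show ?thesis by (rule BU_I)
qed

lemma BU_Ck_on_UNIV:
  fixes f :: "real \<Rightarrow> real"
  assumes "Ck_on n UNIV f" shows "BU n {a..b} f"
  using assms
proof (induction n arbitrary: f)
  case 0
  then show ?case by (intro BU_0_compact compact_Icc continuous_on_subset[OF Ck_on_continuous]) auto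
next
  case (Suc n)
  show ?case
    by (rule BU_1D_SucI[OF DERIV_subset[OF Ck_on_Suc_UNIV(1)[OF Suc.prems]]])
      (use Suc.IH[OF Ck_on_Suc_UNIV(2)[OF Suc.prems]] in auto)
qed

lemma BU_inverse_Icc: assumes "0 < a" shows "BU n {a..b} (\<lambda>x::real. inverse x)"
proof (induction n)
  case 0
  show ?case using assms by (intro BU_0_compact continuous_intros) auto
next
  case (Suc n)
  show ?case
  proof (rule BU_1D_SucI)
    show "(inverse has_real_derivative - (inverse x * inverse x)) (at x within {a..b})" if "x \<in> {a..b}" for x
      using assms that by (auto intro!: derivative_eq_intros simp: power2_eq_square)
    show "BU n {a..b} (\<lambda>x. - (inverse x * inverse x))" by (intro BU_uminus BU_mult Suc)
  qed simp
qed

lemma BU_exp_Icc: "BU n {a..b} (\<lambda>x::real. exp x)"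
proof (induction n)
  case 0
  show ?case by (intro BU_0_compact continuous_intros) auto
next
  case (Suc n)
  show ?case
    by (rule BU_1D_SucI[OF _ Suc]) (auto intro!: derivative_eq_intros)
qed

section \<open>A coordinate linearising the reaction\<close>

lemma Ck_on_1D_SucI:
  fixes F :: "real \<Rightarrow> real"
  assumes "\<And>x. (F has_real_derivative F' x) (at x)" "Ck_on n UNIV F'"
  shows "Ck_on (Suc n) UNIV F"
proof -
  have eq: "pderiv_within UNIV 1 F = F'"
    using has_derivative_pderiv_within[OF nondegenerate_open[OF open_UNIV], of _ F _ 1] assms(1)
    by (fastforce simp: has_field_derivative_def)
  have diff: "F differentiable_on UNIV"
    using assms(1) differentiable_on_def has_field_derivative_def differentiable_def
    by (metis has_derivative_at_withinI)
  have bs: "bs = [] \<or> (\<exists>bs'. bs = bs' @ [1] \<and> bs' \<in> lists Basis)" if "bs \<in> lists Basis" for bs :: "real list"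
    using that by (cases bs rule: rev_cases) auto
  show ?thesis unfolding Ck_on_def
  proof (intro conjI ballI impI)
    fix bs :: "real list" assume b: "bs \<in> lists Basis"
    { assume "length bs < Suc n"
      then show "iter_pderiv UNIV bs F differentiable_on UNIV"
        using bs[OF b] assms(2) diff unfolding Ck_on_def
        by (auto simp: iter_pderiv_snoc eq) }
    { assume "length bs \<le> Suc n"
      then show "continuous_on UNIV (iter_pderiv UNIV bs F)"
        using bs[OF b] assms(2) differentiable_imp_continuous_on[OF diff] unfolding Ck_on_def
        by (auto simp: iter_pderiv_snoc eq) }
  qed
qed

lemma Ck_on_0_iff: "Ck_on 0 S F \<longleftrightarrow> continuous_on S F"
  unfolding Ck_on_def by auto

text \<open>
The powers of \<open>\<tau>\<close> are needed for the induction: each differentiation in \<open>s\<close> brings down one factor \<open>\<tau>\<close>.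
\<close>

lemma Ck_on_moment_integral:
  fixes \<omega> :: "real \<Rightarrow> real"
  assumes "Ck_on n UNIV \<omega>"
  shows "Ck_on n UNIV (\<lambda>s. integral {0..1} (\<lambda>\<tau>. \<tau> ^ i * \<omega> (u + \<tau> * (s - u))))"
  using assms
proof (induction n arbitrary: \<omega> i)
  case 0
  then have c: "continuous_on UNIV \<omega>" by (simp add: Ck_on_0_iff)
  have "continuous_on UNIV (\<lambda>s. integral (cbox 0 1) (\<lambda>\<tau>. \<tau> ^ i * \<omega> (u + \<tau> * (s - u))))"
    by (rule integral_continuous_on_param)
      (auto simp: split_beta intro!: continuous_intros continuous_on_compose2[OF c])
  then show ?case by (simp add: Ck_on_0_iff cbox_interval)
next
  case (Suc n)
  note d = Ck_on_Suc_UNIV[OF Suc.prems]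
  have c: "continuous_on UNIV \<omega>" by (rule Ck_on_continuous[OF Suc.prems])
  have c': "continuous_on UNIV (deriv \<omega>)" by (rule Ck_on_continuous[OF d(2)])
  show ?case
  proof (rule Ck_on_1D_SucI)
    fix s
    have "((\<lambda>s. integral (cbox 0 1) (\<lambda>\<tau>. \<tau> ^ i * \<omega> (u + \<tau> * (s - u)))) has_field_derivative
        integral (cbox 0 1) (\<lambda>\<tau>. \<tau> ^ Suc i * deriv \<omega> (u + \<tau> * (s - u)))) (at s within UNIV)"
    proof (rule leibniz_rule_field_derivative)
      fix x \<tau> :: real
      show "((\<lambda>s. \<tau> ^ i * \<omega> (u + \<tau> * (s - u))) has_real_derivative
          \<tau> ^ Suc i * deriv \<omega> (u + \<tau> * (x - u))) (at x within UNIV)"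
        by (auto intro!: derivative_eq_intros DERIV_chain2[OF d(1)])
      show "(\<lambda>\<tau>. \<tau> ^ i * \<omega> (u + \<tau> * (x - u))) integrable_on cbox 0 1"
        by (intro integrable_continuous continuous_intros continuous_on_compose2[OF c]) auto
      show "continuous_on (UNIV \<times> cbox 0 1) (\<lambda>(x, \<tau>). \<tau> ^ Suc i * deriv \<omega> (u + \<tau> * (x - u)))"
        by (auto simp: split_beta intro!: continuous_intros continuous_on_compose2[OF c'])
    qed auto
    then show "((\<lambda>s. integral {0..1} (\<lambda>\<tau>. \<tau> ^ i * \<omega> (u + \<tau> * (s - u)))) has_real_derivative
        integral {0..1} (\<lambda>\<tau>. \<tau> ^ Suc i * deriv \<omega> (u + \<tau> * (s - u)))) (at s)"
      by (simp add: cbox_interval)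
  qed (rule Suc.IH[OF d(2)])
qed

text \<open>
The difference quotient is an average of the derivative, hence it loses only one order of
differentiability at the point where it is formally singular.
\<close>

lemma Hadamard_quotient:
  fixes \<phi> :: "real \<Rightarrow> real"
  assumes "Ck_on (Suc n) UNIV \<phi>"
  obtains Q where "Ck_on n UNIV Q" "\<And>s. Q s * (s - u) = \<phi> s - \<phi> u" "Q u = deriv \<phi> u"
proof
  let ?Q = "\<lambda>s. integral {0..1} (\<lambda>\<tau>. deriv \<phi> (u + \<tau> * (s - u)))"
  note d = Ck_on_Suc_UNIV[OF assms]
  show "Ck_on n UNIV ?Q" using Ck_on_moment_integral[OF d(2), of 0 u] by simp
  show "?Q u = deriv \<phi> u" by simp
  fix s
  have "((\<lambda>\<tau>. deriv \<phi> (u + \<tau> * (s - u)) * (s - u)) has_integral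
      \<phi> (u + 1 * (s - u)) - \<phi> (u + 0 * (s - u))) {0..1}"
    by (rule fundamental_theorem_of_calculus)
      (auto simp flip: has_real_derivative_iff_has_vector_derivative
        intro!: derivative_eq_intros DERIV_chain2[OF d(1)])
  then have "integral {0..1} (\<lambda>\<tau>. deriv \<phi> (u + \<tau> * (s - u)) * (s - u)) = \<phi> s - \<phi> u"
    by (simp only: integral_unique) (simp add: algebra_simps)
  then show "?Q s * (s - u) = \<phi> s - \<phi> u" by simp
qed

text \<open>
With \<open>G\<close> the difference quotient of \<open>g\<close> at \<open>u\<close>, the equation \<open>lam * h = h' * g\<close> is solved by
\<open>h a = (a - u) * exp (Z a)\<close>, where \<open>Z' = - (G - lam) / ((a - u) * G)\<close> has a removable singularity. The
function \<open>\<beta>\<close> is a primitive of \<open>(f'(u) - f'(a)) / g(a)\<close>, which is a quotient of difference quotients. Here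
spectral stability enters: \<open>G u = g'(u)\<close> does not vanish. The regularity of \<open>h'\<close> at \<open>u\<close> is better than
that of \<open>Z'\<close> because \<open>h'\<close> is again an explicit function of \<open>Z\<close>.
\<close>

lemma straightening:
  fixes f g :: "real \<Rightarrow> real" and u :: real
  assumes k: "k \<ge> 2" and f: "Ck_on (k + 1) UNIV f" and g: "Ck_on k UNIV g"
    and gu: "g u = 0" and neg: "deriv g u < 0" and r0: "r0 > 0"
  obtains r \<rho> h h' q q' \<beta> \<beta>' where
    "0 < r" "r \<le> r0" "0 < \<rho>"
    "\<And>a. a \<in> {u - r..u + r} \<Longrightarrow> (h has_real_derivative h' a) (at a within {u - r..u + r})"
    "BU (k - 1) {u - r..u + r} h'"
    "\<And>a. a \<in> {u - r..u + r} \<Longrightarrow> (\<beta> has_real_derivative \<beta>' a) (at a within {u - r..u + r})"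
    "BU (k - 1) {u - r..u + r} \<beta>'"
    "\<And>y. y \<in> {-\<rho>..\<rho>} \<Longrightarrow> (q has_real_derivative q' y) (at y within {-\<rho>..\<rho>})"
    "BU (k - 1) {-\<rho>..\<rho>} q'"
    "\<And>y. y \<in> {-\<rho>..\<rho>} \<Longrightarrow> q y \<in> {u - r..u + r}"
    "h u = 0" "\<And>a. a \<in> {u - r..u + r} \<Longrightarrow> h a \<in> {-\<rho>..\<rho>} \<Longrightarrow> q (h a) = a"
    "\<And>y. y \<in> {-\<rho>..\<rho>} \<Longrightarrow> deriv g u * y * q' y = g (q y)"
    "\<And>a. a \<in> {u - r..u + r} \<Longrightarrow> \<beta>' a * g a = deriv f u - deriv f a"
proof -
  obtain k2 where k2: "k = Suc (Suc k2)" using k by (metis add_2_eq_Suc le_Suc_ex)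
  define lam where "lam = deriv g u"
  obtain G where G: "Ck_on (Suc k2) UNIV G" "\<And>s. G s * (s - u) = g s" "G u = lam"
    using Hadamard_quotient[of "Suc k2" g u] g gu unfolding k2 lam_def by auto
  obtain Q where Q: "Ck_on k2 UNIV Q" "\<And>s. Q s * (s - u) = G s - lam"
    by (rule Hadamard_quotient[OF G(1), of u]) (simp add: G(3))
  have "Ck_on (Suc (Suc k2)) UNIV (deriv f)" using Ck_on_Suc_UNIV(2) f k2 by simp
  then obtain H where H: "Ck_on (Suc k2) UNIV H" "\<And>s. H s * (s - u) = deriv f s - deriv f u"
    by (rule Hadamard_quotient[of _ _ u]) simp
  have l: "lam < 0" using neg by (simp add: lam_def)
  have contG: "continuous_on UNIV G" by (rule Ck_on_continuous[OF G(1)])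
  have "isCont G u" using contG by (simp add: continuous_on_eq_continuous_at)
  then obtain r1 where r1: "r1 > 0" "\<And>s. dist s u < r1 \<Longrightarrow> dist (G s) (G u) < - lam / 2"
    unfolding continuous_at_eps_delta using l by (meson half_gt_zero neg_0_less_iff_less)
  define r where "r = min r0 (r1 / 2)"
  have r: "0 < r" "r < r1" "r \<le> r0" using r1 r0 by (auto simp: r_def)
  define I where "I = {u - r..u + r}"
  have Gneg: "- G s \<ge> - lam / 2" if "s \<in> I" for s
  proof -
    have "dist s u < r1" using that r by (auto simp: I_def dist_real_def)
    then show ?thesis using r1(2)[of s] G(3) by (auto simp: dist_real_def)
  qed
  have Gn0: "G s \<noteq> 0" if "s \<in> I" for s using Gneg[OF that] l by auto
  have BG: "BU (Suc k2) I G" unfolding I_def by (rule BU_Ck_on_UNIV[OF G(1)])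
  have BQ: "BU k2 I Q" unfolding I_def by (rule BU_Ck_on_UNIV[OF Q(1)])
  have BH: "BU (Suc k2) I H" unfolding I_def by (rule BU_Ck_on_UNIV[OF H(1)])
  obtain KG where KG: "WB (Suc k2) (\<lambda>_. KG) I G" using BG unfolding BU_def by auto
  have "BU (Suc k2) I (\<lambda>s. inverse (- G s))"
  proof (rule BU_compose[OF BU_inverse_Icc[of "- lam / 2" _ KG] BU_uminus[OF BG]])
    show "0 < - lam / 2" using l by simp
    show "(\<lambda>x. - G x) ` I \<subseteq> {- lam / 2..KG}"
      using Gneg WB_bound[OF KG] by force
  qed
  from BU_uminus[OF this] have BiG: "BU (Suc k2) I (\<lambda>s. inverse (G s))"
    by (rule BU_cong) simp
  have BmQG: "BU k2 I (\<lambda>s. - (Q s * inverse (G s)))"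
    by (intro BU_uminus BU_mult BQ BU_le[OF BiG]) simp
  have cont: "continuous_on I F" if "BU n I F" for F n
    using that WB_cont unfolding BU_def by blast
  obtain Z where Z: "\<And>s. s \<in> I \<Longrightarrow> (Z has_real_derivative - (Q s * inverse (G s))) (at s within I)"
    using antiderivative_continuous[OF cont[OF BmQG, unfolded I_def]]
    unfolding I_def has_real_derivative_iff_has_vector_derivative by metis
  have BZ: "BU (Suc k2) I Z" by (rule BU_1D_SucI[OF Z BmQG]) (auto simp: I_def)
  obtain KZ where KZ: "WB (Suc k2) (\<lambda>_. KZ) I Z" using BZ unfolding BU_def by auto
  have BeZ: "BU (Suc k2) I (\<lambda>s. exp (Z s))"
    by (rule BU_compose[OF BU_exp_Icc[of _ "- KZ" KZ] BZ])
      (use WB_bound[OF KZ] in \<open>force simp: abs_le_iff\<close>)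
  have BemZ: "BU (Suc k2) I (\<lambda>s. exp (- Z s))"
    by (rule BU_compose[OF BU_exp_Icc[of _ "- KZ" KZ] BU_uminus[OF BZ]])
      (use WB_bound[OF KZ] in \<open>force simp: abs_le_iff\<close>)
  define h where "h = (\<lambda>s. (s - u) * exp (Z s))"
  define h' where "h' = (\<lambda>s. lam * (exp (Z s) * inverse (G s)))"
  have h': "(h has_real_derivative h' s) (at s within I)" if "s \<in> I" for s
  proof -
    have *: "(h has_real_derivative exp (Z s) + (s - u) * (exp (Z s) * - (Q s * inverse (G s)))) (at s within I)"
      unfolding h_def using Z[OF that] by (auto intro!: derivative_eq_intros)
    have "exp (Z s) + (s - u) * (exp (Z s) * - (Q s * inverse (G s)))
        = exp (Z s) * (1 - (Q s * (s - u)) * inverse (G s))" by (simp add: algebra_simps)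
    also have "\<dots> = h' s" unfolding Q(2) h'_def using Gn0[OF that] by (simp add: field_simps)
    finally show ?thesis using * by simp
  qed
  have Bh': "BU (Suc k2) I h'" unfolding h'_def by (intro BU_mult BU_const BeZ BiG)
  have h'pos: "h' s > 0" if "s \<in> I" for s
  proof -
    have "G s < 0" using Gneg[OF that] l by simp
    then have "inverse (G s) < 0" by simp
    then show ?thesis using l unfolding h'_def by (simp add: mult_neg_neg mult_pos_neg)
  qed
  have h_less: "h a < h b" if "a \<in> I" "b \<in> I" "a < b" for a b
  proof (rule DERIV_pos_imp_increasing_open[OF \<open>a < b\<close>])
    fix x assume x: "a < x" "x < b"
    have "at x within I = at x" using x that by (intro at_within_interior) (auto simp: I_def)
    then show "\<exists>y. (h has_real_derivative y) (at x) \<and> 0 < y"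
      using h'[of x] h'pos[of x] x that by (auto simp: I_def)
  next
    show "continuous_on {a..b} h"
      by (rule continuous_on_subset[OF DERIV_continuous_on[OF h']]) (use that in \<open>auto simp: I_def\<close>)
  qed
  have h_inj: "inj_on h I" unfolding inj_on_def using h_less by (metis less_irrefl linorder_neqE_linordered_idom)
  define q where "q = inv_into I h"
  have qh: "q (h a) = a" if "a \<in> I" for a unfolding q_def using h_inj that by simp
  have hcont: "continuous_on I h" by (rule DERIV_continuous_on[OF h'])
  define \<rho>1 where "\<rho>1 = min (h (u + r)) (- h (u - r))"
  have hu: "h u = 0" by (simp add: h_def)
  have rho1: "\<rho>1 > 0" unfolding \<rho>1_def using h_less[of u "u + r"] h_less[of "u - r" u] hu r by (auto simp: I_def)
  have img: "y \<in> h ` I" if "\<bar>y\<bar> \<le> \<rho>1" for y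
  proof -
    have "\<exists>x\<ge>u - r. x \<le> u + r \<and> h x = y"
      using that r hcont unfolding \<rho>1_def I_def by (intro IVT') auto
    then show ?thesis by (auto simp: I_def)
  qed
  have qI: "q y \<in> I" and hq: "h (q y) = y" if "\<bar>y\<bar> \<le> \<rho>1" for y
    unfolding q_def using inv_into_into[OF img[OF that]] f_inv_into_f[OF img[OF that]] by auto
  have qcont: "continuous_on (h ` I) q"
    by (rule continuous_on_inv[OF hcont]) (auto simp: I_def qh[unfolded I_def])
  define \<rho> where "\<rho> = \<rho>1 / 2"
  have rho: "0 < \<rho>" "\<rho> < \<rho>1" using rho1 by (auto simp: \<rho>_def)
  define \<Theta> where "\<Theta> = (\<lambda>a. G a * (inverse lam * exp (- Z a)))"
  have \<Theta>: "\<Theta> a = inverse (h' a)" if "a \<in> I" for a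
    unfolding \<Theta>_def h'_def using Gn0[OF that] l by (simp add: field_simps exp_minus)
  have q': "(q has_real_derivative \<Theta> (q y)) (at y within S)" if y: "\<bar>y\<bar> < \<rho>1" for y S
  proof -
    have "isCont q y"
    proof (rule continuous_on_interior)
      show "continuous_on {-\<rho>1..\<rho>1} q" using qcont by (rule continuous_on_subset) (use img in auto)
      show "y \<in> interior {-\<rho>1..\<rho>1}" using y by auto
    qed
    have "q y \<in> I" using qI y by simp
    have ne: "q y \<noteq> u + r" "q y \<noteq> u - r"
      using hq[OF less_imp_le[OF y]] y unfolding \<rho>1_def by auto
    then have "at (q y) within I = at (q y)"
      using \<open>q y \<in> I\<close> by (intro at_within_interior) (auto simp: I_def)
    then have D: "DERIV h (q y) :> h' (q y)" using h'[OF \<open>q y \<in> I\<close>] by simp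
    have "DERIV q y :> inverse (h' (q y))"
    proof (rule DERIV_inverse_function[where f=h and g=q and a="-\<rho>1" and b="\<rho>1", OF D])
      show "h' (q y) \<noteq> 0" using h'pos[OF \<open>q y \<in> I\<close>] by simp
      show "- \<rho>1 < y" "y < \<rho>1" using y by auto
      show "h (q z) = z" if "- \<rho>1 < z" "z < \<rho>1" for z using hq[of z] that by simp
    qed fact
    then show ?thesis using \<Theta>[OF \<open>q y \<in> I\<close>] by (simp add: has_field_derivative_at_within)
  qed
  have B\<Theta>: "BU (Suc k2) I \<Theta>" unfolding \<Theta>_def by (intro BU_mult BU_const BG BemZ)
  have Bq: "n \<le> k \<Longrightarrow> BU n {-\<rho>..\<rho>} q" for n
  proof (induction n)
    case 0
    have "{-\<rho>..\<rho>} \<subseteq> h ` I" using img rho by auto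
    from continuous_on_subset[OF qcont this] show ?case by (rule BU_0_compact) simp
  next
    case (Suc n)
    show ?case
    proof (rule BU_1D_SucI)
      show "BU n {-\<rho>..\<rho>} (\<lambda>y. \<Theta> (q y))"
        by (rule BU_compose[OF BU_le[OF B\<Theta>] Suc.IH]) (use Suc.prems k2 qI rho in auto)
    qed (use q' rho in auto)
  qed
  have BB: "BU (Suc k2) I (\<lambda>s. - (H s * inverse (G s)))"
    by (intro BU_uminus BU_mult BH BiG)
  obtain \<beta> where \<beta>: "\<And>s. s \<in> I \<Longrightarrow> (\<beta> has_real_derivative - (H s * inverse (G s))) (at s within I)"
    using antiderivative_continuous[OF cont[OF BB, unfolded I_def]]
    unfolding I_def has_real_derivative_iff_has_vector_derivative by metis
  show ?thesis
  proof (rule that[of r \<rho> h h' \<beta> "\<lambda>s. - (H s * inverse (G s))" q "\<lambda>y. \<Theta> (q y)", folded I_def])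
    show "BU (k - 1) {-\<rho>..\<rho>} (\<lambda>y. \<Theta> (q y))"
      by (rule BU_compose[OF BU_le[OF B\<Theta>] Bq]) (use k2 qI rho in auto)
    fix y assume y: "y \<in> {-\<rho>..\<rho>}"
    then have y1: "\<bar>y\<bar> < \<rho>1" using rho by auto
    show "(q has_real_derivative \<Theta> (q y)) (at y within {- \<rho>..\<rho>})" using q'[OF y1] .
    show "q y \<in> I" using qI y1 by auto
    have "lam * y * \<Theta> (q y) = lam * h (q y) * \<Theta> (q y)" using hq y1 by auto
    also have "\<dots> = (exp (Z (q y)) * exp (- Z (q y))) * (G (q y) * (q y - u))"
      unfolding h_def \<Theta>_def using l by (simp add: field_simps)
    also have "\<dots> = g (q y)" by (simp add: G(2) flip: exp_add)
    finally show "deriv g u * y * \<Theta> (q y) = g (q y)" by (simp add: lam_def)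
  next
    fix a assume a: "a \<in> I"
    show "- (H a * inverse (G a)) * g a = deriv f u - deriv f a"
    proof -
      have "- (H a * inverse (G a)) * (G a * (a - u)) = - (H a * (a - u))" using Gn0[OF a] by simp
      then show ?thesis by (simp add: G(2) H(2))
    qed
  qed (use r rho h' Bh' \<beta> BB hu qh k2 in auto)
qed

section \<open>Uniform bounds for families of functions\<close>

text \<open>
A family of data is indexed by \<open>P\<close>, and each member has its own weights. All constants below are chosen
before the index, which is how uniformity with respect to the data is expressed.
\<close>

locale weights =
  fixes P :: "'i set" and N :: "'i \<Rightarrow> nat \<Rightarrow> real" and L :: real
  assumes N_ge_1: "i \<in> P \<Longrightarrow> 1 \<le> N i j"
    and N_mono: "i \<in> P \<Longrightarrow> j \<le> j' \<Longrightarrow> N i j \<le> N i j'"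
    and N_submult: "i \<in> P \<Longrightarrow> N i a * N i b \<le> L * N i (a + b)"
    and L_ge_1: "1 \<le> L" and N_0: "i \<in> P \<Longrightarrow> N i 0 = 1"
begin

lemma N_nonneg: "i \<in> P \<Longrightarrow> 0 \<le> N i j"
  using N_ge_1[of i j] by simp

text \<open>
One constant \<open>c\<close> serves the whole family; the factor \<open>M i\<close> records that a quantity is linear in the
size of the \<open>i\<close>-th datum.
\<close>

definition UB :: "nat \<Rightarrow> ('i \<Rightarrow> real) \<Rightarrow> ('i \<Rightarrow> 'a::euclidean_space set) \<Rightarrow> ('i \<Rightarrow> 'a \<Rightarrow> real) \<Rightarrow> bool" where
  "UB n M S F \<longleftrightarrow> (\<exists>c\<ge>0. \<forall>i\<in>P. 0 \<le> M i \<and> WB n (\<lambda>j. c * (M i * N i j)) (S i) (F i))"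

abbreviation "UB1 n \<equiv> UB n (\<lambda>_. 1)"

lemma UB_E:
  assumes "UB n M S F"
  obtains c where "c \<ge> 0" "\<And>i. i \<in> P \<Longrightarrow> 0 \<le> M i" "\<And>i. i \<in> P \<Longrightarrow> WB n (\<lambda>j. c * (M i * N i j)) (S i) (F i)"
  using assms unfolding UB_def by blast

lemma UB_I:
  assumes "c \<ge> 0" "\<And>i. i \<in> P \<Longrightarrow> 0 \<le> M i" "\<And>i. i \<in> P \<Longrightarrow> WB n (\<lambda>j. c * (M i * N i j)) (S i) (F i)"
  shows "UB n M S F"
  using assms unfolding UB_def by blast

lemma UB_weaken:
  assumes "UB n M S F" "\<And>i. i \<in> P \<Longrightarrow> M i \<le> C * M' i" "\<And>i. i \<in> P \<Longrightarrow> 0 \<le> M' i" "C \<ge> 0"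
  shows "UB n M' S F"
proof -
  obtain c where c: "c \<ge> 0" "\<And>i. i \<in> P \<Longrightarrow> 0 \<le> M i" "\<And>i. i \<in> P \<Longrightarrow> WB n (\<lambda>j. c * (M i * N i j)) (S i) (F i)"
    by (rule UB_E[OF assms(1)]) (rule that)
  show ?thesis
  proof (rule UB_I[of "c * C"])
    fix i assume i: "i \<in> P"
    show "WB n (\<lambda>j. c * C * (M' i * N i j)) (S i) (F i)"
    proof (rule WB_mono[OF c(3)[OF i]])
      fix j
      have "c * (M i * N i j) \<le> c * ((C * M' i) * N i j)"
        using assms(2)[OF i] c(1) N_nonneg[OF i] by (intro mult_left_mono mult_right_mono) auto
      then show "c * (M i * N i j) \<le> c * C * (M' i * N i j)" by (simp add: algebra_simps)
    qed
  qed (use assms c in auto)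
qed

lemma UB_le: "UB n M S F \<Longrightarrow> m \<le> n \<Longrightarrow> UB m M S F"
  unfolding UB_def using WB_order_le by blast

lemma UB_cong:
  assumes "UB n M S F" "\<And>i x. i \<in> P \<Longrightarrow> x \<in> S i \<Longrightarrow> F i x = G i x"
  shows "UB n M S G"
proof -
  obtain c where c: "c \<ge> 0" "\<And>i. i \<in> P \<Longrightarrow> 0 \<le> M i" "\<And>i. i \<in> P \<Longrightarrow> WB n (\<lambda>j. c * (M i * N i j)) (S i) (F i)"
    by (rule UB_E[OF assms(1)]) (rule that)
  show ?thesis by (rule UB_I[OF c(1,2) WB_cong[OF c(3) assms(2)]])
qed

lemma UB_uc: "UB n M S F \<Longrightarrow> i \<in> P \<Longrightarrow> uniformly_continuous_on (S i) (F i)"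
  unfolding UB_def using WB_uc by blast

lemma UB_add:
  assumes "UB n M S F" "UB n M S G" shows "UB n M S (\<lambda>i x. F i x + G i x)"
proof -
  obtain c where c: "c \<ge> 0" "\<And>i. i \<in> P \<Longrightarrow> 0 \<le> M i" "\<And>i. i \<in> P \<Longrightarrow> WB n (\<lambda>j. c * (M i * N i j)) (S i) (F i)"
    by (rule UB_E[OF assms(1)]) (rule that)
  obtain d where d: "d \<ge> 0" "\<And>i. i \<in> P \<Longrightarrow> 0 \<le> M i" "\<And>i. i \<in> P \<Longrightarrow> WB n (\<lambda>j. d * (M i * N i j)) (S i) (G i)"
    by (rule UB_E[OF assms(2)]) (rule that)
  show ?thesis
  proof (rule UB_I[of "c + d"])
    fix i assume i: "i \<in> P"
    show "WB n (\<lambda>j. (c + d) * (M i * N i j)) (S i) (\<lambda>x. F i x + G i x)"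
      by (rule WB_mono[OF WB_add[OF c(3)[OF i] d(3)[OF i]]]) (simp add: algebra_simps)
  qed (use c d in auto)
qed

lemma UB_mult:
  assumes "UB n M S F" "UB n M' S G" shows "UB n (\<lambda>i. M i * M' i) S (\<lambda>i x. F i x * G i x)"
proof -
  obtain c where c: "c \<ge> 0" "\<And>i. i \<in> P \<Longrightarrow> 0 \<le> M i" "\<And>i. i \<in> P \<Longrightarrow> WB n (\<lambda>j. c * (M i * N i j)) (S i) (F i)"
    by (rule UB_E[OF assms(1)]) (rule that)
  obtain d where d: "d \<ge> 0" "\<And>i. i \<in> P \<Longrightarrow> 0 \<le> M' i" "\<And>i. i \<in> P \<Longrightarrow> WB n (\<lambda>j. d * (M' i * N i j)) (S i) (G i)"
    by (rule UB_E[OF assms(2)]) (rule that)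
  show ?thesis
  proof (rule UB_I[of "2 ^ n * (c * d * L)"])
    fix i assume i: "i \<in> P"
    have "WB n (\<lambda>j. 2 ^ j * (c * d * L * (M i * M' i * N i j))) (S i) (\<lambda>x. F i x * G i x)"
    proof (rule WB_mult[OF c(3)[OF i] d(3)[OF i]])
      fix a b
      have "c * (M i * N i a) * (d * (M' i * N i b)) = (c * d * (M i * M' i)) * (N i a * N i b)"
        by (simp add: algebra_simps)
      also have "\<dots> \<le> (c * d * (M i * M' i)) * (L * N i (a + b))"
        using c d i N_submult[OF i] by (intro mult_left_mono) auto
      finally show "c * (M i * N i a) * (d * (M' i * N i b)) \<le> c * d * L * (M i * M' i * N i (a + b))"
        by (simp add: algebra_simps)
    qed (use c d i N_nonneg[OF i] in auto)
    then show "WB n (\<lambda>j. 2 ^ n * (c * d * L) * (M i * M' i * N i j)) (S i) (\<lambda>x. F i x * G i x)"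
    proof (rule WB_mono)
      fix j assume "j \<le> n"
      have "2 ^ j * (c * d * L * (M i * M' i * N i j)) \<le> 2 ^ n * (c * d * L * (M i * M' i * N i j))"
        using c d i N_nonneg[OF i] L_ge_1 \<open>j \<le> n\<close> by (intro mult_right_mono power_increasing) auto
      then show "2 ^ j * (c * d * L * (M i * M' i * N i j)) \<le> 2 ^ n * (c * d * L) * (M i * M' i * N i j)"
        by (simp add: algebra_simps)
    qed
  qed (use c d L_ge_1 in auto)
qed

lemma UB_mult_UB1: "UB n M S F \<Longrightarrow> UB1 n S G \<Longrightarrow> UB n M S (\<lambda>i x. F i x * G i x)"
  using UB_mult[of n M S F "\<lambda>_. 1" G] by simp

lemma UB1_mult_UB: "UB1 n S F \<Longrightarrow> UB n M S G \<Longrightarrow> UB n M S (\<lambda>i x. F i x * G i x)"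
  using UB_mult[of n "\<lambda>_. 1" S F M G] by simp

lemma UB_const:
  assumes "\<And>i. i \<in> P \<Longrightarrow> \<bar>c i\<bar> \<le> C * M i" "\<And>i. i \<in> P \<Longrightarrow> 0 \<le> M i"
  shows "UB n M S (\<lambda>i _. c i)"
proof (rule UB_I[of "\<bar>C\<bar>"])
  fix i assume i: "i \<in> P"
  have "\<bar>c i\<bar> \<le> \<bar>C\<bar> * M i"
    using assms(1)[OF i] mult_right_mono[OF abs_ge_self[of C] assms(2)[OF i]] by linarith
  also have "\<dots> \<le> \<bar>C\<bar> * (M i * N i 0)"
    using N_ge_1[OF i, of 0] assms(2)[OF i] by (intro mult_left_mono) (auto simp: mult_le_cancel_left1)
  finally show "WB n (\<lambda>j. \<bar>C\<bar> * (M i * N i j)) (S i) (\<lambda>x. c i)"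
    using assms(2)[OF i] N_nonneg[OF i] by (intro WB_const) auto
qed (use assms in auto)

lemma UB1_const: "UB1 n S (\<lambda>_ _. c)"
  by (rule UB_const[of _ "\<bar>c\<bar>"]) auto

lemma UB_cmult: "UB n M S F \<Longrightarrow> UB n M S (\<lambda>i x. c * F i x)"
  by (rule UB1_mult_UB[OF UB1_const])

lemma UB_uminus: "UB n M S F \<Longrightarrow> UB n M S (\<lambda>i x. - F i x)"
  using UB_cmult[of n M S F "-1"] by simp

lemma UB_diff:
  assumes "UB n M S F" "UB n M S G" shows "UB n M S (\<lambda>i x. F i x - G i x)"
  using UB_add[OF assms(1) UB_uminus[OF assms(2)]] by simp

lemma UB1_of_BU:
  assumes "BU n T G" shows "UB1 n (\<lambda>_. T) (\<lambda>_. G)"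
proof -
  obtain K where K: "K \<ge> 1" "WB n (\<lambda>_. K) T G" using assms BU_nonneg by metis
  show ?thesis
  proof (rule UB_I[of K])
    fix i assume i: "i \<in> P"
    show "WB n (\<lambda>j. K * (1 * N i j)) T G"
      by (rule WB_mono[OF K(2)]) (use N_ge_1[OF i] K in \<open>simp add: mult_le_cancel_left1\<close>)
  qed (use K in auto)
qed

lemma finite_Basis_bound:
  fixes S :: "'i \<Rightarrow> 'a::euclidean_space set" and D :: "'i \<Rightarrow> 'a \<Rightarrow> 'a \<Rightarrow> real"
  assumes "\<And>b. b \<in> Basis \<Longrightarrow> UB n M S (\<lambda>i x. D i x b)"
  shows "\<exists>c\<ge>0. \<forall>i\<in>P. \<forall>b\<in>Basis. WB n (\<lambda>j. c * (M i * N i j)) (S i) (\<lambda>x. D i x b)"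
proof -
  obtain c where c: "\<And>b::'a. b \<in> Basis \<Longrightarrow> 0 \<le> c b \<and> (\<forall>i\<in>P. 0 \<le> M i \<and> WB n (\<lambda>j. c b * (M i * N i j)) (S i) (\<lambda>x. D i x b))"
    using assms unfolding UB_def by metis
  have c0: "0 \<le> c b" if "b \<in> Basis" for b using c[OF that] by simp
  show ?thesis
  proof (intro exI[of _ "sum c Basis"] conjI ballI)
    show "0 \<le> sum c Basis" by (rule sum_nonneg[OF c0])
    fix i and b :: 'a assume i: "i \<in> P" and b: "b \<in> Basis"
    have le: "c b \<le> sum c Basis" by (rule member_le_sum[OF b]) (auto intro: c0)
    have W: "WB n (\<lambda>j. c b * (M i * N i j)) (S i) (\<lambda>x. D i x b)" and Mi: "0 \<le> M i"
      using c[OF b] i by auto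
    show "WB n (\<lambda>j. sum c Basis * (M i * N i j)) (S i) (\<lambda>x. D i x b)"
      by (rule WB_mono[OF W]) (use le Mi N_nonneg[OF i] in \<open>intro mult_right_mono mult_nonneg_nonneg; simp\<close>)
  qed
qed

lemma UB_SucI:
  fixes S :: "'i \<Rightarrow> 'a::euclidean_space set"
  assumes uc: "\<And>i. i \<in> P \<Longrightarrow> uniformly_continuous_on (S i) (F i)"
    and bd: "\<And>i x. i \<in> P \<Longrightarrow> x \<in> S i \<Longrightarrow> \<bar>F i x\<bar> \<le> C * M i" and M: "\<And>i. i \<in> P \<Longrightarrow> 0 \<le> M i"
    and D: "\<And>i x. i \<in> P \<Longrightarrow> x \<in> S i \<Longrightarrow> (F i has_derivative D i x) (at x within S i)"
    and UD: "\<And>b. b \<in> Basis \<Longrightarrow> UB n M S (\<lambda>i x. D i x b)"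
  shows "UB (Suc n) M S F"
proof -
  obtain c where c: "c \<ge> 0" "\<And>i b. i \<in> P \<Longrightarrow> b \<in> Basis \<Longrightarrow> WB n (\<lambda>j. c * (M i * N i j)) (S i) (\<lambda>x. D i x b)"
    using finite_Basis_bound[where D=D, OF UD] by auto
  show ?thesis
  proof (rule UB_I[of "max \<bar>C\<bar> c"])
    fix i assume i: "i \<in> P"
    show "WB (Suc n) (\<lambda>j. max \<bar>C\<bar> c * (M i * N i j)) (S i) (F i)"
    proof (rule WB_SucI[OF uc[OF i] _ D[OF i]])
      fix x assume x: "x \<in> S i"
      have "\<bar>F i x\<bar> \<le> C * M i" by (rule bd[OF i x])
      also have "\<dots> \<le> max \<bar>C\<bar> c * (M i * N i 0)"
        using M[OF i] N_ge_1[OF i, of 0] by (intro mult_mono) (auto simp: mult_le_cancel_left1)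
      finally show "\<bar>F i x\<bar> \<le> max \<bar>C\<bar> c * (M i * N i 0)" .
    next
      fix b :: 'a assume b: "b \<in> Basis"
      show "WB n (\<lambda>j. max \<bar>C\<bar> c * (M i * N i (Suc j))) (S i) (\<lambda>x. D i x b)"
      proof (rule WB_mono[OF c(2)[OF i b]])
        fix j
        show "c * (M i * N i j) \<le> max \<bar>C\<bar> c * (M i * N i (Suc j))"
          using M[OF i] N_nonneg[OF i] N_mono[OF i, of j "Suc j"] c(1)
          by (intro mult_mono) auto
      qed
    qed
  qed (use M in auto)
qed

lemma UB_0I:
  assumes uc: "\<And>i. i \<in> P \<Longrightarrow> uniformly_continuous_on (S i) (F i)"
    and bd: "\<And>i x. i \<in> P \<Longrightarrow> x \<in> S i \<Longrightarrow> \<bar>F i x\<bar> \<le> C * M i" and M: "\<And>i. i \<in> P \<Longrightarrow> 0 \<le> M i"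
  shows "UB 0 M S F"
proof (rule UB_I[of "\<bar>C\<bar>"])
  fix i assume i: "i \<in> P"
  have "\<bar>F i x\<bar> \<le> \<bar>C\<bar> * (M i * N i 0)" if "x \<in> S i" for x
  proof -
    have "\<bar>F i x\<bar> \<le> C * M i" by (rule bd[OF i that])
    also have "\<dots> \<le> \<bar>C\<bar> * (M i * N i 0)"
      using M[OF i] N_ge_1[OF i, of 0] by (intro mult_mono) (auto simp: mult_le_cancel_left1)
    finally show ?thesis .
  qed
  then show "WB 0 (\<lambda>j. \<bar>C\<bar> * (M i * N i j)) (S i) (F i)" using uc[OF i] by simp
qed (use M in auto)

lemma UB1_compose_bounded:
  assumes g: "BU n T G" and F: "UB1 n S F" and FT: "\<And>i x. i \<in> P \<Longrightarrow> x \<in> S i \<Longrightarrow> F i x \<in> T"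
  shows "UB1 n S (\<lambda>i x. G (F i x))"
proof -
  obtain K where K: "K \<ge> 1" "WB n (\<lambda>_. K) T G" using g BU_nonneg by metis
  obtain c0 where c0: "c0 \<ge> 0" "\<And>i. i \<in> P \<Longrightarrow> (0::real) \<le> 1" "\<And>i. i \<in> P \<Longrightarrow> WB n (\<lambda>j. c0 * (1 * N i j)) (S i) (F i)"
    by (rule UB_E[OF F]) (rule that)
  define c where "c = max c0 1"
  have c: "c \<ge> 1" "\<And>i. i \<in> P \<Longrightarrow> WB n (\<lambda>j. c * N i j) (S i) (F i)"
    using N_nonneg by (auto simp: c_def intro!: WB_mono[OF c0(3)] mult_right_mono)
  have cL: "1 \<le> c * L" using c(1) L_ge_1 mult_mono[of 1 c 1 L] by simp
  show ?thesis
  proof (rule UB_I[of "(2 ^ n * (c * L)) ^ n * K * c"])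
    fix i assume i: "i \<in> P"
    have "WB n (\<lambda>j. (2 ^ n * (c * L)) ^ n * K * (c * N i j)) (S i) (\<lambda>x. G (F i x))"
    proof (rule WB_compose_bounded[OF K(2) _ c(2)[OF i]])
      show "c * N i a * (c * N i b) \<le> c * L * (c * N i (a + b))" for a b
        using mult_left_mono[OF N_submult[OF i, of a b], of "c * c"] c(1) by (simp add: algebra_simps)
      show "1 \<le> c * N i j" for j using mult_mono[of 1 c 1 "N i j"] c(1) N_ge_1[OF i, of j] by simp
      show "F i ` S i \<subseteq> T" using FT[OF i] by auto
    qed (use cL K in auto)
    then show "WB n (\<lambda>j. (2 ^ n * (c * L)) ^ n * K * c * (1 * N i j)) (S i) (\<lambda>x. G (F i x))"
      by (simp add: mult.assoc)
  qed (use c K L_ge_1 in auto)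
qed

text \<open>
Inner functions of compositions: the function itself may be unbounded (a foot point is), only its
derivatives are controlled.
\<close>

definition IN :: "nat \<Rightarrow> ('i \<Rightarrow> 'a::euclidean_space set) \<Rightarrow> ('i \<Rightarrow> 'a \<Rightarrow> real) \<Rightarrow> ('i \<Rightarrow> 'a \<Rightarrow> 'a \<Rightarrow> real) \<Rightarrow> bool" where
  "IN n S F D \<longleftrightarrow> (\<forall>i\<in>P. uniformly_continuous_on (S i) (F i)) \<and>
     (\<forall>i\<in>P. \<forall>x\<in>S i. (F i has_derivative D i x) (at x within S i)) \<and>
     (n > 0 \<longrightarrow> (\<forall>b\<in>Basis. UB1 (n - 1) S (\<lambda>i x. D i x b)))"

lemma IN_le:
  fixes S :: "'i \<Rightarrow> 'a::euclidean_space set"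
  shows "IN n S F D \<Longrightarrow> m \<le> n \<Longrightarrow> IN m S F D"
  unfolding IN_def
proof (elim conjE, intro conjI impI ballI)
  fix b :: 'a assume "m \<le> n" "0 < n \<longrightarrow> (\<forall>b\<in>Basis. UB1 (n - 1) S (\<lambda>i x. D i x b))" "0 < m" "b \<in> Basis"
  then show "UB1 (m - 1) S (\<lambda>i x. D i x b)" by (intro UB_le[of "n - 1" _ _ _ "m - 1"]) auto
qed auto

text \<open>
Linearity in \<open>M\<close> is inherited from the outer function, the uniform form of \<open>WB_compose\<close>.
\<close>

lemma UB_compose:
  fixes S :: "'i \<Rightarrow> 'a::euclidean_space set"
  assumes g: "UB n M T G" and F: "IN n S F D" and FT: "\<And>i x. i \<in> P \<Longrightarrow> x \<in> S i \<Longrightarrow> F i x \<in> T i"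
  shows "UB n M S (\<lambda>i x. G i (F i x))"
proof -
  obtain c where c: "c \<ge> 0" "\<And>i. i \<in> P \<Longrightarrow> 0 \<le> M i" "\<And>i. i \<in> P \<Longrightarrow> WB n (\<lambda>j. c * (M i * N i j)) (T i) (G i)"
    by (rule UB_E[OF g]) (rule that)
  obtain d0 where d0: "d0 \<ge> 0"
    "\<And>i b. n > 0 \<Longrightarrow> i \<in> P \<Longrightarrow> b \<in> Basis \<Longrightarrow> WB (n - 1) (\<lambda>j. d0 * (1 * N i j)) (S i) (\<lambda>x. D i x b)"
  proof (cases "n > 0")
    case True
    then have "\<And>b. b \<in> Basis \<Longrightarrow> UB1 (n - 1) S (\<lambda>i x. D i x b)" using F by (simp add: IN_def)
    from finite_Basis_bound[where D=D, OF this] obtain c where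
      "c \<ge> 0" "\<forall>i\<in>P. \<forall>b\<in>Basis. WB (n - 1) (\<lambda>j. c * (1 * N i j)) (S i) (\<lambda>x. D i x b)" by auto
    then show ?thesis by (intro that[of c]) auto
  next
    case False then show ?thesis using that[of 0] by simp
  qed
  define d where "d = max d0 1"
  have d: "d \<ge> 1" "\<And>i b. n > 0 \<Longrightarrow> i \<in> P \<Longrightarrow> b \<in> Basis \<Longrightarrow> WB (n - 1) (\<lambda>j. d * N i j) (S i) (\<lambda>x. D i x b)"
  proof -
    show "WB (n - 1) (\<lambda>j. d * N i j) (S i) (\<lambda>x. D i x b)" if "n > 0" "i \<in> P" "b \<in> Basis" for i b
      by (rule WB_mono[OF d0(2)[OF that]]) (use N_nonneg[OF that(2)] in \<open>auto simp: d_def intro!: mult_right_mono\<close>)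
  qed (simp add: d_def)
  have dL: "1 \<le> d * L" using d(1) L_ge_1 mult_mono[of 1 d 1 L] by simp
  show ?thesis
  proof (rule UB_I[of "(2 ^ n * (d * L)) ^ n * c"])
    fix i assume i: "i \<in> P"
    have "WB n (\<lambda>j. (2 ^ n * (d * L)) ^ n * (c * (M i * N i j))) (S i) (\<lambda>x. G i (F i x))"
    proof (rule WB_compose[OF c(3)[OF i], where D="D i" and N="\<lambda>j. d * N i j"])
      show "F i ` S i \<subseteq> T i" using FT[OF i] by auto
      show "uniformly_continuous_on (S i) (F i)" "\<forall>x\<in>S i. (F i has_derivative D i x) (at x within S i)"
        using F i by (auto simp: IN_def)
      show "WB (n - 1) (\<lambda>j. d * N i j) (S i) (\<lambda>x. D i x b)" if "n > 0" "b \<in> Basis" for b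
        using d(2)[OF that(1) i that(2)] .
      show "c * (M i * N i a) * (d * N i b) \<le> d * L * (c * (M i * N i (a + b)))" for a b
        using mult_left_mono[OF N_submult[OF i, of a b], of "c * M i * d"] c(1) c(2)[OF i] d(1)
        by (simp add: algebra_simps)
    qed (use c i d N_nonneg[OF i] dL in auto)
    then show "WB n (\<lambda>j. (2 ^ n * (d * L)) ^ n * c * (M i * N i j)) (S i) (\<lambda>x. G i (F i x))"
      by (simp add: mult.assoc)
  qed (use c d L_ge_1 in auto)
qed

lemma UB_of_IN:
  assumes F: "IN n S F D" and bd: "\<And>i x. i \<in> P \<Longrightarrow> x \<in> S i \<Longrightarrow> \<bar>F i x\<bar> \<le> C * M i"
    and M: "\<And>i. i \<in> P \<Longrightarrow> 0 \<le> M i"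
    and UD: "\<And>b. n > 0 \<Longrightarrow> b \<in> Basis \<Longrightarrow> UB (n - 1) M S (\<lambda>i x. D i x b)"
  shows "UB n M S F"
proof (cases n)
  case 0
  show ?thesis unfolding 0 by (rule UB_0I[OF _ bd M]) (use F in \<open>auto simp: IN_def\<close>)
next
  case (Suc m)
  show ?thesis unfolding Suc
    by (rule UB_SucI[OF _ bd M]) (use F UD Suc in \<open>auto simp: IN_def\<close>)
qed

lemma UB1_of_IN:
  assumes F: "IN n S F D" and bd: "\<And>i x. i \<in> P \<Longrightarrow> x \<in> S i \<Longrightarrow> \<bar>F i x\<bar> \<le> C"
  shows "UB1 n S F"
  by (rule UB_of_IN[OF F, of C]) (use F bd in \<open>auto simp: IN_def\<close>)

lemma IN_compose:
  fixes S :: "'i \<Rightarrow> 'a::euclidean_space set"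
  assumes F: "IN n S F D" and FT: "\<And>i x. i \<in> P \<Longrightarrow> x \<in> S i \<Longrightarrow> F i x \<in> T i"
    and uc: "\<And>i. i \<in> P \<Longrightarrow> uniformly_continuous_on (T i) (G i)"
    and G': "\<And>i y. i \<in> P \<Longrightarrow> y \<in> T i \<Longrightarrow> (G i has_real_derivative G' i y) (at y within T i)"
    and UG': "UB1 (n - 1) T G'"
  shows "IN n S (\<lambda>i x. G i (F i x)) (\<lambda>i x d. G' i (F i x) * D i x d)"
  unfolding IN_def
proof (intro conjI ballI impI)
  fix i assume i: "i \<in> P"
  show "uniformly_continuous_on (S i) (\<lambda>x. G i (F i x))"
    by (rule uniformly_continuous_on_comp[OF uc[OF i]]) (use F FT i in \<open>auto simp: IN_def\<close>)
  fix x assume x: "x \<in> S i"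
  have d: "(F i has_derivative D i x) (at x within S i)" using F i x by (auto simp: IN_def)
  show "((\<lambda>x. G i (F i x)) has_derivative (\<lambda>d. G' i (F i x) * D i x d)) (at x within S i)"
    using has_derivative_in_compose2[of "T i" "G i" "\<lambda>y. times (G' i y)" "F i" "S i" x "D i x"] d
      G'[OF i] FT[OF i] x by (auto simp: has_field_derivative_def)
next
  fix b :: 'a assume n: "0 < n" and b: "b \<in> Basis"
  have "UB1 (n - 1) S (\<lambda>i x. G' i (F i x))"
    by (rule UB_compose[OF UG' IN_le[OF F] FT]) auto
  moreover have "UB1 (n - 1) S (\<lambda>i x. D i x b)" using F n b by (auto simp: IN_def)
  ultimately show "UB1 (n - 1) S (\<lambda>i x. G' i (F i x) * D i x b)" by (rule UB1_mult_UB)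
qed

lemma IN_mult:
  fixes S :: "'i \<Rightarrow> 'a::euclidean_space set"
  assumes F: "IN n S F D" and G: "IN n S G D'"
    and bF: "\<And>i x. i \<in> P \<Longrightarrow> x \<in> S i \<Longrightarrow> \<bar>F i x\<bar> \<le> C" and bG: "\<And>i x. i \<in> P \<Longrightarrow> x \<in> S i \<Longrightarrow> \<bar>G i x\<bar> \<le> C'"
  shows "IN n S (\<lambda>i x. F i x * G i x) (\<lambda>i x d. F i x * D' i x d + D i x d * G i x)"
  unfolding IN_def
proof (intro conjI ballI impI)
  fix i assume i: "i \<in> P"
  show "uniformly_continuous_on (S i) (\<lambda>x. F i x * G i x)"
    by (rule uc_mult[of _ _ _ C C']) (use F G bF bG i in \<open>auto simp: IN_def\<close>)
  fix x assume x: "x \<in> S i"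
  show "((\<lambda>x. F i x * G i x) has_derivative (\<lambda>d. F i x * D' i x d + D i x d * G i x)) (at x within S i)"
    using has_derivative_mult[of "F i" "D i x" x "S i" "G i" "D' i x"] F G i x by (simp add: IN_def)
next
  fix b :: 'a assume n: "0 < n" and b: "b \<in> Basis"
  have "UB1 (n - 1) S F" "UB1 (n - 1) S G"
    by (rule UB_le[OF UB1_of_IN[OF F bF] diff_le_self], simp_all)
      (rule UB_le[OF UB1_of_IN[OF G bG] diff_le_self], simp_all)
  then show "UB1 (n - 1) S (\<lambda>i x. F i x * D' i x b + D i x b * G i x)"
    using F G n b by (intro UB_add UB1_mult_UB) (auto simp: IN_def)
qed

lemma IN_0I:
  assumes "\<And>i. i \<in> P \<Longrightarrow> uniformly_continuous_on (S i) (F i)"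
    "\<And>i x. i \<in> P \<Longrightarrow> x \<in> S i \<Longrightarrow> (F i has_derivative D i x) (at x within S i)"
  shows "IN 0 S F D"
  using assms by (auto simp: IN_def)

lemma IN_SucI:
  assumes "IN 0 S F D" "\<And>b. b \<in> Basis \<Longrightarrow> UB1 n S (\<lambda>i x. D i x b)"
  shows "IN (Suc n) S F D"
  using assms by (auto simp: IN_def)

end

section \<open>The one-sided solutions by characteristics\<close>

lemma lipschitz_of_BU:
  fixes F F' :: "real \<Rightarrow> real"
  assumes "\<And>y. y \<in> {a..b} \<Longrightarrow> (F has_real_derivative F' y) (at y within {a..b})" "BU n {a..b} F'"
  obtains C where "C \<ge> 0" "\<And>x y. x \<in> {a..b} \<Longrightarrow> y \<in> {a..b} \<Longrightarrow> \<bar>F x - F y\<bar> \<le> C * \<bar>x - y\<bar>"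
    "\<And>y. y \<in> {a..b} \<Longrightarrow> \<bar>F' y\<bar> \<le> C"
proof -
  obtain K where K: "K \<ge> 1" "WB n (\<lambda>_. K) {a..b} F'" using BU_nonneg[OF assms(2)] by metis
  have bd: "\<bar>F' y\<bar> \<le> K" if "y \<in> {a..b}" for y using WB_bound[OF K(2) that] by simp
  have "norm (F x - F y) \<le> K * norm (x - y)" if "x \<in> {a..b}" "y \<in> {a..b}" for x y
    by (rule field_differentiable_bound[of "{a..b}" F F' K]) (use assms(1) bd that in auto)
  then show ?thesis using that[of K] K bd by auto
qed

text \<open>
One side of the shock in linearising coordinates: \<open>h\<close>, \<open>q\<close>, \<open>\<beta>\<close> come from \<open>straightening\<close>, \<open>v i\<close> is
the perturbation on the closed half-line \<open>T\<close> and \<open>v' i\<close> its derivative. The last assumption says that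
the map from foot points to positions is a perturbation of a translation by a map of Lipschitz constant
at most one half.
\<close>

locale side = weights P N L for P :: "'i set" and N :: "'i \<Rightarrow> nat \<Rightarrow> real" and L :: real +
  fixes k :: nat and f g :: "real \<Rightarrow> real" and u r \<rho> lam :: real
    and h h' q q' \<beta> \<beta>' :: "real \<Rightarrow> real"
    and T :: "real set" and v v' :: "'i \<Rightarrow> real \<Rightarrow> real" and M M0 :: "'i \<Rightarrow> real"
  assumes k2: "2 \<le> k" and f_Ck: "Ck_on (k + 1) UNIV f"
    and r_pos: "0 < r" and rho_pos: "0 < \<rho>" and lam_neg: "lam < 0"
    and h_deriv: "\<And>a. a \<in> {u - r..u + r} \<Longrightarrow> (h has_real_derivative h' a) (at a within {u - r..u + r})"
    and h'_BU: "BU (k - 1) {u - r..u + r} h'"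
    and beta_deriv: "\<And>a. a \<in> {u - r..u + r} \<Longrightarrow> (\<beta> has_real_derivative \<beta>' a) (at a within {u - r..u + r})"
    and beta'_BU: "BU (k - 1) {u - r..u + r} \<beta>'"
    and q_deriv: "\<And>y. y \<in> {-\<rho>..\<rho>} \<Longrightarrow> (q has_real_derivative q' y) (at y within {-\<rho>..\<rho>})"
    and q'_BU: "BU (k - 1) {-\<rho>..\<rho>} q'"
    and q_range: "\<And>y. y \<in> {-\<rho>..\<rho>} \<Longrightarrow> q y \<in> {u - r..u + r}"
    and h_u: "h u = 0" and q_h: "\<And>a. a \<in> {u - r..u + r} \<Longrightarrow> h a \<in> {-\<rho>..\<rho>} \<Longrightarrow> q (h a) = a"
    and q_ode: "\<And>y. y \<in> {-\<rho>..\<rho>} \<Longrightarrow> lam * y * q' y = g (q y)"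
    and beta_ode: "\<And>a. a \<in> {u - r..u + r} \<Longrightarrow> \<beta>' a * g a = deriv f u - deriv f a"
    and v_deriv: "\<And>i z. i \<in> P \<Longrightarrow> z \<in> T \<Longrightarrow> (v i has_real_derivative v' i z) (at z within T)"
    and v_UB: "UB (k - 1) M (\<lambda>_. T) v'"
    and v_uc: "\<And>i. i \<in> P \<Longrightarrow> uniformly_continuous_on T (v i)"
    and v_bound: "\<And>i z. i \<in> P \<Longrightarrow> z \<in> T \<Longrightarrow> \<bar>v i z\<bar> \<le> M0 i"
    and M0_le: "\<And>i. i \<in> P \<Longrightarrow> M0 i \<le> M i" and M0_nonneg: "\<And>i. i \<in> P \<Longrightarrow> 0 \<le> M0 i"
    and M_le: "\<And>i. i \<in> P \<Longrightarrow> M i \<le> 1"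
    and v_range: "\<And>i z. i \<in> P \<Longrightarrow> z \<in> T \<Longrightarrow> u + v i z \<in> {u - r..u + r} \<and> \<bar>h (u + v i z)\<bar> \<le> \<rho>"
    and jacobian_close: "\<And>i z e. i \<in> P \<Longrightarrow> z \<in> T \<Longrightarrow> 0 \<le> e \<Longrightarrow> e \<le> 1 \<Longrightarrow>
       \<bar>\<beta>' (u + v i z) * v' i z
         - \<beta>' (q (e * h (u + v i z))) * (q' (e * h (u + v i z)) * (e * (h' (u + v i z) * v' i z)))\<bar> \<le> 1 / 2"
begin

abbreviation "I \<equiv> {u - r..u + r}"
abbreviation "R \<equiv> {-\<rho>..\<rho>}"

definition "a0 i z = u + v i z"
definition "p0 i z = h (a0 i z)"
definition "w i e z = e * p0 i z"
definition "U i e z = q (w i e z)"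
text \<open>
The derivative of the position with respect to the foot point, with \<open>e = exp (lam * t)\<close>.
\<close>

definition "J i e z = 1 + \<beta>' (a0 i z) * v' i z - \<beta>' (U i e z) * (q' (w i e z) * (e * (h' (a0 i z) * v' i z)))"

lemma a0_range: "i \<in> P \<Longrightarrow> z \<in> T \<Longrightarrow> a0 i z \<in> I"
  and p0_bound: "i \<in> P \<Longrightarrow> z \<in> T \<Longrightarrow> \<bar>p0 i z\<bar> \<le> \<rho>"
  using v_range unfolding a0_def p0_def by auto

lemma w_range: assumes "i \<in> P" "z \<in> T" "0 \<le> e" "e \<le> 1" shows "w i e z \<in> R"
proof -
  have "\<bar>w i e z\<bar> \<le> 1 * \<rho>" unfolding w_def abs_mult
    using p0_bound[OF assms(1,2)] assms(3,4) by (intro mult_mono) auto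
  then show ?thesis by auto
qed

lemma U_range: "i \<in> P \<Longrightarrow> z \<in> T \<Longrightarrow> 0 \<le> e \<Longrightarrow> e \<le> 1 \<Longrightarrow> U i e z \<in> I"
  unfolding U_def by (rule q_range[OF w_range])

lemma J_close: "i \<in> P \<Longrightarrow> z \<in> T \<Longrightarrow> 0 \<le> e \<Longrightarrow> e \<le> 1 \<Longrightarrow> \<bar>J i e z - 1\<bar> \<le> 1 / 2"
  unfolding J_def U_def w_def p0_def a0_def using jacobian_close by simp

lemma J_ge: "i \<in> P \<Longrightarrow> z \<in> T \<Longrightarrow> 0 \<le> e \<Longrightarrow> e \<le> 1 \<Longrightarrow> 1 / 2 \<le> J i e z"
  using J_close[of i z e] by linarith

lemma U_1: "i \<in> P \<Longrightarrow> z \<in> T \<Longrightarrow> U i 1 z = u + v i z"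
  using q_h[OF a0_range] p0_bound unfolding U_def w_def p0_def a0_def by (force simp: abs_le_iff)

lemma q_0: "q 0 = u"
  using q_h[of u] h_u r_pos rho_pos by auto

lemma h_lip: obtains C where "C \<ge> 0" "\<And>x y. x \<in> I \<Longrightarrow> y \<in> I \<Longrightarrow> \<bar>h x - h y\<bar> \<le> C * \<bar>x - y\<bar>"
  "\<And>y. y \<in> I \<Longrightarrow> \<bar>h' y\<bar> \<le> C"
  by (rule lipschitz_of_BU[OF _ h'_BU, where F=h]) (erule h_deriv, rule that)

lemma q_lip: obtains C where "C \<ge> 0" "\<And>x y. x \<in> R \<Longrightarrow> y \<in> R \<Longrightarrow> \<bar>q x - q y\<bar> \<le> C * \<bar>x - y\<bar>"
  "\<And>y. y \<in> R \<Longrightarrow> \<bar>q' y\<bar> \<le> C"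
  by (rule lipschitz_of_BU[OF _ q'_BU, where F=q]) (erule q_deriv, rule that)

lemma p0_le: obtains C where "C \<ge> 0" "\<And>i z. i \<in> P \<Longrightarrow> z \<in> T \<Longrightarrow> \<bar>p0 i z\<bar> \<le> C * M0 i"
proof -
  obtain C where C: "C \<ge> 0" "\<And>x y. x \<in> I \<Longrightarrow> y \<in> I \<Longrightarrow> \<bar>h x - h y\<bar> \<le> C * \<bar>x - y\<bar>" "\<And>y. y \<in> I \<Longrightarrow> \<bar>h' y\<bar> \<le> C" by (rule h_lip) (rule that)
  have "\<bar>p0 i z\<bar> \<le> C * M0 i" if "i \<in> P" "z \<in> T" for i z
  proof -
    have "u \<in> I" using r_pos by auto
    then have "\<bar>p0 i z\<bar> \<le> C * \<bar>v i z\<bar>"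
      using C(2)[OF a0_range[OF that], of u] h_u by (simp add: p0_def a0_def)
    also have "\<dots> \<le> C * M0 i" using v_bound[OF that] C(1) by (rule mult_left_mono)
    finally show ?thesis .
  qed
  then show ?thesis using that C(1) by blast
qed

lemma U_le: obtains C where "C \<ge> 0"
  "\<And>i z e. i \<in> P \<Longrightarrow> z \<in> T \<Longrightarrow> 0 \<le> e \<Longrightarrow> e \<le> 1 \<Longrightarrow> \<bar>U i e z - u\<bar> \<le> C * (e * M0 i)"
proof -
  obtain C where C: "C \<ge> 0" "\<And>x y. x \<in> R \<Longrightarrow> y \<in> R \<Longrightarrow> \<bar>q x - q y\<bar> \<le> C * \<bar>x - y\<bar>" "\<And>y. y \<in> R \<Longrightarrow> \<bar>q' y\<bar> \<le> C" by (rule q_lip) (rule that)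
  obtain D where D: "D \<ge> 0" "\<And>i z. i \<in> P \<Longrightarrow> z \<in> T \<Longrightarrow> \<bar>p0 i z\<bar> \<le> D * M0 i" by (rule p0_le) (rule that)
  have "\<bar>U i e z - u\<bar> \<le> (C * D) * (e * M0 i)" if "i \<in> P" "z \<in> T" "0 \<le> e" "e \<le> 1" for i z e
  proof -
    have "\<bar>U i e z - u\<bar> \<le> C * \<bar>w i e z\<bar>"
      using C(2)[OF w_range[OF that], of 0] rho_pos q_0 by (simp add: U_def)
    also have "\<dots> = C * e * \<bar>p0 i z\<bar>" using that by (simp add: w_def abs_mult)
    also have "\<dots> \<le> C * e * (D * M0 i)" using D(2)[OF that(1,2)] C(1) that by (intro mult_left_mono) auto
    finally show ?thesis by (simp add: algebra_simps)
  qed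
  then show ?thesis using that[of "C * D"] C(1) D(1) by auto
qed

end

text \<open>
The solution seen through some foot point map \<open>\<xi>\<close> on a set \<open>S i\<close>. Three instances are needed: the
cylinder of all times and foot points, a region of the plane, and the time axis for the traces along the
shock. In each of them \<open>E\<close> is \<open>exp (lam * t)\<close> and \<open>\<tau>\<close> is the time component of a direction.
\<close>

locale side_flow = side P N L k f g u r \<rho> lam h h' q q' \<beta> \<beta>' T v v' M M0
  for P :: "'i set" and N L k f g u r \<rho> lam h h' q q' \<beta> \<beta>' T v v' M M0 +
  fixes S :: "'i \<Rightarrow> 'a::euclidean_space set" and \<xi> :: "'i \<Rightarrow> 'a \<Rightarrow> real"
    and D\<xi> :: "'i \<Rightarrow> 'a \<Rightarrow> 'a \<Rightarrow> real" and E :: "'a \<Rightarrow> real" and \<tau> :: "'a \<Rightarrow> real"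
  assumes xi_T: "\<And>i x. i \<in> P \<Longrightarrow> x \<in> S i \<Longrightarrow> \<xi> i x \<in> T"
    and E_range: "\<And>i x. i \<in> P \<Longrightarrow> x \<in> S i \<Longrightarrow> 0 \<le> E x \<and> E x \<le> 1"
    and E_uc: "\<And>i. i \<in> P \<Longrightarrow> uniformly_continuous_on (S i) E"
    and E_deriv: "\<And>i x. i \<in> P \<Longrightarrow> x \<in> S i \<Longrightarrow> (E has_derivative (\<lambda>d. lam * \<tau> d * E x)) (at x within S i)"
begin

lemma E_UB1: "UB1 n S (\<lambda>_. E)"
proof (induction n)
  case 0
  show ?case by (rule UB_0I[of _ _ 1]) (use E_range E_uc in auto)
next
  case (Suc n)
  show ?case
    by (rule UB_SucI[of _ _ 1, OF _ _ _ E_deriv]) (use E_range E_uc Suc in \<open>auto intro: UB_cmult\<close>)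
qed

lemma E_IN: "IN n S (\<lambda>_. E) (\<lambda>_ x d. lam * \<tau> d * E x)"
  using E_uc E_deriv E_UB1 UB_cmult unfolding IN_def by blast

definition "DA i x d = v' i (\<xi> i x) * D\<xi> i x d"
definition "H i x = p0 i (\<xi> i x)"
definition "DH i x d = h' (a0 i (\<xi> i x)) * (v' i (\<xi> i x) * D\<xi> i x d)"
definition "DW i x d = E x * DH i x d + lam * \<tau> d * E x * H i x"

context
  fixes n
  assumes n: "n \<le> k - 1" and IN_xi: "IN n S \<xi> D\<xi>"
begin

lemma v'_UB1: "UB1 (k - 1) (\<lambda>_. T) v'"
  by (rule UB_weaken[OF v_UB, of 1]) (use M_le in auto)

lemma IN_A: "IN n S (\<lambda>i x. a0 i (\<xi> i x)) DA"
  unfolding DA_def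
proof (rule IN_compose[OF IN_xi xi_T])
  show "uniformly_continuous_on T (a0 i)" if "i \<in> P" for i
    unfolding a0_def using v_uc[OF that] by (intro uniformly_continuous_on_add uniformly_continuous_on_const)
  show "(a0 i has_real_derivative v' i y) (at y within T)" if "i \<in> P" "y \<in> T" for i y
    unfolding a0_def using v_deriv[OF that] by (auto intro!: derivative_eq_intros)
  show "UB1 (n - 1) (\<lambda>_. T) v'" by (rule UB_le[OF v'_UB1]) (use n in auto)
qed

lemma uc_of_deriv:
  fixes F F' :: "real \<Rightarrow> real"
  assumes "\<And>y. y \<in> {a..b} \<Longrightarrow> (F has_real_derivative F' y) (at y within {a..b})"
  shows "uniformly_continuous_on {a..b} F"
  by (intro compact_uniformly_continuous DERIV_continuous_on[OF assms] compact_Icc)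

lemma IN_H: "IN n S H DH"
  unfolding DH_def H_def p0_def DA_def[symmetric]
proof (rule IN_compose[OF IN_A, of "\<lambda>_. I"])
  show "UB1 (n - 1) (\<lambda>_. I) (\<lambda>_. h')" by (rule UB_le[OF UB1_of_BU[OF h'_BU]]) (use n in auto)
qed (use a0_range xi_T h_deriv uc_of_deriv[OF h_deriv] in auto)

lemma IN_W: "IN n S (\<lambda>i x. w i (E x) (\<xi> i x)) DW"
  unfolding w_def DW_def H_def[symmetric]
  by (rule IN_mult[OF E_IN IN_H, of 1 \<rho>]) (use E_range p0_bound xi_T in \<open>auto simp: H_def\<close>)

lemma IN_U: "IN n S (\<lambda>i x. U i (E x) (\<xi> i x)) (\<lambda>i x d. q' (w i (E x) (\<xi> i x)) * DW i x d)"
  unfolding U_def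
proof (rule IN_compose[OF IN_W, of "\<lambda>_. R"])
  show "UB1 (n - 1) (\<lambda>_. R) (\<lambda>_. q')" by (rule UB_le[OF UB1_of_BU[OF q'_BU]]) (use n in auto)
qed (use w_range E_range xi_T q_deriv uc_of_deriv[OF q_deriv] in auto)

lemma UB_v': "UB n M S (\<lambda>i x. v' i (\<xi> i x))"
  by (rule UB_compose[OF UB_le[OF v_UB n] IN_xi xi_T])

lemma UB1_v': "UB1 n S (\<lambda>i x. v' i (\<xi> i x))"
  by (rule UB_compose[OF UB_le[OF v'_UB1 n] IN_xi xi_T])

lemma UB1_h': "UB1 n S (\<lambda>i x. h' (a0 i (\<xi> i x)))"
  by (rule UB_compose[OF UB_le[OF UB1_of_BU[OF h'_BU] n] IN_A]) (use a0_range xi_T in auto)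

lemma UB1_beta': "UB1 n S (\<lambda>i x. \<beta>' (a0 i (\<xi> i x)))"
  by (rule UB_compose[OF UB_le[OF UB1_of_BU[OF beta'_BU] n] IN_A]) (use a0_range xi_T in auto)

lemma UB1_beta'_U: "UB1 n S (\<lambda>i x. \<beta>' (U i (E x) (\<xi> i x)))"
  by (rule UB_compose[OF UB_le[OF UB1_of_BU[OF beta'_BU] n] IN_U]) (use U_range E_range xi_T in auto)

lemma UB1_q': "UB1 n S (\<lambda>i x. q' (w i (E x) (\<xi> i x)))"
  by (rule UB_compose[OF UB_le[OF UB1_of_BU[OF q'_BU] n] IN_W]) (use w_range E_range xi_T in auto)

lemma UB1_comp_U: assumes "Ck_on n UNIV F" shows "UB1 n S (\<lambda>i x. F (U i (E x) (\<xi> i x)))"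
  by (rule UB_compose[OF UB1_of_BU[OF BU_Ck_on_UNIV[OF assms, of "u - r" "u + r"]] IN_U]) (use U_range E_range xi_T in auto)

lemma UB1_J: "UB1 n S (\<lambda>i x. J i (E x) (\<xi> i x))"
  unfolding J_def
  by (intro UB_add UB_diff UB1_const UB1_mult_UB[OF UB1_beta' UB1_v']
      UB1_mult_UB[OF UB1_beta'_U] UB1_mult_UB[OF UB1_q'] UB1_mult_UB[OF E_UB1] UB1_mult_UB[OF UB1_h' UB1_v'])

lemma UB1_inverse:
  assumes "UB1 m S F" "\<And>i x. i \<in> P \<Longrightarrow> x \<in> S i \<Longrightarrow> c \<le> F i x" "c > 0"
  shows "UB1 m S (\<lambda>i x. inverse (F i x))"
proof -
  obtain C where C: "C \<ge> 0" "\<And>i. i \<in> P \<Longrightarrow> (0::real) \<le> 1" "\<And>i. i \<in> P \<Longrightarrow> WB m (\<lambda>j. C * (1 * N i j)) (S i) (F i)"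
    by (rule UB_E[OF assms(1)]) (rule that)
  show ?thesis
  proof (rule UB1_compose_bounded[OF BU_inverse_Icc[OF assms(3), of m C] assms(1)])
    fix i x assume ix: "i \<in> P" "x \<in> S i"
    show "F i x \<in> {c..C}" using WB_bound[OF C(3)[OF ix(1)] ix(2)] assms(2)[OF ix] N_0[OF ix(1)] by auto
  qed
qed

lemma UB1_inverse_J: "UB1 n S (\<lambda>i x. inverse (J i (E x) (\<xi> i x)))"
  by (rule UB1_inverse[OF UB1_J, of "1/2"]) (use J_ge E_range xi_T in auto)

lemma UB_H: "UB n M S H"
proof -
  obtain C where C: "C \<ge> 0" "\<And>i z. i \<in> P \<Longrightarrow> z \<in> T \<Longrightarrow> \<bar>p0 i z\<bar> \<le> C * M0 i" by (rule p0_le) (rule that)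
  show ?thesis
  proof (rule UB_of_IN[OF IN_H, of C])
    fix i x assume ix: "i \<in> P" "x \<in> S i"
    show "\<bar>H i x\<bar> \<le> C * M i"
      using C(2)[OF ix(1) xi_T[OF ix]] mult_left_mono[OF M0_le[OF ix(1)] C(1)] by (simp add: H_def)
  next
    show "0 \<le> M i" if "i \<in> P" for i using M0_le[OF that] M0_nonneg[OF that] by simp
    fix b :: 'a assume b: "0 < n" "b \<in> Basis"
    have "UB1 (n - 1) S (\<lambda>i x. D\<xi> i x b)" using IN_xi b by (simp add: IN_def)
    then show "UB (n - 1) M S (\<lambda>i x. DH i x b)" unfolding DH_def
      using UB_le[OF UB1_h'] UB_le[OF UB_v'] by (intro UB1_mult_UB UB_mult_UB1) auto
  qed
qed

end

text \<open>
The gain of one derivative. Differentiating the equation for the foot point expresses \<open>D\<xi>\<close> through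
\<open>\<xi>\<close> itself, through \<open>v\<close>, \<open>v'\<close> at \<open>\<xi>\<close>, and through the derivative \<open>\<theta>\<close> of the position, so that \<open>n\<close>
controlled derivatives of \<open>\<xi>\<close> yield \<open>n + 1\<close>.
\<close>

lemma xi_step:
  assumes n: "n \<le> k - 1" and IN_xi: "IN n S \<xi> D\<xi>"
    and D\<xi>: "\<And>i x b. i \<in> P \<Longrightarrow> x \<in> S i \<Longrightarrow> b \<in> Basis \<Longrightarrow>
      D\<xi> i x b = (\<theta> i x b - \<tau> b * deriv f (U i (E x) (\<xi> i x))) * inverse (J i (E x) (\<xi> i x))"
    and th: "\<And>b. b \<in> Basis \<Longrightarrow> UB1 n S (\<lambda>i x. \<theta> i x b)"
  shows "IN (Suc n) S \<xi> D\<xi>" "b \<in> Basis \<Longrightarrow> UB1 n S (\<lambda>i x. D\<xi> i x b)"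
proof -
  have f': "Ck_on n UNIV (deriv f)"
    using Ck_on_le[of k UNIV "deriv f" n] Ck_on_Suc_UNIV(2)[of k f] f_Ck n by simp
  have *: "UB1 n S (\<lambda>i x. D\<xi> i x b)" if b: "b \<in> Basis" for b
  proof (rule UB_cong)
    show "UB1 n S (\<lambda>i x. (\<theta> i x b - \<tau> b * deriv f (U i (E x) (\<xi> i x))) * inverse (J i (E x) (\<xi> i x)))"
      by (intro UB1_mult_UB UB_diff th[OF b] UB_cmult UB1_comp_U[OF n IN_xi f'] UB1_inverse_J[OF n IN_xi])
  qed (use D\<xi> b in auto)
  show "IN (Suc n) S \<xi> D\<xi>" by (rule IN_SucI[OF IN_le[OF IN_xi] *]) auto
  show "b \<in> Basis \<Longrightarrow> UB1 n S (\<lambda>i x. D\<xi> i x b)" by (rule *)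
qed

text \<open>
The derivative of the solution with the factor \<open>exp (lam * t)\<close> split off; bounds for \<open>Y\<close> are therefore
decay estimates.
\<close>

definition "Y i x d = q' (w i (E x) (\<xi> i x)) *
   (h' (a0 i (\<xi> i x)) * (v' i (\<xi> i x) * D\<xi> i x d) + lam * \<tau> d * p0 i (\<xi> i x))"

lemma U_deriv:
  assumes "IN 0 S \<xi> D\<xi>" "i \<in> P" "x \<in> S i"
  shows "((\<lambda>x. U i (E x) (\<xi> i x)) has_derivative (\<lambda>d. E x * Y i x d)) (at x within S i)"
proof -
  have "((\<lambda>x. U i (E x) (\<xi> i x)) has_derivative (\<lambda>d. q' (w i (E x) (\<xi> i x)) * DW i x d)) (at x within S i)"
    using IN_U[OF _ assms(1)] assms(2,3) unfolding IN_def by auto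
  moreover have "(\<lambda>d. q' (w i (E x) (\<xi> i x)) * DW i x d) = (\<lambda>d. E x * Y i x d)"
    unfolding DW_def DH_def H_def Y_def
    by (auto simp: algebra_simps)
  ultimately show ?thesis by simp
qed

lemma Y_UB:
  assumes n: "n \<le> k - 1" and IN_xi: "IN n S \<xi> D\<xi>"
    and D: "UB1 n S (\<lambda>i x. D\<xi> i x b)"
  shows "UB n M S (\<lambda>i x. Y i x b)"
proof -
  have "UB n M S (\<lambda>i x. p0 i (\<xi> i x))" using UB_H[OF n IN_xi] unfolding H_def .
  then show ?thesis unfolding Y_def
    by (intro UB_add UB_cmult UB1_mult_UB[OF UB1_q'[OF n IN_xi]] UB1_mult_UB[OF UB1_h'[OF n IN_xi]]
      UB_mult_UB1[OF UB_v'[OF n IN_xi] D])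
qed

lemma U_UB1:
  assumes "n \<le> k - 1" "IN n S \<xi> D\<xi>"
  shows "UB1 n S (\<lambda>i x. U i (E x) (\<xi> i x))"
  by (rule UB1_of_IN[OF IN_U[OF assms], of "\<bar>u\<bar> + r"]) (use U_range E_range xi_T in force)

end

text \<open>
An implicit function theorem in which the implicit function is already known and Lipschitz, so that it is
available on arbitrary sets, in particular up to the boundary.
\<close>

lemma inverse_has_derivative:
  fixes X \<xi> :: "real \<times> real \<Rightarrow> real"
  assumes X: "(X has_derivative (\<lambda>d. A * fst d + J * snd d)) (at (fst p, \<xi> p) within B)"
    and J: "J \<noteq> 0" and p: "p \<in> D"
    and D: "\<And>y. y \<in> D \<Longrightarrow> (fst y, \<xi> y) \<in> B \<and> X (fst y, \<xi> y) = snd y"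
    and lip: "\<And>y. y \<in> D \<Longrightarrow> \<bar>\<xi> y - \<xi> p\<bar> \<le> K * norm (y - p)" and K: "K \<ge> 0"
  shows "(\<xi> has_derivative (\<lambda>d. (snd d - A * fst d) * inverse J)) (at p within D)"
  unfolding has_derivative_within_alt
proof (intro conjI allI impI)
  show "bounded_linear (\<lambda>d. (snd d - A * fst d) * inverse J)"
    by (intro bounded_linear_mult_const bounded_linear_sub bounded_linear_const_mult
        bounded_linear_snd bounded_linear_fst)
  fix e :: real assume e: "e > 0"
  define e1 where "e1 = e * \<bar>J\<bar> / (1 + K)"
  have e1: "e1 > 0" using e J K by (simp add: e1_def)
  obtain d where d: "d > 0" "\<And>y. y \<in> B \<Longrightarrow> norm (y - (fst p, \<xi> p)) < d \<Longrightarrow>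
      norm (X y - X (fst p, \<xi> p) - (A * fst (y - (fst p, \<xi> p)) + J * snd (y - (fst p, \<xi> p))))
        \<le> e1 * norm (y - (fst p, \<xi> p))"
    using X[unfolded has_derivative_within_alt] e1 by blast
  have nb: "norm ((fst y, \<xi> y) - (fst p, \<xi> p)) \<le> (1 + K) * norm (y - p)" if "y \<in> D" for y
  proof -
    have "norm ((fst y, \<xi> y) - (fst p, \<xi> p)) \<le> \<bar>fst y - fst p\<bar> + \<bar>\<xi> y - \<xi> p\<bar>"
      using norm_Pair_le[of "fst y - fst p" "\<xi> y - \<xi> p"] by simp
    moreover have "\<bar>fst y - fst p\<bar> \<le> norm (y - p)"
      using norm_fst_le[of "fst (y - p)" "snd (y - p)"] unfolding prod.collapse by simp
    ultimately show ?thesis using lip[OF that] by (simp add: algebra_simps)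
  qed
  show "\<exists>d>0. \<forall>y\<in>D. norm (y - p) < d \<longrightarrow>
      norm (\<xi> y - \<xi> p - (snd (y - p) - A * fst (y - p)) * inverse J) \<le> e * norm (y - p)"
  proof (intro exI[of _ "d / (1 + K)"] conjI ballI impI)
    show "0 < d / (1 + K)" using d K by simp
    fix y assume y: "y \<in> D" "norm (y - p) < d / (1 + K)"
    have "(1 + K) * norm (y - p) < d" using y(2) K by (simp add: field_simps)
    then have lt: "norm ((fst y, \<xi> y) - (fst p, \<xi> p)) < d" using nb[OF y(1)] by simp
    have "\<bar>snd y - snd p - (A * (fst y - fst p) + J * (\<xi> y - \<xi> p))\<bar> \<le> e1 * norm ((fst y, \<xi> y) - (fst p, \<xi> p))"
      using d(2)[OF _ lt] D[OF y(1)] D[OF p] by simp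
    also have "\<dots> \<le> e1 * ((1 + K) * norm (y - p))"
      using nb[OF y(1)] e1 by (intro mult_left_mono) auto
    also have "\<dots> = \<bar>J\<bar> * (e * norm (y - p))" using K by (simp add: e1_def)
    finally have 1: "\<bar>snd y - snd p - (A * (fst y - fst p) + J * (\<xi> y - \<xi> p))\<bar> \<le> \<bar>J\<bar> * (e * norm (y - p))" .
    have "\<bar>J\<bar> * \<bar>\<xi> y - \<xi> p - (snd (y - p) - A * fst (y - p)) * inverse J\<bar>
        = \<bar>J * (\<xi> y - \<xi> p - (snd (y - p) - A * fst (y - p)) * inverse J)\<bar>" by (simp add: abs_mult)
    also have "J * (\<xi> y - \<xi> p - (snd (y - p) - A * fst (y - p)) * inverse J)
        = - (snd y - snd p - (A * (fst y - fst p) + J * (\<xi> y - \<xi> p)))"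
      using J by (simp add: field_simps)
    finally have "\<bar>J\<bar> * \<bar>\<xi> y - \<xi> p - (snd (y - p) - A * fst (y - p)) * inverse J\<bar> \<le> \<bar>J\<bar> * (e * norm (y - p))"
      using 1 by simp
    then show "norm (\<xi> y - \<xi> p - (snd (y - p) - A * fst (y - p)) * inverse J) \<le> e * norm (y - p)"
      using J by simp
  qed
qed

lemma exp_lipschitz_nonpos:
  fixes x y :: real assumes "x \<le> 0" "y \<le> 0" shows "\<bar>exp x - exp y\<bar> \<le> \<bar>x - y\<bar>"
proof -
  have "norm (exp x - exp y) \<le> 1 * norm (x - y)"
    by (rule field_differentiable_bound[of "{..0::real}" exp exp 1])
      (use assms in \<open>auto intro!: derivative_eq_intros\<close>)
  then show ?thesis by simp
qed

lemma uc_exp_nonpos: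
  fixes F :: "'a::metric_space \<Rightarrow> real"
  assumes "uniformly_continuous_on S F" "\<And>x. x \<in> S \<Longrightarrow> F x \<le> (0::real)"
  shows "uniformly_continuous_on S (\<lambda>x. exp (F x))"
  unfolding uniformly_continuous_on_def
proof (intro allI impI)
  fix e :: real assume "e > 0"
  then obtain d where d: "d > 0" "\<forall>x\<in>S. \<forall>x'\<in>S. dist x' x < d \<longrightarrow> dist (F x') (F x) < e"
    using assms(1) unfolding uniformly_continuous_on_def by auto
  have "dist (exp (F x')) (exp (F x)) < e" if "x \<in> S" "x' \<in> S" "dist x' x < d" for x x'
    using exp_lipschitz_nonpos[OF assms(2)[OF that(2)] assms(2)[OF that(1)]] d(2) that
    by (force simp: dist_real_def)
  then show "\<exists>d>0. \<forall>x\<in>S. \<forall>x'\<in>S. dist x' x < d \<longrightarrow> dist (exp (F x')) (exp (F x)) < e"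
    using d(1) by blast
qed

text \<open>
The retraction \<open>\<pi>\<close> of the line onto the half-line \<open>T\<close> continues the data by a constant; thereby the map
from foot points to positions becomes a bijection of the whole line at every time.
\<close>

locale side_global = side P N L k f g u r \<rho> lam h h' q q' \<beta> \<beta>' T v v' M M0
  for P :: "'i set" and N L k f g u r \<rho> lam h h' q q' \<beta> \<beta>' T v v' M M0 +
  fixes \<pi> :: "real \<Rightarrow> real" and \<psi>0 :: "'i \<Rightarrow> real"
  assumes pi_T: "\<And>z. \<pi> z \<in> T" and pi_id: "\<And>z. z \<in> T \<Longrightarrow> \<pi> z = z"
    and pi_lip: "\<And>z z'. \<bar>\<pi> z - \<pi> z'\<bar> \<le> \<bar>z - z'\<bar>"
    and T_convex: "convex T"
begin

definition "E t = exp (lam * t)"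

lemma E_range: "0 \<le> t \<Longrightarrow> 0 \<le> E t \<and> E t \<le> 1"
  using lam_neg by (simp add: E_def mult_nonpos_nonneg)

text \<open>
The characteristic from \<open>\<psi>0 i + z\<close>. Its velocity is \<open>f'(u) - \<beta>'(U) * g(U) = f'(U)\<close>, where \<open>U\<close> is the
value that it carries.
\<close>

definition "X i t z = \<psi>0 i + z + deriv f u * t + \<beta> (a0 i (\<pi> z)) - \<beta> (U i (E t) (\<pi> z))"

sublocale cyl: side_flow P N L k f g u r \<rho> lam h h' q q' \<beta> \<beta>' T v v' M M0
  "\<lambda>_. {0..} \<times> T" "\<lambda>_. snd" "\<lambda>_ _. snd" "\<lambda>p. E (fst p)" fst
proof
  fix i :: 'i and x :: "real \<times> real" assume x: "x \<in> {0..} \<times> T"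
  then show "snd x \<in> T" by (simp add: mem_Times_iff)
  show "0 \<le> E (fst x) \<and> E (fst x) \<le> 1" using E_range[of "fst x"] x by (simp add: mem_Times_iff)
  show "((\<lambda>p. E (fst p)) has_derivative (\<lambda>d. lam * fst d * E (fst x))) (at x within {0..} \<times> T)"
    unfolding E_def by (auto intro!: derivative_eq_intros)
next
  show "uniformly_continuous_on ({0..} \<times> T) (\<lambda>p. E (fst p))"
    unfolding E_def
  proof (rule uc_exp_nonpos)
    show "uniformly_continuous_on ({0..} \<times> T) (\<lambda>x. lam * fst x)"
      by (intro uniformly_continuous_on_cmul_left bounded_linear.uniformly_continuous_on[OF bounded_linear_fst] uniformly_continuous_on_id)
  qed (use lam_neg in \<open>auto simp: mult_nonpos_nonneg\<close>)
qed

lemma cyl_IN: "IN 0 (\<lambda>_. {0..} \<times> T) (\<lambda>_. snd) (\<lambda>_ _. snd)"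
  by (rule IN_0I) (auto intro!: bounded_linear.uniformly_continuous_on[OF bounded_linear_snd]
      uniformly_continuous_on_id derivative_eq_intros)

lemma X_deriv:
  assumes i: "i \<in> P" and t: "0 \<le> t" and z: "z \<in> T"
  shows "((\<lambda>p. X i (fst p) (snd p)) has_derivative
     (\<lambda>d. deriv f (U i (E t) z) * fst d + J i (E t) z * snd d)) (at (t, z) within {0..} \<times> T)"
proof -
  let ?S = "{0..} \<times> T"
  have tz: "(t, z) \<in> ?S" using t z by auto
  have Br: "\<beta>' (U i (E t) z) * g (U i (E t) z) = deriv f u - deriv f (U i (E t) z)"
    by (rule beta_ode[OF U_range[OF i z]]) (use E_range[OF t] in auto)
  have dA: "((\<lambda>x. a0 i (snd x)) has_derivative (\<lambda>d. v' i z * snd d)) (at (t, z) within ?S)"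
    using cyl.IN_A[OF le0 cyl_IN] i tz unfolding IN_def cyl.DA_def by auto
  have dU: "((\<lambda>x. U i (E (fst x)) (snd x)) has_derivative (\<lambda>d. E t * cyl.Y i (t, z) d)) (at (t, z) within ?S)"
    using cyl.U_deriv[OF cyl_IN i tz] by simp
  have bm: "(\<beta> has_derivative times (\<beta>' y)) (at y within I)" if "y \<in> I" for y
    using beta_deriv[OF that] by (simp add: has_field_derivative_def)
  have bA: "((\<lambda>x. \<beta> (a0 i (snd x))) has_derivative (\<lambda>d. \<beta>' (a0 i z) * (v' i z * snd d))) (at (t, z) within ?S)"
  proof -
    have "(\<lambda>x. a0 i (snd x)) ` ?S \<subseteq> I"
      using a0_range[OF i] by (auto simp: image_subset_iff simp del: atLeastAtMost_iff)
    from has_derivative_in_compose2[OF bm this tz dA] show ?thesis by simp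
  qed
  have "(\<lambda>x. U i (E (fst x)) (snd x)) ` ?S \<subseteq> I"
    using U_range[OF i] E_range by (auto simp: image_subset_iff simp del: atLeastAtMost_iff)
  from has_derivative_in_compose2[OF bm this tz dU]
  have bU: "((\<lambda>x. \<beta> (U i (E (fst x)) (snd x))) has_derivative
      (\<lambda>d. \<beta>' (U i (E t) z) * (E t * cyl.Y i (t, z) d))) (at (t, z) within ?S)" by simp
  have "((\<lambda>p. \<psi>0 i + snd p + deriv f u * fst p + \<beta> (a0 i (snd p)) - \<beta> (U i (E (fst p)) (snd p)))
    has_derivative (\<lambda>d. snd d + deriv f u * fst d + \<beta>' (a0 i z) * (v' i z * snd d)
       - \<beta>' (U i (E t) z) * (E t * cyl.Y i (t, z) d))) (at (t, z) within ?S)"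
    by (intro has_derivative_diff has_derivative_add bA bU)
       (auto intro!: derivative_eq_intros)
  moreover have "(\<lambda>d. snd d + deriv f u * fst d + \<beta>' (a0 i z) * (v' i z * snd d)
       - \<beta>' (U i (E t) z) * (E t * cyl.Y i (t, z) d))
     = (\<lambda>d. deriv f (U i (E t) z) * fst d + J i (E t) z * snd d)"
  proof
    fix d :: "real \<times> real"
    have "w i (E t) z \<in> R" by (rule w_range[OF i z]) (use E_range[OF t] in auto)
    from q_ode[OF this] have q1: "lam * (E t * p0 i z) * q' (w i (E t) z) = g (U i (E t) z)"
      by (simp add: U_def w_def)
    have "\<beta>' (U i (E t) z) * (E t * cyl.Y i (t, z) d)
      = \<beta>' (U i (E t) z) * (q' (w i (E t) z) * (E t * (h' (a0 i z) * v' i z))) * snd d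
        + (\<beta>' (U i (E t) z) * (lam * (E t * p0 i z) * q' (w i (E t) z))) * fst d"
      unfolding cyl.Y_def by (simp add: algebra_simps)
    then show "snd d + deriv f u * fst d + \<beta>' (a0 i z) * (v' i z * snd d)
       - \<beta>' (U i (E t) z) * (E t * cyl.Y i (t, z) d)
     = deriv f (U i (E t) z) * fst d + J i (E t) z * snd d"
      unfolding q1 Br J_def by (simp add: algebra_simps)
  qed
  ultimately have "((\<lambda>p. \<psi>0 i + snd p + deriv f u * fst p + \<beta> (a0 i (snd p)) - \<beta> (U i (E (fst p)) (snd p)))
    has_derivative (\<lambda>d. deriv f (U i (E t) z) * fst d + J i (E t) z * snd d)) (at (t, z) within ?S)"
    by simp
  then show ?thesis
    by (rule has_derivative_transform[OF tz, rotated]) (auto simp: X_def pi_id)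
qed

lemma X_deriv_z:
  assumes i: "i \<in> P" and t: "0 \<le> t" and z: "z \<in> T"
  shows "((\<lambda>z. X i t z) has_real_derivative J i (E t) z) (at z within T)"
proof -
  have "((\<lambda>z. (t, z)) has_derivative (\<lambda>d. (0, d))) (at z within T)"
    by (auto intro!: derivative_eq_intros)
  from has_derivative_in_compose[OF this has_derivative_subset[OF X_deriv[OF assms]]] t
  have "((\<lambda>z. X i t z) has_derivative (\<lambda>d. J i (E t) z * d)) (at z within T)"
    by (simp add: image_subset_iff)
  then show ?thesis by (simp add: has_field_derivative_def)
qed

lemma X_pi: "X i t z = X i t (\<pi> z) + (z - \<pi> z)"
  unfolding X_def using pi_id[OF pi_T[of z]] by simp

lemma X_deriv_t:
  assumes i: "i \<in> P" and t: "0 \<le> t"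
  shows "((\<lambda>t. X i t z) has_real_derivative deriv f (U i (E t) (\<pi> z))) (at t within {0..})"
proof -
  have "((\<lambda>t. (t, \<pi> z)) has_derivative (\<lambda>d. (d, 0))) (at t within {0..})"
    by (auto intro!: derivative_eq_intros)
  from has_derivative_in_compose[OF this has_derivative_subset[OF X_deriv[OF assms pi_T]]] pi_T
  have "((\<lambda>t. X i t (\<pi> z)) has_derivative (\<lambda>d. deriv f (U i (E t) (\<pi> z)) * d)) (at t within {0..})"
    by (simp add: image_subset_iff)
  then have "((\<lambda>t. X i t (\<pi> z)) has_real_derivative deriv f (U i (E t) (\<pi> z))) (at t within {0..})"
    by (simp add: has_field_derivative_def)
  from DERIV_add[OF this DERIV_const[of "z - \<pi> z"]] show ?thesis unfolding X_pi[of i _ z] by simp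
qed

text \<open>
Hence \<open>X i t\<close> is strictly increasing with a Lipschitz inverse.
\<close>

lemma X_contr:
  assumes i: "i \<in> P" and t: "0 \<le> t"
  shows "\<bar>(X i t z - z) - (X i t z' - z')\<bar> \<le> \<bar>z - z'\<bar> / 2"
proof -
  have "norm ((X i t (\<pi> z) - \<pi> z) - (X i t (\<pi> z') - \<pi> z')) \<le> 1 / 2 * norm (\<pi> z - \<pi> z')"
  proof (rule field_differentiable_bound[OF T_convex, of "\<lambda>z. X i t z - z" "\<lambda>z. J i (E t) z - 1"])
    show "((\<lambda>z. X i t z - z) has_field_derivative J i (E t) y - 1) (at y within T)" if "y \<in> T" for y
      using X_deriv_z[OF i t that] by (auto intro!: derivative_eq_intros)
    show "norm (J i (E t) y - 1) \<le> 1 / 2" if "y \<in> T" for y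
      using J_close[OF i that] E_range[OF t] by auto
  qed (use pi_T in auto)
  then show ?thesis using pi_lip[of z z'] X_pi[of i t z] X_pi[of i t z'] by simp
qed

lemma X_less: assumes "i \<in> P" "0 \<le> t" "z < z'" shows "X i t z < X i t z'"
proof -
  have "\<bar>z - z'\<bar> = z' - z" using assms(3) by simp
  then show ?thesis using abs_le_D1[OF X_contr[OF assms(1,2), of z z']] assms(3) by (simp add: field_simps)
qed

lemma X_surj: assumes i: "i \<in> P" and t: "0 \<le> t" shows "\<exists>z. X i t z = x"
proof -
  \<comment> \<open>The map increases at a rate of at least one half.\<close>
  define c where "c = 2 * \<bar>x - X i t 0\<bar>"
  have "X i t c \<ge> x" using X_contr[OF i t, of c 0] by (auto simp: c_def abs_le_iff)
  moreover have "X i t (- c) \<le> x" using X_contr[OF i t, of "- c" 0] by (auto simp: c_def abs_le_iff)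
  moreover have "continuous_on {- c..c} (X i t)"
  proof (rule continuous_on_subset[OF _ subset_UNIV], rule lipschitz_on_continuous_on[of "3/2"], rule lipschitz_onI)
    fix y z :: real
    show "dist (X i t y) (X i t z) \<le> 3 / 2 * dist y z"
      unfolding dist_real_def
      using abs_le_D1[OF X_contr[OF i t, of y z]] abs_le_D2[OF X_contr[OF i t, of y z]]
        abs_ge_self[of "y - z"] abs_ge_minus_self[of "y - z"]
      by (intro abs_leI) (simp_all add: field_simps)
  qed simp
  moreover have "- c \<le> c" by (simp add: c_def)
  ultimately show ?thesis using IVT'[of "X i t" "- c" x c] by blast
qed

definition "\<xi> i t x = (THE z. X i t z = x)"

lemma X_inj: assumes "i \<in> P" "0 \<le> t" "X i t z = X i t z'" shows "z = z'"
  using X_less[OF assms(1,2), of z z'] X_less[OF assms(1,2), of z' z] assms(3)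
  by (cases z z' rule: linorder_cases) auto

lemma X_xi: assumes "i \<in> P" "0 \<le> t" shows "X i t (\<xi> i t x) = x"
proof -
  obtain z where z: "X i t z = x" using X_surj[OF assms] by auto
  have "\<xi> i t x = z" unfolding \<xi>_def
  proof (rule the_equality)
    show "y = z" if "X i t y = x" for y by (rule X_inj[OF assms]) (simp add: z that)
  qed (rule z)
  then show ?thesis using z by simp
qed

lemma xi_X: assumes "i \<in> P" "0 \<le> t" shows "\<xi> i t (X i t z) = z"
  by (rule X_inj[OF assms X_xi[OF assms]])

lemma xi_less_iff: assumes "i \<in> P" "0 \<le> t" shows "\<xi> i t x < z \<longleftrightarrow> x < X i t z"
  using X_less[OF assms, of "\<xi> i t x" z] X_less[OF assms, of z "\<xi> i t x"] X_xi[OF assms, of x]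
  by (cases "\<xi> i t x" z rule: linorder_cases) auto

lemma less_xi_iff: assumes "i \<in> P" "0 \<le> t" shows "z < \<xi> i t x \<longleftrightarrow> X i t z < x"
  using X_less[OF assms, of "\<xi> i t x" z] X_less[OF assms, of z "\<xi> i t x"] X_xi[OF assms, of x]
  by (cases "\<xi> i t x" z rule: linorder_cases) auto

lemma f'_bound: obtains F where "F \<ge> 0" "\<And>y. y \<in> I \<Longrightarrow> \<bar>deriv f y\<bar> \<le> F"
proof -
  have "Ck_on k UNIV (deriv f)" using Ck_on_Suc_UNIV(2)[of k f] f_Ck by simp
  from BU_Ck_on_UNIV[OF this, of "u - r" "u + r"] obtain K where K: "WB k (\<lambda>_. K) I (deriv f)"
    unfolding BU_def by auto
  show ?thesis by (rule that[of "\<bar>K\<bar>"]) (use WB_bound[OF K] in force)+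
qed

text \<open>
Speed of characteristics at most \<open>F\<close>, and an inverse with Lipschitz constant \<open>2\<close>.
\<close>

lemma xi_lip: obtains F where "F \<ge> 0"
  "\<And>i t t' x x'. i \<in> P \<Longrightarrow> 0 \<le> t \<Longrightarrow> 0 \<le> t' \<Longrightarrow> \<bar>\<xi> i t x - \<xi> i t' x'\<bar> \<le> 2 * (\<bar>x - x'\<bar> + F * \<bar>t - t'\<bar>)"
proof -
  obtain F where F: "F \<ge> 0" "\<And>y. y \<in> I \<Longrightarrow> \<bar>deriv f y\<bar> \<le> F" by (rule f'_bound) (rule that)
  have Xt: "\<bar>X i t z - X i t' z\<bar> \<le> F * \<bar>t - t'\<bar>" if "i \<in> P" "0 \<le> t" "0 \<le> t'" for i t t' z
  proof -
    have "norm (X i t z - X i t' z) \<le> F * norm (t - t')"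
    proof (rule field_differentiable_bound[of "{0..}" "\<lambda>t. X i t z", OF _ X_deriv_t[OF that(1)]])
      show "norm (deriv f (U i (E s) (\<pi> z))) \<le> F" if "s \<in> {0..}" for s
        using F(2)[OF U_range[OF \<open>i \<in> P\<close> pi_T]] E_range that by auto
    qed (use that in auto)
    then show ?thesis by simp
  qed
  show ?thesis
  proof (rule that[OF F(1)])
    fix i and t t' x x' :: real assume A: "i \<in> P" "0 \<le> t" "0 \<le> t'"
    let ?z = "\<xi> i t x" and ?z' = "\<xi> i t' x'"
    have "\<bar>X i t ?z - X i t ?z'\<bar> \<le> \<bar>x - x'\<bar> + F * \<bar>t - t'\<bar>"
      using Xt[OF A, of ?z'] X_xi[OF A(1,2), of x] X_xi[OF A(1,3), of x'] by linarith
    moreover have "\<bar>?z - ?z'\<bar> \<le> \<bar>X i t ?z - X i t ?z'\<bar> + \<bar>?z - ?z'\<bar> / 2"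
      using abs_triangle_ineq4[of "X i t ?z - X i t ?z'" "(X i t ?z - ?z) - (X i t ?z' - ?z')"]
        X_contr[OF A(1,2), of ?z ?z'] by (simp add: algebra_simps)
    ultimately show "\<bar>?z - ?z'\<bar> \<le> 2 * (\<bar>x - x'\<bar> + F * \<bar>t - t'\<bar>)"
      by (simp add: field_simps)
  qed
qed

definition "Dom i = {p. 0 \<le> fst p \<and> \<xi> i (fst p) (snd p) \<in> T}"

lemma xi_lip_norm: obtains K where "K \<ge> 0"
  "\<And>i p p'. i \<in> P \<Longrightarrow> 0 \<le> fst p \<Longrightarrow> 0 \<le> fst p' \<Longrightarrow>
     \<bar>\<xi> i (fst p) (snd p) - \<xi> i (fst p') (snd p')\<bar> \<le> K * norm (p - p')"
proof -
  obtain F where F: "F \<ge> 0"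
  "\<And>i t t' x x'. i \<in> P \<Longrightarrow> 0 \<le> t \<Longrightarrow> 0 \<le> t' \<Longrightarrow> \<bar>\<xi> i t x - \<xi> i t' x'\<bar> \<le> 2 * (\<bar>x - x'\<bar> + F * \<bar>t - t'\<bar>)"
    by (rule xi_lip) (rule that)
  show ?thesis
  proof (rule that[of "2 * (1 + F)"])
    fix i and p p' :: "real \<times> real" assume A: "i \<in> P" "0 \<le> fst p" "0 \<le> fst p'"
    have 1: "\<bar>fst p - fst p'\<bar> \<le> norm (p - p')" and 2: "\<bar>snd p - snd p'\<bar> \<le> norm (p - p')"
      using norm_fst_le[of "fst (p - p')" "snd (p - p')"] norm_snd_le[of "snd (p - p')" "fst (p - p')"]
      unfolding prod.collapse by simp_all
    have "\<bar>\<xi> i (fst p) (snd p) - \<xi> i (fst p') (snd p')\<bar> \<le> 2 * (\<bar>snd p - snd p'\<bar> + F * \<bar>fst p - fst p'\<bar>)"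
      by (rule F(2)[OF A])
    also have "\<dots> \<le> 2 * (norm (p - p') + F * norm (p - p'))"
      using 1 2 F(1) by (intro mult_left_mono add_mono) auto
    finally show "\<bar>\<xi> i (fst p) (snd p) - \<xi> i (fst p') (snd p')\<bar> \<le> 2 * (1 + F) * norm (p - p')"
      by (simp add: algebra_simps)
  qed (use F in auto)
qed

lemma xi_deriv:
  assumes i: "i \<in> P" and p: "p \<in> Dom i"
  shows "((\<lambda>p. \<xi> i (fst p) (snd p)) has_derivative
     (\<lambda>d. (snd d - deriv f (U i (E (fst p)) (\<xi> i (fst p) (snd p))) * fst d)
        * inverse (J i (E (fst p)) (\<xi> i (fst p) (snd p))))) (at p within Dom i)"
proof -
  obtain K where K: "K \<ge> 0"
  "\<And>i p p'. i \<in> P \<Longrightarrow> 0 \<le> fst p \<Longrightarrow> 0 \<le> fst p' \<Longrightarrow>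
     \<bar>\<xi> i (fst p) (snd p) - \<xi> i (fst p') (snd p')\<bar> \<le> K * norm (p - p')"
    by (rule xi_lip_norm) (rule that)
  have t: "0 \<le> fst p" and z: "\<xi> i (fst p) (snd p) \<in> T" using p by (auto simp: Dom_def)
  show ?thesis
  proof (rule inverse_has_derivative[where X="\<lambda>p. X i (fst p) (snd p)" and B="{0..} \<times> T", OF _ _ p])
    show "((\<lambda>p. X i (fst p) (snd p)) has_derivative
        (\<lambda>d. deriv f (U i (E (fst p)) (\<xi> i (fst p) (snd p))) * fst d
           + J i (E (fst p)) (\<xi> i (fst p) (snd p)) * snd d))
        (at (fst p, \<xi> i (fst p) (snd p)) within {0..} \<times> T)"
      using X_deriv[OF i t z] by simp
    show "J i (E (fst p)) (\<xi> i (fst p) (snd p)) \<noteq> 0" using J_ge[OF i z] E_range[OF t] by force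
    show "(fst y, \<xi> i (fst y) (snd y)) \<in> {0..} \<times> T \<and>
         X i (fst (fst y, \<xi> i (fst y) (snd y))) (snd (fst y, \<xi> i (fst y) (snd y))) = snd y"
      if "y \<in> Dom i" for y using that X_xi[OF i] by (auto simp: Dom_def)
    show "\<bar>\<xi> i (fst y) (snd y) - \<xi> i (fst p) (snd p)\<bar> \<le> K * norm (y - p)" if "y \<in> Dom i" for y
      using K(2)[OF i] that p by (auto simp: Dom_def)
  qed (rule K(1))
qed

definition "sol i p = U i (E (fst p)) (\<pi> (\<xi> i (fst p) (snd p)))"

lemma sol_range: "i \<in> P \<Longrightarrow> 0 \<le> fst p \<Longrightarrow> sol i p \<in> I"
  unfolding sol_def by (rule U_range[OF _ pi_T]) (use E_range in auto)

lemma sol_Dom: "p \<in> Dom i \<Longrightarrow> sol i p = U i (E (fst p)) (\<xi> i (fst p) (snd p))"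
  unfolding sol_def Dom_def using pi_id by simp

end

section \<open>The scalar Cauchy problem and extension to closed half-lines\<close>

lemma integral_from_0_has_derivative:
  fixes c :: "real \<Rightarrow> real"
  assumes c: "continuous_on {0..} c" and t: "0 \<le> t"
  shows "((\<lambda>t. integral {0..t} c) has_real_derivative c t) (at t within {0..})"
proof -
  have "((\<lambda>t. integral {0..t} c) has_real_derivative c t) (at t within {0..t + 1})"
    by (rule integral_has_real_derivative) (use t in \<open>auto intro: continuous_on_subset[OF c]\<close>)
  moreover have "at t within {0..t + 1} = at t within {0..}"
    by (rule at_within_nhd[of t "{..<t + 1}"]) auto
  ultimately show ?thesis by simp
qed

text \<open>
The right hand side is bounded and Lipschitz uniformly in time, so that an exponentially weighted sup norm
makes the integral equation on the whole half-line a contraction.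
\<close>

lemma Picard_global:
  fixes F :: "real \<Rightarrow> real \<Rightarrow> real"
  assumes cont: "continuous_on ({0..} \<times> UNIV) (\<lambda>p. F (fst p) (snd p))"
    and bound: "\<And>t x. 0 \<le> t \<Longrightarrow> \<bar>F t x\<bar> \<le> B"
    and lip: "\<And>t x y. 0 \<le> t \<Longrightarrow> \<bar>F t x - F t y\<bar> \<le> L * \<bar>x - y\<bar>"
  obtains \<psi> where "\<psi> 0 = x0" "\<And>t. 0 \<le> t \<Longrightarrow> (\<psi> has_real_derivative F t (\<psi> t)) (at t within {0..})"
proof -
  define K where "K = \<bar>L\<bar> + 1"
  have K: "K > 0" "L \<le> K" "K \<ge> 1" by (auto simp: K_def)
  have B0: "B \<ge> 0" using bound[of 0 0] by linarith
  \<comment> \<open>The unknown is \<open>y s = exp (- 2 * K * s) * (\<psi> s - x0)\<close>, a bounded function.\<close>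
  define G where "G = (\<lambda>(y :: real \<Rightarrow>\<^sub>C real) s. F s (x0 + exp (2 * K * s) * y s))"
  have Gc: "continuous_on {0..} (G y)" for y
  proof -
    have "continuous_on {0..} (\<lambda>s. (s, x0 + exp (2 * K * s) * y s))"
      by (intro continuous_intros) auto
    then show ?thesis
      unfolding G_def using continuous_on_compose2[OF cont, of "{0..}" "\<lambda>s. (s, x0 + exp (2 * K * s) * y s)"]
      by auto
  qed
  have Gint: "G y integrable_on {0..t}" for y t
    by (intro integrable_continuous_real continuous_on_subset[OF Gc]) auto
  define \<Phi> where "\<Phi> = (\<lambda>y t. exp (- (2 * K * max 0 t)) * integral {0..max 0 t} (G y))"
  have \<Phi>c: "continuous_on UNIV (\<Phi> y)" for y
  proof -
    have "continuous_on {0..} (\<lambda>t. integral {0..t} (G y))"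
      by (rule DERIV_continuous_on[OF integral_from_0_has_derivative[OF Gc]]) auto
    then have "continuous_on UNIV (\<lambda>t. integral {0..max 0 t} (G y))"
      by (rule continuous_on_compose2) (auto intro!: continuous_intros)
    then show ?thesis unfolding \<Phi>_def by (intro continuous_intros)
  qed
  have \<Phi>b: "\<bar>\<Phi> y t\<bar> \<le> B" for y t
  proof -
    define t' where "t' = max 0 t"
    have t': "t' \<ge> 0" by (simp add: t'_def)
    have "norm (integral {0..t'} (G y)) \<le> B * (t' - 0)"
    proof (rule integral_bound)
      show "continuous_on {0..t'} (G y)" by (rule continuous_on_subset[OF Gc]) auto
    qed (use t' bound in \<open>auto simp: G_def\<close>)
    moreover have "t' \<le> exp (2 * K * t')"
    proof -
      have "t' \<le> 1 + 2 * K * t'" using K t' mult_right_mono[of 1 "2 * K" t'] by linarith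
      then show ?thesis using exp_ge_add_one_self[of "2 * K * t'"] by linarith
    qed
    ultimately have "\<bar>integral {0..t'} (G y)\<bar> \<le> B * exp (2 * K * t')"
      using mult_left_mono[of t' "exp (2 * K * t')" B] B0 by simp
    then have "exp (- (2 * K * t')) * \<bar>integral {0..t'} (G y)\<bar> \<le> exp (- (2 * K * t')) * (B * exp (2 * K * t'))"
      by (intro mult_left_mono) auto
    also have "\<dots> = B" by (simp add: exp_minus)
    finally show ?thesis unfolding \<Phi>_def t'_def[symmetric] by (simp add: abs_mult)
  qed
  define \<Psi> where "\<Psi> = (\<lambda>y. Bcontfun (\<Phi> y))"
  have \<Psi>: "apply_bcontfun (\<Psi> y) = \<Phi> y" for y
    unfolding \<Psi>_def by (rule Bcontfun_inverse[OF bcontfun_normI[OF \<Phi>c]]) (use \<Phi>b in auto)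
  have "\<exists>!y. \<Psi> y = y"
  proof (rule banach_fix_type[of "1 / 2"])
    show "\<forall>x y. dist (\<Psi> x) (\<Psi> y) \<le> 1 / 2 * dist x y"
    proof (intro allI)
      fix y z
      show "dist (\<Psi> y) (\<Psi> z) \<le> 1 / 2 * dist y z"
      proof (rule dist_bound, unfold \<Psi>)
        fix t :: real
        define t' where "t' = max 0 t"
        have t': "t' \<ge> 0" by (simp add: t'_def)
        let ?d = "dist y z"
        have I: "((\<lambda>s. ?d * K * exp (2 * K * s)) has_integral ?d / 2 * exp (2 * K * t') - ?d / 2 * exp (2 * K * 0)) {0..t'}"
          by (rule fundamental_theorem_of_calculus)
            (use t' K in \<open>auto simp flip: has_real_derivative_iff_has_vector_derivative intro!: derivative_eq_intros\<close>)
        have "norm (integral {0..t'} (\<lambda>s. G y s - G z s)) \<le> integral {0..t'} (\<lambda>s. ?d * K * exp (2 * K * s))"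
        proof (rule integral_norm_bound_integral)
          show "(\<lambda>s. G y s - G z s) integrable_on {0..t'}" by (intro integrable_diff Gint)
          show "(\<lambda>s. ?d * K * exp (2 * K * s)) integrable_on {0..t'}" using I by blast
          fix s assume s: "s \<in> {0..t'}"
          have "\<bar>G y s - G z s\<bar> \<le> L * \<bar>exp (2 * K * s) * (y s - z s)\<bar>"
            using lip[of s "x0 + exp (2 * K * s) * y s" "x0 + exp (2 * K * s) * z s"] s
            by (simp add: G_def right_diff_distrib)
          also have "\<dots> \<le> K * (exp (2 * K * s) * ?d)"
            using dist_bounded[of y s z] K by (intro mult_mono) (auto simp: abs_mult dist_real_def)
          finally show "norm (G y s - G z s) \<le> ?d * K * exp (2 * K * s)" by (simp add: algebra_simps)
        qed
        also have "\<dots> \<le> ?d / 2 * exp (2 * K * t')"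
          using integral_unique[OF I] by simp
        finally have "\<bar>integral {0..t'} (G y) - integral {0..t'} (G z)\<bar> \<le> ?d / 2 * exp (2 * K * t')"
          by (simp add: Henstock_Kurzweil_Integration.integral_diff[OF Gint Gint])
        then have "exp (- (2 * K * t')) * \<bar>integral {0..t'} (G y) - integral {0..t'} (G z)\<bar>
            \<le> exp (- (2 * K * t')) * (?d / 2 * exp (2 * K * t'))"
          by (intro mult_left_mono) auto
        also have "\<dots> = 1 / 2 * ?d" by (simp add: exp_minus)
        finally show "dist (\<Phi> y t) (\<Phi> z t) \<le> 1 / 2 * dist y z"
          unfolding \<Phi>_def t'_def[symmetric] dist_real_def right_diff_distrib[symmetric] by (simp add: abs_mult)
      qed
    qed
  qed auto
  then obtain y where y: "\<Psi> y = y" by auto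
  define \<psi> where "\<psi> = (\<lambda>t. x0 + exp (2 * K * t) * y t)"
  have yt: "y t = \<Phi> y t" for t using \<Psi>[of y] y by simp
  have psi: "\<psi> t = x0 + integral {0..t} (G y)" if "t \<ge> 0" for t
    unfolding \<psi>_def by (subst yt) (use that in \<open>simp add: \<Phi>_def exp_minus\<close>)
  show ?thesis
  proof (rule that[of \<psi>])
    show "\<psi> 0 = x0" using psi[of 0] by simp
    fix t :: real assume t: "t \<ge> 0"
    have "((\<lambda>t. x0 + integral {0..t} (G y)) has_real_derivative G y t) (at t within {0..})"
      using DERIV_add[OF DERIV_const integral_from_0_has_derivative[OF Gc t]] by simp
    then have "(\<psi> has_real_derivative G y t) (at t within {0..})"
      by (rule has_field_derivative_transform_within[of _ _ _ _ 1]) (use t psi in auto)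
    then show "(\<psi> has_real_derivative F t (\<psi> t)) (at t within {0..})"
      by (simp add: G_def \<psi>_def)
  qed
qed

text \<open>
Uniform continuity provides the extension of each derivative to the closure, and the mean value theorem
identifies the extensions as derivatives of one another at the end point.
\<close>

lemma WB_extend_0:
  fixes F :: "real \<Rightarrow> real"
  assumes S: "open S" "convex S" "0 \<notin> S" "closure S = insert 0 S"
  shows "WB n N S F \<Longrightarrow> \<exists>G. (\<forall>x\<in>S. G x = F x) \<and> WB n N (insert 0 S) G"
proof (induction n arbitrary: N F)
  have ext0: "\<exists>G. uniformly_continuous_on (insert 0 S) G \<and> (\<forall>x\<in>S. G x = F x) \<and> (\<forall>x\<in>insert 0 S. \<bar>G x\<bar> \<le> B)"
    if uc: "uniformly_continuous_on S F" and B: "\<And>x. x \<in> S \<Longrightarrow> \<bar>F x\<bar> \<le> B" for F :: "real \<Rightarrow> real" and B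
  proof -
    obtain G where G: "uniformly_continuous_on (closure S) G" "\<And>x. x \<in> S \<Longrightarrow> F x = G x"
      by (rule uniformly_continuous_on_extension_on_closure[OF uc]) (rule that)
    have "\<bar>G x\<bar> \<le> B" if "x \<in> closure S" for x
    proof (rule continuous_le_on_closure[of S "\<lambda>x. \<bar>G x\<bar>", OF _ that])
      show "continuous_on (closure S) (\<lambda>x. \<bar>G x\<bar>)"
        using uniformly_continuous_imp_continuous[OF G(1)] by (intro continuous_intros)
    qed (use B G(2) in auto)
    then show ?thesis using G S(4) by (intro exI[of _ G]) auto
  qed
  {
    case 0
    then show ?case using ext0[of F "N 0"] by auto
  next
    case (Suc n)
    obtain F' where F': "\<And>x. x \<in> S \<Longrightarrow> (F has_real_derivative F' x) (at x within S)"
      "WB n (\<lambda>j. N (Suc j)) S F'" by (rule WB_1D_SucE[OF Suc.prems]) (rule that)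
    obtain G' where G': "\<forall>x\<in>S. G' x = F' x" "WB n (\<lambda>j. N (Suc j)) (insert 0 S) G'"
      using Suc.IH[OF F'(2)] by auto
    obtain G where G: "uniformly_continuous_on (insert 0 S) G" "\<forall>x\<in>S. G x = F x" "\<forall>x\<in>insert 0 S. \<bar>G x\<bar> \<le> N 0"
      using ext0[OF WB_uc[OF Suc.prems] WB_bound[OF Suc.prems]] by auto
    have Gat: "(G has_real_derivative G' x) (at x)" if x: "x \<in> S" for x
    proof -
      have "(F has_real_derivative F' x) (at x)" using F'(1)[OF x] x S(1) at_within_open by metis
      then show ?thesis
        using has_field_derivative_transform_within_open[of F "F' x" x S G] S(1) x G(2) G'(1) by auto
    qed
    have Gc: "continuous_on (insert 0 S) G" by (rule uniformly_continuous_imp_continuous[OF G(1)])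
    have G'c: "continuous_on (insert 0 S) G'" by (rule WB_cont[OF G'(2)])
    have "(G has_real_derivative G' 0) (at 0 within insert 0 S)"
      unfolding has_field_derivative_iff
    proof (rule tendstoI)
      fix e :: real assume e: "e > 0"
      obtain d where d: "d > 0" "\<forall>x\<in>insert 0 S. dist x 0 < d \<longrightarrow> dist (G' x) (G' 0) < e"
        using G'c[unfolded continuous_on_iff, rule_format, of 0 e] e by blast
      have "dist ((G y - G 0) / (y - 0)) (G' 0) < e" if y: "y \<in> insert 0 S" "y \<noteq> 0" "dist y 0 < d" for y
      proof -
        have yS: "y \<in> S" using y by auto
        have seg: "z \<in> S" if "z \<in> open_segment 0 y" for z
        proof -
          have "0 \<in> closure S" using S(4) by auto
          moreover have "y \<in> interior S" using yS S(1) by (simp add: interior_open)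
          ultimately have "z \<in> interior S"
            using in_interior_closure_convex_segment[OF S(2), of y 0] that
            by (metis open_segment_commute subsetD)
          then show ?thesis using interior_subset by auto
        qed
        have cs: "closed_segment 0 y \<subseteq> insert 0 S"
          using seg yS unfolding open_segment_def by auto
        have "\<exists>z. z \<in> open_segment 0 y \<and> G y - G 0 = G' z * (y - 0)"
        proof (cases "0 < y")
          case True
          have "continuous_on {0..y} G"
            using cs True by (intro continuous_on_subset[OF Gc]) (simp add: closed_segment_eq_real_ivl)
          then obtain z where "0 < z" "z < y" "G y - G 0 = G' z * (y - 0)"
            by (rule mvt[OF True, of G "\<lambda>x. times (G' x)"])
              (use seg True Gat in \<open>auto simp: open_segment_eq_real_ivl has_field_derivative_def\<close>)
          then show ?thesis using True by (intro exI[of _ z]) (simp add: open_segment_eq_real_ivl)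
        next
          case False
          then have neg: "y < 0" using y(2) by simp
          have "continuous_on {y..0} G"
            using cs neg by (intro continuous_on_subset[OF Gc]) (simp add: closed_segment_eq_real_ivl)
          then obtain z where "y < z" "z < 0" "G 0 - G y = G' z * (0 - y)"
            by (rule mvt[OF neg, of G "\<lambda>x. times (G' x)"])
              (use seg neg Gat in \<open>auto simp: open_segment_eq_real_ivl has_field_derivative_def\<close>)
          then show ?thesis using neg by (intro exI[of _ z]) (simp add: open_segment_eq_real_ivl)
        qed
        then obtain z where z: "z \<in> open_segment 0 y" "G y - G 0 = G' z * y" by auto
        have "dist z 0 < d" using z(1) y(3) by (auto simp: open_segment_eq_real_ivl split: if_splits)
        then have "dist (G' z) (G' 0) < e" using d(2) seg[OF z(1)] by auto
        then show ?thesis using z(2) y(2) by simp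
      qed
      then show "\<forall>\<^sub>F y in at 0 within insert 0 S. dist ((G y - G 0) / (y - 0)) (G' 0) < e"
        unfolding eventually_at using d(1) by auto
    qed
    then have Gd: "(G has_real_derivative G' x) (at x within insert 0 S)" if "x \<in> insert 0 S" for x
      using that Gat by (auto intro: has_field_derivative_at_within)
    have "WB (Suc n) N (insert 0 S) G"
      by (rule WB_1D_SucI[OF G(1) _ Gd G'(2)]) (use G(3) in auto)
    then show ?case using G(2) by blast
  }
qed

section \<open>Kruzhkov's inequality on one side of a curve\<close>

lemma integral_lborel_FTC_interior:
  fixes b G :: "real \<Rightarrow> real"
  assumes "c \<le> d" "continuous_on {c..d} b"
    and "\<And>y. c < y \<Longrightarrow> y < d \<Longrightarrow> (b has_real_derivative G y) (at y)"
    and G: "integrable lborel G" and z: "\<And>y. y \<notin> {c..d} \<Longrightarrow> G y = 0"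
  shows "integral\<^sup>L lborel G = b d - b c"
proof -
  have "(G has_integral (b d - b c)) {c..d}"
    by (rule fundamental_theorem_of_calculus_interior[OF assms(1,2)])
      (use assms(3) in \<open>auto simp flip: has_real_derivative_iff_has_vector_derivative\<close>)
  then have "(G has_integral (b d - b c)) UNIV"
    by (rule has_integral_on_superset) (use z in auto)
  then show ?thesis using has_integral_unique[OF has_integral_integral_lborel[OF G]] by simp
qed

lemma integrable_box:
  fixes F :: "real \<times> real \<Rightarrow> real"
  assumes m: "F \<in> borel_measurable borel" and b: "\<And>p. \<bar>F p\<bar> \<le> B"
    and z: "\<And>p. p \<notin> {c..d} \<times> {- R..R} \<Longrightarrow> F p = 0"
  shows "integrable lborel F" "\<And>y. integrable lborel (\<lambda>t. F (t, y))" "\<And>t. integrable lborel (\<lambda>y. F (t, y))"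
proof -
  have box: "{c..d} \<times> {- R..R} = cbox (c, - R) (d, R)" by (simp add: cbox_Pair_eq)
  show "integrable lborel F"
    by (rule integrableI_bounded_set[of "{c..d} \<times> {- R..R}" _ _ B])
      (use assms in \<open>auto simp: box emeasure_lborel_cbox_eq\<close>)
  have m1: "(\<lambda>t. F (t, y)) \<in> borel_measurable borel" for y
    by (rule measurable_compose[OF _ m]) (intro borel_measurable_Pair measurable_ident_sets borel_measurable_const, auto)
  have m2: "(\<lambda>y. F (t, y)) \<in> borel_measurable borel" for t
    by (rule measurable_compose[OF _ m]) (intro borel_measurable_Pair measurable_ident_sets borel_measurable_const, auto)
  show "integrable lborel (\<lambda>t. F (t, y))" for y
    by (rule integrableI_bounded_set[of "{c..d}" _ _ B]) (use m1 b z in \<open>auto simp: emeasure_lborel_Icc_eq\<close>)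
  show "integrable lborel (\<lambda>y. F (t, y))" for t
    by (rule integrableI_bounded_set[of "{- R..R}" _ _ B]) (use m2 b z in \<open>auto simp: emeasure_lborel_Icc_eq\<close>)
qed

lemma measurable_if_continuous_open:
  fixes F :: "'a::topological_space \<Rightarrow> real"
  assumes "open S" "continuous_on S F"
  shows "(\<lambda>p. if p \<in> S then F p else 0) \<in> borel_measurable borel"
proof -
  have "(\<lambda>p. indicator S p *\<^sub>R F p) \<in> borel_measurable borel"
    by (rule borel_measurable_continuous_on_indicator) (use assms in auto)
  moreover have "(\<lambda>p. indicator S p *\<^sub>R F p) = (\<lambda>p. if p \<in> S then F p else 0)"
    by (auto simp: indicator_def)
  ultimately show ?thesis by simp
qed

lemma integral_lborel_Fubini:
  fixes F :: "real \<times> real \<Rightarrow> real"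
  assumes "integrable lborel F"
  shows "integral\<^sup>L lborel F = (\<integral>t. (\<integral>x. F (t, x) \<partial>lborel) \<partial>lborel)"
    "integral\<^sup>L lborel F = (\<integral>x. (\<integral>t. F (t, x) \<partial>lborel) \<partial>lborel)"
proof -
  have i: "integrable (lborel \<Otimes>\<^sub>M lborel) F" using assms by (simp add: lborel_prod)
  show 1: "integral\<^sup>L lborel F = (\<integral>t. (\<integral>x. F (t, x) \<partial>lborel) \<partial>lborel)"
    using lborel_pair.integral_fst'[OF i] by (simp add: lborel_prod)
  show "integral\<^sup>L lborel F = (\<integral>x. (\<integral>t. F (t, x) \<partial>lborel) \<partial>lborel)"
    unfolding 1 using lborel_pair.Fubini_integral[of "\<lambda>t x. F (t, x)"] i by simp
qed

text \<open>
A smooth approximation of the sign. It is chosen such that \<open>smooth_sgn' n r * r\<close> is bounded and tends to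
\<open>0\<close> pointwise, so that the terms in which the derivative hits the approximation disappear in the limit.
\<close>

definition smooth_sgn :: "nat \<Rightarrow> real \<Rightarrow> real" where
  "smooth_sgn n r = 2 / pi * arctan (real (Suc n) * r)"
definition smooth_sgn' :: "nat \<Rightarrow> real \<Rightarrow> real" where
  "smooth_sgn' n r = 2 / pi * (real (Suc n) / (1 + (real (Suc n) * r)\<^sup>2))"

lemma smooth_sgn_deriv: "(smooth_sgn n has_real_derivative smooth_sgn' n r) (at r)"
  unfolding smooth_sgn_def smooth_sgn'_def
  by (auto intro!: derivative_eq_intros simp: divide_inverse algebra_simps)

lemma smooth_sgn_bound: "\<bar>smooth_sgn n r\<bar> \<le> 1"
proof -
  have "\<bar>arctan (real (Suc n) * r)\<bar> \<le> pi / 2"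
    using arctan_bounded[of "real (Suc n) * r"] by (auto simp: abs_le_iff)
  then show ?thesis by (simp add: smooth_sgn_def abs_mult field_simps)
qed

lemma smooth_sgn'_bound: "\<bar>smooth_sgn' n r\<bar> * \<bar>r\<bar> \<le> 1"
proof -
  define a where "a = \<bar>real (Suc n) * r\<bar>"
  have "a \<le> 1 + a\<^sup>2" using sum_squares_bound[of 1 a] by (simp add: a_def)
  then have "a / (1 + a\<^sup>2) \<le> 1" by (simp add: divide_le_eq add_pos_nonneg)
  moreover have "2 / pi \<le> 1" using pi_ge_two by (simp add: field_simps)
  moreover have "0 \<le> a / (1 + a\<^sup>2)" by (simp add: a_def)
  ultimately have "2 / pi * (a / (1 + a\<^sup>2)) \<le> 1 * 1" by (intro mult_mono) auto
  moreover have "\<bar>smooth_sgn' n r\<bar> * \<bar>r\<bar> = 2 / pi * (a / (1 + a\<^sup>2))"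
    by (simp add: smooth_sgn'_def a_def abs_mult power_mult_distrib add_nonneg_nonneg)
  ultimately show ?thesis by linarith
qed

lemma smooth_sgn_tendsto: "(\<lambda>n. smooth_sgn n r) \<longlonglongrightarrow> sgn r"
proof -
  have lim: "filterlim (\<lambda>n. real (Suc n)) at_top sequentially"
    using filterlim_real_sequentially filterlim_Suc filterlim_compose by blast
  consider "r = 0" | "r > 0" | "r < 0" by linarith
  then show ?thesis
  proof cases
    case 2
    have "filterlim (\<lambda>n. real (Suc n) * r) at_top sequentially"
      by (rule filterlim_at_top_mult_tendsto_pos[OF tendsto_const 2 lim])
    then have "(\<lambda>n. arctan (real (Suc n) * r)) \<longlonglongrightarrow> pi / 2"
      by (rule filterlim_compose[OF tendsto_arctan_at_top])
    from tendsto_mult[OF tendsto_const[of "2 / pi"] this] 2 show ?thesis by (simp add: smooth_sgn_def)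
  next
    case 3
    then have "- r > 0" by simp
    have "filterlim (\<lambda>n. real (Suc n) * - r) at_top sequentially"
      by (rule filterlim_at_top_mult_tendsto_pos[OF tendsto_const \<open>- r > 0\<close> lim])
    then have "(\<lambda>n. arctan (real (Suc n) * - r)) \<longlonglongrightarrow> pi / 2"
      by (rule filterlim_compose[OF tendsto_arctan_at_top])
    from tendsto_mult[OF tendsto_const[of "- (2 / pi)"] this] 3 show ?thesis
      by (simp add: smooth_sgn_def arctan_minus)
  qed (simp add: smooth_sgn_def)
qed

lemma smooth_sgn'_tendsto: "(\<lambda>n. smooth_sgn' n r * r) \<longlonglongrightarrow> 0"
proof (cases "r = 0")
  case False
  have lim: "(\<lambda>n. inverse (real (Suc n))) \<longlonglongrightarrow> 0"
    by (rule LIMSEQ_inverse_real_of_nat)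
  show ?thesis
  proof (rule Lim_null_comparison)
    show "\<forall>\<^sub>F n in sequentially. norm (smooth_sgn' n r * r) \<le> inverse (real (Suc n)) * inverse \<bar>r\<bar>"
    proof (intro always_eventually allI)
      fix n
      define a where "a = \<bar>real (Suc n) * r\<bar>"
      have a: "a > 0" using False by (simp add: a_def)
      have "a / (1 + a\<^sup>2) \<le> a / a\<^sup>2"
        using a by (intro divide_left_mono mult_pos_pos) (auto simp: add_pos_pos)
      also have "\<dots> = inverse a" using a by (simp add: power2_eq_square field_simps)
      finally have "a / (1 + a\<^sup>2) \<le> inverse a" .
      moreover have "norm (smooth_sgn' n r * r) = 2 / pi * (a / (1 + a\<^sup>2))"
        by (simp add: smooth_sgn'_def a_def abs_mult power_mult_distrib add_nonneg_nonneg)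
      moreover have "2 / pi \<le> 1" using pi_ge_two by (simp add: field_simps)
      ultimately have "norm (smooth_sgn' n r * r) \<le> 1 * inverse a"
        using a mult_mono[of "2 / pi" 1 "a / (1 + a\<^sup>2)" "inverse a"] by simp
      then show "norm (smooth_sgn' n r * r) \<le> inverse (real (Suc n)) * inverse \<bar>r\<bar>"
        by (simp add: a_def abs_mult)
    qed
    show "(\<lambda>n. inverse (real (Suc n)) * inverse \<bar>r\<bar>) \<longlonglongrightarrow> 0"
      using tendsto_mult_right[OF lim, of "inverse \<bar>r\<bar>"] by simp
  qed
qed simp

lemma smooth_sgn_cont: "continuous_on S (smooth_sgn n)" "continuous_on S (smooth_sgn' n)"
  unfolding smooth_sgn_def smooth_sgn'_def
  by (intro continuous_intros; simp add: add_nonneg_eq_0_iff)+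

text \<open>
A classical solution on the side \<open>0 < s * (x - \<psi> t)\<close> of a curve, where \<open>s\<close> is \<open>1\<close> or \<open>- 1\<close>, and a
test function supported in a box. Off that side \<open>u\<close> is merely a continuous bounded function.
\<close>

locale kruzhkov_side =
  fixes s \<kappa> B t0 t1 R :: real and f f' g \<psi> \<psi>' :: "real \<Rightarrow> real"
    and u ut ux \<phi> \<phi>t \<phi>x :: "real \<times> real \<Rightarrow> real"
  assumes s: "s * s = 1" and t01: "0 < t0" "t0 \<le> t1" and R: "0 \<le> R" and B: "1 \<le> B"
    and f: "\<And>x. (f has_real_derivative f' x) (at x)" "continuous_on UNIV f'"
    and g: "continuous_on UNIV g"
    and psi: "\<And>t. 0 < t \<Longrightarrow> (\<psi> has_real_derivative \<psi>' t) (at t)" "continuous_on {0<..} \<psi>'"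
    and u_cont: "continuous_on ({0<..} \<times> UNIV) u"
    and du: "\<And>p. 0 < fst p \<Longrightarrow> 0 < s * (snd p - \<psi> (fst p)) \<Longrightarrow>
        (u has_derivative (\<lambda>d. ut p * fst d + ux p * snd d)) (at p)"
    and ut_cont: "continuous_on {p. 0 < fst p \<and> 0 < s * (snd p - \<psi> (fst p))} ut"
    and ux_cont: "continuous_on {p. 0 < fst p \<and> 0 < s * (snd p - \<psi> (fst p))} ux"
    and pde: "\<And>p. 0 < fst p \<Longrightarrow> 0 < s * (snd p - \<psi> (fst p)) \<Longrightarrow> ut p + f' (u p) * ux p = g (u p)"
    and dphi: "\<And>p. (\<phi> has_derivative (\<lambda>d. \<phi>t p * fst d + \<phi>x p * snd d)) (at p)"
    and phi_cont: "continuous_on UNIV \<phi>t" "continuous_on UNIV \<phi>x"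
    and supp: "\<And>p. p \<notin> {t0..t1} \<times> {- R..R} \<Longrightarrow> \<phi> p = 0 \<and> \<phi>t p = 0 \<and> \<phi>x p = 0"
    and bounds: "\<And>p. \<bar>\<phi> p\<bar> \<le> B \<and> \<bar>\<phi>t p\<bar> \<le> B \<and> \<bar>\<phi>x p\<bar> \<le> B"
      "\<And>p. 0 < fst p \<Longrightarrow> \<bar>u p - \<kappa>\<bar> \<le> B \<and> \<bar>g (u p)\<bar> \<le> B \<and> \<bar>f' (u p)\<bar> \<le> B
         \<and> \<bar>f (u p) - f \<kappa>\<bar> \<le> B * \<bar>u p - \<kappa>\<bar>"
      "\<And>p. 0 < fst p \<Longrightarrow> 0 < s * (snd p - \<psi> (fst p)) \<Longrightarrow> \<bar>ut p\<bar> \<le> B \<and> \<bar>ux p\<bar> \<le> B"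
      "\<And>t. 0 < t \<Longrightarrow> \<bar>\<psi>' t\<bar> \<le> B" "\<And>t. t \<in> {t0..t1} \<Longrightarrow> \<bar>\<psi> t\<bar> \<le> B"
begin

definition "reg = {p. 0 < fst p \<and> 0 < s * (snd p - \<psi> (fst p))}"

abbreviation "Sg n p \<equiv> smooth_sgn n (u p - \<kappa>)"
abbreviation "Sg' n p \<equiv> smooth_sgn' n (u p - \<kappa>)"

text \<open>
The space-time divergence of \<open>(eta, q) * \<phi>\<close> for the approximate entropy pair
\<open>eta = Sg * (u - \<kappa>)\<close>, \<open>q = Sg * (f u - f \<kappa>)\<close>, after the equation has been inserted.
\<close>

definition "K n p = Sg n p * (g (u p) * \<phi> p + (u p - \<kappa>) * \<phi>t p + (f (u p) - f \<kappa>) * \<phi>x p)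
  + Sg' n p * ((u p - \<kappa>) * ut p + (f (u p) - f \<kappa>) * ux p) * \<phi> p"

definition "K0 p = sgn (u p - \<kappa>) * (g (u p) * \<phi> p + (u p - \<kappa>) * \<phi>t p + (f (u p) - f \<kappa>) * \<phi>x p)"

lemma psi_cont: "continuous_on {0<..} \<psi>"
  using psi(1) by (intro DERIV_continuous_on) (auto intro: has_field_derivative_at_within)

lemma reg_open: "open reg"
proof -
  have "continuous_on ({0<..} \<times> UNIV) (\<lambda>p. s * (snd p - \<psi> (fst p)))"
    by (intro continuous_intros continuous_on_compose2[OF psi_cont]) auto
  then have "open (({0<..} \<times> UNIV) \<inter> (\<lambda>p. s * (snd p - \<psi> (fst p))) -` {0<..})"
    by (rule continuous_open_preimage) (auto simp: open_Times)
  moreover have "({0<..} \<times> UNIV) \<inter> (\<lambda>p. s * (snd p - \<psi> (fst p))) -` {0<..} = reg"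
    by (auto simp: reg_def)
  ultimately show ?thesis by simp
qed

lemma phi_cont0: "continuous_on UNIV \<phi>"
  using dphi by (meson continuous_on_eq_continuous_within has_derivative_continuous has_derivative_at_withinI)

lemma f_cont: "continuous_on UNIV f"
  using f(1) by (meson DERIV_continuous_on has_field_derivative_at_within)

lemmas compose_conts = continuous_on_compose2[OF smooth_sgn_cont(1)[of UNIV], OF _ subset_UNIV]
  continuous_on_compose2[OF smooth_sgn_cont(2)[of UNIV], OF _ subset_UNIV]
  continuous_on_compose2[OF f_cont, OF _ subset_UNIV] continuous_on_compose2[OF g, OF _ subset_UNIV]
  continuous_on_compose2[OF f(2), OF _ subset_UNIV]
  continuous_on_compose2[OF phi_cont0, OF _ subset_UNIV]
  continuous_on_compose2[OF phi_cont(1), OF _ subset_UNIV]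
  continuous_on_compose2[OF phi_cont(2), OF _ subset_UNIV]

lemma K_cont: "continuous_on reg (K n)"
proof -
  have [continuous_intros]: "continuous_on reg u"
    by (rule continuous_on_subset[OF u_cont]) (auto simp: reg_def)
  have [continuous_intros]: "continuous_on reg ut" "continuous_on reg ux"
    using ut_cont ux_cont by (simp_all add: reg_def)
  have [continuous_intros]: "continuous_on reg \<phi>" "continuous_on reg \<phi>t" "continuous_on reg \<phi>x"
    using phi_cont0 phi_cont continuous_on_subset by blast+
  show ?thesis unfolding K_def by (intro continuous_intros compose_conts)
qed

definition "C = 5 * B ^ 4"

lemma main_bound:
  assumes p: "0 < fst p" and S: "\<bar>S\<bar> \<le> 1"
  shows "\<bar>S * (g (u p) * \<phi> p + (u p - \<kappa>) * \<phi>t p + (f (u p) - f \<kappa>) * \<phi>x p)\<bar> \<le> 3 * B ^ 3"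
proof -
  have B0: "0 \<le> B" using B by simp
  have fB: "\<bar>f (u p) - f \<kappa>\<bar> \<le> B * B"
    using bounds(2)[OF p] mult_left_mono[of "\<bar>u p - \<kappa>\<bar>" B B] B0 by linarith
  have 1: "\<bar>g (u p) * \<phi> p\<bar> \<le> B * B" "\<bar>(u p - \<kappa>) * \<phi>t p\<bar> \<le> B * B" "\<bar>(f (u p) - f \<kappa>) * \<phi>x p\<bar> \<le> (B * B) * B"
    unfolding abs_mult using bounds(1)[of p] bounds(2)[OF p] fB B0 by (intro mult_mono; simp)+
  have BB: "B * B \<le> B ^ 3" using B mult_left_mono[of 1 B "B * B"] by (simp add: power3_eq_cube)
  have "\<bar>S * (g (u p) * \<phi> p + (u p - \<kappa>) * \<phi>t p + (f (u p) - f \<kappa>) * \<phi>x p)\<bar>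
    \<le> 1 * \<bar>g (u p) * \<phi> p + (u p - \<kappa>) * \<phi>t p + (f (u p) - f \<kappa>) * \<phi>x p\<bar>"
    unfolding abs_mult using S by (intro mult_right_mono) auto
  also have "\<dots> \<le> 3 * B ^ 3"
    using 1 BB by (simp add: power3_eq_cube)
  finally show ?thesis .
qed

lemma K_bound: assumes "p \<in> reg" shows "\<bar>K n p\<bar> \<le> C"
proof -
  have p: "0 < fst p" "0 < s * (snd p - \<psi> (fst p))" using assms by (auto simp: reg_def)
  have B0: "0 \<le> B" using B by simp
  have 1: "\<bar>(u p - \<kappa>) * ut p + (f (u p) - f \<kappa>) * ux p\<bar> \<le> \<bar>u p - \<kappa>\<bar> * (B + B * B)"
  proof -
    have "\<bar>(u p - \<kappa>) * ut p\<bar> \<le> \<bar>u p - \<kappa>\<bar> * B"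
      unfolding abs_mult using bounds(3)[OF p] by (intro mult_left_mono) auto
    moreover have "\<bar>(f (u p) - f \<kappa>) * ux p\<bar> \<le> (B * \<bar>u p - \<kappa>\<bar>) * B"
      unfolding abs_mult using bounds(2)[OF p(1)] bounds(3)[OF p] B0 by (intro mult_mono) auto
    ultimately show ?thesis by (simp add: algebra_simps)
  qed
  have "\<bar>Sg' n p * ((u p - \<kappa>) * ut p + (f (u p) - f \<kappa>) * ux p) * \<phi> p\<bar>
     \<le> (\<bar>Sg' n p\<bar> * (\<bar>u p - \<kappa>\<bar> * (B + B * B))) * B"
    unfolding abs_mult using 1 bounds(1)[of p] B0 by (intro mult_mono) auto
  also have "\<dots> = (\<bar>Sg' n p\<bar> * \<bar>u p - \<kappa>\<bar>) * ((B + B * B) * B)" by (simp add: algebra_simps)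
  also have "\<dots> \<le> 1 * ((B + B * B) * B)"
    using smooth_sgn'_bound[of n "u p - \<kappa>"] B0 by (intro mult_right_mono) auto
  finally have 2: "\<bar>Sg' n p * ((u p - \<kappa>) * ut p + (f (u p) - f \<kappa>) * ux p) * \<phi> p\<bar> \<le> B * B + B * B * B"
    by (simp add: algebra_simps)
  have "B * B \<le> B ^ 3" using B mult_left_mono[of 1 B "B * B"] by (simp add: power3_eq_cube)
  moreover have "B ^ 3 \<le> B ^ 4" using B by (intro power_increasing) auto
  moreover have "B * B * B = B ^ 3" by (simp add: power3_eq_cube)
  ultimately show ?thesis
    using 2 main_bound[OF p(1) smooth_sgn_bound[of n "u p - \<kappa>"]]
      abs_triangle_ineq[of "Sg n p * (g (u p) * \<phi> p + (u p - \<kappa>) * \<phi>t p + (f (u p) - f \<kappa>) * \<phi>x p)"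
       "Sg' n p * ((u p - \<kappa>) * ut p + (f (u p) - f \<kappa>) * ux p) * \<phi> p"]
    unfolding K_def C_def by linarith
qed

lemma C_nonneg: "0 \<le> C" using B by (simp add: C_def)

definition "KI n p = (if p \<in> reg then K n p else 0)"

lemma KI_integrable: "integrable lborel (KI n)"
proof (rule integrable_box(1)[of _ C t0 t1 R])
  show "KI n \<in> borel_measurable borel"
    unfolding KI_def[abs_def] by (rule measurable_if_continuous_open[OF reg_open K_cont])
  show "\<bar>KI n p\<bar> \<le> C" for p using K_bound C_nonneg by (simp add: KI_def)
  show "KI n p = 0" if "p \<notin> {t0..t1} \<times> {- R..R}" for p
    using supp[OF that] by (simp add: KI_def K_def)
qed

text \<open>
Coordinates in which the curve is the line \<open>y = 0\<close> and the side under consideration is \<open>0 < y\<close>.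
\<close>

definition "\<Theta> p = (fst p, \<psi> (fst p) + s * snd p)"
definition "Q = {p::real \<times> real. 0 < fst p \<and> 0 < snd p}"

text \<open>
In the straightened coordinates the divergence splits into a \<open>t\<close>-derivative \<open>G1\<close>, which integrates to
\<open>0\<close>, and a \<open>y\<close>-derivative \<open>G2\<close>, which leaves the boundary term on the curve.
\<close>

definition "G1 n p = (if p \<in> Q then
  (Sg' n (\<Theta> p) * (u (\<Theta> p) - \<kappa>) + Sg n (\<Theta> p)) * (ut (\<Theta> p) + \<psi>' (fst p) * ux (\<Theta> p)) * \<phi> (\<Theta> p)
  + Sg n (\<Theta> p) * (u (\<Theta> p) - \<kappa>) * (\<phi>t (\<Theta> p) + \<psi>' (fst p) * \<phi>x (\<Theta> p)) else 0)"

definition "G2 n p = (if p \<in> Q then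
  s * ((Sg' n (\<Theta> p) * (f (u (\<Theta> p)) - f \<kappa> - \<psi>' (fst p) * (u (\<Theta> p) - \<kappa>))
        + Sg n (\<Theta> p) * (f' (u (\<Theta> p)) - \<psi>' (fst p))) * (s * ux (\<Theta> p)) * \<phi> (\<Theta> p)
    + Sg n (\<Theta> p) * (f (u (\<Theta> p)) - f \<kappa> - \<psi>' (fst p) * (u (\<Theta> p) - \<kappa>)) * (s * \<phi>x (\<Theta> p))) else 0)"

lemma ss: "s * (s * y) = y" using s by (metis mult.assoc mult_1)

lemma abs_s: "\<bar>s\<bar> = 1"
  using s by (metis abs_mult_self_eq abs_1 abs_ge_zero mult_cancel_left2 mult_eq_0_iff power2_eq_1_iff power2_eq_square abs_minus_cancel)

lemma Theta_reg: "p \<in> Q \<Longrightarrow> \<Theta> p \<in> reg"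
  by (simp add: Q_def reg_def \<Theta>_def ss)

lemma Theta_not_reg: "p \<notin> Q \<Longrightarrow> \<Theta> p \<notin> reg"
  by (auto simp: Q_def reg_def \<Theta>_def ss)

lemma G12: "G1 n p + G2 n p = KI n (\<Theta> p)"
proof (cases "p \<in> Q")
  case True
  have pd: "ut (\<Theta> p) + f' (u (\<Theta> p)) * ux (\<Theta> p) = g (u (\<Theta> p))"
    using Theta_reg[OF True] pde by (simp add: reg_def)
  show ?thesis
    using Theta_reg[OF True] True unfolding KI_def G1_def G2_def K_def
    by (simp add: pd[symmetric] algebra_simps ss)
next
  case False
  then show ?thesis using Theta_not_reg[OF False] by (simp add: KI_def G1_def G2_def)
qed

lemma Q_open: "open Q"
proof -
  have "Q = {0<..} \<times> {0<..}" by (auto simp: Q_def)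
  then show ?thesis by (metis open_Times open_greaterThan)
qed

lemma Theta_cont: "continuous_on ({0<..} \<times> UNIV) \<Theta>"
  unfolding \<Theta>_def by (intro continuous_intros continuous_on_compose2[OF psi_cont]) auto

lemma G_cont: "continuous_on Q (\<lambda>p. u (\<Theta> p))" "continuous_on Q (\<lambda>p. ut (\<Theta> p))" "continuous_on Q (\<lambda>p. ux (\<Theta> p))"
  "continuous_on Q (\<lambda>p. \<phi> (\<Theta> p))" "continuous_on Q (\<lambda>p. \<phi>t (\<Theta> p))" "continuous_on Q (\<lambda>p. \<phi>x (\<Theta> p))"
  "continuous_on Q (\<lambda>p. \<psi>' (fst p))"
proof -
  have T: "continuous_on Q \<Theta>" by (rule continuous_on_subset[OF Theta_cont]) (auto simp: Q_def)
  show "continuous_on Q (\<lambda>p. u (\<Theta> p))"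
    by (rule continuous_on_compose2[OF u_cont T]) (auto simp: Q_def \<Theta>_def)
  show "continuous_on Q (\<lambda>p. ut (\<Theta> p))"
    by (rule continuous_on_compose2[OF ut_cont T]) (use Theta_reg in \<open>auto simp: reg_def\<close>)
  show "continuous_on Q (\<lambda>p. ux (\<Theta> p))"
    by (rule continuous_on_compose2[OF ux_cont T]) (use Theta_reg in \<open>auto simp: reg_def\<close>)
  show "continuous_on Q (\<lambda>p. \<phi> (\<Theta> p))" by (rule continuous_on_compose2[OF phi_cont0 T]) auto
  show "continuous_on Q (\<lambda>p. \<phi>t (\<Theta> p))" by (rule continuous_on_compose2[OF phi_cont(1) T]) auto
  show "continuous_on Q (\<lambda>p. \<phi>x (\<Theta> p))" by (rule continuous_on_compose2[OF phi_cont(2) T]) auto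
  show "continuous_on Q (\<lambda>p. \<psi>' (fst p))"
    by (rule continuous_on_compose2[OF psi(2)]) (auto simp: Q_def intro!: continuous_intros)
qed

lemma G_meas: "G1 n \<in> borel_measurable borel" "G2 n \<in> borel_measurable borel"
  unfolding G1_def[abs_def] G2_def[abs_def]
  by (rule measurable_if_continuous_open[OF Q_open]; intro continuous_intros compose_conts G_cont)+

lemma flux_bound: assumes "0 < fst p" shows "\<bar>f (u p) - f \<kappa> - \<psi>' (fst p) * (u p - \<kappa>)\<bar> \<le> 2 * B * \<bar>u p - \<kappa>\<bar>"
proof -
  have "\<bar>\<psi>' (fst p) * (u p - \<kappa>)\<bar> \<le> B * \<bar>u p - \<kappa>\<bar>"
    unfolding abs_mult using bounds(4)[OF assms] by (intro mult_right_mono) auto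
  then show ?thesis
    using bounds(2)[OF assms] abs_triangle_ineq4[of "f (u p) - f \<kappa>" "\<psi>' (fst p) * (u p - \<kappa>)"] by linarith
qed

lemma G1_bound: "\<bar>G1 n p\<bar> \<le> 2 * (B + B * B) * B + B * (B + B * B)"
proof (cases "p \<in> Q")
  case True
  have t: "0 < fst p" "fst (\<Theta> p) = fst p" using True by (auto simp: Q_def \<Theta>_def)
  have r: "0 < fst (\<Theta> p)" "0 < s * (snd (\<Theta> p) - \<psi> (fst (\<Theta> p)))" using Theta_reg[OF True] by (auto simp: reg_def)
  have B0: "0 \<le> B" using B by simp
  have "\<bar>Sg' n (\<Theta> p) * (u (\<Theta> p) - \<kappa>) + Sg n (\<Theta> p)\<bar> \<le> 2"
    using abs_triangle_ineq[of "Sg' n (\<Theta> p) * (u (\<Theta> p) - \<kappa>)" "Sg n (\<Theta> p)"]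
      smooth_sgn'_bound[of n "u (\<Theta> p) - \<kappa>"] smooth_sgn_bound[of n "u (\<Theta> p) - \<kappa>"]
    by (simp add: abs_mult)
  moreover have "\<bar>ut (\<Theta> p) + \<psi>' (fst p) * ux (\<Theta> p)\<bar> \<le> B + B * B"
    using abs_triangle_ineq[of "ut (\<Theta> p)" "\<psi>' (fst p) * ux (\<Theta> p)"] bounds(3)[OF r]
      mult_mono[of "\<bar>\<psi>' (fst p)\<bar>" B "\<bar>ux (\<Theta> p)\<bar>" B] bounds(4)[OF t(1)] B0 by (simp add: abs_mult)
  moreover have "\<bar>\<phi>t (\<Theta> p) + \<psi>' (fst p) * \<phi>x (\<Theta> p)\<bar> \<le> B + B * B"
    using abs_triangle_ineq[of "\<phi>t (\<Theta> p)" "\<psi>' (fst p) * \<phi>x (\<Theta> p)"] bounds(1)[of "\<Theta> p"]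
      mult_mono[of "\<bar>\<psi>' (fst p)\<bar>" B "\<bar>\<phi>x (\<Theta> p)\<bar>" B] bounds(4)[OF t(1)] B0 by (simp add: abs_mult)
  moreover have "\<bar>Sg n (\<Theta> p) * (u (\<Theta> p) - \<kappa>)\<bar> \<le> B"
    using mult_mono[of "\<bar>Sg n (\<Theta> p)\<bar>" 1 "\<bar>u (\<Theta> p) - \<kappa>\<bar>" B] smooth_sgn_bound[of n "u (\<Theta> p) - \<kappa>"] bounds(2)[OF r(1)]
    by (simp add: abs_mult)
  ultimately have
    "\<bar>(Sg' n (\<Theta> p) * (u (\<Theta> p) - \<kappa>) + Sg n (\<Theta> p)) * (ut (\<Theta> p) + \<psi>' (fst p) * ux (\<Theta> p)) * \<phi> (\<Theta> p)\<bar> \<le> 2 * (B + B * B) * B"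
    "\<bar>Sg n (\<Theta> p) * (u (\<Theta> p) - \<kappa>) * (\<phi>t (\<Theta> p) + \<psi>' (fst p) * \<phi>x (\<Theta> p))\<bar> \<le> B * (B + B * B)"
    using bounds(1)[of "\<Theta> p"] B0 unfolding abs_mult by (intro mult_mono; simp)+
  then show ?thesis using True unfolding G1_def by (simp only: if_True)
qed (use B in \<open>simp add: G1_def\<close>)

lemma G2_bound: "\<bar>G2 n p\<bar> \<le> 4 * B * B * B + 2 * B * B * B"
proof (cases "p \<in> Q")
  case True
  have t: "0 < fst p" "fst (\<Theta> p) = fst p" using True by (auto simp: Q_def \<Theta>_def)
  have r: "0 < fst (\<Theta> p)" "0 < s * (snd (\<Theta> p) - \<psi> (fst (\<Theta> p)))" using Theta_reg[OF True] by (auto simp: reg_def)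
  have B0: "0 \<le> B" using B by simp
  define w where "w = u (\<Theta> p) - \<kappa>"
  define F where "F = f (u (\<Theta> p)) - f \<kappa> - \<psi>' (fst p) * w"
  have F: "\<bar>F\<bar> \<le> 2 * B * \<bar>w\<bar>" using flux_bound[OF r(1)] by (simp add: F_def w_def t(2))
  have wB: "\<bar>w\<bar> \<le> B" using bounds(2)[OF r(1)] by (simp add: w_def)
  have "\<bar>Sg' n (\<Theta> p) * F\<bar> \<le> \<bar>Sg' n (\<Theta> p)\<bar> * (2 * B * \<bar>w\<bar>)"
    unfolding abs_mult using F by (intro mult_left_mono) auto
  also have "\<dots> = 2 * B * (\<bar>Sg' n (\<Theta> p)\<bar> * \<bar>w\<bar>)" by simp
  also have "\<dots> \<le> 2 * B * 1" using smooth_sgn'_bound[of n w] B0 by (intro mult_left_mono) (auto simp: w_def)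
  finally have 1: "\<bar>Sg' n (\<Theta> p) * F\<bar> \<le> 2 * B" by simp
  have 2: "\<bar>Sg n (\<Theta> p) * (f' (u (\<Theta> p)) - \<psi>' (fst p))\<bar> \<le> 1 * (2 * B)"
    unfolding abs_mult
    using smooth_sgn_bound[of n "u (\<Theta> p) - \<kappa>"] bounds(2)[OF r(1)] bounds(4)[OF t(1)]
    by (intro mult_mono) auto
  have 3: "\<bar>Sg n (\<Theta> p) * F\<bar> \<le> 1 * (2 * B * B)"
  proof -
    have "2 * B * \<bar>w\<bar> \<le> 2 * B * B" using wB B0 by (intro mult_left_mono) auto
    then show ?thesis unfolding abs_mult
      using smooth_sgn_bound[of n "u (\<Theta> p) - \<kappa>"] F by (intro mult_mono) auto
  qed
  have sx: "\<bar>s * ux (\<Theta> p)\<bar> \<le> B" "\<bar>s * \<phi>x (\<Theta> p)\<bar> \<le> B"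
    using bounds(3)[OF r] bounds(1)[of "\<Theta> p"] by (auto simp: abs_mult abs_s)
  have "\<bar>Sg' n (\<Theta> p) * F + Sg n (\<Theta> p) * (f' (u (\<Theta> p)) - \<psi>' (fst p))\<bar> \<le> 4 * B"
    using 1 2 by linarith
  then have "\<bar>(Sg' n (\<Theta> p) * F + Sg n (\<Theta> p) * (f' (u (\<Theta> p)) - \<psi>' (fst p))) * (s * ux (\<Theta> p)) * \<phi> (\<Theta> p)\<bar>
    \<le> 4 * B * B * B"
    unfolding abs_mult[of "_ * _" "\<phi> _"] abs_mult[of _ "s * ux _"]
    using sx bounds(1)[of "\<Theta> p"] B0 by (intro mult_mono) auto
  moreover have "\<bar>Sg n (\<Theta> p) * F * (s * \<phi>x (\<Theta> p))\<bar> \<le> 2 * B * B * B"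
    unfolding abs_mult[of _ "s * \<phi>x _"] using 3 sx B0 by (intro mult_mono) auto
  ultimately have "\<bar>(Sg' n (\<Theta> p) * F + Sg n (\<Theta> p) * (f' (u (\<Theta> p)) - \<psi>' (fst p))) * (s * ux (\<Theta> p)) * \<phi> (\<Theta> p)
     + Sg n (\<Theta> p) * F * (s * \<phi>x (\<Theta> p))\<bar> \<le> 4 * B * B * B + 2 * B * B * B" by linarith
  then show ?thesis using True unfolding G2_def F_def w_def by (simp only: if_True abs_mult[of s] abs_s mult_1)
qed (use B in \<open>simp add: G2_def\<close>)

lemma Theta_supp:
  assumes "p \<notin> {t0..t1} \<times> {- (R + B)..R + B}"
  shows "\<phi> (\<Theta> p) = 0 \<and> \<phi>t (\<Theta> p) = 0 \<and> \<phi>x (\<Theta> p) = 0"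
proof (rule supp)
  show "\<Theta> p \<notin> {t0..t1} \<times> {- R..R}"
  proof
    assume A: "\<Theta> p \<in> {t0..t1} \<times> {- R..R}"
    then have "fst p \<in> {t0..t1}" by (auto simp: \<Theta>_def)
    then have "\<bar>\<psi> (fst p)\<bar> \<le> B" by (rule bounds(5))
    moreover have "\<bar>\<psi> (fst p) + s * snd p\<bar> \<le> R" using A by (auto simp: \<Theta>_def)
    ultimately have "\<bar>s * snd p\<bar> \<le> R + B" by linarith
    then have "snd p \<in> {- (R + B)..R + B}" by (auto simp: abs_mult abs_s)
    then show False using assms \<open>fst p \<in> {t0..t1}\<close> by (auto simp: mem_Times_iff)
  qed
qed

lemma G_supp: "p \<notin> {t0..t1} \<times> {- (R + B)..R + B} \<Longrightarrow> G1 n p = 0 \<and> G2 n p = 0"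
  using Theta_supp by (simp add: G1_def G2_def)

lemma G_integrable: "integrable lborel (G1 n)" "\<And>y. integrable lborel (\<lambda>t. G1 n (t, y))"
   "integrable lborel (G2 n)" "\<And>t. integrable lborel (\<lambda>y. G2 n (t, y))"
  using integrable_box[OF G_meas(1) G1_bound, of t0 t1 "R + B"] G_supp
    integrable_box[OF G_meas(2) G2_bound, of t0 t1 "R + B"] by blast+

lemma u_Theta_deriv_t:
  assumes "0 < t" "0 < y"
  shows "((\<lambda>t. u (\<Theta> (t, y))) has_real_derivative ut (\<Theta> (t, y)) + \<psi>' t * ux (\<Theta> (t, y))) (at t)"
proof -
  have T: "((\<lambda>t. \<Theta> (t, y)) has_derivative (\<lambda>d. (d, \<psi>' t * d))) (at t)"
    unfolding \<Theta>_def using psi(1)[OF assms(1)]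
    by (auto simp: has_field_derivative_def intro!: derivative_eq_intros)
  have "(t, y) \<in> Q" using assms by (simp add: Q_def)
  then have "(u has_derivative (\<lambda>d. ut (\<Theta> (t, y)) * fst d + ux (\<Theta> (t, y)) * snd d)) (at (\<Theta> (t, y)))"
    using Theta_reg du by (simp add: reg_def)
  from has_derivative_compose[OF T this] have "((\<lambda>t. u (\<Theta> (t, y))) has_derivative (\<lambda>d. (ut (\<Theta> (t, y)) + \<psi>' t * ux (\<Theta> (t, y))) * d)) (at t)"
    by (rule has_derivative_eq_rhs) (auto simp: algebra_simps)
  then show ?thesis by (simp add: has_field_derivative_def)
qed

lemma phi_Theta_deriv_t:
  assumes "0 < t"
  shows "((\<lambda>t. \<phi> (\<Theta> (t, y))) has_real_derivative \<phi>t (\<Theta> (t, y)) + \<psi>' t * \<phi>x (\<Theta> (t, y))) (at t)"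
proof -
  have T: "((\<lambda>t. \<Theta> (t, y)) has_derivative (\<lambda>d. (d, \<psi>' t * d))) (at t)"
    unfolding \<Theta>_def using psi(1)[OF assms(1)]
    by (auto simp: has_field_derivative_def intro!: derivative_eq_intros)
  from has_derivative_compose[OF T dphi] have "((\<lambda>t. \<phi> (\<Theta> (t, y))) has_derivative (\<lambda>d. (\<phi>t (\<Theta> (t, y)) + \<psi>' t * \<phi>x (\<Theta> (t, y))) * d)) (at t)"
    by (rule has_derivative_eq_rhs) (auto simp: algebra_simps)
  then show ?thesis by (simp add: has_field_derivative_def)
qed

lemma u_Theta_deriv_y:
  assumes "0 < t" "0 < y"
  shows "((\<lambda>y. u (\<Theta> (t, y))) has_real_derivative s * ux (\<Theta> (t, y))) (at y)"
proof -
  have T: "((\<lambda>y. \<Theta> (t, y)) has_derivative (\<lambda>d. (0, s * d))) (at y)"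
    unfolding \<Theta>_def by (auto intro!: derivative_eq_intros)
  have "(t, y) \<in> Q" using assms by (simp add: Q_def)
  then have "(u has_derivative (\<lambda>d. ut (\<Theta> (t, y)) * fst d + ux (\<Theta> (t, y)) * snd d)) (at (\<Theta> (t, y)))"
    using Theta_reg du by (simp add: reg_def)
  from has_derivative_compose[OF T this] have "((\<lambda>y. u (\<Theta> (t, y))) has_derivative (\<lambda>d. (s * ux (\<Theta> (t, y))) * d)) (at y)"
    by (rule has_derivative_eq_rhs) (auto simp: algebra_simps)
  then show ?thesis by (simp add: has_field_derivative_def)
qed

lemma phi_Theta_deriv_y: "((\<lambda>y. \<phi> (\<Theta> (t, y))) has_real_derivative s * \<phi>x (\<Theta> (t, y))) (at y)"
proof -
  have T: "((\<lambda>y. \<Theta> (t, y)) has_derivative (\<lambda>d. (0, s * d))) (at y)"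
    unfolding \<Theta>_def by (auto intro!: derivative_eq_intros)
  from has_derivative_compose[OF T dphi] have "((\<lambda>y. \<phi> (\<Theta> (t, y))) has_derivative (\<lambda>d. (s * \<phi>x (\<Theta> (t, y))) * d)) (at y)"
    by (rule has_derivative_eq_rhs) (auto simp: algebra_simps)
  then show ?thesis by (simp add: has_field_derivative_def)
qed

lemma int_G1: "integral\<^sup>L lborel (G1 n) = 0"
proof -
  have "(\<integral>t. G1 n (t, y) \<partial>lborel) = 0" for y
  proof (cases "0 < y")
    case False
    then have "G1 n (t, y) = 0" for t by (simp add: G1_def Q_def)
    then show ?thesis by simp
  next
    case True
    let ?b = "\<lambda>t. Sg n (\<Theta> (t, y)) * (u (\<Theta> (t, y)) - \<kappa>) * \<phi> (\<Theta> (t, y))"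
    have D: "(?b has_real_derivative G1 n (t, y)) (at t)" if "0 < t" for t
    proof -
      note d = u_Theta_deriv_t[OF that True] phi_Theta_deriv_t[OF that, of y]
      have "((\<lambda>t. Sg n (\<Theta> (t, y))) has_real_derivative
          Sg' n (\<Theta> (t, y)) * (ut (\<Theta> (t, y)) + \<psi>' t * ux (\<Theta> (t, y)))) (at t)"
        by (rule DERIV_chain2[OF smooth_sgn_deriv]) (use d(1) in \<open>auto intro!: derivative_eq_intros\<close>)
      then have "(?b has_real_derivative
          (Sg' n (\<Theta> (t, y)) * (ut (\<Theta> (t, y)) + \<psi>' t * ux (\<Theta> (t, y))) * (u (\<Theta> (t, y)) - \<kappa>)
            + (ut (\<Theta> (t, y)) + \<psi>' t * ux (\<Theta> (t, y))) * Sg n (\<Theta> (t, y))) * \<phi> (\<Theta> (t, y))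
          + (\<phi>t (\<Theta> (t, y)) + \<psi>' t * \<phi>x (\<Theta> (t, y))) * (Sg n (\<Theta> (t, y)) * (u (\<Theta> (t, y)) - \<kappa>))) (at t)"
        using d by (intro DERIV_mult) (auto intro!: derivative_eq_intros)
      then show ?thesis
        by (rule DERIV_cong) (use that True in \<open>simp add: G1_def Q_def algebra_simps\<close>)
    qed
    have "(\<integral>t. G1 n (t, y) \<partial>lborel) = ?b (t1 + 1) - ?b (t0 / 2)"
    proof (rule integral_lborel_FTC_interior[where b="?b", OF _ _ _ G_integrable(2)])
      show "continuous_on {t0 / 2..t1 + 1} ?b"
        by (rule DERIV_continuous_on[OF has_field_derivative_at_within[OF D]]) (use t01 in auto)
      show "G1 n (t, y) = 0" if "t \<notin> {t0 / 2..t1 + 1}" for t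
        using G_supp[of "(t, y)" n] that t01 by auto
    qed (use t01 D in auto)
    also have "\<dots> = 0"
      using Theta_supp[of "(t1 + 1, y)"] Theta_supp[of "(t0 / 2, y)"] t01 by auto
    finally show ?thesis .
  qed
  then show ?thesis unfolding integral_lborel_Fubini(2)[OF G_integrable(1)] by simp
qed

definition "Bd n t = (if 0 < t then Sg n (t, \<psi> t) * (f (u (t, \<psi> t)) - f \<kappa> - \<psi>' t * (u (t, \<psi> t) - \<kappa>)) * \<phi> (t, \<psi> t) else 0)"
definition "B0 t = (if 0 < t then sgn (u (t, \<psi> t) - \<kappa>) * (f (u (t, \<psi> t)) - f \<kappa> - \<psi>' t * (u (t, \<psi> t) - \<kappa>)) * \<phi> (t, \<psi> t) else 0)"

lemma int_G2_y: "(\<integral>y. G2 n (t, y) \<partial>lborel) = - s * Bd n t"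
proof (cases "0 < t")
  case False
  then have "G2 n (t, y) = 0" for y by (simp add: G2_def Q_def)
  then show ?thesis using False by (simp add: Bd_def)
next
  case True
  let ?F = "\<lambda>y. f (u (\<Theta> (t, y))) - f \<kappa> - \<psi>' t * (u (\<Theta> (t, y)) - \<kappa>)"
  let ?b = "\<lambda>y. s * (Sg n (\<Theta> (t, y)) * ?F y * \<phi> (\<Theta> (t, y)))"
  let ?d = "R + B + 1"
  have D: "(?b has_real_derivative G2 n (t, y)) (at y)" if "0 < y" for y
  proof -
    note d = u_Theta_deriv_y[OF True that] phi_Theta_deriv_y[of t y]
    have 1: "((\<lambda>y. Sg n (\<Theta> (t, y))) has_real_derivative
        Sg' n (\<Theta> (t, y)) * (s * ux (\<Theta> (t, y)))) (at y)"
      by (rule DERIV_chain2[OF smooth_sgn_deriv]) (use d(1) in \<open>auto intro!: derivative_eq_intros\<close>)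
    have 2: "(?F has_real_derivative f' (u (\<Theta> (t, y))) * (s * ux (\<Theta> (t, y))) - \<psi>' t * (s * ux (\<Theta> (t, y)))) (at y)"
      using DERIV_chain2[OF f(1) d(1)] d(1) by (auto intro!: derivative_eq_intros)
    show ?thesis
      by (rule DERIV_cong[OF DERIV_cmult[OF DERIV_mult[OF DERIV_mult[OF 1 2] d(2)]]])
        (use that True in \<open>simp add: G2_def Q_def algebra_simps\<close>)
  qed
  have uc: "continuous_on {0..?d} (\<lambda>y. u (\<Theta> (t, y)))"
    by (rule continuous_on_compose2[OF u_cont]) (use True in \<open>auto simp: \<Theta>_def intro!: continuous_intros\<close>)
  have pc: "continuous_on {0..?d} (\<lambda>y. \<phi> (\<Theta> (t, y)))"
    by (rule continuous_on_compose2[OF phi_cont0]) (auto simp: \<Theta>_def intro!: continuous_intros)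
  have "(\<integral>y. G2 n (t, y) \<partial>lborel) = ?b ?d - ?b 0"
  proof (rule integral_lborel_FTC_interior[where b="?b", OF _ _ _ G_integrable(4)])
    show "continuous_on {0..?d} ?b" by (intro continuous_intros compose_conts uc pc)
    show "G2 n (t, y) = 0" if "y \<notin> {0..?d}" for y
    proof (cases "0 < y")
      case True then show ?thesis using G_supp[of "(t, y)" n] that R B by auto
    next
      case False then show ?thesis by (simp add: G2_def Q_def)
    qed
  qed (use R B D in auto)
  also have "?b ?d = 0" using Theta_supp[of "(t, ?d)"] R B by auto
  finally show ?thesis using True by (simp add: Bd_def \<Theta>_def)
qed

lemma int_KI: "integral\<^sup>L lborel (KI n) = - s * integral\<^sup>L lborel (Bd n)"
proof -
  have i: "integrable lborel (\<lambda>p. G1 n p + G2 n p)" using G_integrable by auto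
  have "integral\<^sup>L lborel (KI n) = (\<integral>t. (\<integral>x. KI n (t, x) \<partial>lborel) \<partial>lborel)"
    by (rule integral_lborel_Fubini(1)[OF KI_integrable])
  also have "\<dots> = (\<integral>t. (\<integral>y. KI n (t, \<psi> t + s * y) \<partial>lborel) \<partial>lborel)"
  proof (rule Bochner_Integration.integral_cong[OF refl])
    fix t
    have "s \<noteq> 0" using s by auto
    from lborel_integral_real_affine[OF this, of "\<lambda>x. KI n (t, x)" "\<psi> t"]
    show "(\<integral>x. KI n (t, x) \<partial>lborel) = (\<integral>y. KI n (t, \<psi> t + s * y) \<partial>lborel)"
      by (simp add: abs_s)
  qed
  also have "\<dots> = (\<integral>t. (\<integral>y. G1 n (t, y) + G2 n (t, y) \<partial>lborel) \<partial>lborel)"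
    unfolding G12 \<Theta>_def by simp
  also have "\<dots> = integral\<^sup>L lborel (\<lambda>p. G1 n p + G2 n p)"
    by (rule integral_lborel_Fubini(1)[OF i, symmetric])
  also have "\<dots> = integral\<^sup>L lborel (G1 n) + integral\<^sup>L lborel (G2 n)"
    by (rule Bochner_Integration.integral_add[OF G_integrable(1,3)])
  also have "\<dots> = (\<integral>t. - s * Bd n t \<partial>lborel)"
    unfolding int_G1 integral_lborel_Fubini(1)[OF G_integrable(3)] int_G2_y by simp
  finally show ?thesis by simp
qed

lemma Bd_bound: "\<bar>Bd n t\<bar> \<le> 2 * B * B * B" "t \<notin> {t0..t1} \<Longrightarrow> Bd n t = 0"
proof -
  show "\<bar>Bd n t\<bar> \<le> 2 * B * B * B"
  proof (cases "0 < t")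
    case True
    have "\<bar>f (u (t, \<psi> t)) - f \<kappa> - \<psi>' t * (u (t, \<psi> t) - \<kappa>)\<bar> \<le> 2 * B * \<bar>u (t, \<psi> t) - \<kappa>\<bar>"
      using flux_bound[of "(t, \<psi> t)"] True by simp
    also have "\<dots> \<le> 2 * B * B" using bounds(2)[of "(t, \<psi> t)"] True B by (intro mult_left_mono) auto
    finally have "\<bar>f (u (t, \<psi> t)) - f \<kappa> - \<psi>' t * (u (t, \<psi> t) - \<kappa>)\<bar> \<le> 2 * B * B" .
    then have "\<bar>Sg n (t, \<psi> t) * (f (u (t, \<psi> t)) - f \<kappa> - \<psi>' t * (u (t, \<psi> t) - \<kappa>)) * \<phi> (t, \<psi> t)\<bar> \<le> 1 * (2 * B * B) * B"
      unfolding abs_mult using smooth_sgn_bound bounds(1) B by (intro mult_mono) auto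
    then show ?thesis using True by (simp add: Bd_def)
  qed (use B in \<open>simp add: Bd_def\<close>)
  show "t \<notin> {t0..t1} \<Longrightarrow> Bd n t = 0" using supp[of "(t, \<psi> t)"] by (auto simp: Bd_def)
qed

lemma Bd_meas: "Bd n \<in> borel_measurable borel"
proof -
  have p: "continuous_on {0<..} (\<lambda>t. (t, \<psi> t))" by (intro continuous_intros psi_cont)
  have uc: "continuous_on {0<..} (\<lambda>t. u (t, \<psi> t))"
    by (rule continuous_on_compose2[OF u_cont p]) auto
  have pc: "continuous_on {0<..} (\<lambda>t. \<phi> (t, \<psi> t))"
    by (rule continuous_on_compose2[OF phi_cont0 p]) auto
  have "continuous_on {0<..} (\<lambda>t. Sg n (t, \<psi> t) * (f (u (t, \<psi> t)) - f \<kappa> - \<psi>' t * (u (t, \<psi> t) - \<kappa>)) * \<phi> (t, \<psi> t))"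
    by (intro continuous_intros compose_conts uc pc psi(2))
  from measurable_if_continuous_open[OF _ this] show ?thesis
    unfolding Bd_def[abs_def] by simp
qed

definition "K0I p = (if p \<in> reg then K0 p else 0)"

lemma K_tendsto: "(\<lambda>n. KI n p) \<longlonglongrightarrow> K0I p"
proof (cases "p \<in> reg")
  case True
  have p: "0 < fst p" using True by (simp add: reg_def)
  let ?w = "u p - \<kappa>"
  have 1: "(\<lambda>n. Sg n p * (g (u p) * \<phi> p + (u p - \<kappa>) * \<phi>t p + (f (u p) - f \<kappa>) * \<phi>x p)) \<longlonglongrightarrow> K0 p"
    unfolding K0_def by (intro tendsto_intros smooth_sgn_tendsto)
  have 2: "(\<lambda>n. Sg' n p * ((u p - \<kappa>) * ut p + (f (u p) - f \<kappa>) * ux p) * \<phi> p) \<longlonglongrightarrow> 0"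
  proof (cases "?w = 0")
    case False
    have "(\<lambda>n. (Sg' n p * ?w) * ((ut p + (f (u p) - f \<kappa>) / ?w * ux p) * \<phi> p)) \<longlonglongrightarrow> 0"
      using tendsto_mult_right[OF smooth_sgn'_tendsto, of ?w "(ut p + (f (u p) - f \<kappa>) / ?w * ux p) * \<phi> p"] by simp
    moreover have eq: "(Sg' n p * ?w) * ((ut p + (f (u p) - f \<kappa>) / ?w * ux p) * \<phi> p)
       = Sg' n p * (?w * ut p + (f (u p) - f \<kappa>) * ux p) * \<phi> p" for n
    proof -
      have "(f (u p) - f \<kappa>) = ?w * ((f (u p) - f \<kappa>) / ?w)" using False by simp
      then show ?thesis by (metis (no_types, opaque_lifting) distrib_left mult.assoc)
    qed
    ultimately show ?thesis by (simp only: eq)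
  next
    case w: True
    then have "f (u p) - f \<kappa> = 0" by simp
    then show ?thesis unfolding w by simp
  qed
  have "(\<lambda>n. K n p) \<longlonglongrightarrow> K0 p + 0" unfolding K_def by (rule tendsto_add[OF 1 2])
  then show ?thesis using True by (simp add: KI_def K0I_def)
qed (simp add: KI_def K0I_def)

lemma Bd_tendsto: "(\<lambda>n. Bd n t) \<longlonglongrightarrow> B0 t"
  unfolding Bd_def B0_def by (cases "0 < t") (auto intro!: tendsto_intros smooth_sgn_tendsto)

text \<open>
The limit \<open>n \<rightarrow> \<infinity>\<close> of the integration by parts formula, by dominated convergence.
\<close>

lemma side_identity:
  "integrable lborel K0I" "integrable lborel B0" "integral\<^sup>L lborel K0I = - s * integral\<^sup>L lborel B0"
proof -
  let ?w = "\<lambda>p::real \<times> real. if p \<in> {t0..t1} \<times> {- R..R} then C else 0"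
  have box: "{t0..t1} \<times> {- R..R} = cbox (t0, - R) (t1, R)" by (simp add: cbox_Pair_eq)
  have wi: "integrable lborel ?w"
    by (rule integrable_box(1)[of _ "\<bar>C\<bar>" t0 t1 R]) (auto simp: box intro!: measurable_If)
  have KIm: "KI n \<in> borel_measurable lborel" for n using KI_integrable by (rule borel_measurable_integrable)
  have K0m: "K0I \<in> borel_measurable lborel"
    by (rule borel_measurable_LIMSEQ_real[OF K_tendsto KIm])
  have kb: "norm (KI n p) \<le> ?w p" for n p
    using K_bound[of p n] supp[of p] C_nonneg by (auto simp: KI_def K_def)
  have Bm: "Bd n \<in> borel_measurable lborel" for n using Bd_meas by simp
  have B0m: "B0 \<in> borel_measurable lborel"
    by (rule borel_measurable_LIMSEQ_real[OF Bd_tendsto Bm])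
  let ?v = "\<lambda>t::real. if t \<in> {t0..t1} then 2 * B * B * B else 0"
  have vi: "integrable lborel ?v"
    by (rule integrableI_bounded_set[of "{t0..t1}" _ _ "2 * B * B * B"])
      (use B in \<open>auto simp: emeasure_lborel_Icc_eq\<close>)
  have vb: "norm (Bd n t) \<le> ?v t" for n t using Bd_bound(1)[of n t] Bd_bound(2)[of t n] by auto
  show "integrable lborel K0I"
    by (rule integrable_dominated_convergence[where s="\<lambda>n. KI n", OF K0m KIm wi]) (use K_tendsto kb in auto)
  show "integrable lborel B0"
    by (rule integrable_dominated_convergence[where s="\<lambda>n. Bd n", OF B0m Bm vi]) (use Bd_tendsto vb in auto)
  have "(\<lambda>n. integral\<^sup>L lborel (KI n)) \<longlonglongrightarrow> integral\<^sup>L lborel K0I"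
    by (rule integral_dominated_convergence[where s="\<lambda>n. KI n", OF K0m KIm wi]) (use K_tendsto kb in auto)
  moreover have "(\<lambda>n. integral\<^sup>L lborel (Bd n)) \<longlonglongrightarrow> integral\<^sup>L lborel B0"
    by (rule integral_dominated_convergence[where s="\<lambda>n. Bd n", OF B0m Bm vi]) (use Bd_tendsto vb in auto)
  then have "(\<lambda>n. integral\<^sup>L lborel (KI n)) \<longlonglongrightarrow> - s * integral\<^sup>L lborel B0"
    unfolding int_KI by (rule tendsto_mult_left)
  ultimately show "integral\<^sup>L lborel K0I = - s * integral\<^sup>L lborel B0" by (rule LIMSEQ_unique)
qed

end

section \<open>Stability of the chord condition\<close>

text \<open>
In the middle of the interval the strict inequality has a positive margin by compactness. Near the end
points there is no margin, and the inequality holds because \<open>f'\<close> stays on the correct side of the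
chord slope there, by Lax's inequalities.
\<close>

lemma Oleinik_perturbation_aux:
  fixes f f' :: "real \<Rightarrow> real"
  assumes f: "\<And>x. (f has_real_derivative f' x) (at x)" and f'c: "continuous_on UNIV f'"
    and lt: "um < up" and RH: "f up - f um = \<sigma> * (up - um)"
    and Lax: "f' up < \<sigma>" "\<sigma> < f' um"
    and L: "\<And>x. um < x \<Longrightarrow> x < up \<Longrightarrow> 0 < f x - f um - \<sigma> * (x - um)"
  shows "\<exists>\<delta>>0. \<forall>a b \<kappa>. \<bar>a - up\<bar> \<le> \<delta> \<longrightarrow> \<bar>b - um\<bar> \<le> \<delta> \<longrightarrow> b \<le> \<kappa> \<longrightarrow> \<kappa> \<le> a \<longrightarrow>
      0 \<le> f \<kappa> - f b - (f a - f b) / (a - b) * (\<kappa> - b)"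
proof -
  define s where "s = (\<lambda>p::real \<times> real. (f (fst p) - f (snd p)) / (fst p - snd p))"
  define \<gamma> where "\<gamma> = min (\<sigma> - f' up) (f' um - \<sigma>) / 2"
  have g0: "\<gamma> > 0" using Lax by (simp add: \<gamma>_def)
  have f'at: "isCont f' x" for x using f'c by (simp add: continuous_on_eq_continuous_at)
  have fat: "isCont f x" for x using f DERIV_isCont by blast
  obtain d1 where d1: "d1 > 0" "\<And>x. \<bar>x - um\<bar> < d1 \<Longrightarrow> \<bar>f' x - f' um\<bar> < \<gamma>"
    using f'at[of um, unfolded continuous_at_eps_delta, rule_format, OF g0] by (auto simp: dist_real_def)
  obtain d2 where d2: "d2 > 0" "\<And>x. \<bar>x - up\<bar> < d2 \<Longrightarrow> \<bar>f' x - f' up\<bar> < \<gamma>"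
    using f'at[of up, unfolded continuous_at_eps_delta, rule_format, OF g0] by (auto simp: dist_real_def)
  define d where "d = min (min d1 d2) (up - um) / 3"
  have d: "d > 0" "d < d1" "d < d2" "3 * d \<le> up - um" using d1(1) d2(1) lt by (auto simp: d_def)
  have fc: "continuous_on {um + d..up - d} (\<lambda>x. f x - f um - \<sigma> * (x - um))"
    using fat by (intro continuous_intros continuous_at_imp_continuous_on) auto
  obtain x0 where x0: "x0 \<in> {um + d..up - d}" "\<forall>x\<in>{um + d..up - d}. f x0 - f um - \<sigma> * (x0 - um) \<le> f x - f um - \<sigma> * (x - um)"
    using continuous_attains_inf[OF compact_Icc _ fc] d by auto
  define m where "m = f x0 - f um - \<sigma> * (x0 - um)"
  have m: "m > 0" unfolding m_def by (rule L) (use x0(1) d in auto)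
  \<comment> \<open>Bounds the change of the chord function when \<open>(up, um)\<close> is replaced by \<open>p\<close>.\<close>
  define e where "e = (\<lambda>p. \<bar>f um - f (snd p)\<bar> + \<bar>\<sigma> - s p\<bar> * (up - um) + \<bar>s p * (snd p - um)\<bar>)"
  have s0: "s (up, um) = \<sigma>" using RH lt by (simp add: s_def)
  have sc: "isCont s (up, um)"
    unfolding s_def using lt
    by (intro continuous_intros continuous_at_compose[of _ fst f, unfolded o_def] continuous_at_compose[of _ snd f, unfolded o_def]) (auto intro: fat continuous_intros)
  have ec: "isCont e (up, um)"
    unfolding e_def by (intro continuous_intros sc continuous_at_compose[of _ snd f, unfolded o_def]) (auto intro: fat)
  have e0: "e (up, um) = 0" by (simp add: e_def s0)
  obtain r1 where r1: "r1 > 0" "\<And>p. dist p (up, um) < r1 \<Longrightarrow> \<bar>e p\<bar> < m"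
    using ec[unfolded continuous_at_eps_delta, rule_format, OF m] e0 by (auto simp: dist_real_def)
  obtain r2 where r2: "r2 > 0" "\<And>p. dist p (up, um) < r2 \<Longrightarrow> \<bar>s p - \<sigma>\<bar> < \<gamma>"
    using sc[unfolded continuous_at_eps_delta, rule_format, OF g0] s0 by (auto simp: dist_real_def)
  define \<delta> where "\<delta> = min (min r1 r2 / 3) d"
  have de: "\<delta> > 0" "\<delta> \<le> d" "3 * \<delta> \<le> r1" "3 * \<delta> \<le> r2" using r1(1) r2(1) d by (auto simp: \<delta>_def)
  have "0 \<le> f \<kappa> - f b - (f a - f b) / (a - b) * (\<kappa> - b)"
    if a: "\<bar>a - up\<bar> \<le> \<delta>" and b: "\<bar>b - um\<bar> \<le> \<delta>" and k: "b \<le> \<kappa>" "\<kappa> \<le> a" for a b \<kappa>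
  proof -
    have ab: "b < a" using a b de d by linarith
    have "dist (a, b) (up, um) \<le> \<bar>a - up\<bar> + \<bar>b - um\<bar>"
      unfolding dist_norm using norm_Pair_le[of "a - up" "b - um"] by simp
    then have ds: "dist (a, b) (up, um) < r1" "dist (a, b) (up, um) < r2" using a b de by linarith+
    define S where "S = s (a, b)"
    have S: "S * (a - b) = f a - f b" using ab by (simp add: S_def s_def)
    have Sg: "\<bar>S - \<sigma>\<bar> < \<gamma>" using r2(2)[OF ds(2)] by (simp add: S_def)
    have gl: "2 * \<gamma> \<le> \<sigma> - f' up" "2 * \<gamma> \<le> f' um - \<sigma>" by (auto simp: \<gamma>_def)
    have "0 \<le> f \<kappa> - f b - S * (\<kappa> - b)"
    proof -
      consider "\<kappa> = b" | "b < \<kappa>" "\<kappa> \<le> um + d" | "um + d < \<kappa>" "\<kappa> < up - d" | "\<kappa> = a" | "up - d \<le> \<kappa>" "\<kappa> < a"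
        using k by linarith
      then show ?thesis
      proof cases
        case 2
        obtain z where z: "b < z" "z < \<kappa>" "f \<kappa> - f b = (\<kappa> - b) * f' z"
          using MVT2[OF 2(1), of f f'] f by auto
        have "\<bar>z - um\<bar> < d1" using z(1,2) 2 b de d by linarith
        then have "S \<le> f' z" using d1(2)[of z] Sg gl by linarith
        then have "S * (\<kappa> - b) \<le> (\<kappa> - b) * f' z" using 2(1) by (simp add: mult.commute)
        then show ?thesis using z(3) by simp
      next
        case 3
        have kk: "\<kappa> \<in> {um + d..up - d}" using 3 by auto
        have "\<bar>(\<sigma> - S) * (\<kappa> - um)\<bar> \<le> \<bar>\<sigma> - S\<bar> * (up - um)"
          unfolding abs_mult using 3 d by (intro mult_left_mono) auto
        moreover have "\<bar>e (a, b)\<bar> < m" by (rule r1(2)[OF ds(1)])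
        moreover have "m \<le> f \<kappa> - f um - \<sigma> * (\<kappa> - um)" using x0(2) kk by (auto simp: m_def)
        moreover have "f \<kappa> - f b - S * (\<kappa> - b)
           = (f \<kappa> - f um - \<sigma> * (\<kappa> - um)) + (f um - f b) + (\<sigma> - S) * (\<kappa> - um) + S * (b - um)"
          by (simp add: algebra_simps)
        ultimately show ?thesis unfolding e_def S_def fst_conv snd_conv by linarith
      next
        case 5
        obtain z where z: "\<kappa> < z" "z < a" "f a - f \<kappa> = (a - \<kappa>) * f' z"
          using MVT2[OF 5(2), of f f'] f by auto
        have "\<bar>z - up\<bar> < d2" using z(1,2) 5 a de d by linarith
        then have "f' z \<le> S" using d2(2)[of z] Sg gl by linarith
        then have "(a - \<kappa>) * f' z \<le> S * (a - \<kappa>)" using 5(2) by (simp add: mult.commute)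
        then show ?thesis using z(3) S by (simp add: algebra_simps)
      qed (use S in auto)
    qed
    then show ?thesis by (simp add: S_def s_def)
  qed
  then show ?thesis using de(1) by blast
qed

text \<open>
The case \<open>up < um\<close> follows from the other one by the symmetry \<open>x \<mapsto> - x\<close> of the state space.
\<close>

lemma Oleinik_perturbation:
  fixes f f' :: "real \<Rightarrow> real"
  assumes f: "\<And>x. (f has_real_derivative f' x) (at x)" and f'c: "continuous_on UNIV f'"
    and ne: "up \<noteq> um" and RH: "f up - f um = \<sigma> * (up - um)"
    and O: "strict_Oleinik f \<sigma> um up"
  obtains \<delta> where "\<delta> > 0" "\<And>a b \<kappa>. \<bar>a - up\<bar> \<le> \<delta> \<Longrightarrow> \<bar>b - um\<bar> \<le> \<delta> \<Longrightarrow>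
      b \<le> \<kappa> \<and> \<kappa> \<le> a \<or> a \<le> \<kappa> \<and> \<kappa> \<le> b \<Longrightarrow> 0 \<le> (f \<kappa> - f b - (f a - f b) / (a - b) * (\<kappa> - b)) * (a - b)"
proof -
  have df: "deriv f x = f' x" for x using f DERIV_imp_deriv by blast
  have Lax: "f' up < \<sigma>" "\<sigma> < f' um" using O by (auto simp: strict_Oleinik_def df)
  have L: "0 < (f x - f um - \<sigma> * (x - um)) * (up - um)"
    if x: "um < x \<and> x < up \<or> up < x \<and> x < um" for x
  proof -
    define \<tau> where "\<tau> = (up - x) / (up - um)"
    have t: "\<tau> \<in> {0<..<1}" using x by (auto simp: \<tau>_def field_simps)
    have tx: "\<tau> * um + (1 - \<tau>) * up = x"
    proof -
      have "\<tau> * (up - um) = up - x" using ne by (simp add: \<tau>_def)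
      then show ?thesis by (simp add: algebra_simps)
    qed
    have O': "(f x - f up) / (x - up) < (f x - f um) / (x - um)"
      using O t tx unfolding strict_Oleinik_def Let_def by metis
    define L where "L = f x - f um - \<sigma> * (x - um)"
    have 1: "f x - f um = \<sigma> * (x - um) + L" by (simp add: L_def)
    have 2: "f x - f up = \<sigma> * (x - up) + L" using RH by (simp add: L_def algebra_simps)
    have n: "x - um \<noteq> 0" "x - up \<noteq> 0" using x by auto
    have "L / (x - up) < L / (x - um)"
      using O' unfolding 1 2 using n by (simp add: add_divide_distrib)
    then have "0 < L * (up - um)"
      using x by (auto simp: field_simps mult_less_cancel_left mult_less_cancel_right split: if_splits)
    then show ?thesis by (simp add: L_def)
  qed
  show ?thesis
  proof (cases "um < up")
    case True
    have "0 < f x - f um - \<sigma> * (x - um)" if "um < x" "x < up" for x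
      using L[of x] that True by (simp add: zero_less_mult_iff)
    from Oleinik_perturbation_aux[OF f f'c True RH Lax this] obtain \<delta> where \<delta>: "\<delta> > 0"
      "\<forall>a b \<kappa>. \<bar>a - up\<bar> \<le> \<delta> \<longrightarrow> \<bar>b - um\<bar> \<le> \<delta> \<longrightarrow> b \<le> \<kappa> \<longrightarrow> \<kappa> \<le> a \<longrightarrow>
      0 \<le> f \<kappa> - f b - (f a - f b) / (a - b) * (\<kappa> - b)" by blast
    show ?thesis
    proof (rule that[of "min \<delta> ((up - um) / 3)"])
      fix a b \<kappa> assume A: "\<bar>a - up\<bar> \<le> min \<delta> ((up - um) / 3)" "\<bar>b - um\<bar> \<le> min \<delta> ((up - um) / 3)"
        "b \<le> \<kappa> \<and> \<kappa> \<le> a \<or> a \<le> \<kappa> \<and> \<kappa> \<le> b"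
      have A1: "\<bar>a - up\<bar> \<le> \<delta>" "\<bar>b - um\<bar> \<le> \<delta>" "\<bar>a - up\<bar> \<le> (up - um) / 3" "\<bar>b - um\<bar> \<le> (up - um) / 3"
        using A(1,2) by auto
      have "b < a"
        using abs_le_D1[OF A1(4)] abs_le_D2[OF A1(3)] True by (simp add: field_simps)
      then show "0 \<le> (f \<kappa> - f b - (f a - f b) / (a - b) * (\<kappa> - b)) * (a - b)"
        using \<delta>(2) A1 A(3) by auto
    qed (use \<delta> True in auto)
  next
    case False
    then have lt: "- um < - up" using ne by simp
    let ?F = "\<lambda>x. - f (- x)" and ?F' = "\<lambda>x. f' (- x)"
    have F: "(?F has_real_derivative ?F' x) (at x)" for x
    proof -
      have i: "(uminus has_real_derivative - 1) (at x)" by (auto intro!: derivative_eq_intros)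
      show ?thesis using DERIV_minus[OF DERIV_chain2[where g=uminus, OF f i]] by simp
    qed
    have F'c: "continuous_on UNIV ?F'" by (intro continuous_on_compose2[OF f'c] continuous_intros) auto
    have "0 < ?F x - ?F (- um) - \<sigma> * (x - - um)" if "- um < x" "x < - up" for x
    proof -
      have "f (- x) - f um - \<sigma> * (- x - um) < 0"
        using L[of "- x"] that lt by (simp add: zero_less_mult_iff)
      then show ?thesis by (simp add: algebra_simps)
    qed
    from Oleinik_perturbation_aux[OF F F'c lt _ _ _ this] RH Lax obtain \<delta> where \<delta>: "\<delta> > 0"
      "\<forall>a b \<kappa>. \<bar>a - - up\<bar> \<le> \<delta> \<longrightarrow> \<bar>b - - um\<bar> \<le> \<delta> \<longrightarrow> b \<le> \<kappa> \<longrightarrow> \<kappa> \<le> a \<longrightarrow>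
      0 \<le> ?F \<kappa> - ?F b - (?F a - ?F b) / (a - b) * (\<kappa> - b)" by (auto simp: algebra_simps)
    show ?thesis
    proof (rule that[of "min \<delta> ((um - up) / 3)"])
      fix a b \<kappa> assume A: "\<bar>a - up\<bar> \<le> min \<delta> ((um - up) / 3)" "\<bar>b - um\<bar> \<le> min \<delta> ((um - up) / 3)"
        "b \<le> \<kappa> \<and> \<kappa> \<le> a \<or> a \<le> \<kappa> \<and> \<kappa> \<le> b"
      have A1: "\<bar>a - up\<bar> \<le> \<delta>" "\<bar>b - um\<bar> \<le> \<delta>" "\<bar>a - up\<bar> \<le> (um - up) / 3" "\<bar>b - um\<bar> \<le> (um - up) / 3"
        using A(1,2) by auto
      have ab: "a < b"
        using abs_le_D1[OF A1(3)] abs_le_D2[OF A1(4)] lt by (simp add: field_simps)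
      then have k: "- b \<le> - \<kappa>" "- \<kappa> \<le> - a" using A(3) by auto
      have "\<bar>- a - - up\<bar> \<le> \<delta>" "\<bar>- b - - um\<bar> \<le> \<delta>" using A1(1,2) by (auto simp: abs_minus_commute)
      then have F: "0 \<le> ?F (- \<kappa>) - ?F (- b) - (?F (- a) - ?F (- b)) / (- a - - b) * (- \<kappa> - - b)"
        using \<delta>(2) k by blast
      define S where "S = (f a - f b) / (a - b)"
      have "(?F (- a) - ?F (- b)) / (- a - - b) = S"
        unfolding S_def using ab by (subst frac_eq_eq) (auto simp: algebra_simps)
      then have "0 \<le> ?F (- \<kappa>) - ?F (- b) - S * (- \<kappa> - - b)" using F by simp
      then have "f \<kappa> - f b - S * (\<kappa> - b) \<le> 0" by (simp add: algebra_simps)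
      then show "0 \<le> (f \<kappa> - f b - (f a - f b) / (a - b) * (\<kappa> - b)) * (a - b)"
        unfolding S_def using ab by (intro mult_nonpos_nonpos) auto
    qed (use \<delta> lt in auto)
  qed
qed

text \<open>
Only values \<open>\<kappa>\<close> between the two states matter: for the others both signs agree and the jump relation
makes the two sides equal.
\<close>

lemma Oleinik_entropy_jump:
  fixes f :: "real \<Rightarrow> real"
  assumes S: "f a - f b = S * (a - b)"
    and L: "\<And>\<kappa>. b \<le> \<kappa> \<and> \<kappa> \<le> a \<or> a \<le> \<kappa> \<and> \<kappa> \<le> b \<Longrightarrow> 0 \<le> (f \<kappa> - f b - S * (\<kappa> - b)) * (a - b)"
  shows "sgn (a - \<kappa>) * (f a - f \<kappa> - S * (a - \<kappa>)) \<le> sgn (b - \<kappa>) * (f b - f \<kappa> - S * (b - \<kappa>))"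
proof -
  define Lk where "Lk = f \<kappa> - f b - S * (\<kappa> - b)"
  have 1: "f b - f \<kappa> - S * (b - \<kappa>) = - Lk" by (simp add: Lk_def algebra_simps)
  have 2: "f a - f \<kappa> - S * (a - \<kappa>) = - Lk" using S by (simp add: Lk_def algebra_simps)
  have "0 \<le> (sgn (a - \<kappa>) - sgn (b - \<kappa>)) * Lk"
  proof (cases "b \<le> \<kappa> \<and> \<kappa> \<le> a \<or> a \<le> \<kappa> \<and> \<kappa> \<le> b")
    case False
    then have "sgn (a - \<kappa>) = sgn (b - \<kappa>)" by (auto simp: sgn_if)
    then show ?thesis by simp
  next
    case True
    from L[OF True] have l: "0 \<le> Lk * (a - b)" by (simp add: Lk_def)
    consider "a = b" | "b < a" | "a < b" by linarith
    then show ?thesis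
    proof cases
      case 2
      then have "0 \<le> Lk" using l by (simp add: zero_le_mult_iff)
      moreover have "0 \<le> sgn (a - \<kappa>) - sgn (b - \<kappa>)" using True 2 by (auto simp: sgn_if)
      ultimately show ?thesis by simp
    next
      case 3
      then have "Lk \<le> 0" using l by (simp add: zero_le_mult_iff)
      moreover have "sgn (a - \<kappa>) - sgn (b - \<kappa>) \<le> 0" using True 3 by (auto simp: sgn_if)
      ultimately show ?thesis by (rule mult_nonpos_nonpos[rotated])
    qed simp
  qed
  then show ?thesis unfolding 1 2 by (simp add: algebra_simps)
qed

section \<open>Landau's inequality and the essential supremum\<close>

text \<open>
The mean value theorem finds a point within distance \<open>\<delta>\<close> at which the derivative is at most
\<open>2 * A / \<delta>\<close>; from there the second derivative changes it by at most \<open>\<delta> * B\<close>. One ray contained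
in the set suffices, which is why half-lines are allowed.
\<close>

lemma Landau_pointwise:
  fixes F F' F'' :: "real \<Rightarrow> real"
  assumes dir: "s = 1 \<or> s = - 1" and ray: "\<And>r. 0 \<le> r \<Longrightarrow> x + s * r \<in> S"
    and d1: "\<And>y. y \<in> S \<Longrightarrow> (F has_real_derivative F' y) (at y)"
    and d2: "\<And>y. y \<in> S \<Longrightarrow> (F' has_real_derivative F'' y) (at y)"
    and A: "\<And>y. y \<in> S \<Longrightarrow> \<bar>F y\<bar> \<le> A" and B: "\<And>y. y \<in> S \<Longrightarrow> \<bar>F'' y\<bar> \<le> B" and del: "\<delta> > 0"
  shows "\<bar>F' x\<bar> \<le> 2 * A / \<delta> + \<delta> * B"
proof -
  let ?G = "\<lambda>r. F (x + s * r)" and ?G' = "\<lambda>r. F' (x + s * r)"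
  have lin: "((\<lambda>r. x + s * r) has_real_derivative s) (at r)" for r
    by (auto intro!: derivative_eq_intros)
  have G: "(?G has_real_derivative s * F' (x + s * r)) (at r)" if "0 \<le> r" for r
    using DERIV_chain2[where g="\<lambda>r. x + s * r", OF d1[OF ray[OF that]] lin] by (simp add: mult.commute)
  have G': "(?G' has_real_derivative s * F'' (x + s * r)) (at r)" if "0 \<le> r" for r
    using DERIV_chain2[where g="\<lambda>r. x + s * r", OF d2[OF ray[OF that]] lin] by (simp add: mult.commute)
  have as: "\<bar>s\<bar> = 1" using dir by auto
  obtain z where z: "0 < z" "z < \<delta>" "?G \<delta> - ?G 0 = (\<delta> - 0) * (s * F' (x + s * z))"
    using MVT2[OF del, of ?G "\<lambda>r. s * F' (x + s * r)"] G by auto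
  have "\<bar>\<delta> * (s * F' (x + s * z))\<bar> \<le> 2 * A"
    using z(3) A[OF ray[of \<delta>]] A[OF ray[of 0]] del by auto
  then have 1: "\<bar>F' (x + s * z)\<bar> \<le> 2 * A / \<delta>"
    using del as by (simp add: abs_mult field_simps)
  obtain y where y: "0 < y" "y < z" "?G' z - ?G' 0 = (z - 0) * (s * F'' (x + s * y))"
    using MVT2[OF z(1), of ?G' "\<lambda>r. s * F'' (x + s * r)"] G' by auto
  have "\<bar>?G' z - ?G' 0\<bar> = z * \<bar>F'' (x + s * y)\<bar>"
    unfolding y(3) using as z(1) by (simp add: abs_mult)
  also have "\<dots> \<le> \<delta> * B" using B[OF ray[of y]] z y by (intro mult_mono) auto
  finally show ?thesis using 1 by simp
qed

text \<open>
Optimising Landau's inequality over \<open>\<delta>\<close> gives a geometric mean; summation over lower orders does not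
destroy it.
\<close>

lemma log_convex_of_Landau:
  fixes m :: "nat \<Rightarrow> real"
  assumes m0: "\<And>i. 0 \<le> m i"
    and L: "\<And>i \<delta>. 0 < i \<Longrightarrow> i < k \<Longrightarrow> 0 < \<delta> \<Longrightarrow> m i \<le> 2 * m (i - 1) / \<delta> + \<delta> * m (i + 1)"
    and i: "0 < i" "i < k"
  defines "M \<equiv> \<lambda>j. \<Sum>l\<le>j. m l"
  shows "M i * M i \<le> 16 * (M (i - 1) * M (i + 1))"
proof -
  have M0: "0 \<le> M j" for j unfolding M_def using m0 by (intro sum_nonneg) auto
  have step: "M (Suc j) = M j + m (Suc j)" for j by (simp add: M_def)
  obtain i' where i': "i = Suc i'" using i by (cases i) auto
  have mono: "M i' \<le> M i" "M i \<le> M (Suc i)" using step m0 i' by simp_all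
  have ml: "m i' \<le> M i'" "m (Suc i) \<le> M (Suc i)" unfolding M_def by (rule member_le_sum; simp add: m0)+
  show ?thesis
  proof (cases "M i' = 0")
    case True
    then have "m i' = 0" using ml(1) m0[of i'] by simp
    have "m i \<le> 0"
    proof (rule field_le_epsilon)
      fix e :: real assume e: "0 < e"
      \<comment> \<open>The norm of order \<open>i - 1\<close> vanishes, so that \<open>\<delta>\<close> may be arbitrarily small.\<close>
      define \<delta> where "\<delta> = e / (1 + m (Suc i))"
      have \<delta>: "\<delta> > 0" using e m0[of "Suc i"] by (simp add: \<delta>_def)
      have "m i \<le> \<delta> * m (Suc i)" using L[OF i \<delta>] i' \<open>m i' = 0\<close> by simp
      also have "\<dots> \<le> \<delta> * (1 + m (Suc i))" using \<delta> by simp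
      also have "\<dots> = e" using m0[of "Suc i"] by (simp add: \<delta>_def)
      finally show "m i \<le> 0 + e" by simp
    qed
    then have "M i = 0" using step[of i'] i' True m0[of i] by simp
    then show ?thesis using M0 by simp
  next
    case False
    then have A: "0 < M i'" using M0[of i'] by simp
    then have B: "0 < M (Suc i)" using mono by simp
    \<comment> \<open>The minimiser of \<open>M i' / \<delta> + \<delta> * M (Suc i)\<close>.\<close>
    define \<delta> where "\<delta> = sqrt (M i' / M (Suc i))"
    have \<delta>: "\<delta> > 0" using A B by (simp add: \<delta>_def)
    define r where "r = sqrt (M i' * M (Suc i))"
    have sA: "sqrt (M i') * sqrt (M i') = M i'" "sqrt (M (Suc i)) * sqrt (M (Suc i)) = M (Suc i)"
      "sqrt (M i') > 0" "sqrt (M (Suc i)) > 0" using A B by simp_all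
    have r3: "r * r = M i' * M (Suc i)" "0 < r" using A B by (simp_all add: r_def)
    have r1: "M i' / \<delta> = r"
      using sA by (simp add: \<delta>_def r_def real_sqrt_divide real_sqrt_mult nonzero_divide_eq_eq field_simps)
    have r2: "\<delta> * M (Suc i) = r"
      using sA by (simp add: \<delta>_def r_def real_sqrt_divide real_sqrt_mult field_simps)
    note r = r1 r2 r3
    have "m i \<le> 2 * M i' / \<delta> + \<delta> * M (Suc i)"
    proof -
      have "2 * m (i - 1) / \<delta> \<le> 2 * M i' / \<delta>" using ml(1) \<delta> i' by (intro divide_right_mono) auto
      moreover have "\<delta> * m (i + 1) \<le> \<delta> * M (Suc i)" using ml(2) \<delta> by simp
      ultimately show ?thesis using L[OF i \<delta>] by linarith
    qed
    then have "m i \<le> 3 * r" using r(1,2) by simp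
    moreover have "M i' \<le> r"
    proof -
      have "M i' \<le> M (Suc i)" using mono by linarith
      then have "M i' * M i' \<le> M i' * M (Suc i)" by (rule mult_left_mono) (use A in simp)
      then have "(M i')\<^sup>2 \<le> r\<^sup>2" unfolding power2_eq_square r(3) .
      then show ?thesis by (rule power2_le_imp_le) (use r(4) in simp)
    qed
    ultimately have "M i \<le> 4 * r" using step[of i'] i' by simp
    then have "M i * M i \<le> (4 * r) * (4 * r)" using M0 r(4) by (intro mult_mono) auto
    also have "\<dots> = 16 * (M i' * M (Suc i))" using r(3) by simp
    finally show ?thesis using i' by simp
  qed
qed

text \<open>
The quotients \<open>M (j + 1) / M 1\<close> for \<open>j < k\<close>. Beyond the available orders they are continued by a
geometric sequence which is large enough to keep monotonicity and submultiplicativity; vanishing data get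
constant weights.
\<close>

definition weight :: "nat \<Rightarrow> (nat \<Rightarrow> real) \<Rightarrow> nat \<Rightarrow> real" where
  "weight k M j = (if M 1 = 0 then 1 else if j < k then M (Suc j) / M 1 else (M k / M 1) ^ j)"

lemma log_convex_mult:
  fixes M :: "nat \<Rightarrow> real"
  assumes pos: "\<And>j. 1 \<le> j \<Longrightarrow> 0 < M j"
    and lc: "\<And>i. 0 < i \<Longrightarrow> i < k \<Longrightarrow> M i * M i \<le> 16 * (M (i - 1) * M (i + 1))"
    and ab: "1 + a + b \<le> k"
  shows "M (Suc a) * M (Suc b) \<le> (16 ^ k) ^ k * (M 1 * M (Suc (a + b)))"
proof -
  have step: "M (Suc i) * M l \<le> 16 ^ (l - i) * (M i * M (Suc l))" if "1 \<le> i" "i \<le> l" "l < k" for i l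
    using that(2,3)
  proof (induction l rule: dec_induct)
    case base then show ?case by simp
  next
    case (step l)
    have p: "0 < M i" "0 < M l" "0 < M (Suc l)" "0 < M (Suc i)" using pos that(1) step.hyps by auto
    have lc': "M (Suc l) * M (Suc l) \<le> 16 * (M l * M (Suc (Suc l)))"
      using lc[of "Suc l"] step.prems by simp
    have "(M (Suc i) * M (Suc l)) * (M l * M (Suc l)) = (M (Suc i) * M l) * (M (Suc l) * M (Suc l))" by simp
    also have "\<dots> \<le> (16 ^ (l - i) * (M i * M (Suc l))) * (16 * (M l * M (Suc (Suc l))))"
      by (rule mult_mono) (use step.IH step.prems lc' p in auto)
    also have "\<dots> = (16 ^ (Suc l - i) * (M i * M (Suc (Suc l)))) * (M l * M (Suc l))"
      using step.hyps by (simp add: Suc_diff_le)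
    finally show ?case using p by (simp add: mult_le_cancel_right)
  qed
  have main: "M (Suc a) * M (Suc b) \<le> (16 ^ k) ^ a * (M 1 * M (Suc (a + b)))" if "a \<le> b" "1 + a + b \<le> k" for a b
    using that
  proof (induction a arbitrary: b)
    case 0 then show ?case by simp
  next
    case (Suc a)
    have "M (Suc (Suc a)) * M (Suc b) \<le> 16 ^ (Suc b - Suc a) * (M (Suc a) * M (Suc (Suc b)))"
      by (rule step) (use Suc.prems in auto)
    also have "\<dots> \<le> 16 ^ k * (M (Suc a) * M (Suc (Suc b)))"
      using pos[of "Suc a"] pos[of "Suc (Suc b)"] Suc.prems by (intro mult_right_mono power_increasing) auto
    also have "\<dots> \<le> 16 ^ k * ((16 ^ k) ^ a * (M 1 * M (Suc (a + Suc b))))"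
      using Suc.IH[of "Suc b"] Suc.prems by (intro mult_left_mono) auto
    finally show ?case by simp
  qed
  have up: "(16 ^ k) ^ c * (M 1 * M (Suc (a + b))) \<le> (16 ^ k) ^ k * (M 1 * M (Suc (a + b)))" if "c \<le> k" for c
    using pos[of 1] pos[of "Suc (a + b)"] that by (intro mult_right_mono power_increasing) (auto intro: one_le_power)
  show ?thesis
  proof (cases "a \<le> b")
    case True
    then show ?thesis using main[OF True ab] up[of a] ab by linarith
  next
    case False
    then have "M (Suc b) * M (Suc a) \<le> (16 ^ k) ^ b * (M 1 * M (Suc (b + a)))" using main[of b a] ab by auto
    then show ?thesis using up[of b] ab by (simp add: mult.commute add.commute)
  qed
qed

lemma weight_properties:
  fixes M :: "nat \<Rightarrow> real"
  assumes k: "2 \<le> k" and M0: "\<And>j. 0 \<le> M j" and mono: "\<And>j. M j \<le> M (Suc j)"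
    and lc: "\<And>i. 0 < i \<Longrightarrow> i < k \<Longrightarrow> M i * M i \<le> 16 * (M (i - 1) * M (i + 1))"
  shows "weight k M 0 = 1" "1 \<le> weight k M j" "j \<le> j' \<Longrightarrow> weight k M j \<le> weight k M j'"
    "weight k M a * weight k M b \<le> (16 ^ k) ^ k * weight k M (a + b)"
proof -
  have L1: "(1::real) \<le> (16 ^ k) ^ k" by (intro one_le_power) auto
  have "weight k M 0 = 1 \<and> (\<forall>j. 1 \<le> weight k M j) \<and> (\<forall>j j'. j \<le> j' \<longrightarrow> weight k M j \<le> weight k M j') \<and>
    (\<forall>a b. weight k M a * weight k M b \<le> (16 ^ k) ^ k * weight k M (a + b))"
  proof (cases "M 1 = 0")
    case True then show ?thesis using L1 by (simp add: weight_def)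
  next
    case False
    have monoM: "i \<le> j \<Longrightarrow> M i \<le> M j" for i j using mono by (rule lift_Suc_mono_le)
    have M1: "0 < M 1" using False M0[of 1] by simp
    have pos: "0 < M j" if "1 \<le> j" for j using monoM[OF that] M1 by simp
    define q where "q = M k / M 1"
    have q1: "1 \<le> q" using monoM[of 1 k] M1 k by (simp add: q_def)
    have w1: "weight k M j = M (Suc j) / M 1" if "j < k" for j using False that by (simp add: weight_def)
    have w2: "weight k M j = q ^ j" if "k \<le> j" for j using False that by (simp add: weight_def q_def)
    have wq: "weight k M j \<le> q" if "j < k" for j
      unfolding w1[OF that] q_def using monoM[of "Suc j" k] that M1 by (intro divide_right_mono) auto
    have ge1: "1 \<le> weight k M j" for j
      using w1[of j] w2[of j] monoM[of 1 "Suc j"] M1 q1 one_le_power[OF q1, of j] by (cases "j < k") auto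
    have wm: "weight k M j \<le> weight k M j'" if "j \<le> j'" for j j'
    proof (cases "j' < k")
      case True
      then show ?thesis using w1[of j] w1[of j'] that monoM[of "Suc j" "Suc j'"] M1 by (simp add: divide_right_mono)
    next
      case F: False
      show ?thesis
      proof (cases "j < k")
        case True
        have "weight k M j \<le> q ^ 1" using wq[OF True] by simp
        also have "\<dots> \<le> q ^ j'" using q1 F k by (intro power_increasing) auto
        finally show ?thesis using w2 F by simp
      next
        case False
        then show ?thesis using w2[of j] w2[of j'] F that q1 by (simp add: power_increasing)
      qed
    qed
    have wpow: "weight k M j \<le> q ^ j" for j
    proof (cases "j < k")
      case True
      show ?thesis
      proof (cases j)
        case 0 then show ?thesis using w1[of 0] k M1 by simp
      next
        case (Suc j')
        have "q ^ 1 \<le> q ^ j" using q1 Suc by (intro power_increasing) auto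
        then show ?thesis using wq[OF True] by simp
      qed
    qed (use w2 in simp)
    have sub: "weight k M a * weight k M b \<le> (16 ^ k) ^ k * weight k M (a + b)" for a b
    proof (cases "a + b < k")
      case True
      have "M (Suc a) * M (Suc b) \<le> (16 ^ k) ^ k * (M 1 * M (Suc (a + b)))"
        by (rule log_convex_mult[OF pos lc]) (use True in auto)
      then have "M (Suc a) * M (Suc b) / (M 1 * M 1) \<le> (16 ^ k) ^ k * (M 1 * M (Suc (a + b))) / (M 1 * M 1)"
        using M1 by (intro divide_right_mono) auto
      then show ?thesis using w1[of a] w1[of b] w1[of "a + b"] True M1 by simp
    next
      case False
      have "weight k M a * weight k M b \<le> q ^ a * q ^ b"
        using wpow ge1 q1 by (intro mult_mono) (auto intro: order_trans[OF zero_le_one])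
      also have "\<dots> = 1 * weight k M (a + b)" using w2 False by (simp add: power_add)
      also have "\<dots> \<le> (16 ^ k) ^ k * weight k M (a + b)"
        using L1 ge1[of "a + b"] by (intro mult_right_mono) auto
      finally show ?thesis .
    qed
    have "weight k M 0 = 1" using w1[of 0] k M1 by simp
    then show ?thesis using ge1 wm sub by blast
  qed
  then show "weight k M 0 = 1" "1 \<le> weight k M j" "j \<le> j' \<Longrightarrow> weight k M j \<le> weight k M j'"
    "weight k M a * weight k M b \<le> (16 ^ k) ^ k * weight k M (a + b)" by auto
qed

lemma Linf_norm_le:
  assumes S: "open S" and F: "continuous_on S F" and b: "\<And>x. x \<in> S \<Longrightarrow> \<bar>F x\<bar> \<le> c"
  shows "Linf_norm S F \<le> ereal c"
  unfolding Linf_norm_def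
proof (rule esssup_I)
  have "S \<in> sets lebesgue" using S by simp
  moreover have "continuous_on S (\<lambda>x. \<bar>F x\<bar>)" using F by (intro continuous_intros)
  ultimately have "(\<lambda>x. \<bar>F x\<bar>) \<in> borel_measurable (lebesgue_on S)"
    by (intro continuous_imp_measurable_on_sets_lebesgue)
  then show "(\<lambda>x. ereal \<bar>F x\<bar>) \<in> borel_measurable (lebesgue_on S)" by simp
  show "AE x in lebesgue_on S. ereal \<bar>F x\<bar> \<le> ereal c" using b by (intro AE_I2) simp
qed

text \<open>
For a continuous function on an open set the essential supremum is a supremum, since a nonempty open set
is not null.
\<close>

lemma Linf_norm_ge:
  assumes S: "open S" and F: "continuous_on S F" and x: "x \<in> S"
  shows "ereal \<bar>F x\<bar> \<le> Linf_norm S F"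
proof (rule ccontr)
  assume "\<not> ereal \<bar>F x\<bar> \<le> Linf_norm S F"
  then have lt: "Linf_norm S F < ereal \<bar>F x\<bar>" by simp
  obtain c where c: "Linf_norm S F < ereal c" "c < \<bar>F x\<bar>"
    using ereal_dense2[OF lt] by auto
  have "AE y in lebesgue_on S. ereal \<bar>F y\<bar> \<le> Linf_norm S F"
    unfolding Linf_norm_def by (rule esssup_AE)
  then have "AE y in lebesgue. y \<in> S \<longrightarrow> ereal \<bar>F y\<bar> \<le> Linf_norm S F"
    using S by (subst (asm) AE_restrict_space_iff) auto
  then have ae: "AE y in lebesgue. y \<notin> {y\<in>S. c < \<bar>F y\<bar>}"
  proof (rule AE_mp, intro AE_I2 impI notI)
    fix y assume "y \<in> S \<longrightarrow> ereal \<bar>F y\<bar> \<le> Linf_norm S F" "y \<in> {y \<in> S. c < \<bar>F y\<bar>}"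
    then have le: "ereal \<bar>F y\<bar> \<le> Linf_norm S F" "c < \<bar>F y\<bar>" by auto
    have "ereal \<bar>F y\<bar> < ereal c" by (rule order_le_less_trans[OF le(1) c(1)])
    then show False using le(2) by simp
  qed
  have "{y\<in>S. c < \<bar>F y\<bar>} = S \<inter> (\<lambda>y. \<bar>F y\<bar>) -` {c<..}" by auto
  moreover have "open (S \<inter> (\<lambda>y. \<bar>F y\<bar>) -` {c<..})"
    using F S by (intro continuous_open_preimage continuous_intros) auto
  ultimately have o: "open {y\<in>S. c < \<bar>F y\<bar>}" by simp
  have "{y\<in>S. c < \<bar>F y\<bar>} \<in> null_sets lebesgue"
    using ae o by (subst AE_iff_null_sets) auto
  then have "negligible {y\<in>S. c < \<bar>F y\<bar>}" by (simp add: negligible_iff_null_sets)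
  then have "{y\<in>S. c < \<bar>F y\<bar>} = {}" using open_not_negligible[OF o] by blast
  then show False using x c(2) by blast
qed

section \<open>Entropy solutions with one curve of discontinuity\<close>

lemma test_function_derivative:
  assumes "test_function \<phi>"
  defines "\<phi>t \<equiv> pderiv_within UNIV (1, 0) \<phi>" and "\<phi>x \<equiv> pderiv_within UNIV (0, 1) \<phi>"
  shows "(\<phi> has_derivative (\<lambda>d. \<phi>t p * fst d + \<phi>x p * snd d)) (at p)"
    "continuous_on UNIV \<phi>t" "continuous_on UNIV \<phi>x"
proof -
  have C1: "Ck_on 1 UNIV \<phi>" using assms(1) by (simp add: test_function_def)
  have nil: "[] \<in> lists (Basis :: (real \<times> real) set)" by simp
  have "\<forall>bs\<in>lists Basis. length bs < 1 \<longrightarrow> iter_pderiv UNIV bs \<phi> differentiable_on UNIV"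
    using C1 unfolding Ck_on_def by (rule conjunct1)
  from bspec[OF this nil] have "\<phi> differentiable_on UNIV" by simp
  then have "\<phi> differentiable (at p)" unfolding differentiable_on_def by blast
  then have D: "(\<phi> has_derivative frechet_derivative \<phi> (at p)) (at p)"
    unfolding frechet_derivative_works .
  have "frechet_derivative \<phi> (at p) d = \<phi>t p * fst d + \<phi>x p * snd d" for d
  proof -
    have l: "linear (frechet_derivative \<phi> (at p))" using D has_derivative_linear by blast
    have eq: "fst d *\<^sub>R (1, 0) + snd d *\<^sub>R (0, 1) = d" by (simp add: prod_eq_iff)
    have "frechet_derivative \<phi> (at p) (fst d *\<^sub>R (1, 0) + snd d *\<^sub>R (0, 1))
        = fst d *\<^sub>R frechet_derivative \<phi> (at p) (1, 0) + snd d *\<^sub>R frechet_derivative \<phi> (at p) (0, 1)"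
      by (simp only: linear_add[OF l] linear_cmul[OF l])
    then have "frechet_derivative \<phi> (at p) d
        = fst d *\<^sub>R frechet_derivative \<phi> (at p) (1, 0) + snd d *\<^sub>R frechet_derivative \<phi> (at p) (0, 1)"
      unfolding eq .
    then show ?thesis by (simp add: \<phi>t_def \<phi>x_def pderiv_within_def mult.commute)
  qed
  then have "frechet_derivative \<phi> (at p) = (\<lambda>d. \<phi>t p * fst d + \<phi>x p * snd d)" by (rule ext)
  with D show "(\<phi> has_derivative (\<lambda>d. \<phi>t p * fst d + \<phi>x p * snd d)) (at p)" by simp
  have b: "(1, 0) \<in> (Basis :: (real \<times> real) set)" "(0, 1) \<in> (Basis :: (real \<times> real) set)"
    by (auto simp: Basis_prod_def)
  have c: "continuous_on UNIV (iter_pderiv UNIV [e] \<phi>)" if "e \<in> Basis" for e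
  proof -
    have 1: "\<forall>bs\<in>lists Basis. length bs \<le> 1 \<longrightarrow> continuous_on UNIV (iter_pderiv UNIV bs \<phi>)"
      using C1 unfolding Ck_on_def by (rule conjunct2)
    have 2: "[e] \<in> lists Basis" using that by simp
    show ?thesis using bspec[OF 1 2] by simp
  qed
  show "continuous_on UNIV \<phi>t" "continuous_on UNIV \<phi>x"
    using c[OF b(1)] c[OF b(2)] by (simp_all add: \<phi>t_def \<phi>x_def)
qed

lemma test_function_box:
  assumes T: "test_function \<phi>"
  defines "\<phi>t \<equiv> pderiv_within UNIV (1, 0) \<phi>" and "\<phi>x \<equiv> pderiv_within UNIV (0, 1) \<phi>"
  obtains t0 t1 R B where "0 < t0" "t0 \<le> t1" "0 \<le> R"
    "\<And>p. p \<notin> {t0..t1} \<times> {- R..R} \<Longrightarrow> \<phi> p = 0 \<and> \<phi>t p = 0 \<and> \<phi>x p = 0"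
    "\<And>p. \<bar>\<phi> p\<bar> \<le> B \<and> \<bar>\<phi>t p\<bar> \<le> B \<and> \<bar>\<phi>x p\<bar> \<le> B"
proof -
  define K where "K = closure {p. \<phi> p \<noteq> 0}"
  have K: "compact K" "K \<subseteq> {0<..} \<times> UNIV"
    using T[unfolded test_function_def, THEN conjunct2] unfolding K_def
    by (rule conjunct1, rule conjunct2)
  note d = test_function_derivative[OF T, folded \<phi>t_def \<phi>x_def]
  have zero: "\<phi> p = 0 \<and> \<phi>t p = 0 \<and> \<phi>x p = 0" if "p \<notin> K" for p
  proof -
    have z: "\<phi> y = 0" if "y \<in> - K" for y
    proof (rule ccontr)
      assume "\<phi> y \<noteq> 0"
      then have "y \<in> {p. \<phi> p \<noteq> 0}" by simp
      then have "y \<in> K" using closure_subset unfolding K_def by (rule subsetD[rotated])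
      with that show False by simp
    qed
    have "open (- K)" unfolding K_def by auto
    have "((\<lambda>_. 0) has_derivative (\<lambda>_. 0)) (at p)" by simp
    then have "(\<phi> has_derivative (\<lambda>_. 0)) (at p)"
      by (rule has_derivative_transform_within_open[OF _ \<open>open (- K)\<close>]) (use that z in auto)
    from has_derivative_pderiv_within[OF nondegenerate_open[OF open_UNIV] _ this]
    show ?thesis using z that by (auto simp: \<phi>t_def \<phi>x_def)
  qed
  have bnd: "\<exists>B. \<forall>p. \<bar>h p\<bar> \<le> B" if c: "continuous_on UNIV h" and z: "\<And>p. p \<notin> K \<Longrightarrow> h p = 0" for h :: "real \<times> real \<Rightarrow> real"
  proof -
    have "bounded (h ` K)"
      by (intro compact_imp_bounded compact_continuous_image continuous_on_subset[OF c] K(1)) auto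
    then obtain B where B: "\<forall>p\<in>K. \<bar>h p\<bar> \<le> B" by (auto simp: bounded_iff)
    have "\<bar>h p\<bar> \<le> max B 0" for p using B z[of p] by (cases "p \<in> K") auto
    then show ?thesis by blast
  qed
  have phc: "continuous_on UNIV \<phi>"
    using d(1) by (meson continuous_on_eq_continuous_within has_derivative_continuous has_derivative_at_withinI)
  obtain B1 B2 B3 where B: "\<forall>p. \<bar>\<phi> p\<bar> \<le> B1" "\<forall>p. \<bar>\<phi>t p\<bar> \<le> B2" "\<forall>p. \<bar>\<phi>x p\<bar> \<le> B3"
    using bnd[OF phc] bnd[OF d(2)] bnd[OF d(3)] zero by metis
  obtain r where r: "\<forall>p\<in>K. norm p \<le> r" using compact_imp_bounded[OF K(1)] by (auto simp: bounded_iff)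
  obtain t0 where t0: "0 < t0" "\<forall>p\<in>K. t0 \<le> fst p"
  proof (cases "K = {}")
    case True then show ?thesis using that[of 1] by auto
  next
    case False
    have "continuous_on K fst" by (intro continuous_intros)
    from continuous_attains_inf[OF K(1) False this]
    obtain p where "p \<in> K" "\<forall>y\<in>K. fst p \<le> fst y" by (elim bexE) (rule that)
    then show ?thesis using that[of "fst p"] K(2) by auto
  qed
  show ?thesis
  proof (rule that[of t0 "max t0 r" "max r 0" "max B1 (max B2 B3)"])
    fix p :: "real \<times> real" assume p: "p \<notin> {t0..max t0 r} \<times> {- max r 0..max r 0}"
    show "\<phi> p = 0 \<and> \<phi>t p = 0 \<and> \<phi>x p = 0"
    proof (rule zero, rule notI)
      assume pk: "p \<in> K"
      have n: "norm p \<le> r" "t0 \<le> fst p" using r t0 pk by auto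
      have "\<bar>fst p\<bar> \<le> norm p" "\<bar>snd p\<bar> \<le> norm p"
        using norm_fst_le[of "fst p" "snd p"] norm_snd_le[of "snd p" "fst p"] unfolding prod.collapse by simp_all
      then have "fst p \<le> r" "\<bar>snd p\<bar> \<le> r" using n by linarith+
      then show False using p n by (auto simp: mem_Times_iff abs_le_iff)
    qed
  next
    show "\<bar>\<phi> p\<bar> \<le> max B1 (max B2 B3) \<and> \<bar>\<phi>t p\<bar> \<le> max B1 (max B2 B3) \<and> \<bar>\<phi>x p\<bar> \<le> max B1 (max B2 B3)" for p
      using spec[OF B(1), of p] spec[OF B(2), of p] spec[OF B(3), of p] by (simp add: le_max_iff_disj)
  qed (use t0 in auto)
qed

text \<open>
Two classical solutions on the two sides of a curve. Both are continuous on the closed half-plane of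
nonnegative times and carry traces on the curve; \<open>jump\<close> is Kruzhkov's inequality for the traces.
\<close>

locale piecewise_solution =
  fixes f f' g \<psi> \<psi>' :: "real \<Rightarrow> real" and ur urt urx ul ult ulx :: "real \<times> real \<Rightarrow> real" and A :: real
  assumes f: "\<And>x. (f has_real_derivative f' x) (at x)" "continuous_on UNIV f'"
    and g: "continuous_on UNIV g"
    and psi: "\<And>t. 0 < t \<Longrightarrow> (\<psi> has_real_derivative \<psi>' t) (at t)" "continuous_on {0<..} \<psi>'"
      "continuous_on {0..} \<psi>"
    and ur_cont: "continuous_on ({0..} \<times> UNIV) ur" and ul_cont: "continuous_on ({0..} \<times> UNIV) ul"
    and dur: "\<And>p. 0 < fst p \<Longrightarrow> \<psi> (fst p) < snd p \<Longrightarrow>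
        (ur has_derivative (\<lambda>d. urt p * fst d + urx p * snd d)) (at p)"
    and dul: "\<And>p. 0 < fst p \<Longrightarrow> snd p < \<psi> (fst p) \<Longrightarrow>
        (ul has_derivative (\<lambda>d. ult p * fst d + ulx p * snd d)) (at p)"
    and urt_cont: "continuous_on {p. 0 < fst p \<and> \<psi> (fst p) < snd p} urt"
    and urx_cont: "continuous_on {p. 0 < fst p \<and> \<psi> (fst p) < snd p} urx"
    and ult_cont: "continuous_on {p. 0 < fst p \<and> snd p < \<psi> (fst p)} ult"
    and ulx_cont: "continuous_on {p. 0 < fst p \<and> snd p < \<psi> (fst p)} ulx"
    and pde_r: "\<And>p. 0 < fst p \<Longrightarrow> \<psi> (fst p) < snd p \<Longrightarrow> urt p + f' (ur p) * urx p = g (ur p)"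
    and pde_l: "\<And>p. 0 < fst p \<Longrightarrow> snd p < \<psi> (fst p) \<Longrightarrow> ult p + f' (ul p) * ulx p = g (ul p)"
    and bounds: "\<And>p. 0 \<le> fst p \<Longrightarrow> \<bar>ur p\<bar> \<le> A \<and> \<bar>ul p\<bar> \<le> A"
      "\<And>p. 0 < fst p \<Longrightarrow> \<psi> (fst p) < snd p \<Longrightarrow> \<bar>urt p\<bar> \<le> A \<and> \<bar>urx p\<bar> \<le> A"
      "\<And>p. 0 < fst p \<Longrightarrow> snd p < \<psi> (fst p) \<Longrightarrow> \<bar>ult p\<bar> \<le> A \<and> \<bar>ulx p\<bar> \<le> A"
      "\<And>t. 0 < t \<Longrightarrow> \<bar>\<psi>' t\<bar> \<le> A"
    and jump: "\<And>t \<kappa>. 0 < t \<Longrightarrow>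
      sgn (ur (t, \<psi> t) - \<kappa>) * (f (ur (t, \<psi> t)) - f \<kappa> - \<psi>' t * (ur (t, \<psi> t) - \<kappa>))
      \<le> sgn (ul (t, \<psi> t) - \<kappa>) * (f (ul (t, \<psi> t)) - f \<kappa> - \<psi>' t * (ul (t, \<psi> t) - \<kappa>))"
begin

definition "sol p = (if \<psi> (fst p) < snd p then ur p else ul p)"

lemma cont_bound: 
  fixes h :: "real \<Rightarrow> real"
  assumes "continuous_on UNIV h" obtains B where "\<And>x. \<bar>x\<bar> \<le> r \<Longrightarrow> \<bar>h x\<bar> \<le> B"
proof -
  have "bounded (h ` {- r..r})"
    by (intro compact_imp_bounded compact_continuous_image continuous_on_subset[OF assms] compact_Icc) auto
  then obtain B where "\<forall>x\<in>{- r..r}. \<bar>h x\<bar> \<le> B" by (auto simp: bounded_iff)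
  then show ?thesis by (intro that[of B]) (auto simp: abs_le_iff)
qed

lemma sides:
  assumes T: "test_function \<phi>"
  defines "\<phi>t \<equiv> pderiv_within UNIV (1, 0) \<phi>" and "\<phi>x \<equiv> pderiv_within UNIV (0, 1) \<phi>"
  obtains B t0 t1 R where "kruzhkov_side 1 \<kappa> B t0 t1 R f f' g \<psi> \<psi>' ur urt urx \<phi> \<phi>t \<phi>x"
    "kruzhkov_side (- 1) \<kappa> B t0 t1 R f f' g \<psi> \<psi>' ul ult ulx \<phi> \<phi>t \<phi>x"
proof -
  note d = test_function_derivative[OF T, folded \<phi>t_def \<phi>x_def]
  obtain t0 t1 R B0 where b: "0 < t0" "t0 \<le> t1" "0 \<le> R"
    "\<And>p. p \<notin> {t0..t1} \<times> {- R..R} \<Longrightarrow> \<phi> p = 0 \<and> \<phi>t p = 0 \<and> \<phi>x p = 0"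
    "\<And>p. \<bar>\<phi> p\<bar> \<le> B0 \<and> \<bar>\<phi>t p\<bar> \<le> B0 \<and> \<bar>\<phi>x p\<bar> \<le> B0"
    by (rule test_function_box[OF T, folded \<phi>t_def \<phi>x_def]) (rule that)
  obtain Bg where Bg: "\<And>x. \<bar>x\<bar> \<le> A \<Longrightarrow> \<bar>g x\<bar> \<le> Bg" by (rule cont_bound[OF g]) (rule that)
  obtain Bf where Bf: "\<And>x. \<bar>x\<bar> \<le> A + \<bar>\<kappa>\<bar> \<Longrightarrow> \<bar>f' x\<bar> \<le> Bf" by (rule cont_bound[OF f(2)]) (rule that)
  have "bounded (\<psi> ` {t0..t1})"
    by (intro compact_imp_bounded compact_continuous_image continuous_on_subset[OF psi(3)] compact_Icc) (use b in auto)
  then obtain Bp where Bp: "\<forall>t\<in>{t0..t1}. \<bar>\<psi> t\<bar> \<le> Bp" by (auto simp: bounded_iff)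
  have A0: "0 \<le> A" using order_trans[OF abs_ge_zero conjunct1[OF bounds(1)[of "(0, 0)"]]] by simp
  define B where "B = max (max 1 (max B0 Bg)) (max (max Bf Bp) (A + \<bar>\<kappa>\<bar>))"
  have B: "1 \<le> B" "B0 \<le> B" "Bg \<le> B" "Bf \<le> B" "Bp \<le> B" "A + \<bar>\<kappa>\<bar> \<le> B" unfolding B_def by simp_all
  have AB: "A \<le> B" using B(6) by simp
  have ub: "\<bar>x - \<kappa>\<bar> \<le> B \<and> \<bar>g x\<bar> \<le> B \<and> \<bar>f' x\<bar> \<le> B \<and> \<bar>f x - f \<kappa>\<bar> \<le> B * \<bar>x - \<kappa>\<bar>" if x: "\<bar>x\<bar> \<le> A" for x
  proof -
    have "\<bar>x - \<kappa>\<bar> \<le> B" using abs_triangle_ineq4[of x \<kappa>] x B(6) by linarith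
    moreover have "\<bar>g x\<bar> \<le> B" using Bg[OF x] B by linarith
    moreover have "\<bar>f' x\<bar> \<le> B" using Bf[of x] x B by linarith
    moreover have "norm (f x - f \<kappa>) \<le> B * norm (x - \<kappa>)"
    proof (rule field_differentiable_bound[of "{- (A + \<bar>\<kappa>\<bar>)..A + \<bar>\<kappa>\<bar>}" f f'])
      show "norm (f' z) \<le> B" if "z \<in> {- (A + \<bar>\<kappa>\<bar>)..A + \<bar>\<kappa>\<bar>}" for z
        using Bf[of z] that B(4) by (auto simp: abs_le_iff)
      show "(f has_field_derivative f' z) (at z within {- (A + \<bar>\<kappa>\<bar>)..A + \<bar>\<kappa>\<bar>})" for z
        by (rule has_field_derivative_at_within[OF f(1)])
    qed (use x A0 in \<open>auto simp: abs_le_iff\<close>)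
    ultimately show ?thesis by simp
  qed
  have "kruzhkov_side 1 \<kappa> B t0 t1 R f f' g \<psi> \<psi>' ur urt urx \<phi> \<phi>t \<phi>x"
  proof
    show "continuous_on ({0<..} \<times> UNIV) ur" by (rule continuous_on_subset[OF ur_cont]) auto
    show "\<bar>\<phi> p\<bar> \<le> B \<and> \<bar>\<phi>t p\<bar> \<le> B \<and> \<bar>\<phi>x p\<bar> \<le> B" for p using b(5)[of p] B(2) by linarith
    show "\<bar>\<psi>' t\<bar> \<le> B" if "0 < t" for t using bounds(4)[OF that] AB by linarith
    show "\<bar>\<psi> t\<bar> \<le> B" if "t \<in> {t0..t1}" for t using Bp that B(5) by fastforce
    show "\<bar>urt p\<bar> \<le> B \<and> \<bar>urx p\<bar> \<le> B" if "0 < fst p" "0 < 1 * (snd p - \<psi> (fst p))" for p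
      using bounds(2)[of p] that AB by simp
    show "\<bar>ur p - \<kappa>\<bar> \<le> B \<and> \<bar>g (ur p)\<bar> \<le> B \<and> \<bar>f' (ur p)\<bar> \<le> B \<and> \<bar>f (ur p) - f \<kappa>\<bar> \<le> B * \<bar>ur p - \<kappa>\<bar>"
      if "0 < fst p" for p using ub[of "ur p"] bounds(1)[of p] that by simp
  qed (use b d f g psi B dur urt_cont urx_cont pde_r in auto)
  moreover have "kruzhkov_side (- 1) \<kappa> B t0 t1 R f f' g \<psi> \<psi>' ul ult ulx \<phi> \<phi>t \<phi>x"
  proof
    show "continuous_on ({0<..} \<times> UNIV) ul" by (rule continuous_on_subset[OF ul_cont]) auto
    show "\<bar>\<phi> p\<bar> \<le> B \<and> \<bar>\<phi>t p\<bar> \<le> B \<and> \<bar>\<phi>x p\<bar> \<le> B" for p using b(5)[of p] B(2) by linarith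
    show "\<bar>\<psi>' t\<bar> \<le> B" if "0 < t" for t using bounds(4)[OF that] AB by linarith
    show "\<bar>\<psi> t\<bar> \<le> B" if "t \<in> {t0..t1}" for t using Bp that B(5) by fastforce
    show "\<bar>ult p\<bar> \<le> B \<and> \<bar>ulx p\<bar> \<le> B" if "0 < fst p" "0 < - 1 * (snd p - \<psi> (fst p))" for p
      using bounds(3)[of p] that AB by simp
    show "\<bar>ul p - \<kappa>\<bar> \<le> B \<and> \<bar>g (ul p)\<bar> \<le> B \<and> \<bar>f' (ul p)\<bar> \<le> B \<and> \<bar>f (ul p) - f \<kappa>\<bar> \<le> B * \<bar>ul p - \<kappa>\<bar>"
      if "0 < fst p" for p using ub[of "ul p"] bounds(1)[of p] that by simp
  qed (use b d f g psi B dul ult_cont ulx_cont pde_l in auto)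
  ultimately show ?thesis by (rule that)
qed

definition "W = {0::real<..} \<times> (UNIV :: real set)"
definition "um p = (if p \<in> {p. 0 < fst p \<and> \<psi> (fst p) < snd p} then ur p else if p \<in> W then ul p else 0)"

lemma right_open: "open {p. 0 < fst p \<and> \<psi> (fst p) < snd p}" and left_open: "open {p. 0 < fst p \<and> snd p < \<psi> (fst p)}"
proof -
  have c: "continuous_on W (\<lambda>p. snd p - \<psi> (fst p))"
    unfolding W_def by (intro continuous_intros continuous_on_compose2[OF psi(3)]) auto
  have W: "open W" unfolding W_def by (intro open_Times) auto
  have "open (W \<inter> (\<lambda>p. snd p - \<psi> (fst p)) -` {0<..})"
    by (rule continuous_open_preimage[OF c W]) auto
  moreover have "W \<inter> (\<lambda>p. snd p - \<psi> (fst p)) -` {0<..} = {p. 0 < fst p \<and> \<psi> (fst p) < snd p}"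
    by (auto simp: W_def)
  ultimately show "open {p. 0 < fst p \<and> \<psi> (fst p) < snd p}" by simp
  have "open (W \<inter> (\<lambda>p. snd p - \<psi> (fst p)) -` {..<0})"
    by (rule continuous_open_preimage[OF c W]) auto
  moreover have "W \<inter> (\<lambda>p. snd p - \<psi> (fst p)) -` {..<0} = {p. 0 < fst p \<and> snd p < \<psi> (fst p)}"
    by (auto simp: W_def)
  ultimately show "open {p. 0 < fst p \<and> snd p < \<psi> (fst p)}" by simp
qed

lemma W_open: "open W" unfolding W_def by (intro open_Times) auto

lemma um_meas: "um \<in> borel_measurable borel"
proof -
  have "(\<lambda>p. if p \<in> {p. 0 < fst p \<and> \<psi> (fst p) < snd p} then ur p else 0) \<in> borel_measurable borel"
    by (rule measurable_if_continuous_open[OF right_open continuous_on_subset[OF ur_cont]]) auto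
  moreover have "(\<lambda>p. if p \<in> W then ul p else 0) \<in> borel_measurable borel"
    by (rule measurable_if_continuous_open[OF W_open continuous_on_subset[OF ul_cont]]) (auto simp: W_def)
  ultimately have "(\<lambda>p. if p \<in> {p. 0 < fst p \<and> \<psi> (fst p) < snd p}
      then (if p \<in> {p. 0 < fst p \<and> \<psi> (fst p) < snd p} then ur p else 0)
      else (if p \<in> W then ul p else 0)) \<in> borel_measurable borel"
    by (rule measurable_If_set) (use right_open in simp)
  then show ?thesis
    by (rule back_subst[of "\<lambda>h. h \<in> borel_measurable borel"]) (auto simp: um_def fun_eq_iff)
qed

lemma um_sol: "p \<in> W \<Longrightarrow> um p = sol p"
  by (auto simp: um_def sol_def W_def)

lemma curve_null: "AE p in lborel. \<not> (0 < fst p \<and> snd p = \<psi> (fst p))"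
proof -
  let ?S = "{p. 0 < fst p \<and> snd p = \<psi> (fst p)}"
  have "?S = W - {p. 0 < fst p \<and> \<psi> (fst p) < snd p} - {p. 0 < fst p \<and> snd p < \<psi> (fst p)}"
    by (auto simp: W_def)
  moreover have "\<dots> \<in> sets borel" using W_open right_open left_open by (intro sets.Diff) auto
  ultimately have S: "?S \<in> sets borel" by simp
  then have S2: "?S \<in> sets (lborel \<Otimes>\<^sub>M lborel)" unfolding lborel_prod sets_lborel .
  have "emeasure (lborel \<Otimes>\<^sub>M lborel) ?S = (\<integral>\<^sup>+ t. emeasure lborel (Pair t -` ?S) \<partial>lborel)"
    by (rule lborel.emeasure_pair_measure_alt[OF S2])
  also have "\<dots> = (\<integral>\<^sup>+ t. 0 \<partial>(lborel :: real measure))"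
  proof (rule nn_integral_cong)
    fix t :: real
    have "Pair t -` ?S \<subseteq> {\<psi> t}" by auto
    then have "countable (Pair t -` ?S)" by (rule countable_subset) simp
    then show "emeasure lborel (Pair t -` ?S) = 0" by (rule emeasure_lborel_countable)
  qed
  finally have "emeasure lborel ?S = 0" by (simp add: lborel_prod)
  then have "?S \<in> null_sets lborel" using S by (auto simp: null_sets_def)
  then show ?thesis by (rule AE_I'[of ?S]) auto
qed

text \<open>
The curve is a null set, so the integral is the sum of the two one-sided ones; these are the boundary
integrals of \<open>side_identity\<close>, with opposite signs, and the jump condition compares the integrands.
\<close>

lemma kruzhkov_inequality:
  assumes T: "test_function \<phi>" and pos: "\<And>p. 0 \<le> \<phi> p"
  shows "0 \<le> set_lebesgue_integral lebesgue ({0<..} \<times> UNIV)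
          (\<lambda>p. \<bar>sol p - \<kappa>\<bar> * pderiv_within UNIV (1, 0) \<phi> p
             + sgn (sol p - \<kappa>) * (f (sol p) - f \<kappa>) * pderiv_within UNIV (0, 1) \<phi> p
             + sgn (sol p - \<kappa>) * g (sol p) * \<phi> p)"
proof -
  define \<phi>t where "\<phi>t = pderiv_within UNIV (1, 0) \<phi>"
  define \<phi>x where "\<phi>x = pderiv_within UNIV (0, 1) \<phi>"
  obtain B t0 t1 R where S: "kruzhkov_side 1 \<kappa> B t0 t1 R f f' g \<psi> \<psi>' ur urt urx \<phi> \<phi>t \<phi>x"
    "kruzhkov_side (- 1) \<kappa> B t0 t1 R f f' g \<psi> \<psi>' ul ult ulx \<phi> \<phi>t \<phi>x"
    by (rule sides[OF T, folded \<phi>t_def \<phi>x_def]) (rule that)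
  interpret r: kruzhkov_side 1 \<kappa> B t0 t1 R f f' g \<psi> \<psi>' ur urt urx \<phi> \<phi>t \<phi>x by (rule S(1))
  interpret l: kruzhkov_side "- 1" \<kappa> B t0 t1 R f f' g \<psi> \<psi>' ul ult ulx \<phi> \<phi>t \<phi>x by (rule S(2))
  define K where "K = (\<lambda>y p. \<bar>y - \<kappa>\<bar> * \<phi>t p + sgn (y - \<kappa>) * (f y - f \<kappa>) * \<phi>x p + sgn (y - \<kappa>) * g y * \<phi> p)"
  have fm: "f \<in> borel_measurable borel" and gm: "g \<in> borel_measurable borel"
    using r.f_cont g by (auto intro: borel_measurable_continuous_onI)
  have pm: "\<phi> \<in> borel_measurable borel" "\<phi>t \<in> borel_measurable borel" "\<phi>x \<in> borel_measurable borel"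
    using r.phi_cont0 r.phi_cont by (auto intro: borel_measurable_continuous_onI)
  have m1: "(\<lambda>p. indicator W p *\<^sub>R K (um p) p) \<in> borel_measurable borel"
  proof -
    have [measurable]: "um \<in> borel_measurable borel" by (rule um_meas)
    note [measurable] = fm gm pm
    have [measurable]: "W \<in> sets borel" using W_open by auto
    have [measurable]: "(\<lambda>x::real. sgn x) \<in> borel_measurable borel" by simp
    show ?thesis unfolding K_def by measurable
  qed
  have eqW: "indicator W p *\<^sub>R K (sol p) p = indicator W p *\<^sub>R K (um p) p" for p
    by (cases "p \<in> W") (auto simp: um_sol)
  have "set_lebesgue_integral lebesgue W (\<lambda>p. K (sol p) p) = (\<integral>p. indicator W p *\<^sub>R K (um p) p \<partial>lebesgue)"
    unfolding set_lebesgue_integral_def eqW ..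
  also have "\<dots> = (\<integral>p. indicator W p *\<^sub>R K (um p) p \<partial>lborel)"
    by (rule integral_completion) (use m1 in simp)
  also have "\<dots> = (\<integral>p. r.K0I p + l.K0I p \<partial>lborel)"
  proof (rule integral_cong_AE)
    show "(\<lambda>p. r.K0I p + l.K0I p) \<in> borel_measurable lborel"
      using r.side_identity(1) l.side_identity(1) by (intro borel_measurable_add borel_measurable_integrable)
    show "AE p in lborel. indicator W p *\<^sub>R K (um p) p = r.K0I p + l.K0I p"
      using curve_null
    proof (rule AE_mp, intro AE_I2 impI)
      fix p assume p: "\<not> (0 < fst p \<and> snd p = \<psi> (fst p))"
      have ab: "\<bar>y\<bar> = sgn y * y" for y :: real by (simp add: sgn_if abs_if)
      show "indicator W p *\<^sub>R K (um p) p = r.K0I p + l.K0I p"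
      proof (cases "p \<in> W")
        case True
        then have "0 < fst p" by (auto simp: W_def)
        then consider "0 < fst p" "\<psi> (fst p) < snd p" | "0 < fst p" "snd p < \<psi> (fst p)" using p by linarith
        then show ?thesis
          by cases (use True in \<open>simp_all add: um_sol sol_def r.K0I_def l.K0I_def r.reg_def l.reg_def
              r.K0_def l.K0_def K_def ab algebra_simps\<close>)
      next
        case False
        then have "\<not> 0 < fst p" by (auto simp: W_def mem_Times_iff)
        then show ?thesis using False by (simp add: r.K0I_def l.K0I_def r.reg_def l.reg_def)
      qed
    qed
  qed (use m1 in simp)
  also have "\<dots> = - integral\<^sup>L lborel r.B0 + integral\<^sup>L lborel l.B0"
    using r.side_identity l.side_identity by simp
  also have "\<dots> \<ge> 0"
  proof -
    have "integral\<^sup>L lborel r.B0 \<le> integral\<^sup>L lborel l.B0"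
      by (rule integral_mono[OF r.side_identity(2) l.side_identity(2)])
        (use jump pos in \<open>simp add: r.B0_def l.B0_def mult_right_mono\<close>)
    then show ?thesis by simp
  qed
  finally show ?thesis unfolding W_def K_def \<phi>t_def \<phi>x_def .
qed

lemma sol_slice_meas: assumes "0 \<le> t" shows "(\<lambda>x. sol (t, x)) \<in> borel_measurable borel"
proof -
  have "continuous_on UNIV (\<lambda>x. ur (t, x))" "continuous_on UNIV (\<lambda>x. ul (t, x))"
    using assms by (auto intro!: continuous_on_compose2[OF ur_cont] continuous_on_compose2[OF ul_cont] continuous_intros)
  then have [measurable]: "(\<lambda>x. ur (t, x)) \<in> borel_measurable borel" "(\<lambda>x. ul (t, x)) \<in> borel_measurable borel"
    by (auto intro: borel_measurable_continuous_onI)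
  show ?thesis unfolding sol_def by simp
qed

lemma sol_bound: "0 \<le> fst p \<Longrightarrow> \<bar>sol p\<bar> \<le> A"
  using bounds(1)[of p] by (simp add: sol_def)

lemma entropy_solution_sol:
  assumes u0: "\<And>x. x \<noteq> \<psi> 0 \<Longrightarrow> u0 x = sol (0, x)"
  shows "entropy_solution f g u0 sol"
proof -
  have u0m: "u0 \<in> borel_measurable borel"
  proof -
    have "(\<lambda>x. if x \<in> {\<psi> 0} then u0 (\<psi> 0) else sol (0, x)) \<in> borel_measurable borel"
      using sol_slice_meas[of 0] by (intro measurable_If_set) auto
    moreover have "(\<lambda>x. if x \<in> {\<psi> 0} then u0 (\<psi> 0) else sol (0, x)) = u0" using u0 by auto
    ultimately show ?thesis by simp
  qed
  have ae: "AE x in lebesgue. x \<noteq> \<psi> 0"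
    using AE_lborel_singleton[of "\<psi> 0"] by (rule AE_completion)
  show ?thesis unfolding entropy_solution_def
  proof (intro conjI allI impI)
    show "sol \<in> borel_measurable (lebesgue_on ({0<..} \<times> UNIV))"
    proof -
      have "um \<in> borel_measurable lebesgue" using um_meas by (intro measurable_completion) simp
      then have "um \<in> borel_measurable (lebesgue_on W)" by (rule measurable_restrict_space1)
      then show ?thesis unfolding W_def[symmetric]
        by (rule measurable_cong[THEN iffD1, rotated]) (simp add: um_sol)
    qed
    show "\<exists>M. AE p in lebesgue_on ({0<..} \<times> UNIV). \<bar>sol p\<bar> \<le> M"
      by (rule exI[of _ A], rule AE_I2) (auto intro: sol_bound)
    show "u0 \<in> borel_measurable lebesgue" using u0m by (intro measurable_completion) simp
    show "\<exists>M. AE x in lebesgue. \<bar>u0 x\<bar> \<le> M"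
      using ae by (intro exI[of _ A]) (elim AE_mp, auto intro!: AE_I2 simp: u0 sol_bound)
    show "0 \<le> set_lebesgue_integral lebesgue ({0<..} \<times> UNIV)
          (\<lambda>p. \<bar>sol p - \<kappa>\<bar> * pderiv_within UNIV (1, 0) \<phi> p
             + sgn (sol p - \<kappa>) * (f (sol p) - f \<kappa>) * pderiv_within UNIV (0, 1) \<phi> p
             + sgn (sol p - \<kappa>) * g (sol p) * \<phi> p)" if "test_function \<phi> \<and> (\<forall>p. 0 \<le> \<phi> p)" for \<kappa> \<phi>
      by (rule kruzhkov_inequality) (use that in auto)
    show "\<exists>E\<in>null_sets lebesgue.
        (\<forall>t\<in>{0<..} - E. (\<lambda>x. sol (t, x)) \<in> borel_measurable lebesgue \<and>
           (\<exists>M. AE x in lebesgue. \<bar>sol (t, x)\<bar> \<le> M)) \<and>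
        (\<forall>r>0. ((\<lambda>t. set_lebesgue_integral lebesgue {-r..r} (\<lambda>x. \<bar>sol (t, x) - u0 x\<bar>)) \<longlongrightarrow> 0)
           (at 0 within ({0<..} - E)))"
    proof (rule bexI[of _ "{}"], intro conjI ballI allI impI)
      fix t :: real assume t: "t \<in> {0<..} - {}"
      then show "(\<lambda>x. sol (t, x)) \<in> borel_measurable lebesgue"
        using sol_slice_meas[of t] by (intro measurable_completion) simp
      show "\<exists>M. AE x in lebesgue. \<bar>sol (t, x)\<bar> \<le> M"
        using t sol_bound[of "(t, _)"] by (intro exI[of _ A] AE_I2) simp
    next
      fix r :: real assume r: "0 < r"
      show "((\<lambda>t. set_lebesgue_integral lebesgue {-r..r} (\<lambda>x. \<bar>sol (t, x) - u0 x\<bar>)) \<longlongrightarrow> 0) (at 0 within ({0<..} - {}))"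
        unfolding tendsto_at_iff_sequentially comp_def set_lebesgue_integral_def
      proof (intro allI impI)
        fix X :: "nat \<Rightarrow> real" assume X: "\<forall>i. X i \<in> {0<..} - {} - {0}" "X \<longlonglongrightarrow> 0"
        have X0: "0 < X i" for i using X(1) by auto
        have lim: "(\<lambda>n. \<integral>x. indicator {-r..r} x *\<^sub>R \<bar>sol (X n, x) - u0 x\<bar> \<partial>lebesgue) \<longlonglongrightarrow> (\<integral>x. 0 \<partial>(lebesgue :: real measure))"
        proof (rule integral_dominated_convergence[where f="\<lambda>_. 0" and s="\<lambda>n x. indicator {-r..r} x *\<^sub>R \<bar>sol (X n, x) - u0 x\<bar>"
            and w="\<lambda>x. indicator {-r..r} x *\<^sub>R (2 * A)"])
          show "(\<lambda>x. indicator {-r..r} x *\<^sub>R \<bar>sol (X n, x) - u0 x\<bar>) \<in> borel_measurable lebesgue" for n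
          proof (rule measurable_completion)
            have [measurable]: "(\<lambda>x. sol (X n, x)) \<in> borel_measurable borel" "u0 \<in> borel_measurable borel"
              using sol_slice_meas[of "X n"] X0[of n] u0m by auto
            show "(\<lambda>x. indicator {-r..r} x *\<^sub>R \<bar>sol (X n, x) - u0 x\<bar>) \<in> borel_measurable lborel" by measurable
          qed
          have "integrable lborel (\<lambda>x. indicator {-r..r} x *\<^sub>R (2 * A))"
            by (rule borel_integrable_compact) auto
          then show "integrable lebesgue (\<lambda>x. indicator {-r..r} x *\<^sub>R (2 * A))"
            by (simp add: integrable_completion)
          show "AE x in lebesgue. norm (indicator {-r..r} x *\<^sub>R \<bar>sol (X n, x) - u0 x\<bar>) \<le> indicator {-r..r} x *\<^sub>R (2 * A)" for n
            using ae
          proof (rule AE_mp, intro AE_I2 impI)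
            fix x assume x: "x \<noteq> \<psi> 0"
            have "\<bar>sol (X n, x) - u0 x\<bar> \<le> 2 * A"
              using sol_bound[of "(X n, x)"] sol_bound[of "(0, x)"] X0[of n] u0[OF x]
                abs_triangle_ineq4[of "sol (X n, x)" "u0 x"] by simp
            then show "norm (indicator {-r..r} x *\<^sub>R \<bar>sol (X n, x) - u0 x\<bar>) \<le> indicator {-r..r} x *\<^sub>R (2 * A)"
              by (simp add: indicator_def)
          qed
          show "AE x in lebesgue. (\<lambda>n. indicator {-r..r} x *\<^sub>R \<bar>sol (X n, x) - u0 x\<bar>) \<longlonglongrightarrow> 0"
            using ae
          proof (rule AE_mp, intro AE_I2 impI)
            fix x assume x: "x \<noteq> \<psi> 0"
            have "(\<lambda>n. \<psi> (X n)) \<longlonglongrightarrow> \<psi> 0"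
              using continuous_on_tendsto_compose[OF psi(3) X(2)] X0 by (simp add: less_imp_le)
            have uu: "(\<lambda>n. w (X n, x)) \<longlonglongrightarrow> w (0, x)" if "continuous_on ({0..} \<times> UNIV) w" for w :: "real \<times> real \<Rightarrow> real"
              using continuous_on_tendsto_compose[OF that tendsto_Pair[OF X(2) tendsto_const]] X0 by (simp add: less_imp_le)
            have "(\<lambda>n. sol (X n, x)) \<longlonglongrightarrow> sol (0, x)"
            proof (cases "\<psi> 0 < x")
              case True
              then have "\<forall>\<^sub>F n in sequentially. \<psi> (X n) < x"
                using order_tendstoD(2)[OF \<open>(\<lambda>n. \<psi> (X n)) \<longlonglongrightarrow> \<psi> 0\<close>] by blast
              then have "\<forall>\<^sub>F n in sequentially. ur (X n, x) = sol (X n, x)"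
                by eventually_elim (simp add: sol_def)
              from Lim_transform_eventually[OF uu[OF ur_cont] this] show ?thesis using True by (simp add: sol_def)
            next
              case False
              then have "x < \<psi> 0" using x by simp
              then have "\<forall>\<^sub>F n in sequentially. x < \<psi> (X n)"
                using order_tendstoD(1)[OF \<open>(\<lambda>n. \<psi> (X n)) \<longlonglongrightarrow> \<psi> 0\<close>] by blast
              then have "\<forall>\<^sub>F n in sequentially. ul (X n, x) = sol (X n, x)"
                by eventually_elim (simp add: sol_def)
              from Lim_transform_eventually[OF uu[OF ul_cont] this] show ?thesis using False by (simp add: sol_def)
            qed
            from tendsto_diff[OF this tendsto_const[of "u0 x"]]
            have "(\<lambda>n. sol (X n, x) - u0 x) \<longlonglongrightarrow> 0" using u0[OF x] by simp
            then have "(\<lambda>n. \<bar>sol (X n, x) - u0 x\<bar>) \<longlonglongrightarrow> 0" by (rule tendsto_rabs_zero)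
            from tendsto_scaleR[OF tendsto_const[of "indicator {-r..r} x :: real"] this]
            show "(\<lambda>n. indicator {-r..r} x *\<^sub>R \<bar>sol (X n, x) - u0 x\<bar>) \<longlonglongrightarrow> 0" by simp
          qed
        qed simp
        then show "(\<lambda>n. \<integral>x. indicator {-r..r} x *\<^sub>R \<bar>sol (X n, x) - u0 x\<bar> \<partial>lebesgue) \<longlonglongrightarrow> 0" by simp
      qed
    qed simp
  qed
qed

end

section \<open>Derivatives on half-lines and on the complement of a curve\<close>

lemma WB_slice:
  fixes F :: "real \<times> real \<Rightarrow> real"
  assumes "WB n N C F" and inC: "\<And>y. y \<in> H \<Longrightarrow> (t, y + c) \<in> C"
  shows "WB n N H (\<lambda>y. F (t, y + c))"
  using assms(1)
proof (induction n arbitrary: N F)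
  have uc: "uniformly_continuous_on H (\<lambda>y. F (t, y + c))" if "uniformly_continuous_on C F" for F :: "real \<times> real \<Rightarrow> real"
  proof (rule uniformly_continuous_on_comp[OF that])
    show "uniformly_continuous_on H (\<lambda>y. (t, y + c))"
      by (intro uniformly_continuous_on_Pair uniformly_continuous_on_const uniformly_continuous_on_add uniformly_continuous_on_id)
  qed (use inC in auto)
  {
    case 0
    then show ?case using uc inC by auto
  next
    case (Suc n)
    from Suc.prems obtain D where D: "\<forall>x\<in>C. (F has_derivative D x) (at x within C)"
      "\<forall>b\<in>Basis. WB n (\<lambda>j. N (Suc j)) C (\<lambda>x. D x b)" by auto
    show ?case
    proof (rule WB_SucI[where D="\<lambda>y d. D (t, y + c) (0, d)"])
      show "uniformly_continuous_on H (\<lambda>y. F (t, y + c))" by (rule uc[OF WB_uc[OF Suc.prems]])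
      show "\<bar>F (t, y + c)\<bar> \<le> N 0" if "y \<in> H" for y by (rule WB_bound[OF Suc.prems inC[OF that]])
      show "((\<lambda>y. F (t, y + c)) has_derivative (\<lambda>d. D (t, y + c) (0, d))) (at y within H)" if "y \<in> H" for y
      proof -
        have T: "((\<lambda>y. (t, y + c)) has_derivative (\<lambda>d. (0, d))) (at y within H)"
          by (auto intro!: derivative_eq_intros)
        have "(F has_derivative D (t, y + c)) (at (t, y + c) within (\<lambda>y. (t, y + c)) ` H)"
          by (rule has_derivative_subset[OF D(1)[rule_format, OF inC[OF that]]]) (use inC in auto)
        from has_derivative_in_compose[OF T this] show ?thesis .
      qed
      fix b :: real assume "b \<in> Basis"
      then have b: "b = 1" by simp
      have "WB n (\<lambda>j. N (Suc j)) C (\<lambda>x. D x (0, 1))" using D(2) by (auto simp: Basis_prod_def)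
      then show "WB n (\<lambda>j. N (Suc j)) H (\<lambda>y. D (t, y + c) (0, b))" unfolding b by (rule Suc.IH)
    qed
  }
qed

lemma WB_cmult:
  assumes "WB n N S F" "\<And>j. 0 \<le> N j"
  shows "WB n (\<lambda>j. \<bar>c\<bar> * N j) S (\<lambda>x. c * F x)"
  using assms
proof (induction n arbitrary: N F)
  have uc: "uniformly_continuous_on S (\<lambda>x. c * F x)" if "uniformly_continuous_on S F" for F
    by (rule uniformly_continuous_on_cmul_left[OF that])
  have bd: "\<bar>c * y\<bar> \<le> \<bar>c\<bar> * B" if "\<bar>y\<bar> \<le> B" for y B
    unfolding abs_mult using that by (rule mult_left_mono) simp
  {
    case 0
    show ?case unfolding WB.simps using uc[OF WB_uc[OF 0(1)]] bd[OF WB_bound[OF 0(1)]] by (intro conjI ballI)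
  next
    case (Suc n)
    from Suc.prems(1) obtain D where D: "\<forall>x\<in>S. (F has_derivative D x) (at x within S)"
      "\<forall>b\<in>Basis. WB n (\<lambda>j. N (Suc j)) S (\<lambda>x. D x b)" by auto
    show ?case
    proof (rule WB_SucI[where D="\<lambda>x d. c * D x d"])
      show "((\<lambda>x. c * F x) has_derivative (\<lambda>d. c * D x d)) (at x within S)" if "x \<in> S" for x
        using D(1) that by (auto intro: has_derivative_mult_right)
      show "WB n (\<lambda>j. \<bar>c\<bar> * N (Suc j)) S (\<lambda>x. c * D x b)" if "b \<in> Basis" for b
        by (rule Suc.IH) (use D(2) that Suc.prems(2) in auto)
    qed (use uc[OF WB_uc[OF Suc.prems(1)]] bd[OF WB_bound[OF Suc.prems(1)]] in auto)
  }
qed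

lemma nderiv_Suc_eq:
  assumes S: "nondegenerate S" and x: "x \<in> S"
    and h: "\<And>y. y \<in> S \<Longrightarrow> (h has_real_derivative h' y) (at y within S)"
  shows "nderiv S (Suc j) h x = nderiv S j h' x"
proof -
  have d: "pderiv_within S 1 h y = h' y" if "y \<in> S" for y
    using has_derivative_pderiv_within[OF S that h[OF that, unfolded has_field_derivative_def], of 1] by simp
  have "nderiv S (Suc j) h x = nderiv S j (pderiv_within S 1 h) x"
    unfolding nderiv_def replicate_Suc replicate_append_same[symmetric] iter_pderiv_snoc ..
  also have "\<dots> = nderiv S j h' x"
    unfolding nderiv_def by (rule iter_pderiv_cong) (use d x in auto)
  finally show ?thesis .
qed

text \<open>
Differentiating the exponential only produces factors \<open>lam\<close>, and lower derivatives of \<open>Y\<close> are absorbed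
because the weights increase.
\<close>

lemma exp_decay:
  fixes Y :: "real \<Rightarrow> real"
  assumes "WB n N {0..} Y" "\<And>j. 0 \<le> N j" "\<And>j. N j \<le> N (Suc j)" "j \<le> n" "0 \<le> t"
  shows "\<bar>nderiv {0..} j (\<lambda>s. exp (lam * s) * Y s) t\<bar> \<le> exp (lam * t) * ((1 + \<bar>lam\<bar>) ^ j * N j)"
  using assms(1-4)
proof (induction j arbitrary: n N Y)
  case 0
  then show ?case using WB_bound[OF 0(1), of t] assms(5) by (simp add: nderiv_def abs_mult)
next
  case (Suc j)
  then obtain n' where n': "n = Suc n'" by (cases n) auto
  obtain Y' where Y': "\<And>x. x \<in> {0..} \<Longrightarrow> (Y has_real_derivative Y' x) (at x within {0..})"
    "WB n' (\<lambda>j. N (Suc j)) {0..} Y'" by (rule WB_1D_SucE[OF Suc.prems(1)[unfolded n']]) (rule that)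
  let ?Z = "\<lambda>s. lam * Y s + Y' s"
  have d: "((\<lambda>s. exp (lam * s) * Y s) has_real_derivative exp (lam * s) * ?Z s) (at s within {0..})" if "s \<in> {0..}" for s
    using Y'(1)[OF that] by (auto intro!: derivative_eq_intros simp: algebra_simps)
  have 1: "nderiv {0..} (Suc j) (\<lambda>s. exp (lam * s) * Y s) t = nderiv {0..} j (\<lambda>s. exp (lam * s) * ?Z s) t"
    by (rule nderiv_Suc_eq[OF nondegenerate_halfline(1) _ d]) (use assms(5) in auto)
  have W: "WB n' (\<lambda>j. (1 + \<bar>lam\<bar>) * N (Suc j)) {0..} ?Z"
  proof -
    have "WB n' (\<lambda>j. \<bar>lam\<bar> * N j) {0..} (\<lambda>s. lam * Y s)"
      by (rule WB_cmult[OF WB_order_le[OF Suc.prems(1)]]) (use Suc.prems(2) n' in auto)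
    from WB_add[OF this Y'(2)] show ?thesis
    proof (rule WB_mono)
      fix j show "\<bar>lam\<bar> * N j + N (Suc j) \<le> (1 + \<bar>lam\<bar>) * N (Suc j)"
        using mult_left_mono[OF Suc.prems(3)[of j], of "\<bar>lam\<bar>"] by (simp add: algebra_simps)
    qed
  qed
  have "\<bar>nderiv {0..} j (\<lambda>s. exp (lam * s) * ?Z s) t\<bar> \<le> exp (lam * t) * ((1 + \<bar>lam\<bar>) ^ j * ((1 + \<bar>lam\<bar>) * N (Suc j)))"
    by (rule Suc.IH[OF W]) (use Suc.prems n' in \<open>auto intro!: mult_left_mono\<close>)
  then show ?case unfolding 1 by (simp add: algebra_simps)
qed

lemma nderiv_add:
  assumes S: "nondegenerate S" and x: "x \<in> S"
  shows "WB n N S F \<Longrightarrow> WB n N' S G \<Longrightarrow> j \<le> n \<Longrightarrow>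
     nderiv S j (\<lambda>x. F x + G x) x = nderiv S j F x + nderiv S j G x"
proof (induction j arbitrary: n N N' F G)
  case 0 then show ?case by (simp add: nderiv_def)
next
  case (Suc j)
  then obtain n' where n': "n = Suc n'" by (cases n) auto
  obtain F' where F': "\<And>x. x \<in> S \<Longrightarrow> (F has_real_derivative F' x) (at x within S)"
    "WB n' (\<lambda>j. N (Suc j)) S F'" by (rule WB_1D_SucE[OF Suc.prems(1)[unfolded n']]) (rule that)
  obtain G' where G': "\<And>x. x \<in> S \<Longrightarrow> (G has_real_derivative G' x) (at x within S)"
    "WB n' (\<lambda>j. N' (Suc j)) S G'" by (rule WB_1D_SucE[OF Suc.prems(2)[unfolded n']]) (rule that)
  have "nderiv S (Suc j) (\<lambda>x. F x + G x) x = nderiv S j (\<lambda>x. F' x + G' x) x"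
    by (rule nderiv_Suc_eq[OF S x]) (use F' G' in \<open>auto intro: DERIV_add\<close>)
  also have "\<dots> = nderiv S j F' x + nderiv S j G' x" by (rule Suc.IH[OF F'(2) G'(2)]) (use Suc.prems n' in auto)
  finally show ?case using nderiv_Suc_eq[OF S x F'(1), of j] nderiv_Suc_eq[OF S x G'(1), of j] by simp
qed

lemma nderiv_bound:
  assumes "nondegenerate S" "WB n N S F" "j \<le> n" "x \<in> S"
  shows "\<bar>nderiv S j F x\<bar> \<le> N j"
  using WB_iter_bound[OF assms(1,2), of "replicate j 1" x] assms(3,4) by (simp add: nderiv_def set_replicate_conv_if)

lemma nderiv_continuous:
  assumes "nondegenerate S" "WB n N S F" "j \<le> n"
  shows "continuous_on S (nderiv S j F)"
  using WB_cont[OF WB_iter_pderiv[OF assms(1,2), of "replicate j 1"]] assms(3)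
  by (simp add: nderiv_def set_replicate_conv_if)

lemma nderiv_has_derivative:
  assumes S: "nondegenerate S" and W: "WB n N S F" and j: "j < n" and x: "x \<in> S"
  shows "(nderiv S j F has_real_derivative nderiv S (Suc j) F x) (at x within S)"
proof -
  have "WB (n - j) (\<lambda>l. N (l + j)) S (nderiv S j F)"
    using WB_iter_pderiv[OF S W, of "replicate j 1"] j by (simp add: nderiv_def set_replicate_conv_if)
  moreover obtain m where m: "n - j = Suc m" using j by (metis Suc_diff_Suc)
  ultimately have W': "WB (Suc m) (\<lambda>l. N (l + j)) S (nderiv S j F)" by simp
  obtain G where G: "\<And>y. y \<in> S \<Longrightarrow> (nderiv S j F has_real_derivative G y) (at y within S)"
    by (rule WB_1D_SucE[OF W']) (rule that)
  have "nderiv S (Suc j) F x = pderiv_within S 1 (nderiv S j F) x" by (simp add: nderiv_def)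
  also have "\<dots> = G x"
    using has_derivative_pderiv_within[OF S x G[OF x, unfolded has_field_derivative_def], of 1] by simp
  finally show ?thesis using G[OF x] by simp
qed

lemma Ck_on_within_SucI:
  fixes F :: "real \<Rightarrow> real"
  assumes S: "nondegenerate S" and d: "\<And>x. x \<in> S \<Longrightarrow> (F has_real_derivative F' x) (at x within S)" and c: "Ck_on n S F'"
  shows "Ck_on (Suc n) S F"
proof -
  have eq: "pderiv_within S 1 F x = F' x" if "x \<in> S" for x
    using has_derivative_pderiv_within[OF S that d[OF that, unfolded has_field_derivative_def], of 1] by simp
  have diff: "F differentiable_on S"
    using d unfolding differentiable_on_def differentiable_def has_field_derivative_def by blast
  have ieq: "iter_pderiv S (bs @ [1]) F x = iter_pderiv S bs F' x" if "x \<in> S" for bs x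
    unfolding iter_pderiv_snoc by (rule iter_pderiv_cong) (use eq that in auto)
  have bs: "bs = [] \<or> (\<exists>bs'. bs = bs' @ [1] \<and> bs' \<in> lists Basis)" if "bs \<in> lists Basis" for bs :: "real list"
    using that by (cases bs rule: rev_cases) auto
  show ?thesis unfolding Ck_on_def
  proof (intro conjI ballI impI)
    fix bs :: "real list" assume b: "bs \<in> lists Basis"
    { assume l: "length bs < Suc n"
      show "iter_pderiv S bs F differentiable_on S"
      proof (cases "bs = []")
        case False
        then obtain bs' where b': "bs = bs' @ [1]" "bs' \<in> lists Basis" using bs[OF b] by auto
        then have D: "iter_pderiv S bs' F' differentiable_on S" using c l by (simp add: Ck_on_def)
        show ?thesis unfolding b'(1) differentiable_on_def
        proof
          fix x assume x: "x \<in> S"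
          show "iter_pderiv S (bs' @ [1]) F differentiable at x within S"
            by (rule differentiable_transform_within[OF bspec[OF D[unfolded differentiable_on_def] x] zero_less_one x])
              (rule ieq[symmetric])
        qed
      qed (use diff in simp) }
    { assume l: "length bs \<le> Suc n"
      show "continuous_on S (iter_pderiv S bs F)"
      proof (cases "bs = []")
        case False
        then obtain bs' where b': "bs = bs' @ [1]" "bs' \<in> lists Basis" using bs[OF b] by auto
        then have "continuous_on S (iter_pderiv S bs' F')" using c l by (simp add: Ck_on_def)
        then show ?thesis unfolding b'(1) by (rule continuous_on_eq) (rule ieq[symmetric])
      qed (use differentiable_imp_continuous_on[OF diff] in simp) }
  qed
qed

lemma BU_component:
  assumes S: "nondegenerate C" and B: "BU k C u"
  shows "Ck_on k C u \<and> (\<forall>bs\<in>lists Basis. length bs \<le> k \<longrightarrow>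
           bounded (iter_pderiv C bs u ` C) \<and> uniformly_continuous_on C (iter_pderiv C bs u))"
proof -
  obtain K where W: "WB k (\<lambda>_. K) C u" using B unfolding BU_def by auto
  have "bounded (iter_pderiv C bs u ` C) \<and> uniformly_continuous_on C (iter_pderiv C bs u)"
    if "bs \<in> lists Basis" "length bs \<le> k" for bs
  proof -
    have s: "set bs \<subseteq> Basis" using that by auto
    have "\<forall>x\<in>C. norm (iter_pderiv C bs u x) \<le> K" using WB_iter_bound[OF S W s that(2)] by auto
    then show ?thesis using WB_uc[OF WB_iter_pderiv[OF S W s that(2)]] by (auto simp: bounded_iff)
  qed
  then show ?thesis using WB_Ck_on[OF S W] by auto
qed

lemma BUC_imp_BU:
  assumes "BUC k S u" "C \<in> components S" shows "BU k C u"
proof -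
  have C: "Ck_on k C u" "\<And>bs. bs \<in> lists Basis \<Longrightarrow> length bs \<le> k \<Longrightarrow>
           bounded (iter_pderiv C bs u ` C) \<and> uniformly_continuous_on C (iter_pderiv C bs u)"
    using assms unfolding BUC_def by auto
  let ?L = "{bs. set bs \<subseteq> (Basis :: 'a set) \<and> length bs \<le> k}"
  have fin: "finite ?L" by (rule finite_lists_length_le[OF finite_Basis])
  have "\<exists>B. \<forall>x\<in>C. \<bar>iter_pderiv C bs u x\<bar> \<le> B" if "bs \<in> ?L" for bs
  proof -
    have "bounded (iter_pderiv C bs u ` C)" using C(2)[of bs] that by (simp add: lists_eq_set)
    then show ?thesis by (auto simp: bounded_iff)
  qed
  then obtain B where B: "\<And>bs x. bs \<in> ?L \<Longrightarrow> x \<in> C \<Longrightarrow> \<bar>iter_pderiv C bs u x\<bar> \<le> B bs" by metis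
  have "WB k (\<lambda>_. Max (B ` ?L)) C u"
  proof (rule WB_of_iter_pderiv)
    fix bs :: "'a list" assume b: "set bs \<subseteq> Basis"
    { assume "length bs < k" then show "iter_pderiv C bs u differentiable_on C"
        using C(1) b by (simp add: Ck_on_def lists_eq_set) }
    { assume "length bs \<le> k" then show "uniformly_continuous_on C (iter_pderiv C bs u)"
        using C(2)[of bs] b by (simp add: lists_eq_set) }
    { fix x assume l: "length bs \<le> k" and x: "x \<in> C"
      have "B bs \<le> Max (B ` ?L)" using fin b l by (intro Max_ge) auto
      then show "\<bar>iter_pderiv C bs u x\<bar> \<le> Max (B ` ?L)" using B[of bs x] b l x by fastforce }
  qed
  then show ?thesis by (auto simp: BU_def)
qed

lemma iter_pderiv_open_subset:
  assumes "open S" "open T" "S \<subseteq> T"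
  shows "x \<in> S \<Longrightarrow> iter_pderiv S bs F x = iter_pderiv T bs F x"
proof (induction bs arbitrary: x)
  case (Cons b bs)
  have "iter_pderiv S (b # bs) F x = pderiv_within S b (iter_pderiv T bs F) x"
    unfolding iter_pderiv.simps by (rule pderiv_within_cong) (use Cons.IH Cons.prems in auto)
  also have "\<dots> = pderiv_within T b (iter_pderiv T bs F) x"
    using at_within_open[OF Cons.prems assms(1)] at_within_open[OF subsetD[OF assms(3) Cons.prems] assms(2)]
    by (simp add: pderiv_within_def)
  finally show ?case by simp
qed simp

lemma components_two:
  assumes S: "S = A \<union> B" and AB: "A \<inter> B = {}" and ne: "A \<noteq> {}" "B \<noteq> {}"
    and c: "connected A" "connected B" and o: "openin (top_of_set S) A" "openin (top_of_set S) B"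
  shows "components S = {A, B}"
proof -
  have A: "connected_component_set S x = A" if x: "x \<in> A"
    and S: "S = A \<union> B" "A \<inter> B = {}" "connected A" "openin (top_of_set S) A" "openin (top_of_set S) B" for x and A B :: "'a set"
  proof
    show "A \<subseteq> connected_component_set S x"
      by (rule connected_component_maximal[OF x S(3)]) (use S in auto)
    let ?C = "connected_component_set S x"
    show "?C \<subseteq> A"
    proof (rule ccontr)
      assume "\<not> ?C \<subseteq> A"
      moreover have CS: "?C \<subseteq> S" by (rule connected_component_subset)
      ultimately have 1: "B \<inter> ?C \<noteq> {}" using S(1) by auto
      have 2: "A \<inter> ?C \<noteq> {}" using x S(1) by auto
      obtain U V where UV: "open U" "A = S \<inter> U" "open V" "B = S \<inter> V" using S(4,5) by (auto simp: openin_open)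
      have "connected ?C" by (rule connected_connected_component)
      moreover have "U \<inter> V \<inter> ?C = {}" using CS S(2) unfolding UV(2,4) by auto
      moreover have "?C \<subseteq> U \<union> V"
      proof
        fix y assume "y \<in> ?C"
        then have "y \<in> A \<union> B" using CS S(1) by auto
        then show "y \<in> U \<union> V" unfolding UV(2,4) by auto
      qed
      ultimately have "U \<inter> ?C = {} \<or> V \<inter> ?C = {}" using UV(1,3) by (intro connectedD)
      then show False
      proof
        assume "U \<inter> ?C = {}" then show False using 2 unfolding UV(2) by auto
      next
        assume "V \<inter> ?C = {}" then show False using 1 unfolding UV(4) by auto
      qed
    qed
  qed
  have 1: "connected_component_set S x = A" if "x \<in> A" for x by (rule A[OF that S AB c(1) o])
  have 2: "connected_component_set S x = B" if "x \<in> B" for x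
    by (rule A[OF that _ _ c(2) o(2,1)]) (use S AB in auto)
  have "connected_component_set S ` A = {A}" using ne(1) by (simp add: 1 image_constant_conv)
  moreover have "connected_component_set S ` B = {B}" using ne(2) by (simp add: 2 image_constant_conv)
  ultimately show ?thesis unfolding components_def by (subst S) (simp only: image_Un, auto)
qed

lemma components_real_minus_0: "components (- {0::real}) = {{0<..}, {..<0}}"
proof (rule components_two)
  show "openin (top_of_set (- {0::real})) {0<..}" "openin (top_of_set (- {0::real})) {..<0}"
    by (auto intro!: open_subset)
qed (auto intro: convex_connected)

definition "upper \<psi> = {p::real \<times> real. 0 \<le> fst p \<and> \<psi> (fst p) < snd p}"
definition "lower \<psi> = {p::real \<times> real. 0 \<le> fst p \<and> snd p < \<psi> (fst p)}"

lemma components_Omega: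
  assumes c: "continuous_on {0..} \<psi>"
  shows "components (Omega \<psi>) = {upper \<psi>, lower \<psi>}"
proof (rule components_two)
  show eq: "Omega \<psi> = upper \<psi> \<union> lower \<psi>" by (auto simp: Omega_def upper_def lower_def)
  show "upper \<psi> \<inter> lower \<psi> = {}" by (auto simp: upper_def lower_def)
  show "upper \<psi> \<noteq> {}" "lower \<psi> \<noteq> {}"
    by (auto simp: upper_def lower_def intro!: exI[of _ 0] lt_ex gt_ex)
  have u: "upper \<psi> = (\<lambda>p. (fst p, \<psi> (fst p) + snd p)) ` ({0..} \<times> {0<..})"
  proof (intro equalityI subsetI)
    fix p assume "p \<in> upper \<psi>"
    then show "p \<in> (\<lambda>p. (fst p, \<psi> (fst p) + snd p)) ` ({0..} \<times> {0<..})"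
      by (intro image_eqI[of _ _ "(fst p, snd p - \<psi> (fst p))"]) (auto simp: upper_def)
  qed (auto simp: upper_def)
  have l: "lower \<psi> = (\<lambda>p. (fst p, \<psi> (fst p) + snd p)) ` ({0..} \<times> {..<0})"
  proof (intro equalityI subsetI)
    fix p assume "p \<in> lower \<psi>"
    then show "p \<in> (\<lambda>p. (fst p, \<psi> (fst p) + snd p)) ` ({0..} \<times> {..<0})"
      by (intro image_eqI[of _ _ "(fst p, snd p - \<psi> (fst p))"]) (auto simp: lower_def)
  qed (auto simp: lower_def)
  have cc: "continuous_on ({0..} \<times> X) (\<lambda>p. (fst p, \<psi> (fst p) + snd p))" for X :: "real set"
    by (intro continuous_intros continuous_on_compose2[OF c]) auto
  show "connected (upper \<psi>)" unfolding u
    by (rule connected_continuous_image[OF cc]) (intro convex_connected convex_Times, auto)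
  show "connected (lower \<psi>)" unfolding l
    by (rule connected_continuous_image[OF cc]) (intro convex_connected convex_Times, auto)
  have c2: "continuous_on (Omega \<psi>) (\<lambda>p. snd p - \<psi> (fst p))"
    by (intro continuous_intros continuous_on_compose2[OF c]) (auto simp: Omega_def)
  have "upper \<psi> = Omega \<psi> \<inter> (\<lambda>p. snd p - \<psi> (fst p)) -` {0<..}"
    by (auto simp: eq) (auto simp: upper_def lower_def)
  then show "openin (top_of_set (Omega \<psi>)) (upper \<psi>)"
    using continuous_openin_preimage_gen[OF c2, of "{0<..}"] by simp
  have "lower \<psi> = Omega \<psi> \<inter> (\<lambda>p. snd p - \<psi> (fst p)) -` {..<0}"
    by (auto simp: eq) (auto simp: upper_def lower_def)
  then show "openin (top_of_set (Omega \<psi>)) (lower \<psi>)"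
    using continuous_openin_preimage_gen[OF c2, of "{..<0}"] by simp
qed

lemma nondegenerate_upper:
  assumes c: "continuous_on {0..} \<psi>" shows "nondegenerate (upper \<psi>)" "nondegenerate (lower \<psi>)"
proof -
  have key: "\<exists>d. 0 < \<bar>d\<bar> \<and> \<bar>d\<bar> < e \<and> p + d *\<^sub>R i \<in> {p. 0 \<le> fst p \<and> 0 < s * (snd p - \<psi> (fst p))}"
    if p: "0 \<le> fst p" "0 < s * (snd p - \<psi> (fst p))" and i: "i \<in> Basis" and e: "e > 0" and s: "s = 1 \<or> s = -1" for p i e s
  proof -
    consider "i = (0, 1)" | "i = (1, 0)" using i by (auto simp: Basis_prod_def)
    then show ?thesis
    proof cases
      case 1
      have "0 < s * (snd p + s * (e / 2) - \<psi> (fst p))" using p(2) e s by (auto simp: algebra_simps)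
      then show ?thesis using 1 p e s by (intro exI[of _ "s * (e / 2)"]) (auto simp: abs_mult)
    next
      case 2
      define a where "a = \<bar>snd p - \<psi> (fst p)\<bar>"
      have a: "a > 0" using p(2) s by (auto simp: a_def)
      obtain r where r: "r > 0" "\<And>t. t \<in> {0..} \<Longrightarrow> dist t (fst p) < r \<Longrightarrow> dist (\<psi> t) (\<psi> (fst p)) < a"
        using c[unfolded continuous_on_iff, rule_format, of "fst p" a] p(1) a by auto
      define d where "d = min r e / 2"
      have d: "d > 0" "d < r" "d < e" using r(1) e by (auto simp: d_def)
      have "dist (\<psi> (fst p + d)) (\<psi> (fst p)) < a" using r(2)[of "fst p + d"] p(1) d by (auto simp: dist_real_def)
      then have "0 < s * (snd p - \<psi> (fst p + d))" using s p(2) by (auto simp: a_def dist_real_def)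
      then show ?thesis using 2 p(1) d by (intro exI[of _ d]) auto
    qed
  qed
  show "nondegenerate (upper \<psi>)"
    unfolding nondegenerate_def upper_def using key[of _ 1] by simp
  show "nondegenerate (lower \<psi>)"
    unfolding nondegenerate_def lower_def using key[of _ "-1"] by simp
qed

text \<open>
Real versions of the sup norm of the derivative of order \<open>l\<close> and of the norm of order \<open>j\<close>. Beyond
\<open>k\<close> the former are \<open>0\<close> and the latter constant, so that the norms form a monotone sequence.
\<close>

definition "dnorm k S v l = (if l \<le> k then real_of_ereal (Linf_norm S (nderiv S l v)) else 0)"
definition "snorm k S v j = (\<Sum>l\<le>j. dnorm k S v l)"

text \<open>
The two half-lines and the punctured line are the sets of interest; on each of them every point is the
origin of a ray inside the set, as Landau's inequality requires.
\<close>

locale norm_data =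
  fixes k :: nat and S :: "real set" and v :: "real \<Rightarrow> real"
  assumes k2: "2 \<le> k" and S: "open S" "S \<noteq> {}"
    and ray: "\<And>x. x \<in> S \<Longrightarrow> \<exists>s. (s = 1 \<or> s = -1) \<and> (\<forall>r\<ge>0. x + s * r \<in> S)"
    and d: "\<And>l y. l < k \<Longrightarrow> y \<in> S \<Longrightarrow> (nderiv S l v has_real_derivative nderiv S (Suc l) v y) (at y)"
    and c: "\<And>l. l \<le> k \<Longrightarrow> continuous_on S (nderiv S l v)"
    and b: "\<exists>K. \<forall>l\<le>k. \<forall>y\<in>S. \<bar>nderiv S l v y\<bar> \<le> K"
begin

lemma Linf_eq: assumes "l \<le> k" shows "Linf_norm S (nderiv S l v) = ereal (dnorm k S v l)"
proof -
  obtain K where K: "\<forall>y\<in>S. \<bar>nderiv S l v y\<bar> \<le> K" using b assms by auto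
  obtain x where x: "x \<in> S" using S by auto
  have 1: "Linf_norm S (nderiv S l v) \<le> ereal K" by (rule Linf_norm_le[OF S(1) c[OF assms]]) (use K in auto)
  have 2: "ereal \<bar>nderiv S l v x\<bar> \<le> Linf_norm S (nderiv S l v)" by (rule Linf_norm_ge[OF S(1) c[OF assms] x])
  from 1 2 show ?thesis using assms
    by (cases "Linf_norm S (nderiv S l v)") (auto simp: dnorm_def)
qed

lemma dnorm_ge: "l \<le> k \<Longrightarrow> x \<in> S \<Longrightarrow> \<bar>nderiv S l v x\<bar> \<le> dnorm k S v l"
  using Linf_norm_ge[OF S(1) c, of l x] Linf_eq[of l] by simp

lemma dnorm_le: assumes "l \<le> k" "\<And>x. x \<in> S \<Longrightarrow> \<bar>nderiv S l v x\<bar> \<le> B" shows "dnorm k S v l \<le> B"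
  using Linf_norm_le[OF S(1) c[OF assms(1)] assms(2)] Linf_eq[OF assms(1)] by simp

lemma dnorm_nonneg: "0 \<le> dnorm k S v l"
proof (cases "l \<le> k")
  case True
  obtain x where "x \<in> S" using S by auto
  then show ?thesis using dnorm_ge[OF True, of x] by linarith
qed (simp add: dnorm_def)

lemma Wkinf_eq: "j \<le> k \<Longrightarrow> Wkinf_norm j S v = ereal (snorm k S v j)"
  unfolding Wkinf_norm_def snorm_def using Linf_eq by simp

lemma snorm_nonneg: "0 \<le> snorm k S v j"
  unfolding snorm_def by (intro sum_nonneg dnorm_nonneg)

lemma snorm_Suc: "snorm k S v j \<le> snorm k S v (Suc j)"
  unfolding snorm_def using dnorm_nonneg by simp

lemma dnorm_le_snorm: "l \<le> j \<Longrightarrow> dnorm k S v l \<le> snorm k S v j"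
  unfolding snorm_def by (rule member_le_sum) (auto simp: dnorm_nonneg)

lemma Landau: "0 < i \<Longrightarrow> i < k \<Longrightarrow> 0 < \<delta> \<Longrightarrow> dnorm k S v i \<le> 2 * dnorm k S v (i - 1) / \<delta> + \<delta> * dnorm k S v (i + 1)"
proof (rule dnorm_le)
  fix x assume i: "0 < i" "i < k" "0 < \<delta>" and x: "x \<in> S"
  then obtain i' where i': "i = Suc i'" by (cases i) auto
  obtain s where s: "s = 1 \<or> s = -1" "\<And>r. 0 \<le> r \<Longrightarrow> x + s * r \<in> S" using ray[OF x] by auto
  show "\<bar>nderiv S i v x\<bar> \<le> 2 * dnorm k S v (i - 1) / \<delta> + \<delta> * dnorm k S v (i + 1)"
    by (rule Landau_pointwise[OF s(1,2), of "nderiv S i' v" _ "nderiv S (Suc i) v"])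
      (use d i i' dnorm_ge in auto)
qed auto

lemma weight_props:
  "weight k (snorm k S v) 0 = 1" "1 \<le> weight k (snorm k S v) j"
  "j \<le> j' \<Longrightarrow> weight k (snorm k S v) j \<le> weight k (snorm k S v) j'"
  "weight k (snorm k S v) a * weight k (snorm k S v) b \<le> (16 ^ k) ^ k * weight k (snorm k S v) (a + b)"
proof -
  have lc: "snorm k S v i * snorm k S v i \<le> 16 * (snorm k S v (i - 1) * snorm k S v (i + 1))" if "0 < i" "i < k" for i
    unfolding snorm_def by (rule log_convex_of_Landau[OF dnorm_nonneg Landau that])
  note w = weight_properties[OF k2 snorm_nonneg snorm_Suc lc]
  show "weight k (snorm k S v) 0 = 1" by (rule w(1))
  show "1 \<le> weight k (snorm k S v) j" by (rule w(2))
  show "j \<le> j' \<Longrightarrow> weight k (snorm k S v) j \<le> weight k (snorm k S v) j'" by (rule w(3))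
  show "weight k (snorm k S v) a * weight k (snorm k S v) b \<le> (16 ^ k) ^ k * weight k (snorm k S v) (a + b)" by (rule w(4))
qed

text \<open>
This covers the case of vanishing data, in which the weights are not the quotients of norms.
\<close>

lemma snorm_1_zero: assumes "snorm k S v 1 = 0" "l \<le> k" shows "dnorm k S v l = 0"
proof -
  have "dnorm k S v 0 \<le> 0" using dnorm_le_snorm[of 0 1] assms by simp
  then have z: "v x = 0" if "x \<in> S" for x using dnorm_ge[of 0 x] that by (simp add: nderiv_def)
  have "dnorm k S v l \<le> 0"
  proof (rule dnorm_le[OF assms(2)])
    fix x assume x: "x \<in> S"
    have "nderiv S l v x = nderiv S l (\<lambda>_. 0) x"
      unfolding nderiv_def by (rule iter_pderiv_cong) (use z x in auto)
    moreover have "\<bar>nderiv S l (\<lambda>_. 0) x\<bar> \<le> 0"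
      by (rule nderiv_bound[OF nondegenerate_open[OF S(1)] _ le_refl x, where N="\<lambda>_. 0"]) (rule WB_const, auto)
    ultimately show "\<bar>nderiv S l v x\<bar> \<le> 0" by simp
  qed
  then show ?thesis using dnorm_nonneg[of l] by simp
qed

lemma dnorm_Suc_le: "j < k \<Longrightarrow> dnorm k S v (Suc j) \<le> snorm k S v 1 * weight k (snorm k S v) j"
proof (cases "snorm k S v 1 = 0")
  case True
  then show "j < k \<Longrightarrow> ?thesis" using snorm_1_zero by simp
next
  case False
  assume "j < k"
  then show ?thesis using dnorm_le_snorm[of "Suc j" "Suc j"] False by (simp add: weight_def)
qed

lemma snorm_1_weight: "j < k \<Longrightarrow> snorm k S v 1 * weight k (snorm k S v) j \<le> snorm k S v (Suc j)"
  using snorm_nonneg by (cases "snorm k S v 1 = 0") (auto simp: weight_def)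

end

section \<open>Regularity and decay of the one-sided solutions\<close>

context side
begin

lemma v_zero_lip: obtains K where "K \<ge> 0" "\<And>i z. i \<in> P \<Longrightarrow> z \<in> T \<Longrightarrow> \<bar>v' i z\<bar> \<le> K"
proof -
  obtain c where c: "c \<ge> 0" "\<And>i. i \<in> P \<Longrightarrow> 0 \<le> M i" "\<And>i. i \<in> P \<Longrightarrow> WB (k - 1) (\<lambda>j. c * (M i * N i j)) T (v' i)"
    by (rule UB_E[OF v_UB]) (rule that)
  have "\<bar>v' i z\<bar> \<le> c" if "i \<in> P" "z \<in> T" for i z
  proof -
    have "\<bar>v' i z\<bar> \<le> c * (M i * N i 0)" by (rule WB_bound[OF c(3)[OF that(1)] that(2)])
    also have "\<dots> \<le> c * 1" using N_0[OF that(1)] M_le[OF that(1)] c(1) by (intro mult_left_mono) auto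
    finally show ?thesis by simp
  qed
  then show ?thesis using that c(1) by blast
qed

end

context side_global
begin

lemma E_0: "E 0 = 1" by (simp add: E_def)

lemma xi_cont: assumes "i \<in> P" shows "continuous_on ({0..} \<times> UNIV) (\<lambda>p. \<xi> i (fst p) (snd p))"
proof -
  obtain K where K: "K \<ge> 0"
  "\<And>i p p'. i \<in> P \<Longrightarrow> 0 \<le> fst p \<Longrightarrow> 0 \<le> fst p' \<Longrightarrow>
     \<bar>\<xi> i (fst p) (snd p) - \<xi> i (fst p') (snd p')\<bar> \<le> K * norm (p - p')"
    by (rule xi_lip_norm) (rule that)
  have "K-lipschitz_on ({0..} \<times> UNIV) (\<lambda>p. \<xi> i (fst p) (snd p))"
    by (rule lipschitz_onI) (use K assms in \<open>auto simp: dist_norm\<close>)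
  then show ?thesis by (rule lipschitz_on_continuous_on)
qed

lemma sol_cont: assumes i: "i \<in> P" shows "continuous_on ({0..} \<times> UNIV) (sol i)"
proof -
  let ?S = "{0::real..} \<times> (UNIV :: real set)"
  have piz: "continuous_on UNIV \<pi>"
    by (rule lipschitz_on_continuous_on[of 1], rule lipschitz_onI) (use pi_lip in \<open>auto simp: dist_real_def\<close>)
  have z: "continuous_on ?S (\<lambda>p. \<pi> (\<xi> i (fst p) (snd p)))"
    by (rule continuous_on_compose2[OF piz xi_cont[OF i]]) auto
  have vc: "continuous_on T (v i)" by (rule uniformly_continuous_imp_continuous[OF v_uc[OF i]])
  have a: "continuous_on ?S (\<lambda>p. a0 i (\<pi> (\<xi> i (fst p) (snd p))))"
    unfolding a0_def by (intro continuous_intros continuous_on_compose2[OF vc z]) (use pi_T in auto)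
  have hc: "continuous_on I h" by (rule DERIV_continuous_on[OF h_deriv])
  have p: "continuous_on ?S (\<lambda>p. p0 i (\<pi> (\<xi> i (fst p) (snd p))))"
    unfolding p0_def by (rule continuous_on_compose2[OF hc a]) (use a0_range[OF i pi_T] in auto)
  have w: "continuous_on ?S (\<lambda>p. w i (E (fst p)) (\<pi> (\<xi> i (fst p) (snd p))))"
    unfolding w_def E_def by (intro continuous_intros p)
  have qc: "continuous_on R q" by (rule DERIV_continuous_on[OF q_deriv])
  have "continuous_on ?S (\<lambda>p. q (w i (E (fst p)) (\<pi> (\<xi> i (fst p) (snd p)))))"
  proof (rule continuous_on_compose2[OF qc w])
    show "(\<lambda>p. w i (E (fst p)) (\<pi> (\<xi> i (fst p) (snd p)))) ` ?S \<subseteq> R"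
    proof (rule image_subsetI)
      fix p assume "p \<in> ?S"
      then have "0 \<le> fst p" by auto
      then show "w i (E (fst p)) (\<pi> (\<xi> i (fst p) (snd p))) \<in> R"
        using w_range[OF i pi_T] E_range by blast
    qed
  qed
  then show ?thesis unfolding sol_def U_def by simp
qed

lemma sol_lip: obtains C where "C \<ge> 0"
  "\<And>i t x y. i \<in> P \<Longrightarrow> 0 \<le> t \<Longrightarrow> \<bar>sol i (t, x) - sol i (t, y)\<bar> \<le> C * \<bar>x - y\<bar>"
proof -
  obtain Kv where Kv: "Kv \<ge> 0" "\<And>i z. i \<in> P \<Longrightarrow> z \<in> T \<Longrightarrow> \<bar>v' i z\<bar> \<le> Kv" by (rule v_zero_lip) (rule that)
  obtain Kh where Kh: "Kh \<ge> 0" "\<And>x y. x \<in> I \<Longrightarrow> y \<in> I \<Longrightarrow> \<bar>h x - h y\<bar> \<le> Kh * \<bar>x - y\<bar>" "\<And>y. y \<in> I \<Longrightarrow> \<bar>h' y\<bar> \<le> Kh"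
    by (rule h_lip) (rule that)
  obtain Kq where Kq: "Kq \<ge> 0" "\<And>x y. x \<in> R \<Longrightarrow> y \<in> R \<Longrightarrow> \<bar>q x - q y\<bar> \<le> Kq * \<bar>x - y\<bar>" "\<And>y. y \<in> R \<Longrightarrow> \<bar>q' y\<bar> \<le> Kq"
    by (rule q_lip) (rule that)
  obtain F where F: "F \<ge> 0"
  "\<And>i t t' x x'. i \<in> P \<Longrightarrow> 0 \<le> t \<Longrightarrow> 0 \<le> t' \<Longrightarrow> \<bar>\<xi> i t x - \<xi> i t' x'\<bar> \<le> 2 * (\<bar>x - x'\<bar> + F * \<bar>t - t'\<bar>)"
    by (rule xi_lip) (rule that)
  show ?thesis
  proof (rule that[of "Kq * (Kh * (Kv * 2))"])
    fix i and t x y :: real assume i: "i \<in> P" and t: "0 \<le> t"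
    let ?z = "\<pi> (\<xi> i t x)" and ?z' = "\<pi> (\<xi> i t y)"
    have z: "\<bar>?z - ?z'\<bar> \<le> 2 * \<bar>x - y\<bar>" using pi_lip[of "\<xi> i t x" "\<xi> i t y"] F(2)[OF i t t, of x y] by simp
    have "norm (v i ?z - v i ?z') \<le> Kv * norm (?z - ?z')"
      by (rule field_differentiable_bound[OF T_convex v_deriv[OF i]]) (use Kv i pi_T in auto)
    then have vv: "\<bar>a0 i ?z - a0 i ?z'\<bar> \<le> Kv * (2 * \<bar>x - y\<bar>)"
      using mult_left_mono[OF z Kv(1)] by (simp add: a0_def)
    have e: "0 \<le> E t" "E t \<le> 1" using E_range[OF t] by auto
    have "\<bar>p0 i ?z - p0 i ?z'\<bar> \<le> Kh * \<bar>a0 i ?z - a0 i ?z'\<bar>"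
      unfolding p0_def by (rule Kh(2)[OF a0_range[OF i pi_T] a0_range[OF i pi_T]])
    also have "\<dots> \<le> Kh * (Kv * (2 * \<bar>x - y\<bar>))" using vv Kh(1) by (rule mult_left_mono)
    finally have pp: "\<bar>p0 i ?z - p0 i ?z'\<bar> \<le> Kh * (Kv * (2 * \<bar>x - y\<bar>))" .
    have "\<bar>w i (E t) ?z - w i (E t) ?z'\<bar> = E t * \<bar>p0 i ?z - p0 i ?z'\<bar>"
      using e by (simp add: w_def abs_mult flip: right_diff_distrib)
    also have "\<dots> \<le> 1 * (Kh * (Kv * (2 * \<bar>x - y\<bar>)))" using e pp by (intro mult_mono) auto
    finally have ww: "\<bar>w i (E t) ?z - w i (E t) ?z'\<bar> \<le> Kh * (Kv * (2 * \<bar>x - y\<bar>))" by simp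
    have "\<bar>sol i (t, x) - sol i (t, y)\<bar> \<le> Kq * \<bar>w i (E t) ?z - w i (E t) ?z'\<bar>"
      unfolding sol_def U_def fst_conv snd_conv
      by (rule Kq(2)[OF w_range[OF i pi_T e] w_range[OF i pi_T e]])
    also have "\<dots> \<le> Kq * (Kh * (Kv * (2 * \<bar>x - y\<bar>)))" using ww Kq(1) by (rule mult_left_mono)
    finally show "\<bar>sol i (t, x) - sol i (t, y)\<bar> \<le> Kq * (Kh * (Kv * 2)) * \<bar>x - y\<bar>" by (simp add: algebra_simps)
  qed (use Kq Kh Kv in auto)
qed

lemma X_0: assumes "i \<in> P" shows "X i 0 z = \<psi>0 i + z"
  using U_1[OF assms pi_T[of z]] by (simp add: X_def E_0 a0_def)

lemma xi_0: assumes "i \<in> P" shows "\<xi> i 0 x = x - \<psi>0 i"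
  using xi_X[OF assms order_refl, of "x - \<psi>0 i"] X_0[OF assms] by simp

lemma sol_0: assumes "i \<in> P" "x - \<psi>0 i \<in> T" shows "sol i (0, x) = u + v i (x - \<psi>0 i)"
  using U_1[OF assms] pi_id[OF assms(2)] by (simp add: sol_def E_0 xi_0[OF assms(1)])

end

text \<open>
A region of the plane all of whose points are reached by genuine characteristics. The weights need not be
the ones used for the construction of the shock curve, which allows decay estimates with one-sided norms.
\<close>

locale side_region = side_global P N L k f g u r \<rho> lam h h' q q' \<beta> \<beta>' T v v' M M0 \<pi> \<psi>0
  for P :: "'i set" and N L k f g u r \<rho> lam h h' q q' \<beta> \<beta>' T v v' M M0 \<pi> \<psi>0 +
  fixes C :: "'i \<Rightarrow> (real \<times> real) set"
  assumes C_Dom: "\<And>i. i \<in> P \<Longrightarrow> C i \<subseteq> Dom i"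
begin

definition "D\<xi> i p d = (snd d - fst d * deriv f (U i (E (fst p)) (\<xi> i (fst p) (snd p))))
   * inverse (J i (E (fst p)) (\<xi> i (fst p) (snd p)))"

lemma C_D: "i \<in> P \<Longrightarrow> p \<in> C i \<Longrightarrow> 0 \<le> fst p \<and> \<xi> i (fst p) (snd p) \<in> T"
  using C_Dom by (auto simp: Dom_def)

sublocale reg: side_flow P N L k f g u r \<rho> lam h h' q q' \<beta> \<beta>' T v v' M M0
  C "\<lambda>i p. \<xi> i (fst p) (snd p)" D\<xi> "\<lambda>p. E (fst p)" fst
proof
  show "uniformly_continuous_on (C i) (\<lambda>p. E (fst p))" if i: "i \<in> P" for i
    unfolding E_def
  proof (rule uc_exp_nonpos)
    show "uniformly_continuous_on (C i) (\<lambda>x. lam * fst x)"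
      by (intro uniformly_continuous_on_cmul_left bounded_linear.uniformly_continuous_on[OF bounded_linear_fst] uniformly_continuous_on_id)
    show "lam * fst p \<le> 0" if "p \<in> C i" for p using C_D[OF i that] lam_neg by (simp add: mult_nonpos_nonneg)
  qed
  show "((\<lambda>p. E (fst p)) has_derivative (\<lambda>d. lam * fst d * E (fst x))) (at x within C i)" if "i \<in> P" for i x
    unfolding E_def by (auto intro!: derivative_eq_intros)
  show "0 \<le> E (fst x) \<and> E (fst x) \<le> 1" if "i \<in> P" "x \<in> C i" for i x
    using E_range C_D[OF that] by simp
  show "\<xi> i (fst x) (snd x) \<in> T" if "i \<in> P" "x \<in> C i" for i x using C_D[OF that] by simp
qed

lemma reg_IN_0: "IN 0 C (\<lambda>i p. \<xi> i (fst p) (snd p)) D\<xi>"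
proof (rule IN_0I)
  fix i assume i: "i \<in> P"
  obtain K where K: "K \<ge> 0"
  "\<And>i p p'. i \<in> P \<Longrightarrow> 0 \<le> fst p \<Longrightarrow> 0 \<le> fst p' \<Longrightarrow>
     \<bar>\<xi> i (fst p) (snd p) - \<xi> i (fst p') (snd p')\<bar> \<le> K * norm (p - p')"
    by (rule xi_lip_norm) (rule that)
  have "K-lipschitz_on (C i) (\<lambda>p. \<xi> i (fst p) (snd p))"
    by (rule lipschitz_onI) (use K i C_D[OF i] in \<open>auto simp: dist_norm\<close>)
  then show "uniformly_continuous_on (C i) (\<lambda>p. \<xi> i (fst p) (snd p))"
    by (rule lipschitz_on_uniformly_continuous)
  fix p assume p: "p \<in> C i"
  have "p \<in> Dom i" using p C_Dom[OF i] by auto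
  from has_derivative_subset[OF xi_deriv[OF i this] C_Dom[OF i]]
  show "((\<lambda>p. \<xi> i (fst p) (snd p)) has_derivative D\<xi> i p) (at p within C i)"
    by (rule has_derivative_eq_rhs) (auto simp: D\<xi>_def fun_eq_iff)
qed

lemma reg_IN: "n \<le> k \<Longrightarrow> IN n C (\<lambda>i p. \<xi> i (fst p) (snd p)) D\<xi>"
proof (induction n)
  case 0 show ?case by (rule reg_IN_0)
next
  case (Suc n)
  then have n: "n \<le> k - 1" and IN: "IN n C (\<lambda>i p. \<xi> i (fst p) (snd p)) D\<xi>" by auto
  show ?case
    by (rule reg.xi_step(1)[OF n IN, where \<theta>="\<lambda>i p b. snd b"])
      (use UB1_const in \<open>auto simp: D\<xi>_def\<close>)
qed

lemma reg_D\<xi>_UB1: "b \<in> Basis \<Longrightarrow> UB1 (k - 1) C (\<lambda>i p. D\<xi> i p b)"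
  using reg_IN[OF order_refl] k2 by (auto simp: IN_def)

lemma reg_Y_UB: "b \<in> Basis \<Longrightarrow> UB (k - 1) M C (\<lambda>i p. reg.Y i p b)"
  by (rule reg.Y_UB[OF order_refl reg_IN reg_D\<xi>_UB1]) auto

lemma sol_eq: "i \<in> P \<Longrightarrow> p \<in> C i \<Longrightarrow> sol i p = U i (E (fst p)) (\<xi> i (fst p) (snd p))"
  using C_Dom sol_Dom by blast

lemma sol_deriv: assumes "i \<in> P" "p \<in> C i"
  shows "(sol i has_derivative (\<lambda>d. E (fst p) * reg.Y i p d)) (at p within C i)"
  by (rule has_derivative_transform[OF assms(2) sol_eq[OF assms(1)] reg.U_deriv[OF reg_IN_0 assms]])

lemma sol_UB1: "UB1 k C sol"
proof -
  obtain k' where k': "k = Suc k'" using k2 by (cases k) auto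
  have U: "UB1 (k - 1) C sol"
    by (rule UB_cong[OF reg.U_UB1[OF order_refl reg_IN]]) (use sol_eq in auto)
  have "UB1 (Suc k') C sol"
  proof (rule UB_SucI[where D="\<lambda>i p d. E (fst p) * reg.Y i p d" and C="\<bar>u\<bar> + r", OF _ _ _ sol_deriv])
    show "uniformly_continuous_on (C i) (sol i)" if "i \<in> P" for i by (rule UB_uc[OF U that])
    show "\<bar>sol i p\<bar> \<le> (\<bar>u\<bar> + r) * 1" if "i \<in> P" "p \<in> C i" for i p
      using sol_range[of i p] C_D[OF that] that by auto
    fix b :: "real \<times> real" assume b: "b \<in> Basis"
    have "UB1 (k - 1) C (\<lambda>i p. reg.Y i p b)"
      by (rule UB_weaken[OF reg_Y_UB[OF b], of 1]) (use M_le in auto)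
    then show "UB1 k' C (\<lambda>i p. E (fst p) * reg.Y i p b)"
      using UB1_mult_UB[OF reg.E_UB1] k' by simp
  qed auto
  then show ?thesis using k' by simp
qed

lemma sol_BU: assumes "i \<in> P" shows "BU k (C i) (sol i)"
proof -
  obtain c where "c \<ge> 0" "\<And>i. i \<in> P \<Longrightarrow> (0::real) \<le> 1" "\<And>i. i \<in> P \<Longrightarrow> WB k (\<lambda>j. c * (1 * N i j)) (C i) (sol i)"
    by (rule UB_E[OF sol_UB1]) (rule that)
  then show ?thesis using assms BU_I by blast
qed

lemma Y_linear: "reg.Y i p d = reg.Y i p (1, 0) * fst d + reg.Y i p (0, 1) * snd d"
  unfolding reg.Y_def D\<xi>_def by (simp add: algebra_simps)

text \<open>
The linearised coordinate obeys \<open>lam * y * q'(y) = g (q y)\<close>, and the transport terms cancel because the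
foot point is constant along characteristics.
\<close>

lemma sol_pde: assumes "i \<in> P" "p \<in> C i"
  shows "E (fst p) * reg.Y i p (1, 0) + deriv f (sol i p) * (E (fst p) * reg.Y i p (0, 1)) = g (sol i p)"
proof -
  let ?z = "\<xi> i (fst p) (snd p)" and ?e = "E (fst p)"
  have t: "0 \<le> fst p" "?z \<in> T" using C_D[OF assms] by auto
  have "w i ?e ?z \<in> R" using w_range[OF assms(1) t(2)] E_range[OF t(1)] by blast
  from q_ode[OF this] have q1: "lam * (?e * p0 i ?z) * q' (w i ?e ?z) = g (sol i p)"
    unfolding sol_eq[OF assms] U_def by (simp add: w_def)
  have "?e * reg.Y i p (1, 0) + deriv f (sol i p) * (?e * reg.Y i p (0, 1)) = lam * (?e * p0 i ?z) * q' (w i ?e ?z)"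
    unfolding reg.Y_def D\<xi>_def sol_eq[OF assms] by (simp add: algebra_simps)
  then show ?thesis using q1 by simp
qed

lemma Y_cont: assumes "i \<in> P" "b \<in> Basis" shows "continuous_on (C i) (\<lambda>p. E (fst p) * reg.Y i p b)"
proof -
  have "continuous_on (C i) (\<lambda>p. reg.Y i p b)"
    by (rule uniformly_continuous_imp_continuous[OF UB_uc[OF reg_Y_UB[OF assms(2)] assms(1)]])
  then show ?thesis unfolding E_def by (intro continuous_intros)
qed

lemma Y_bounded: assumes "b \<in> Basis" obtains c where "\<And>i p. i \<in> P \<Longrightarrow> p \<in> C i \<Longrightarrow> \<bar>E (fst p) * reg.Y i p b\<bar> \<le> c"
proof -
  obtain c where c: "c \<ge> 0" "\<And>i. i \<in> P \<Longrightarrow> 0 \<le> M i"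
    "\<And>i. i \<in> P \<Longrightarrow> WB (k - 1) (\<lambda>j. c * (M i * N i j)) (C i) (\<lambda>p. reg.Y i p b)"
    by (rule UB_E[OF reg_Y_UB[OF assms]]) (rule that)
  have "\<bar>E (fst p) * reg.Y i p b\<bar> \<le> c" if "i \<in> P" "p \<in> C i" for i p
  proof -
    have "\<bar>reg.Y i p b\<bar> \<le> c * (M i * N i 0)" by (rule WB_bound[OF c(3)[OF that(1)] that(2)])
    also have "\<dots> \<le> c * 1" using N_0[OF that(1)] M_le[OF that(1)] c(1) by (intro mult_left_mono) auto
    finally have "\<bar>reg.Y i p b\<bar> \<le> c" by simp
    moreover have "0 \<le> E (fst p)" "E (fst p) \<le> 1" using E_range C_D[OF that] by auto
    ultimately have "\<bar>E (fst p)\<bar> * \<bar>reg.Y i p b\<bar> \<le> 1 * c" by (intro mult_mono) auto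
    then show ?thesis by (simp add: abs_mult)
  qed
  then show ?thesis by (rule that)
qed

text \<open>
The sup norm decays with \<open>M0\<close>, the bound of \<open>v\<close>, and the derivative of order \<open>j\<close> with \<open>M * N (j - 1)\<close>,
which for the weights of the application is at most the norm of order \<open>j\<close>.
\<close>

lemma slice_estimate:
  assumes H: "open H"
  obtains c where "c \<ge> 0" "\<And>i t s. i \<in> P \<Longrightarrow> 0 \<le> t \<Longrightarrow> (\<And>y. y \<in> H \<Longrightarrow> (t, y + s) \<in> C i) \<Longrightarrow>
     WB k (\<lambda>j. c * E t * (if j = 0 then M0 i else M i * N i (j - 1))) H (\<lambda>y. sol i (t, y + s) - u)"
proof -
  obtain k' where k': "k = Suc k'" using k2 by (cases k) auto
  have b01: "(0, 1) \<in> (Basis :: (real \<times> real) set)" by (simp add: Basis_prod_def)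
  obtain c where c: "c \<ge> 0" "\<And>i. i \<in> P \<Longrightarrow> 0 \<le> M i"
    "\<And>i. i \<in> P \<Longrightarrow> WB (k - 1) (\<lambda>j. c * (M i * N i j)) (C i) (\<lambda>p. reg.Y i p (0, 1))"
    by (rule UB_E[OF reg_Y_UB[OF b01]]) (rule that)
  obtain d where d: "d \<ge> 0" "\<And>i z e. i \<in> P \<Longrightarrow> z \<in> T \<Longrightarrow> 0 \<le> e \<Longrightarrow> e \<le> 1 \<Longrightarrow> \<bar>U i e z - u\<bar> \<le> d * (e * M0 i)"
    by (rule U_le) (rule that)
  obtain Cl where Cl: "Cl \<ge> 0" "\<And>i t x y. i \<in> P \<Longrightarrow> 0 \<le> t \<Longrightarrow> \<bar>sol i (t, x) - sol i (t, y)\<bar> \<le> Cl * \<bar>x - y\<bar>"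
    by (rule sol_lip) (rule that)
  show ?thesis
  proof (rule that[of "max c d"])
    fix i and t s :: real assume i: "i \<in> P" and t: "0 \<le> t" and HC: "\<And>y. y \<in> H \<Longrightarrow> (t, y + s) \<in> C i"
    let ?N = "\<lambda>j. max c d * E t * (if j = 0 then M0 i else M i * N i (j - 1))"
    have e: "0 \<le> E t" "E t \<le> 1" using E_range[OF t] by auto
    have "WB (Suc k') ?N H (\<lambda>y. sol i (t, y + s) - u)"
    proof (rule WB_1D_SucI[where F'="\<lambda>y. E t * reg.Y i (t, y + s) (0, 1)"])
      have "Cl-lipschitz_on H (\<lambda>y. sol i (t, y + s) - u)"
      proof (rule lipschitz_onI)
        show "dist (sol i (t, x + s) - u) (sol i (t, y + s) - u) \<le> Cl * dist x y" for x y
          using Cl(2)[OF i t, of "x + s" "y + s"] by (simp add: dist_real_def)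
      qed (rule Cl(1))
      then show "uniformly_continuous_on H (\<lambda>y. sol i (t, y + s) - u)" by (rule lipschitz_on_uniformly_continuous)
      show "\<bar>sol i (t, y + s) - u\<bar> \<le> ?N 0" if "y \<in> H" for y
      proof -
        have "\<bar>sol i (t, y + s) - u\<bar> \<le> d * (E t * M0 i)"
          using sol_eq[OF i HC[OF that]] d(2)[OF i _ e] C_D[OF i HC[OF that]] by simp
        also have "\<dots> \<le> max c d * (E t * M0 i)" using e M0_nonneg[OF i] by (intro mult_right_mono) auto
        finally show ?thesis by (simp add: mult.assoc)
      qed
      show "((\<lambda>y. sol i (t, y + s) - u) has_real_derivative E t * reg.Y i (t, y + s) (0, 1)) (at y within H)"
        if y: "y \<in> H" for y
      proof -
        have T: "((\<lambda>y. (t, y + s)) has_derivative (\<lambda>d. (0, d))) (at y within H)"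
          by (auto intro!: derivative_eq_intros)
        have sd: "(sol i has_derivative (\<lambda>d. E t * reg.Y i (t, y + s) d)) (at (t, y + s) within (\<lambda>y. (t, y + s)) ` H)"
        proof -
          have "(\<lambda>y. (t, y + s)) ` H \<subseteq> C i" by (rule image_subsetI) (rule HC)
          from has_derivative_subset[OF sol_deriv[OF i HC[OF y]] this] show ?thesis unfolding fst_conv .
        qed
        have lin: "reg.Y i (t, y + s) (0, d) = reg.Y i (t, y + s) (0, 1) * d" for d
          using Y_linear[of i "(t, y + s)" "(0, d)"] unfolding fst_conv snd_conv by simp
        from has_derivative_in_compose[OF T sd]
        have "((\<lambda>y. sol i (t, y + s)) has_derivative (\<lambda>d. E t * reg.Y i (t, y + s) (0, 1) * d)) (at y within H)"
        proof (rule has_derivative_eq_rhs)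
          show "(\<lambda>d. E t * reg.Y i (t, y + s) (0, d)) = (\<lambda>d. E t * reg.Y i (t, y + s) (0, 1) * d)"
          proof (rule ext)
            fix d show "E t * reg.Y i (t, y + s) (0, d) = E t * reg.Y i (t, y + s) (0, 1) * d"
              unfolding lin[of d] by simp
          qed
        qed
        then have "((\<lambda>y. sol i (t, y + s)) has_real_derivative E t * reg.Y i (t, y + s) (0, 1)) (at y within H)"
          unfolding has_field_derivative_def .
        from DERIV_diff[OF this DERIV_const[of u]] show ?thesis unfolding diff_0_right .
      qed
      have "WB k' (\<lambda>j. c * (M i * N i j)) H (\<lambda>y. reg.Y i (t, y + s) (0, 1))"
        using WB_slice[OF c(3)[OF i] HC] k' by simp
      then have "WB k' (\<lambda>j. \<bar>E t\<bar> * (c * (M i * N i j))) H (\<lambda>y. E t * reg.Y i (t, y + s) (0, 1))"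
        by (rule WB_cmult) (use c i N_nonneg[OF i] in auto)
      then show "WB k' (\<lambda>j. ?N (Suc j)) H (\<lambda>y. E t * reg.Y i (t, y + s) (0, 1))"
      proof (rule WB_mono)
        fix j
        have "E t * (c * (M i * N i j)) \<le> E t * (max c d * (M i * N i j))"
          using e c(2)[OF i] N_nonneg[OF i] by (intro mult_left_mono mult_right_mono) auto
        then show "\<bar>E t\<bar> * (c * (M i * N i j)) \<le> ?N (Suc j)" using e by (simp add: algebra_simps)
      qed
    qed
    then show "WB k ?N H (\<lambda>y. sol i (t, y + s) - u)" using k' by simp
  qed (use c in auto)
qed

end

text \<open>
The same analysis along a curve: the traces of the solution are functions of time, of the same form with
the foot point \<open>\<zeta>\<close>. The equation for \<open>\<zeta>\<close> involves \<open>\<psi>'\<close>, so that its regularity and that of the curve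
have to be established together.
\<close>

locale side_curve = side_global P N L k f g u r \<rho> lam h h' q q' \<beta> \<beta>' T v v' M M0 \<pi> \<psi>0
  for P :: "'i set" and N L k f g u r \<rho> lam h h' q q' \<beta> \<beta>' T v v' M M0 \<pi> \<psi>0 +
  fixes \<psi> \<psi>' :: "'i \<Rightarrow> real \<Rightarrow> real" and C\<psi> :: real
  assumes psi_deriv: "\<And>i t. i \<in> P \<Longrightarrow> 0 \<le> t \<Longrightarrow> (\<psi> i has_real_derivative \<psi>' i t) (at t within {0..})"
    and psi_Dom: "\<And>i t. i \<in> P \<Longrightarrow> 0 \<le> t \<Longrightarrow> (t, \<psi> i t) \<in> Dom i"
    and psi'_bound: "\<And>i t. i \<in> P \<Longrightarrow> 0 \<le> t \<Longrightarrow> \<bar>\<psi>' i t\<bar> \<le> C\<psi>"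
begin

definition "\<zeta> i t = \<xi> i t (\<psi> i t)"
definition "D\<zeta> i t d = (\<psi>' i t * d - d * deriv f (U i (E t) (\<zeta> i t))) * inverse (J i (E t) (\<zeta> i t))"

lemma zeta_T: "i \<in> P \<Longrightarrow> 0 \<le> t \<Longrightarrow> \<zeta> i t \<in> T"
  using psi_Dom by (auto simp: Dom_def \<zeta>_def)

sublocale crv: side_flow P N L k f g u r \<rho> lam h h' q q' \<beta> \<beta>' T v v' M M0
  "\<lambda>_. {0..}" \<zeta> D\<zeta> E "\<lambda>d. d"
proof
  show "uniformly_continuous_on {0..} E"
    unfolding E_def
  proof (rule uc_exp_nonpos)
    show "uniformly_continuous_on {0..} (\<lambda>x. lam * x)"
      by (intro uniformly_continuous_on_cmul_left uniformly_continuous_on_id)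
  qed (use lam_neg in \<open>auto simp: mult_nonpos_nonneg\<close>)
  show "(E has_derivative (\<lambda>d. lam * d * E x)) (at x within {0..})" for x
    unfolding E_def by (auto intro!: derivative_eq_intros)
qed (use E_range zeta_T in auto)

lemma crv_IN_0: "IN 0 (\<lambda>_. {0..}) \<zeta> D\<zeta>"
proof (rule IN_0I)
  fix i assume i: "i \<in> P"
  obtain F where F: "F \<ge> 0"
  "\<And>i t t' x x'. i \<in> P \<Longrightarrow> 0 \<le> t \<Longrightarrow> 0 \<le> t' \<Longrightarrow> \<bar>\<xi> i t x - \<xi> i t' x'\<bar> \<le> 2 * (\<bar>x - x'\<bar> + F * \<bar>t - t'\<bar>)"
    by (rule xi_lip) (rule that)
  have C0: "0 \<le> C\<psi>" using psi'_bound[OF i, of 0] by simp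
  have "(2 * (C\<psi> + F))-lipschitz_on {0..} (\<zeta> i)"
  proof (rule lipschitz_onI)
    fix t t' :: real assume t: "t \<in> {0..}" "t' \<in> {0..}"
    have "norm (\<psi> i t - \<psi> i t') \<le> C\<psi> * norm (t - t')"
      by (rule field_differentiable_bound[of "{0..}" _ "\<psi>' i"]) (use psi_deriv[OF i] psi'_bound[OF i] t in auto)
    then have "\<bar>\<psi> i t - \<psi> i t'\<bar> \<le> C\<psi> * \<bar>t - t'\<bar>" by simp
    moreover have "\<bar>\<zeta> i t - \<zeta> i t'\<bar> \<le> 2 * (\<bar>\<psi> i t - \<psi> i t'\<bar> + F * \<bar>t - t'\<bar>)"
      unfolding \<zeta>_def by (rule F(2)[OF i]) (use t in auto)
    ultimately show "dist (\<zeta> i t) (\<zeta> i t') \<le> 2 * (C\<psi> + F) * dist t t'"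
      unfolding dist_real_def by (simp add: algebra_simps)
  qed (use C0 F(1) in simp)
  then show "uniformly_continuous_on {0..} (\<zeta> i)" by (rule lipschitz_on_uniformly_continuous)
  fix t :: real assume t: "t \<in> {0..}"
  have d: "((\<lambda>t. (t, \<psi> i t)) has_derivative (\<lambda>d. (d, \<psi>' i t * d))) (at t within {0..})"
    using psi_deriv[OF i, of t] t by (auto simp: has_field_derivative_def intro!: derivative_eq_intros)
  have x: "((\<lambda>p. \<xi> i (fst p) (snd p)) has_derivative
     (\<lambda>d. (snd d - deriv f (U i (E t) (\<zeta> i t)) * fst d) * inverse (J i (E t) (\<zeta> i t)))) (at (t, \<psi> i t) within (\<lambda>t. (t, \<psi> i t)) ` {0..})"
    using has_derivative_subset[OF xi_deriv[OF i psi_Dom[OF i, of t]]] t psi_Dom[OF i]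
    by (simp add: image_subset_iff \<zeta>_def)
  from has_derivative_in_compose[OF d x, unfolded fst_conv snd_conv]
  have "((\<lambda>t. \<xi> i t (\<psi> i t)) has_derivative D\<zeta> i t) (at t within {0..})"
    by (rule has_derivative_eq_rhs) (auto simp: D\<zeta>_def fun_eq_iff mult.commute)
  then show "(\<zeta> i has_derivative D\<zeta> i t) (at t within {0..})" unfolding \<zeta>_def[abs_def] .
qed

lemma crv_step:
  assumes "n \<le> k - 1" "IN n (\<lambda>_. {0..}) \<zeta> D\<zeta>" "UB1 n (\<lambda>_. {0..}) \<psi>'"
  shows "IN (Suc n) (\<lambda>_. {0..}) \<zeta> D\<zeta>"
  by (rule crv.xi_step(1)[OF assms(1,2), where \<theta>="\<lambda>i t d. \<psi>' i t * d"])
    (use assms(3) in \<open>auto simp: D\<zeta>_def\<close>)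

end

section \<open>The shock curve and the glued solution\<close>

text \<open>
Both one-sided solutions share the index set and the weights, which are those of the data on the whole
punctured line. The intervals of values around the two end states are so small that the states remain
separated and that Lax's inequalities and the chord condition hold for all pairs of values.
\<close>

locale two_sides =
  rt: side_global P N L k f g up rp \<rho>p lamp hp hp' qp qp' \<beta>p \<beta>p' "{0..}" vp vp' M M0 "max 0" \<psi>0 +
  lf: side_global P N L k f g um rm \<rho>m lamm hm hm' qm qm' \<beta>m \<beta>m' "{..0}" vm vm' M M0 "min 0" \<psi>0
  for P :: "'i set" and N L k f g up rp \<rho>p lamp hp hp' qp qp' \<beta>p \<beta>p' vp vp' M M0 \<psi>0
    um rm \<rho>m lamm hm hm' qm qm' \<beta>m \<beta>m' vm vm' +
  fixes \<sigma> c0 sg :: real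
  assumes g_Ck: "Ck_on k UNIV g"
    and sg: "sg = 1 \<or> sg = - 1" and c0: "0 < c0"
    and sep: "\<And>a b. a \<in> {up - rp..up + rp} \<Longrightarrow> b \<in> {um - rm..um + rm} \<Longrightarrow> c0 \<le> sg * (a - b)"
    and Lax: "\<And>a a' b b'. a \<in> {up - rp..up + rp} \<Longrightarrow> a' \<in> {up - rp..up + rp} \<Longrightarrow>
       b \<in> {um - rm..um + rm} \<Longrightarrow> b' \<in> {um - rm..um + rm} \<Longrightarrow>
       deriv f a' < (f a - f b) / (a - b) \<and> (f a - f b) / (a - b) < deriv f b'"
    and Ol: "\<And>a b \<kappa>. a \<in> {up - rp..up + rp} \<Longrightarrow> b \<in> {um - rm..um + rm} \<Longrightarrow>
       b \<le> \<kappa> \<and> \<kappa> \<le> a \<or> a \<le> \<kappa> \<and> \<kappa> \<le> b \<Longrightarrow> 0 \<le> (f \<kappa> - f b - (f a - f b) / (a - b) * (\<kappa> - b)) * (a - b)"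
    and RH: "f up - f um = \<sigma> * (up - um)"
begin

abbreviation "Jp \<equiv> {up - rp..up + rp}"
abbreviation "Jm \<equiv> {um - rm..um + rm}"

definition "slope a b = (f a - f b) / (a - b)"

lemma ne: "a \<in> Jp \<Longrightarrow> b \<in> Jm \<Longrightarrow> a - b \<noteq> 0"
  using sep[of a b] c0 by auto

lemma abs_sep: "a \<in> Jp \<Longrightarrow> b \<in> Jm \<Longrightarrow> c0 \<le> \<bar>a - b\<bar>"
  using sep[of a b] sg by auto

lemma slope_eq: "a \<in> Jp \<Longrightarrow> b \<in> Jm \<Longrightarrow> f a - f b = slope a b * (a - b)"
  using ne by (simp add: slope_def)

lemma f_deriv: "(f has_real_derivative deriv f x) (at x)" and f'_Ck: "Ck_on k UNIV (deriv f)"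
  using Ck_on_Suc_UNIV[of k f] rt.f_Ck by auto

lemma f_cont: "continuous_on UNIV f"
  by (rule DERIV_continuous_on[OF has_field_derivative_at_within[OF f_deriv]])

lemma up_Ip: "up \<in> Jp" and um_Im: "um \<in> Jm"
  using rt.r_pos lf.r_pos by auto

lemma slope_bound: obtains Cs where "0 \<le> Cs" "\<And>a b. a \<in> Jp \<Longrightarrow> b \<in> Jm \<Longrightarrow> \<bar>slope a b\<bar> \<le> Cs"
proof -
  have bd: "\<exists>B. \<forall>x\<in>{a..b}. \<bar>f x\<bar> \<le> B" for a b
  proof -
    have "bounded (f ` {a..b})"
      by (intro compact_imp_bounded compact_continuous_image continuous_on_subset[OF f_cont] compact_Icc) auto
    then show ?thesis by (auto simp: bounded_iff)
  qed
  obtain B1 where B1: "\<forall>x\<in>Jp. \<bar>f x\<bar> \<le> B1" using bd by blast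
  obtain B2 where B2: "\<forall>x\<in>Jm. \<bar>f x\<bar> \<le> B2" using bd by blast
  have B0: "0 \<le> B1" "0 \<le> B2"
    using order_trans[OF abs_ge_zero B1[rule_format, OF up_Ip]] order_trans[OF abs_ge_zero B2[rule_format, OF um_Im]]
    by simp_all
  show ?thesis
  proof (rule that[of "(B1 + B2) / c0"])
    fix a b assume ab: "a \<in> Jp" "b \<in> Jm"
    have "\<bar>f a - f b\<bar> \<le> B1 + B2"
      using B1[rule_format, OF ab(1)] B2[rule_format, OF ab(2)] abs_triangle_ineq4[of "f a" "f b"] by linarith
    then have "\<bar>f a - f b\<bar> / \<bar>a - b\<bar> \<le> (B1 + B2) / c0"
      using abs_sep[OF ab] c0 by (intro frac_le) auto
    then show "\<bar>slope a b\<bar> \<le> (B1 + B2) / c0" by (simp add: slope_def)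
  qed (use B0 c0 in simp)
qed

lemma slope_lip: obtains K where "0 \<le> K"
  "\<And>a b a' b'. a \<in> Jp \<Longrightarrow> b \<in> Jm \<Longrightarrow> a' \<in> Jp \<Longrightarrow> b' \<in> Jm \<Longrightarrow>
     \<bar>slope a b - slope a' b'\<bar> \<le> K * (\<bar>a - a'\<bar> + \<bar>b - b'\<bar>)"
proof -
  obtain Cs where Cs: "0 \<le> Cs" "\<And>a b. a \<in> Jp \<Longrightarrow> b \<in> Jm \<Longrightarrow> \<bar>slope a b\<bar> \<le> Cs" by (rule slope_bound) (rule that)
  obtain F1 where F1: "F1 \<ge> 0" "\<And>y. y \<in> Jp \<Longrightarrow> \<bar>deriv f y\<bar> \<le> F1" by (rule rt.f'_bound) (rule that)
  obtain F2 where F2: "F2 \<ge> 0" "\<And>y. y \<in> Jm \<Longrightarrow> \<bar>deriv f y\<bar> \<le> F2" by (rule lf.f'_bound) (rule that)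
  define F where "F = F1 + F2"
  have lip: "\<bar>f x - f y\<bar> \<le> F * \<bar>x - y\<bar>" if "x \<in> S" "y \<in> S" "S = Jp \<or> S = Jm" for x y S
  proof -
    have "norm (f x - f y) \<le> F * norm (x - y)"
      by (rule field_differentiable_bound[of S f "deriv f"])
        (use that F1 F2 in \<open>auto intro!: has_field_derivative_at_within[OF f_deriv] simp: F_def add_increasing add_increasing2\<close>)
    then show ?thesis by simp
  qed
  show ?thesis
  proof (rule that[of "(F + Cs) / c0"])
    show "0 \<le> (F + Cs) / c0" using F1 F2 Cs c0 by (simp add: F_def)
    fix a b a' b' assume A: "a \<in> Jp" "b \<in> Jm" "a' \<in> Jp" "b' \<in> Jm"
    define s where "s = slope a' b'"
    have s: "\<bar>s\<bar> \<le> Cs" using Cs(2) A by (simp add: s_def)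
    have "slope a b - s = ((f a - f a' - s * (a - a')) - (f b - f b' - s * (b - b'))) / (a - b)"
    proof -
      have "f a' - f b' = s * (a' - b')" using slope_eq[OF A(3,4)] by (simp add: s_def)
      then have "(f a - f a' - s * (a - a')) - (f b - f b' - s * (b - b')) = (slope a b - s) * (a - b)"
        using slope_eq[OF A(1,2)] by (simp add: algebra_simps)
      then show ?thesis using ne[OF A(1,2)] by simp
    qed
    moreover have "\<bar>(f a - f a' - s * (a - a')) - (f b - f b' - s * (b - b'))\<bar> \<le> (F + Cs) * (\<bar>a - a'\<bar> + \<bar>b - b'\<bar>)"
    proof -
      have e: "\<bar>f x - f y - s * (x - y)\<bar> \<le> (F + Cs) * \<bar>x - y\<bar>" if "\<bar>f x - f y\<bar> \<le> F * \<bar>x - y\<bar>" for x y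
      proof -
        have "\<bar>s * (x - y)\<bar> \<le> Cs * \<bar>x - y\<bar>" unfolding abs_mult by (rule mult_right_mono[OF s abs_ge_zero])
        then show ?thesis using abs_triangle_ineq4[of "f x - f y" "s * (x - y)"] that
          unfolding distrib_right by linarith
      qed
      show ?thesis
        using e[OF lip[OF A(1,3)]] e[OF lip[OF A(2,4)]]
          abs_triangle_ineq4[of "f a - f a' - s * (a - a')" "f b - f b' - s * (b - b')"]
        by (simp add: distrib_left)
    qed
    then have "\<bar>(f a - f a' - s * (a - a')) - (f b - f b' - s * (b - b'))\<bar> / \<bar>a - b\<bar>
        \<le> (F + Cs) * (\<bar>a - a'\<bar> + \<bar>b - b'\<bar>) / c0"
      using abs_sep[OF A(1,2)] c0 by (intro frac_le) auto
    ultimately show "\<bar>slope a b - slope a' b'\<bar> \<le> (F + Cs) / c0 * (\<bar>a - a'\<bar> + \<bar>b - b'\<bar>)"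
      by (simp add: s_def)
  qed
qed

text \<open>
The chord slope is a Lipschitz function of the two states, and the one-sided solutions are Lipschitz in
\<open>x\<close>, uniformly in time.
\<close>

lemma shock_curve_exists:
  assumes i: "i \<in> P"
  shows "\<exists>\<psi>. \<psi> 0 = \<psi>0 i \<and> (\<forall>t\<ge>0. (\<psi> has_real_derivative slope (rt.sol i (t, \<psi> t)) (lf.sol i (t, \<psi> t))) (at t within {0..}))"
proof -
  obtain Cs where Cs: "0 \<le> Cs" "\<And>a b. a \<in> Jp \<Longrightarrow> b \<in> Jm \<Longrightarrow> \<bar>slope a b\<bar> \<le> Cs" by (rule slope_bound) (rule that)
  obtain K where K: "0 \<le> K" "\<And>a b a' b'. a \<in> Jp \<Longrightarrow> b \<in> Jm \<Longrightarrow> a' \<in> Jp \<Longrightarrow> b' \<in> Jm \<Longrightarrow>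
     \<bar>slope a b - slope a' b'\<bar> \<le> K * (\<bar>a - a'\<bar> + \<bar>b - b'\<bar>)" by (rule slope_lip) (rule that)
  obtain C1 where C1: "C1 \<ge> 0" "\<And>i t x y. i \<in> P \<Longrightarrow> 0 \<le> t \<Longrightarrow> \<bar>rt.sol i (t, x) - rt.sol i (t, y)\<bar> \<le> C1 * \<bar>x - y\<bar>"
    by (rule rt.sol_lip) (rule that)
  obtain C2 where C2: "C2 \<ge> 0" "\<And>i t x y. i \<in> P \<Longrightarrow> 0 \<le> t \<Longrightarrow> \<bar>lf.sol i (t, x) - lf.sol i (t, y)\<bar> \<le> C2 * \<bar>x - y\<bar>"
    by (rule lf.sol_lip) (rule that)
  have rI: "rt.sol i (t, x) \<in> Jp" if "0 \<le> t" for t x by (rule rt.sol_range[OF i]) (simp add: that)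
  have lI: "lf.sol i (t, x) \<in> Jm" if "0 \<le> t" for t x by (rule lf.sol_range[OF i]) (simp add: that)
  let ?F = "\<lambda>t x. slope (rt.sol i (t, x)) (lf.sol i (t, x))"
  have "continuous_on ({0..} \<times> UNIV) (\<lambda>p. slope (rt.sol i p) (lf.sol i p))"
    unfolding slope_def
  proof (intro continuous_on_divide continuous_on_diff)
    show "continuous_on ({0..} \<times> UNIV) (\<lambda>p. f (rt.sol i p))"
      by (rule continuous_on_compose2[OF f_cont rt.sol_cont[OF i]]) auto
    show "continuous_on ({0..} \<times> UNIV) (\<lambda>p. f (lf.sol i p))"
      by (rule continuous_on_compose2[OF f_cont lf.sol_cont[OF i]]) auto
    show "continuous_on ({0..} \<times> UNIV) (rt.sol i)" "continuous_on ({0..} \<times> UNIV) (lf.sol i)"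
      by (rule rt.sol_cont[OF i] lf.sol_cont[OF i])+
    show "\<forall>p\<in>{0..} \<times> UNIV. rt.sol i p - lf.sol i p \<noteq> 0"
      using ne[OF rI lI] by auto
  qed
  then have cont: "continuous_on ({0..} \<times> UNIV) (\<lambda>p. ?F (fst p) (snd p))" by simp
  have lip: "\<bar>?F t x - ?F t y\<bar> \<le> (K * (C1 + C2)) * \<bar>x - y\<bar>" if t: "0 \<le> t" for t x y
  proof -
    have "\<bar>?F t x - ?F t y\<bar> \<le> K * (\<bar>rt.sol i (t, x) - rt.sol i (t, y)\<bar> + \<bar>lf.sol i (t, x) - lf.sol i (t, y)\<bar>)"
      by (rule K(2)[OF rI[OF t] lI[OF t] rI[OF t] lI[OF t]])
    also have "\<dots> \<le> K * (C1 * \<bar>x - y\<bar> + C2 * \<bar>x - y\<bar>)"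
      using C1(2)[OF i t] C2(2)[OF i t] K(1) by (intro mult_left_mono add_mono) auto
    finally show ?thesis by (simp add: algebra_simps)
  qed
  have bnd: "\<bar>?F t x\<bar> \<le> Cs" if t: "0 \<le> t" for t x by (rule Cs(2)[OF rI[OF t] lI[OF t]])
  show ?thesis
    by (rule Picard_global[OF cont bnd lip, where ?x0.0="\<psi>0 i"]) auto
qed

definition "\<psi> i = (SOME \<psi>. \<psi> 0 = \<psi>0 i \<and> (\<forall>t\<ge>0. (\<psi> has_real_derivative
   slope (rt.sol i (t, \<psi> t)) (lf.sol i (t, \<psi> t))) (at t within {0..})))"
definition "\<psi>' i t = slope (rt.sol i (t, \<psi> i t)) (lf.sol i (t, \<psi> i t))"

lemma psi_0: assumes "i \<in> P" shows "\<psi> i 0 = \<psi>0 i"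
  unfolding \<psi>_def by (rule conjunct1[OF someI_ex[OF shock_curve_exists[OF assms]]])

lemma psi_deriv: assumes "i \<in> P" "0 \<le> t"
  shows "(\<psi> i has_real_derivative \<psi>' i t) (at t within {0..})"
  unfolding \<psi>'_def \<psi>_def
  by (rule conjunct2[OF someI_ex[OF shock_curve_exists[OF assms(1)]], rule_format, OF assms(2)])

lemma rI: "i \<in> P \<Longrightarrow> 0 \<le> t \<Longrightarrow> rt.sol i (t, x) \<in> Jp"
  by (rule rt.sol_range) auto

lemma lI: "i \<in> P \<Longrightarrow> 0 \<le> t \<Longrightarrow> lf.sol i (t, x) \<in> Jm"
  by (rule lf.sol_range) auto

text \<open>
Lax's inequality: the shock is faster than the characteristic of the right state issuing from its
starting point, so every characteristic found to the right of the shock carries genuine data.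
\<close>

lemma psi_right: assumes i: "i \<in> P" and t: "0 \<le> t" shows "rt.X i t 0 \<le> \<psi> i t"
proof -
  have d: "((\<lambda>t. \<psi> i t - rt.X i t 0) has_real_derivative \<psi>' i s - deriv f (rt.U i (rt.E s) (max 0 0))) (at s within {0..})"
    if "0 \<le> s" for s
    by (rule DERIV_diff[OF psi_deriv[OF i that] rt.X_deriv_t[OF i that]])
  have "\<psi> i 0 - rt.X i 0 0 \<le> \<psi> i t - rt.X i t 0"
  proof (cases "t = 0")
    case False
    show ?thesis
    proof (rule DERIV_nonneg_imp_increasing_open[of 0 t])
      fix s assume s: "0 < s" "s < t"
      have "at s within {0..} = at s" using s by (intro at_within_interior) auto
      then have dd: "((\<lambda>t. \<psi> i t - rt.X i t 0) has_real_derivative \<psi>' i s - deriv f (rt.U i (rt.E s) (max 0 0))) (at s)"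
        using d[of s] s by simp
      have sp: "0 \<le> s" and mx: "max 0 0 \<in> {0::real..}" and e: "0 \<le> rt.E s" "rt.E s \<le> 1"
        using s rt.E_range[of s] by auto
      have lt: "deriv f (rt.U i (rt.E s) (max 0 0)) < \<psi>' i s"
        unfolding \<psi>'_def slope_def
        by (rule conjunct1[OF Lax[OF rI[OF i sp] rt.U_range[OF i mx e] lI[OF i sp] um_Im]])
      show "\<exists>y. ((\<lambda>t. \<psi> i t - rt.X i t 0) has_real_derivative y) (at s) \<and> 0 \<le> y" using dd lt by (intro exI conjI) (assumption, simp)
    next
      show "continuous_on {0..t} (\<lambda>t. \<psi> i t - rt.X i t 0)"
        by (rule continuous_on_subset[OF DERIV_continuous_on[OF d]]) auto
    qed (use t in simp)
  qed simp
  then show ?thesis using psi_0[OF i] rt.X_0[OF i] by simp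
qed

lemma psi_left: assumes i: "i \<in> P" and t: "0 \<le> t" shows "\<psi> i t \<le> lf.X i t 0"
proof -
  have d: "((\<lambda>t. lf.X i t 0 - \<psi> i t) has_real_derivative deriv f (lf.U i (lf.E s) (min 0 0)) - \<psi>' i s) (at s within {0..})"
    if "0 \<le> s" for s
    by (rule DERIV_diff[OF lf.X_deriv_t[OF i that] psi_deriv[OF i that]])
  have "lf.X i 0 0 - \<psi> i 0 \<le> lf.X i t 0 - \<psi> i t"
  proof (cases "t = 0")
    case False
    show ?thesis
    proof (rule DERIV_nonneg_imp_increasing_open[of 0 t])
      fix s assume s: "0 < s" "s < t"
      have "at s within {0..} = at s" using s by (intro at_within_interior) auto
      then have dd: "((\<lambda>t. lf.X i t 0 - \<psi> i t) has_real_derivative deriv f (lf.U i (lf.E s) (min 0 0)) - \<psi>' i s) (at s)"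
        using d[of s] s by simp
      have sp: "0 \<le> s" and mx: "min 0 0 \<in> {..0::real}" and e: "0 \<le> lf.E s" "lf.E s \<le> 1"
        using s lf.E_range[of s] by auto
      have lt: "\<psi>' i s < deriv f (lf.U i (lf.E s) (min 0 0))"
        unfolding \<psi>'_def slope_def
        by (rule conjunct2[OF Lax[OF rI[OF i sp] up_Ip lI[OF i sp] lf.U_range[OF i mx e]]])
      show "\<exists>y. ((\<lambda>t. lf.X i t 0 - \<psi> i t) has_real_derivative y) (at s) \<and> 0 \<le> y" using dd lt by (intro exI conjI) (assumption, simp)
    next
      show "continuous_on {0..t} (\<lambda>t. lf.X i t 0 - \<psi> i t)"
        by (rule continuous_on_subset[OF DERIV_continuous_on[OF d]]) auto
    qed (use t in simp)
  qed simp
  then show ?thesis using psi_0[OF i] lf.X_0[OF i] by simp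
qed

lemma right_Dom: assumes "i \<in> P" "0 \<le> t" "\<psi> i t \<le> x" shows "(t, x) \<in> rt.Dom i"
proof -
  have "\<not> rt.\<xi> i t x < 0"
    using psi_right[OF assms(1,2)] assms(3) unfolding rt.xi_less_iff[OF assms(1,2)] by linarith
  then show ?thesis using assms(2) by (simp add: rt.Dom_def)
qed

lemma left_Dom: assumes "i \<in> P" "0 \<le> t" "x \<le> \<psi> i t" shows "(t, x) \<in> lf.Dom i"
proof -
  have "\<not> 0 < lf.\<xi> i t x"
    using psi_left[OF assms(1,2)] assms(3) unfolding lf.less_xi_iff[OF assms(1,2)] by linarith
  then show ?thesis using assms(2) by (simp add: lf.Dom_def)
qed

definition "Cs = (SOME C. \<forall>a\<in>Jp. \<forall>b\<in>Jm. \<bar>slope a b\<bar> \<le> C)"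

lemma Cs: "a \<in> Jp \<Longrightarrow> b \<in> Jm \<Longrightarrow> \<bar>slope a b\<bar> \<le> Cs"
proof -
  obtain C where C: "0 \<le> C" "\<And>a b. a \<in> Jp \<Longrightarrow> b \<in> Jm \<Longrightarrow> \<bar>slope a b\<bar> \<le> C" by (rule slope_bound) (rule that)
  have "\<exists>C. \<forall>a\<in>Jp. \<forall>b\<in>Jm. \<bar>slope a b\<bar> \<le> C" by (intro exI[of _ C] ballI C(2))
  from someI_ex[OF this] show "a \<in> Jp \<Longrightarrow> b \<in> Jm \<Longrightarrow> \<bar>slope a b\<bar> \<le> Cs" unfolding Cs_def by blast
qed

sublocale rc: side_curve P N L k f g up rp \<rho>p lamp hp hp' qp qp' \<beta>p \<beta>p' "{0..}" vp vp' M M0 "max 0" \<psi>0 \<psi> \<psi>' Cs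
  by unfold_locales (use psi_deriv right_Dom Cs[OF rI lI] in \<open>auto simp: \<psi>'_def\<close>)

sublocale lc: side_curve P N L k f g um rm \<rho>m lamm hm hm' qm qm' \<beta>m \<beta>m' "{..0}" vm vm' M M0 "min 0" \<psi>0 \<psi> \<psi>' Cs
  by unfold_locales (use psi_deriv left_Dom Cs[OF rI lI] in \<open>auto simp: \<psi>'_def\<close>)

sublocale rr: side_region P N L k f g up rp \<rho>p lamp hp hp' qp qp' \<beta>p \<beta>p' "{0..}" vp vp' M M0 "max 0" \<psi>0 "\<lambda>i. upper (\<psi> i)"
  by unfold_locales (auto simp: upper_def intro!: right_Dom)

sublocale lr: side_region P N L k f g um rm \<rho>m lamm hm hm' qm qm' \<beta>m \<beta>m' "{..0}" vm vm' M M0 "min 0" \<psi>0 "\<lambda>i. lower (\<psi> i)"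
  by unfold_locales (auto simp: lower_def intro!: left_Dom)

abbreviation "S0 \<equiv> (\<lambda>_::'i. {0::real..})"
abbreviation "a i t \<equiv> rt.U i (rt.E t) (rc.\<zeta> i t)"
abbreviation "b i t \<equiv> lf.U i (lf.E t) (lc.\<zeta> i t)"

lemma a_eq: "i \<in> P \<Longrightarrow> 0 \<le> t \<Longrightarrow> rt.sol i (t, \<psi> i t) = a i t"
  using rt.sol_Dom[OF rc.psi_Dom] by (simp add: rc.\<zeta>_def)

lemma b_eq: "i \<in> P \<Longrightarrow> 0 \<le> t \<Longrightarrow> lf.sol i (t, \<psi> i t) = b i t"
  using lf.sol_Dom[OF lc.psi_Dom] by (simp add: lc.\<zeta>_def)

lemma a_Ip: "i \<in> P \<Longrightarrow> 0 \<le> t \<Longrightarrow> a i t \<in> Jp" and b_Im: "i \<in> P \<Longrightarrow> 0 \<le> t \<Longrightarrow> b i t \<in> Jm"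
  by (simp_all only: a_eq[symmetric] b_eq[symmetric] rI lI)

lemma psi'_eq: "i \<in> P \<Longrightarrow> 0 \<le> t \<Longrightarrow> \<psi>' i t = (f (a i t) - f (b i t)) * inverse (a i t - b i t)"
  by (simp add: \<psi>'_def a_eq b_eq slope_def divide_inverse)

lemma inv_UB1:
  assumes "n \<le> k - 1" "rt.IN n S0 rc.\<zeta> rc.D\<zeta>" "rt.IN n S0 lc.\<zeta> lc.D\<zeta>"
  shows "rt.UB1 n S0 (\<lambda>i t. inverse (a i t - b i t))"
proof -
  have "rt.UB1 n S0 (\<lambda>i t. sg * (a i t - b i t))"
    by (intro rt.UB_cmult rt.UB_diff rc.crv.U_UB1 lc.crv.U_UB1 assms)
  then have "rt.UB1 n S0 (\<lambda>i t. inverse (sg * (a i t - b i t)))"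
    by (rule rc.crv.UB1_inverse[OF assms(1,2) _ _ c0]) (use sep a_Ip b_Im in auto)
  then have "rt.UB1 n S0 (\<lambda>i t. sg * inverse (sg * (a i t - b i t)))" by (rule rt.UB_cmult)
  then show ?thesis by (rule rt.UB_cong) (use sg in auto)
qed

lemma psi'_UB1:
  assumes n: "n \<le> k - 1" and IN: "rt.IN n S0 rc.\<zeta> rc.D\<zeta>" "rt.IN n S0 lc.\<zeta> lc.D\<zeta>"
  shows "rt.UB1 n S0 \<psi>'"
proof (rule rt.UB_cong)
  have f: "Ck_on n UNIV f" by (rule Ck_on_le[OF rt.f_Ck]) (use n in auto)
  show "rt.UB1 n S0 (\<lambda>i t. (f (a i t) - f (b i t)) * inverse (a i t - b i t))"
    by (intro rt.UB1_mult_UB rt.UB_diff rc.crv.UB1_comp_U lc.crv.UB1_comp_U inv_UB1 n IN f)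
qed (use psi'_eq in auto)

text \<open>
The bootstrap for the curve: \<open>n\<close> derivatives of both foot points give \<open>n\<close> derivatives of the traces and
hence of \<open>\<psi>'\<close>, and with these \<open>n + 1\<close> derivatives of the foot points.
\<close>

lemma curve_IN: "n \<le> k \<Longrightarrow> rt.IN n S0 rc.\<zeta> rc.D\<zeta> \<and> rt.IN n S0 lc.\<zeta> lc.D\<zeta>"
proof (induction n)
  case 0 show ?case using rc.crv_IN_0 lc.crv_IN_0 by simp
next
  case (Suc n)
  then have n: "n \<le> k - 1" and IN: "rt.IN n S0 rc.\<zeta> rc.D\<zeta>" "rt.IN n S0 lc.\<zeta> lc.D\<zeta>" by auto
  show ?case using rc.crv_step[OF n IN(1) psi'_UB1[OF n IN]] lc.crv_step[OF n IN(2) psi'_UB1[OF n IN]] by simp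
qed

lemma curve_IN1: "rt.IN (k - 1) S0 rc.\<zeta> rc.D\<zeta>" "rt.IN (k - 1) S0 lc.\<zeta> lc.D\<zeta>"
  using curve_IN[of "k - 1"] by auto

definition "Q1 i t = (deriv f (a i t) - \<psi>' i t) * inverse (a i t - b i t) * rc.crv.Y i t 1"
definition "Q2 i t = (\<psi>' i t - deriv f (b i t)) * inverse (a i t - b i t) * lc.crv.Y i t 1"

lemma Q_UB: "rt.UB (k - 1) M S0 Q1" "rt.UB (k - 1) M S0 Q2"
proof -
  have D: "rt.UB1 (k - 1) S0 (\<lambda>i t. rc.D\<zeta> i t 1)" "rt.UB1 (k - 1) S0 (\<lambda>i t. lc.D\<zeta> i t 1)"
    using curve_IN[OF order_refl] rt.k2 by (auto simp: rt.IN_def)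
  have Y: "rt.UB (k - 1) M S0 (\<lambda>i t. rc.crv.Y i t 1)" "rt.UB (k - 1) M S0 (\<lambda>i t. lc.crv.Y i t 1)"
    by (rule rc.crv.Y_UB lc.crv.Y_UB, rule order_refl, rule curve_IN1, rule D)+
  have f': "Ck_on (k - 1) UNIV (deriv f)" by (rule Ck_on_le[OF f'_Ck]) simp
  note p = psi'_UB1[OF order_refl curve_IN1] inv_UB1[OF order_refl curve_IN1]
  show "rt.UB (k - 1) M S0 Q1"
    unfolding Q1_def by (intro rt.UB1_mult_UB[OF _ Y(1)] rt.UB1_mult_UB rt.UB_diff rc.crv.UB1_comp_U order_refl curve_IN1 f' p)
  show "rt.UB (k - 1) M S0 Q2"
    unfolding Q2_def by (intro rt.UB1_mult_UB[OF _ Y(2)] rt.UB1_mult_UB rt.UB_diff lc.crv.UB1_comp_U order_refl curve_IN1 f' p)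
qed

text \<open>
Differentiating the Rankine-Hugoniot relation expresses the acceleration of the shock through the time
derivatives of the two traces, each of which carries its own exponential factor.
\<close>

lemma psi''_deriv:
  assumes i: "i \<in> P" and t: "0 \<le> t"
  shows "(\<psi>' i has_real_derivative rt.E t * Q1 i t + lf.E t * Q2 i t) (at t within {0..})"
proof -
  have tt: "t \<in> {0..}" using t by simp
  have IN0: "rt.IN 0 S0 rc.\<zeta> rc.D\<zeta>" "rt.IN 0 S0 lc.\<zeta> lc.D\<zeta>" using curve_IN[of 0] by auto
  have lin: "rc.crv.Y i t d = rc.crv.Y i t 1 * d" "lc.crv.Y i t d = lc.crv.Y i t 1 * d" for d
    unfolding rc.crv.Y_def lc.crv.Y_def rc.D\<zeta>_def lc.D\<zeta>_def by (simp_all add: algebra_simps)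
  have "(a i has_derivative (\<lambda>d. rt.E t * rc.crv.Y i t 1 * d)) (at t within {0..})"
    using rc.crv.U_deriv[OF IN0(1) i tt]
  proof (rule has_derivative_eq_rhs, intro ext)
    fix d show "rt.E t * rc.crv.Y i t d = rt.E t * rc.crv.Y i t 1 * d" unfolding lin(1)[of d] by simp
  qed
  then have a': "(a i has_real_derivative rt.E t * rc.crv.Y i t 1) (at t within {0..})"
    by (simp add: has_field_derivative_def)
  have "(b i has_derivative (\<lambda>d. lf.E t * lc.crv.Y i t 1 * d)) (at t within {0..})"
    using lc.crv.U_deriv[OF IN0(2) i tt]
  proof (rule has_derivative_eq_rhs, intro ext)
    fix d show "lf.E t * lc.crv.Y i t d = lf.E t * lc.crv.Y i t 1 * d" unfolding lin(2)[of d] by simp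
  qed
  then have b': "(b i has_real_derivative lf.E t * lc.crv.Y i t 1) (at t within {0..})"
    by (simp add: has_field_derivative_def)
  have nz: "a i t - b i t \<noteq> 0" by (rule ne[OF a_Ip[OF i t] b_Im[OF i t]])
  define A where "A = rt.E t * rc.crv.Y i t 1"
  define B where "B = lf.E t * lc.crv.Y i t 1"
  have "((\<lambda>t. (f (a i t) - f (b i t)) / (a i t - b i t)) has_real_derivative
      ((deriv f (a i t) * A - deriv f (b i t) * B) * (a i t - b i t) - (f (a i t) - f (b i t)) * (A - B))
        / ((a i t - b i t) * (a i t - b i t))) (at t within {0..})"
    unfolding A_def B_def
    by (intro DERIV_divide DERIV_diff a' b' DERIV_chain2[OF f_deriv a'] DERIV_chain2[OF f_deriv b'] nz)
  then have "(\<psi>' i has_real_derivative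
      ((deriv f (a i t) * A - deriv f (b i t) * B) * (a i t - b i t) - (f (a i t) - f (b i t)) * (A - B))
        / ((a i t - b i t) * (a i t - b i t))) (at t within {0..})"
    by (rule has_field_derivative_transform_within[of _ _ _ _ 1]) (use t i psi'_eq in \<open>auto simp: divide_inverse\<close>)
  moreover have "((deriv f (a i t) * A - deriv f (b i t) * B) * (a i t - b i t) - (f (a i t) - f (b i t)) * (A - B))
        / ((a i t - b i t) * (a i t - b i t)) = rt.E t * Q1 i t + lf.E t * Q2 i t"
  proof -
    have ff: "f (a i t) - f (b i t) = \<psi>' i t * (a i t - b i t)"
      using psi'_eq[OF i t] nz by simp
    have num: "((deriv f (a i t) * A - deriv f (b i t) * B) * (a i t - b i t) - (f (a i t) - f (b i t)) * (A - B))
       = ((deriv f (a i t) - \<psi>' i t) * A + (\<psi>' i t - deriv f (b i t)) * B) * (a i t - b i t)"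
      unfolding ff by (simp add: algebra_simps)
    have gen: "n / (d * d) = K * inverse d" if "n = K * d" "d \<noteq> 0" for n K d :: real
      using that by (simp add: divide_inverse)
    have "((deriv f (a i t) - \<psi>' i t) * A + (\<psi>' i t - deriv f (b i t)) * B) * inverse (a i t - b i t)
        = rt.E t * Q1 i t + lf.E t * Q2 i t"
      unfolding Q1_def Q2_def A_def B_def distrib_right by (simp only: ac_simps)
    with gen[OF num nz] show ?thesis by (rule trans)
  qed
  ultimately show ?thesis by simp
qed

definition "lmax = max lamp lamm"

lemma psi'_decay_0: obtains c where "c \<ge> 0"
  "\<And>i t. i \<in> P \<Longrightarrow> 0 \<le> t \<Longrightarrow> \<bar>\<psi>' i t - \<sigma>\<bar> \<le> c * exp (lmax * t) * M0 i"
proof -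
  obtain K where K: "0 \<le> K" "\<And>a b a' b'. a \<in> Jp \<Longrightarrow> b \<in> Jm \<Longrightarrow> a' \<in> Jp \<Longrightarrow> b' \<in> Jm \<Longrightarrow>
     \<bar>slope a b - slope a' b'\<bar> \<le> K * (\<bar>a - a'\<bar> + \<bar>b - b'\<bar>)" by (rule slope_lip) (rule that)
  obtain d1 where d1: "d1 \<ge> 0" "\<And>i z e. i \<in> P \<Longrightarrow> z \<in> {0..} \<Longrightarrow> 0 \<le> e \<Longrightarrow> e \<le> 1 \<Longrightarrow> \<bar>rt.U i e z - up\<bar> \<le> d1 * (e * M0 i)"
    by (rule rt.U_le) (rule that)
  obtain d2 where d2: "d2 \<ge> 0" "\<And>i z e. i \<in> P \<Longrightarrow> z \<in> {..0} \<Longrightarrow> 0 \<le> e \<Longrightarrow> e \<le> 1 \<Longrightarrow> \<bar>lf.U i e z - um\<bar> \<le> d2 * (e * M0 i)"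
    by (rule lf.U_le) (rule that)
  have sig: "slope up um = \<sigma>" using RH ne[OF up_Ip um_Im] by (simp add: slope_def)
  show ?thesis
  proof (rule that[of "K * (d1 + d2)"])
    fix i t assume i: "i \<in> P" and t: "0 \<le> (t::real)"
    have m0: "0 \<le> M0 i" by (rule rt.M0_nonneg[OF i])
    have ee: "rt.E t \<le> exp (lmax * t)" "lf.E t \<le> exp (lmax * t)"
      using t by (auto simp: rt.E_def lf.E_def lmax_def intro!: mult_right_mono)
    have 1: "\<bar>a i t - up\<bar> \<le> d1 * (exp (lmax * t) * M0 i)"
    proof -
      have "\<bar>a i t - up\<bar> \<le> d1 * (rt.E t * M0 i)" by (rule d1(2)[OF i rc.zeta_T[OF i t]]) (use rt.E_range[OF t] in auto)
      also have "\<dots> \<le> d1 * (exp (lmax * t) * M0 i)" using ee m0 d1(1) by (intro mult_left_mono mult_right_mono) auto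
      finally show ?thesis .
    qed
    have 2: "\<bar>b i t - um\<bar> \<le> d2 * (exp (lmax * t) * M0 i)"
    proof -
      have "\<bar>b i t - um\<bar> \<le> d2 * (lf.E t * M0 i)" by (rule d2(2)[OF i lc.zeta_T[OF i t]]) (use lf.E_range[OF t] in auto)
      also have "\<dots> \<le> d2 * (exp (lmax * t) * M0 i)" using ee m0 d2(1) by (intro mult_left_mono mult_right_mono) auto
      finally show ?thesis .
    qed
    have "\<bar>\<psi>' i t - \<sigma>\<bar> = \<bar>slope (a i t) (b i t) - slope up um\<bar>" by (simp add: \<psi>'_def a_eq[OF i t] b_eq[OF i t] sig)
    also have "\<dots> \<le> K * (\<bar>a i t - up\<bar> + \<bar>b i t - um\<bar>)" by (rule K(2)[OF a_Ip[OF i t] b_Im[OF i t] up_Ip um_Im])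
    also have "\<dots> \<le> K * (d1 * (exp (lmax * t) * M0 i) + d2 * (exp (lmax * t) * M0 i))"
      using 1 2 K(1) by (intro mult_left_mono add_mono) auto
    finally show "\<bar>\<psi>' i t - \<sigma>\<bar> \<le> K * (d1 + d2) * exp (lmax * t) * M0 i" by (simp add: algebra_simps)
  qed (use K d1 d2 in auto)
qed

text \<open>
The exponentials are differentiated as well, but they return multiples of themselves (\<open>exp_decay\<close>).
\<close>

lemma psi'_decay_Suc: obtains c where "c \<ge> 0"
  "\<And>i t j. i \<in> P \<Longrightarrow> 0 \<le> t \<Longrightarrow> j < k \<Longrightarrow> \<bar>nderiv {0..} (Suc j) (\<lambda>s. \<psi>' i s - \<sigma>) t\<bar> \<le> c * exp (lmax * t) * (M i * N i j)"
proof -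
  obtain c1 where c1: "c1 \<ge> 0" "\<And>i. i \<in> P \<Longrightarrow> 0 \<le> M i" "\<And>i. i \<in> P \<Longrightarrow> WB (k - 1) (\<lambda>j. c1 * (M i * N i j)) {0..} (Q1 i)"
    by (rule rt.UB_E[OF Q_UB(1)]) (rule that)
  obtain c2 where c2: "c2 \<ge> 0" "\<And>i. i \<in> P \<Longrightarrow> 0 \<le> M i" "\<And>i. i \<in> P \<Longrightarrow> WB (k - 1) (\<lambda>j. c2 * (M i * N i j)) {0..} (Q2 i)"
    by (rule rt.UB_E[OF Q_UB(2)]) (rule that)
  define d where "d = (1 + \<bar>lamp\<bar>) ^ k * c1 + (1 + \<bar>lamm\<bar>) ^ k * c2"
  show ?thesis
  proof (rule that[of d])
    show "0 \<le> d" using c1 c2 by (simp add: d_def)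
    fix i and t :: real and j assume i: "i \<in> P" and t: "0 \<le> t" and j: "j < k"
    have tt: "t \<in> {0..}" using t by simp
    have MN: "0 \<le> M i * N i j'" for j' using c1(2)[OF i] rt.N_nonneg[OF i] by simp
    have MNm: "M i * N i j' \<le> M i * N i (Suc j')" for j'
      using c1(2)[OF i] rt.N_mono[OF i, of j' "Suc j'"] by (intro mult_left_mono) auto
    have j': "j \<le> k - 1" using j by simp
    have "nderiv {0..} (Suc j) (\<lambda>s. \<psi>' i s - \<sigma>) t = nderiv {0..} j (\<lambda>s. rt.E s * Q1 i s + lf.E s * Q2 i s) t"
    proof (rule nderiv_Suc_eq[OF nondegenerate_halfline(1) tt])
      show "((\<lambda>s. \<psi>' i s - \<sigma>) has_real_derivative rt.E y * Q1 i y + lf.E y * Q2 i y) (at y within {0..})" if "y \<in> {0..}" for y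
        using DERIV_diff[OF psi''_deriv[OF i, of y] DERIV_const[of \<sigma>]] that by simp
    qed
    also have "\<dots> = nderiv {0..} j (\<lambda>s. rt.E s * Q1 i s) t + nderiv {0..} j (\<lambda>s. lf.E s * Q2 i s) t"
    proof -
      have U1: "rt.UB (k - 1) M S0 (\<lambda>i s. rt.E s * Q1 i s)" by (rule rt.UB1_mult_UB[OF rc.crv.E_UB1 Q_UB(1)])
      have U2: "rt.UB (k - 1) M S0 (\<lambda>i s. lf.E s * Q2 i s)" by (rule rt.UB1_mult_UB[OF lc.crv.E_UB1 Q_UB(2)])
      obtain N1 where N1: "WB (k - 1) N1 {0..} (\<lambda>s. rt.E s * Q1 i s)" using U1 i unfolding rt.UB_def by blast
      obtain N2 where N2: "WB (k - 1) N2 {0..} (\<lambda>s. lf.E s * Q2 i s)" using U2 i unfolding rt.UB_def by blast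
      show ?thesis by (rule nderiv_add[OF nondegenerate_halfline(1) tt N1 N2 j'])
    qed
    finally have eq: "nderiv {0..} (Suc j) (\<lambda>s. \<psi>' i s - \<sigma>) t
        = nderiv {0..} j (\<lambda>s. rt.E s * Q1 i s) t + nderiv {0..} j (\<lambda>s. lf.E s * Q2 i s) t" .
    have pw: "(1 + \<bar>l\<bar>) ^ j \<le> (1 + \<bar>l\<bar>) ^ k" for l :: real using j by (intro power_increasing) auto
    have "\<bar>nderiv {0..} j (\<lambda>s. rt.E s * Q1 i s) t\<bar> \<le> exp (lamp * t) * ((1 + \<bar>lamp\<bar>) ^ j * (c1 * (M i * N i j)))"
      unfolding rt.E_def by (rule exp_decay[OF c1(3)[OF i] _ _ j' t]) (use c1(1) MN MNm in \<open>auto intro: mult_left_mono\<close>)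
    also have "\<dots> \<le> exp (lmax * t) * ((1 + \<bar>lamp\<bar>) ^ k * (c1 * (M i * N i j)))"
      using t pw[of lamp] MN[of j] c1(1) by (intro mult_mono mult_right_mono) (auto simp: lmax_def intro!: mult_right_mono)
    finally have 1: "\<bar>nderiv {0..} j (\<lambda>s. rt.E s * Q1 i s) t\<bar> \<le> exp (lmax * t) * ((1 + \<bar>lamp\<bar>) ^ k * (c1 * (M i * N i j)))" .
    have "\<bar>nderiv {0..} j (\<lambda>s. lf.E s * Q2 i s) t\<bar> \<le> exp (lamm * t) * ((1 + \<bar>lamm\<bar>) ^ j * (c2 * (M i * N i j)))"
      unfolding lf.E_def by (rule exp_decay[OF c2(3)[OF i] _ _ j' t]) (use c2(1) MN MNm in \<open>auto intro: mult_left_mono\<close>)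
    also have "\<dots> \<le> exp (lmax * t) * ((1 + \<bar>lamm\<bar>) ^ k * (c2 * (M i * N i j)))"
      using t pw[of lamm] MN[of j] c2(1) by (intro mult_mono mult_right_mono) (auto simp: lmax_def intro!: mult_right_mono)
    finally have 2: "\<bar>nderiv {0..} j (\<lambda>s. lf.E s * Q2 i s) t\<bar> \<le> exp (lmax * t) * ((1 + \<bar>lamm\<bar>) ^ k * (c2 * (M i * N i j)))" .
    show "\<bar>nderiv {0..} (Suc j) (\<lambda>s. \<psi>' i s - \<sigma>) t\<bar> \<le> d * exp (lmax * t) * (M i * N i j)"
      unfolding eq d_def using 1 2 abs_triangle_ineq[of "nderiv {0..} j (\<lambda>s. rt.E s * Q1 i s) t" "nderiv {0..} j (\<lambda>s. lf.E s * Q2 i s) t"]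
      by (simp add: algebra_simps)
  qed
qed

lemma psi_Ck: assumes i: "i \<in> P" shows "Ck_on (k + 1) {0..} (\<psi> i)"
proof -
  obtain k' where k': "k = Suc k'" using rt.k2 by (cases k) auto
  have U: "rt.UB (k - 1) M S0 (\<lambda>i s. rt.E s * Q1 i s + lf.E s * Q2 i s)"
    by (intro rt.UB_add rt.UB1_mult_UB[OF rc.crv.E_UB1 Q_UB(1)] rt.UB1_mult_UB[OF lc.crv.E_UB1 Q_UB(2)])
  obtain N1 where N1: "WB (k - 1) N1 {0..} (\<lambda>s. rt.E s * Q1 i s + lf.E s * Q2 i s)" using U i unfolding rt.UB_def by blast
  have "Ck_on (k - 1) {0..} (\<lambda>s. rt.E s * Q1 i s + lf.E s * Q2 i s)"
    by (rule WB_Ck_on[OF nondegenerate_halfline(1) N1])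
  then have "Ck_on (Suc (k - 1)) {0..} (\<psi>' i)"
    by (rule Ck_on_within_SucI[OF nondegenerate_halfline(1) psi''_deriv[OF i], rotated]) auto
  then have "Ck_on (Suc (Suc (k - 1))) {0..} (\<psi> i)"
    by (rule Ck_on_within_SucI[OF nondegenerate_halfline(1) psi_deriv[OF i], rotated]) auto
  then show ?thesis using k' by simp
qed

lemma psi_cont: assumes i: "i \<in> P" shows "continuous_on {0..} (\<psi> i)"
  by (rule DERIV_continuous_on[OF psi_deriv[OF i]]) auto

lemma nderiv_psi: assumes i: "i \<in> P" and t: "0 \<le> t"
  shows "nderiv {0..} j (\<lambda>s. nderiv {0..} 1 (\<psi> i) s - \<sigma>) t = nderiv {0..} j (\<lambda>s. \<psi>' i s - \<sigma>) t"
proof -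
  have "nderiv {0..} 1 (\<psi> i) s = \<psi>' i s" if "0 \<le> s" for s
  proof -
    have "nderiv {0..} (Suc 0) (\<psi> i) s = nderiv {0..} 0 (\<psi>' i) s"
      by (rule nderiv_Suc_eq[OF nondegenerate_halfline(1)]) (use that psi_deriv[OF i] in auto)
    then show ?thesis by (simp add: nderiv_def)
  qed
  then show ?thesis unfolding nderiv_def[of _ j] by (intro iter_pderiv_cong) (use t in auto)
qed

definition "usol i p = (if \<psi> i (fst p) < snd p then rt.sol i p else lf.sol i p)"

lemma usol_BUC: assumes i: "i \<in> P" shows "BUC k (Omega (\<psi> i)) (usol i)"
  unfolding BUC_def components_Omega[OF psi_cont[OF i]]
proof
  fix C assume "C \<in> {upper (\<psi> i), lower (\<psi> i)}"
  then consider "C = upper (\<psi> i)" | "C = lower (\<psi> i)" by auto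
  then show "Ck_on k C (usol i) \<and> (\<forall>bs\<in>lists Basis. length bs \<le> k \<longrightarrow>
      bounded (iter_pderiv C bs (usol i) ` C) \<and> uniformly_continuous_on C (iter_pderiv C bs (usol i)))"
  proof cases
    case 1
    have "BU k (upper (\<psi> i)) (usol i)"
      by (rule BU_cong[OF rr.sol_BU[OF i]]) (auto simp: usol_def upper_def)
    then show ?thesis unfolding 1 by (rule BU_component[OF nondegenerate_upper(1)[OF psi_cont[OF i]]])
  next
    case 2
    have "BU k (lower (\<psi> i)) (usol i)"
      by (rule BU_cong[OF lr.sol_BU[OF i]]) (auto simp: usol_def lower_def)
    then show ?thesis unfolding 2 by (rule BU_component[OF nondegenerate_upper(2)[OF psi_cont[OF i]]])
  qed
qed

lemma usol_entropy:
  assumes i: "i \<in> P" and u0: "\<And>x. x \<noteq> \<psi>0 i \<Longrightarrow> u0 x = usol i (0, x)"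
  shows "entropy_solution f g u0 (usol i)"
proof -
  have bas: "(1, 0) \<in> (Basis :: (real \<times> real) set)" "(0, 1) \<in> (Basis :: (real \<times> real) set)"
    by (auto simp: Basis_prod_def)
  obtain A1 where A1: "\<And>i p. i \<in> P \<Longrightarrow> p \<in> upper (\<psi> i) \<Longrightarrow> \<bar>rt.E (fst p) * rr.reg.Y i p (1, 0)\<bar> \<le> A1"
    by (rule rr.Y_bounded[OF bas(1)]) (rule that)
  obtain A2 where A2: "\<And>i p. i \<in> P \<Longrightarrow> p \<in> upper (\<psi> i) \<Longrightarrow> \<bar>rt.E (fst p) * rr.reg.Y i p (0, 1)\<bar> \<le> A2"
    by (rule rr.Y_bounded[OF bas(2)]) (rule that)
  obtain A3 where A3: "\<And>i p. i \<in> P \<Longrightarrow> p \<in> lower (\<psi> i) \<Longrightarrow> \<bar>lf.E (fst p) * lr.reg.Y i p (1, 0)\<bar> \<le> A3"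
    by (rule lr.Y_bounded[OF bas(1)]) (rule that)
  obtain A4 where A4: "\<And>i p. i \<in> P \<Longrightarrow> p \<in> lower (\<psi> i) \<Longrightarrow> \<bar>lf.E (fst p) * lr.reg.Y i p (0, 1)\<bar> \<le> A4"
    by (rule lr.Y_bounded[OF bas(2)]) (rule that)
  define A where "A = max (max (max A1 A2) (max A3 A4)) (max Cs (max (\<bar>up\<bar> + rp) (\<bar>um\<bar> + rm)))"
  have A: "A1 \<le> A" "A2 \<le> A" "A3 \<le> A" "A4 \<le> A" "Cs \<le> A" "\<bar>up\<bar> + rp \<le> A" "\<bar>um\<bar> + rm \<le> A"
    unfolding A_def by (simp_all add: le_max_iff_disj)
  have ru: "{p. 0 < fst p \<and> \<psi> i (fst p) < snd p} \<subseteq> upper (\<psi> i)" by (auto simp: upper_def)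
  have lu: "{p. 0 < fst p \<and> snd p < \<psi> i (fst p)} \<subseteq> lower (\<psi> i)" by (auto simp: lower_def)
  have interior: "at p within upper (\<psi> i) = at p" if "0 < fst p" "\<psi> i (fst p) < snd p" for p
  proof (rule at_within_interior)
    have W: "open ({0::real<..} \<times> (UNIV :: real set))" by (intro open_Times) auto
    have c: "continuous_on ({0<..} \<times> UNIV) (\<lambda>p. snd p - \<psi> i (fst p))"
      by (intro continuous_intros continuous_on_compose2[OF psi_cont[OF i]]) auto
    have "open (({0<..} \<times> UNIV) \<inter> (\<lambda>p. snd p - \<psi> i (fst p)) -` {0<..})"
      by (rule continuous_open_preimage[OF c W]) auto
    moreover have "({0<..} \<times> UNIV) \<inter> (\<lambda>p. snd p - \<psi> i (fst p)) -` {0<..} \<subseteq> upper (\<psi> i)" by (auto simp: upper_def)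
    ultimately show "p \<in> interior (upper (\<psi> i))" using that by (intro interiorI[of _ p]) (auto simp: mem_Times_iff)
  qed
  have interior': "at p within lower (\<psi> i) = at p" if "0 < fst p" "snd p < \<psi> i (fst p)" for p
  proof (rule at_within_interior)
    have W: "open ({0::real<..} \<times> (UNIV :: real set))" by (intro open_Times) auto
    have c: "continuous_on ({0<..} \<times> UNIV) (\<lambda>p. snd p - \<psi> i (fst p))"
      by (intro continuous_intros continuous_on_compose2[OF psi_cont[OF i]]) auto
    have "open (({0<..} \<times> UNIV) \<inter> (\<lambda>p. snd p - \<psi> i (fst p)) -` {..<0})"
      by (rule continuous_open_preimage[OF c W]) auto
    moreover have "({0<..} \<times> UNIV) \<inter> (\<lambda>p. snd p - \<psi> i (fst p)) -` {..<0} \<subseteq> lower (\<psi> i)" by (auto simp: lower_def)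
    ultimately show "p \<in> interior (lower (\<psi> i))" using that by (intro interiorI[of _ p]) (auto simp: mem_Times_iff)
  qed
  interpret ps: piecewise_solution f "deriv f" g "\<psi> i" "\<psi>' i" "rt.sol i"
    "\<lambda>p. rt.E (fst p) * rr.reg.Y i p (1, 0)" "\<lambda>p. rt.E (fst p) * rr.reg.Y i p (0, 1)" "lf.sol i"
    "\<lambda>p. lf.E (fst p) * lr.reg.Y i p (1, 0)" "\<lambda>p. lf.E (fst p) * lr.reg.Y i p (0, 1)" A
  proof
    show "(f has_real_derivative deriv f x) (at x)" for x by (rule f_deriv)
    show "continuous_on UNIV (deriv f)" "continuous_on UNIV g"
      using Ck_on_continuous[OF f'_Ck] Ck_on_continuous[OF g_Ck] by auto
    show "(\<psi> i has_real_derivative \<psi>' i t) (at t)" if "0 < t" for t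
    proof -
      have "at t within {0..} = at t" using that by (intro at_within_interior) auto
      then show ?thesis using psi_deriv[OF i, of t] that by simp
    qed
    show "continuous_on {0<..} (\<psi>' i)"
      by (rule continuous_on_subset[OF DERIV_continuous_on[OF psi''_deriv[OF i]]]) auto
    show "continuous_on {0..} (\<psi> i)" by (rule psi_cont[OF i])
    show "continuous_on ({0..} \<times> UNIV) (rt.sol i)" "continuous_on ({0..} \<times> UNIV) (lf.sol i)"
      by (rule rt.sol_cont[OF i] lf.sol_cont[OF i])+
    show "(rt.sol i has_derivative (\<lambda>d. rt.E (fst p) * rr.reg.Y i p (1, 0) * fst d + rt.E (fst p) * rr.reg.Y i p (0, 1) * snd d)) (at p)"
      if p: "0 < fst p" "\<psi> i (fst p) < snd p" for p
    proof -
      have "(rt.sol i has_derivative (\<lambda>d. rt.E (fst p) * rr.reg.Y i p d)) (at p within upper (\<psi> i))"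
        by (rule rr.sol_deriv[OF i]) (use p in \<open>auto simp: upper_def\<close>)
      then show ?thesis unfolding interior[OF p]
      proof (rule has_derivative_eq_rhs, intro ext)
        fix d :: "real \<times> real"
        show "rt.E (fst p) * rr.reg.Y i p d = rt.E (fst p) * rr.reg.Y i p (1, 0) * fst d + rt.E (fst p) * rr.reg.Y i p (0, 1) * snd d"
          unfolding rr.Y_linear[of i p d] by (simp add: algebra_simps)
      qed
    qed
    show "(lf.sol i has_derivative (\<lambda>d. lf.E (fst p) * lr.reg.Y i p (1, 0) * fst d + lf.E (fst p) * lr.reg.Y i p (0, 1) * snd d)) (at p)"
      if p: "0 < fst p" "snd p < \<psi> i (fst p)" for p
    proof -
      have "(lf.sol i has_derivative (\<lambda>d. lf.E (fst p) * lr.reg.Y i p d)) (at p within lower (\<psi> i))"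
        by (rule lr.sol_deriv[OF i]) (use p in \<open>auto simp: lower_def\<close>)
      then show ?thesis unfolding interior'[OF p]
      proof (rule has_derivative_eq_rhs, intro ext)
        fix d :: "real \<times> real"
        show "lf.E (fst p) * lr.reg.Y i p d = lf.E (fst p) * lr.reg.Y i p (1, 0) * fst d + lf.E (fst p) * lr.reg.Y i p (0, 1) * snd d"
          unfolding lr.Y_linear[of i p d] by (simp add: algebra_simps)
      qed
    qed
    show "continuous_on {p. 0 < fst p \<and> \<psi> i (fst p) < snd p} (\<lambda>p. rt.E (fst p) * rr.reg.Y i p (1, 0))"
      "continuous_on {p. 0 < fst p \<and> \<psi> i (fst p) < snd p} (\<lambda>p. rt.E (fst p) * rr.reg.Y i p (0, 1))"
      "continuous_on {p. 0 < fst p \<and> snd p < \<psi> i (fst p)} (\<lambda>p. lf.E (fst p) * lr.reg.Y i p (1, 0))"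
      "continuous_on {p. 0 < fst p \<and> snd p < \<psi> i (fst p)} (\<lambda>p. lf.E (fst p) * lr.reg.Y i p (0, 1))"
      by (rule continuous_on_subset[OF rr.Y_cont[OF i bas(1)] ru] continuous_on_subset[OF rr.Y_cont[OF i bas(2)] ru]
          continuous_on_subset[OF lr.Y_cont[OF i bas(1)] lu] continuous_on_subset[OF lr.Y_cont[OF i bas(2)] lu])+
    show "rt.E (fst p) * rr.reg.Y i p (1, 0) + deriv f (rt.sol i p) * (rt.E (fst p) * rr.reg.Y i p (0, 1)) = g (rt.sol i p)"
      if "0 < fst p" "\<psi> i (fst p) < snd p" for p
      by (rule rr.sol_pde[OF i]) (use that in \<open>auto simp: upper_def\<close>)
    show "lf.E (fst p) * lr.reg.Y i p (1, 0) + deriv f (lf.sol i p) * (lf.E (fst p) * lr.reg.Y i p (0, 1)) = g (lf.sol i p)"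
      if "0 < fst p" "snd p < \<psi> i (fst p)" for p
      by (rule lr.sol_pde[OF i]) (use that in \<open>auto simp: lower_def\<close>)
    show "\<bar>rt.sol i p\<bar> \<le> A \<and> \<bar>lf.sol i p\<bar> \<le> A" if "0 \<le> fst p" for p
      using rt.sol_range[OF i that] lf.sol_range[OF i that] A(6,7) by (auto simp: abs_le_iff)
    show "\<bar>rt.E (fst p) * rr.reg.Y i p (1, 0)\<bar> \<le> A \<and> \<bar>rt.E (fst p) * rr.reg.Y i p (0, 1)\<bar> \<le> A"
      if "0 < fst p" "\<psi> i (fst p) < snd p" for p
      using A1[OF i, of p] A2[OF i, of p] A(1,2) ru that by fastforce
    show "\<bar>lf.E (fst p) * lr.reg.Y i p (1, 0)\<bar> \<le> A \<and> \<bar>lf.E (fst p) * lr.reg.Y i p (0, 1)\<bar> \<le> A"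
      if "0 < fst p" "snd p < \<psi> i (fst p)" for p
      using A3[OF i, of p] A4[OF i, of p] A(3,4) lu that by fastforce
    show "\<bar>\<psi>' i t\<bar> \<le> A" if "0 < t" for t
      unfolding \<psi>'_def
      by (rule order_trans[OF Cs[OF rI[OF i less_imp_le[OF that]] lI[OF i less_imp_le[OF that]]] A(5)])
    show "sgn (rt.sol i (t, \<psi> i t) - \<kappa>) * (f (rt.sol i (t, \<psi> i t)) - f \<kappa> - \<psi>' i t * (rt.sol i (t, \<psi> i t) - \<kappa>))
      \<le> sgn (lf.sol i (t, \<psi> i t) - \<kappa>) * (f (lf.sol i (t, \<psi> i t)) - f \<kappa> - \<psi>' i t * (lf.sol i (t, \<psi> i t) - \<kappa>))"
      if "0 < t" for t \<kappa>
    proof (rule Oleinik_entropy_jump)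
      have r: "rt.sol i (t, \<psi> i t) \<in> Jp" and l: "lf.sol i (t, \<psi> i t) \<in> Jm" using rI[OF i] lI[OF i] that by auto
      show "f (rt.sol i (t, \<psi> i t)) - f (lf.sol i (t, \<psi> i t)) = \<psi>' i t * (rt.sol i (t, \<psi> i t) - lf.sol i (t, \<psi> i t))"
        unfolding \<psi>'_def by (rule slope_eq[OF r l])
      show "0 \<le> (f \<kappa>' - f (lf.sol i (t, \<psi> i t)) - \<psi>' i t * (\<kappa>' - lf.sol i (t, \<psi> i t))) * (rt.sol i (t, \<psi> i t) - lf.sol i (t, \<psi> i t))"
        if "lf.sol i (t, \<psi> i t) \<le> \<kappa>' \<and> \<kappa>' \<le> rt.sol i (t, \<psi> i t) \<or> rt.sol i (t, \<psi> i t) \<le> \<kappa>' \<and> \<kappa>' \<le> lf.sol i (t, \<psi> i t)" for \<kappa>'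
        unfolding \<psi>'_def slope_def by (rule Ol[OF r l that])
    qed
  qed
  have "usol i = ps.sol" by (auto simp: fun_eq_iff usol_def ps.sol_def)
  then show ?thesis using ps.entropy_solution_sol[of u0] u0 psi_0[OF i] by simp
qed

end

section \<open>Stability of the shock\<close>

text \<open>
Continuity of the chord slope and of \<open>f'\<close>; the second bound on \<open>\<delta>\<close> keeps the two states apart.
\<close>

lemma Lax_perturbation:
  fixes f f' :: "real \<Rightarrow> real"
  assumes f: "\<And>x. (f has_real_derivative f' x) (at x)" and f'c: "continuous_on UNIV f'"
    and ne: "up \<noteq> um" and RH: "f up - f um = \<sigma> * (up - um)"
    and Lax: "f' up < \<sigma>" "\<sigma> < f' um"
  obtains \<delta> where "0 < \<delta>" "\<delta> \<le> \<bar>up - um\<bar> / 4"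
    "\<And>a a' b b'. \<bar>a - up\<bar> \<le> \<delta> \<Longrightarrow> \<bar>a' - up\<bar> \<le> \<delta> \<Longrightarrow> \<bar>b - um\<bar> \<le> \<delta> \<Longrightarrow> \<bar>b' - um\<bar> \<le> \<delta> \<Longrightarrow>
       f' a' < (f a - f b) / (a - b) \<and> (f a - f b) / (a - b) < f' b'"
proof -
  define m1 where "m1 = (f' up + \<sigma>) / 2"
  define m2 where "m2 = (\<sigma> + f' um) / 2"
  have m: "f' up < m1" "m1 < \<sigma>" "\<sigma> < m2" "m2 < f' um" using Lax by (auto simp: m1_def m2_def)
  let ?G = "\<lambda>p. (f (fst p) - f (snd p)) / (fst p - snd p)"
  have fc: "isCont f x" for x by (rule DERIV_isCont[OF f])
  have "isCont ?G (up, um)"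
    using ne by (intro continuous_intros isCont_o2[OF _ fc]) auto
  then have G: "(?G \<longlongrightarrow> \<sigma>) (nhds (up, um))"
    using RH ne tendsto_at_iff_tendsto_nhds[of ?G "(up, um)"] by (simp add: isCont_def)
  have "eventually (\<lambda>p. m1 < ?G p \<and> ?G p < m2) (nhds (up, um))"
    using order_tendstoD(1)[OF G m(2)] order_tendstoD(2)[OF G m(3)] by (rule eventually_conj)
  then obtain d1 where d1: "0 < d1" "\<And>p. dist p (up, um) < d1 \<Longrightarrow> m1 < ?G p \<and> ?G p < m2"
    unfolding eventually_nhds_metric by auto
  have f't: "(f' \<longlongrightarrow> f' x) (nhds x)" for x
    using f'c tendsto_at_iff_tendsto_nhds[of f' x] by (simp add: continuous_on_eq_continuous_at isCont_def)
  obtain d2 where d2: "0 < d2" "\<And>x. dist x up < d2 \<Longrightarrow> f' x < m1"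
    using order_tendstoD(2)[OF f't m(1)] unfolding eventually_nhds_metric by auto
  obtain d3 where d3: "0 < d3" "\<And>x. dist x um < d3 \<Longrightarrow> m2 < f' x"
    using order_tendstoD(1)[OF f't m(4)] unfolding eventually_nhds_metric by auto
  define \<delta> where "\<delta> = min (\<bar>up - um\<bar> / 4) (min (d1 / 4) (min (d2 / 2) (d3 / 2)))"
  have \<delta>: "0 < \<delta>" "\<delta> \<le> \<bar>up - um\<bar> / 4" "\<delta> \<le> d1 / 4" "\<delta> \<le> d2 / 2" "\<delta> \<le> d3 / 2"
  proof -
    show "0 < \<delta>" using d1(1) d2(1) d3(1) ne by (simp add: \<delta>_def)
    show "\<delta> \<le> \<bar>up - um\<bar> / 4" unfolding \<delta>_def by (rule min.cobounded1)
    show "\<delta> \<le> d1 / 4" unfolding \<delta>_def by (rule min.coboundedI2[OF min.cobounded1])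
    show "\<delta> \<le> d2 / 2" unfolding \<delta>_def by (rule min.coboundedI2[OF min.coboundedI2[OF min.cobounded1]])
    show "\<delta> \<le> d3 / 2" unfolding \<delta>_def by (rule min.coboundedI2[OF min.coboundedI2[OF min.cobounded2]])
  qed
  show ?thesis
  proof (rule that[OF \<delta>(1,2)])
    fix a a' b b' assume A: "\<bar>a - up\<bar> \<le> \<delta>" "\<bar>a' - up\<bar> \<le> \<delta>" "\<bar>b - um\<bar> \<le> \<delta>" "\<bar>b' - um\<bar> \<le> \<delta>"
    have "dist (a, b) (up, um) \<le> \<bar>a - up\<bar> + \<bar>b - um\<bar>"
      using norm_Pair_le[of "a - up" "b - um"] by (simp add: dist_norm)
    then have "dist (a, b) (up, um) < d1" using A \<delta> d1(1) by linarith
    from d1(2)[OF this] have 1: "m1 < (f a - f b) / (a - b)" "(f a - f b) / (a - b) < m2" by auto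
    have 2: "f' a' < m1" by (rule d2(2)) (use A \<delta> d2(1) in \<open>simp add: dist_real_def\<close>)
    have 3: "m2 < f' b'" by (rule d3(2)) (use A \<delta> d3(1) in \<open>simp add: dist_real_def\<close>)
    show "f' a' < (f a - f b) / (a - b) \<and> (f a - f b) / (a - b) < f' b'" using 1 2 3 by linarith
  qed
qed

text \<open>
The conditions on a family of data under which the construction on one side works; the smallness
parameter \<open>\<epsilon>\<close> concerns \<open>v\<close> and \<open>v'\<close> only.
\<close>

locale side_data = weights P N L for P :: "'i set" and N :: "'i \<Rightarrow> nat \<Rightarrow> real" and L :: real +
  fixes k :: nat and \<epsilon> :: real and T :: "real set" and v v' :: "'i \<Rightarrow> real \<Rightarrow> real" and M M0 :: "'i \<Rightarrow> real"
    and \<pi> :: "real \<Rightarrow> real"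
  assumes d_deriv: "\<And>i z. i \<in> P \<Longrightarrow> z \<in> T \<Longrightarrow> (v i has_real_derivative v' i z) (at z within T)"
    and d_UB: "UB (k - 1) M (\<lambda>_. T) v'"
    and d_uc: "\<And>i. i \<in> P \<Longrightarrow> uniformly_continuous_on T (v i)"
    and d_bound: "\<And>i z. i \<in> P \<Longrightarrow> z \<in> T \<Longrightarrow> \<bar>v i z\<bar> \<le> M0 i"
    and d_M0_le: "\<And>i. i \<in> P \<Longrightarrow> M0 i \<le> M i" and d_M0_nonneg: "\<And>i. i \<in> P \<Longrightarrow> 0 \<le> M0 i"
    and d_M_le: "\<And>i. i \<in> P \<Longrightarrow> M i \<le> 1"
    and d_small: "\<And>i z. i \<in> P \<Longrightarrow> z \<in> T \<Longrightarrow> \<bar>v i z\<bar> \<le> \<epsilon>"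
    and d_small': "\<And>i z. i \<in> P \<Longrightarrow> z \<in> T \<Longrightarrow> \<bar>v' i z\<bar> \<le> \<epsilon>"
    and d_pi_T: "\<And>z. \<pi> z \<in> T" and d_pi_id: "\<And>z. z \<in> T \<Longrightarrow> \<pi> z = z"
    and d_pi_lip: "\<And>z z'. \<bar>\<pi> z - \<pi> z'\<bar> \<le> \<bar>z - z'\<bar>"
    and d_convex: "convex T"

text \<open>
The functions provided by \<open>straightening\<close> and \<open>\<epsilon>\<close> are fixed before the family of data. Smallness of \<open>v\<close>
keeps the values in the domain of the coordinate, smallness of \<open>v'\<close> makes the Jacobian close to \<open>1\<close>.
\<close>

lemma side_construction:
  fixes f g :: "real \<Rightarrow> real" and u :: real
  assumes k: "k \<ge> 2" and f: "Ck_on (k + 1) UNIV f" and g: "Ck_on k UNIV g"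
    and gu: "g u = 0" and neg: "deriv g u < 0" and r0: "r0 > 0"
  obtains r \<rho> h h' q q' \<beta> \<beta>' \<epsilon> where "0 < r" "r \<le> r0" "0 < \<epsilon>"
    "\<And>(P::'i set) N L T v v' M M0 \<pi>. side_data P N L k \<epsilon> T v v' M M0 \<pi> \<Longrightarrow>
        side_global P N L k f g u r \<rho> (deriv g u) h h' q q' \<beta> \<beta>' T v v' M M0 \<pi>"
proof -
  obtain r \<rho> h h' q q' \<beta> \<beta>' where
    r: "0 < r" "r \<le> r0" "0 < \<rho>"
    and h: "\<And>a. a \<in> {u - r..u + r} \<Longrightarrow> (h has_real_derivative h' a) (at a within {u - r..u + r})"
    "BU (k - 1) {u - r..u + r} h'"
    and \<beta>: "\<And>a. a \<in> {u - r..u + r} \<Longrightarrow> (\<beta> has_real_derivative \<beta>' a) (at a within {u - r..u + r})"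
    "BU (k - 1) {u - r..u + r} \<beta>'"
    and q: "\<And>y. y \<in> {-\<rho>..\<rho>} \<Longrightarrow> (q has_real_derivative q' y) (at y within {-\<rho>..\<rho>})"
    "BU (k - 1) {-\<rho>..\<rho>} q'"
    and qr: "\<And>y. y \<in> {-\<rho>..\<rho>} \<Longrightarrow> q y \<in> {u - r..u + r}"
    and hu: "h u = 0" and qh: "\<And>a. a \<in> {u - r..u + r} \<Longrightarrow> h a \<in> {-\<rho>..\<rho>} \<Longrightarrow> q (h a) = a"
    and ode: "\<And>y. y \<in> {-\<rho>..\<rho>} \<Longrightarrow> deriv g u * y * q' y = g (q y)"
    "\<And>a. a \<in> {u - r..u + r} \<Longrightarrow> \<beta>' a * g a = deriv f u - deriv f a"
    by (rule straightening[OF k f g gu neg r0]) (rule that)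
  obtain Ch where Ch: "Ch \<ge> 0" "\<And>x y. x \<in> {u - r..u + r} \<Longrightarrow> y \<in> {u - r..u + r} \<Longrightarrow> \<bar>h x - h y\<bar> \<le> Ch * \<bar>x - y\<bar>"
    "\<And>y. y \<in> {u - r..u + r} \<Longrightarrow> \<bar>h' y\<bar> \<le> Ch" by (rule lipschitz_of_BU[OF h]) (assumption, rule that)
  obtain Cq where Cq: "Cq \<ge> 0" "\<And>x y. x \<in> {-\<rho>..\<rho>} \<Longrightarrow> y \<in> {-\<rho>..\<rho>} \<Longrightarrow> \<bar>q x - q y\<bar> \<le> Cq * \<bar>x - y\<bar>"
    "\<And>y. y \<in> {-\<rho>..\<rho>} \<Longrightarrow> \<bar>q' y\<bar> \<le> Cq" by (rule lipschitz_of_BU[OF q]) (assumption, rule that)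
  obtain Cb where Cb: "Cb \<ge> 0" "\<And>x y. x \<in> {u - r..u + r} \<Longrightarrow> y \<in> {u - r..u + r} \<Longrightarrow> \<bar>\<beta> x - \<beta> y\<bar> \<le> Cb * \<bar>x - y\<bar>"
    "\<And>y. y \<in> {u - r..u + r} \<Longrightarrow> \<bar>\<beta>' y\<bar> \<le> Cb" by (rule lipschitz_of_BU[OF \<beta>]) (assumption, rule that)
  define D where "D = Cb + Cb * (Cq * Ch)"
  have D: "0 \<le> D" using Ch Cq Cb by (simp add: D_def)
  \<comment> \<open>The three bounds keep the states in the coordinate interval, \<open>h\<close> in the domain of \<open>q\<close>, and the Jacobian within \<open>1 / 2\<close> of \<open>1\<close>.\<close>
  define \<epsilon> where "\<epsilon> = min r (min (\<rho> / (Ch + 1)) (1 / (2 * (D + 1))))"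
  have e: "0 < \<epsilon>" "\<epsilon> \<le> r" "\<epsilon> \<le> \<rho> / (Ch + 1)" "\<epsilon> \<le> 1 / (2 * (D + 1))"
    using r Ch(1) D by (auto simp: \<epsilon>_def)
  have eh: "Ch * \<epsilon> \<le> \<rho>"
  proof -
    have "Ch * \<epsilon> \<le> (Ch + 1) * \<epsilon>" using e(1) by (simp add: algebra_simps)
    also have "\<dots> \<le> \<rho>" using e(3) Ch(1) by (simp add: field_simps)
    finally show ?thesis .
  qed
  have eD: "D * \<epsilon> \<le> 1 / 2"
  proof -
    have "D * \<epsilon> \<le> (D + 1) * \<epsilon>" using e(1) by (simp add: algebra_simps)
    also have "\<dots> \<le> 1 / 2" using e(4) D by (simp add: field_simps)
    finally show ?thesis .
  qed
  show ?thesis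
  proof (rule that[OF r(1,2) e(1)])
    fix P :: "'i set" and N L T v v' M M0 \<pi>
    assume "side_data P N L k \<epsilon> T v v' M M0 \<pi>"
    then interpret side_data P N L k \<epsilon> T v v' M M0 \<pi> .
    have range: "u + v i z \<in> {u - r..u + r} \<and> \<bar>h (u + v i z)\<bar> \<le> \<rho>" if iz: "i \<in> P" "z \<in> T" for i z
    proof -
      have s: "\<bar>v i z\<bar> \<le> \<epsilon>" by (rule d_small[OF iz])
      then have m: "u + v i z \<in> {u - r..u + r}" using e(2) by auto
      have "\<bar>h (u + v i z) - h u\<bar> \<le> Ch * \<bar>u + v i z - u\<bar>" by (rule Ch(2)[OF m]) (use r in auto)
      also have "\<dots> \<le> Ch * \<epsilon>" using s Ch(1) by (intro mult_left_mono) auto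
      finally show ?thesis using m eh hu by simp
    qed
    have jac: "\<bar>\<beta>' (u + v i z) * v' i z
         - \<beta>' (q (e' * h (u + v i z))) * (q' (e' * h (u + v i z)) * (e' * (h' (u + v i z) * v' i z)))\<bar> \<le> 1 / 2"
      if iz: "i \<in> P" "z \<in> T" and e': "0 \<le> e'" "e' \<le> 1" for i z e'
    proof -
      have s: "\<bar>v' i z\<bar> \<le> \<epsilon>" by (rule d_small'[OF iz])
      have m: "u + v i z \<in> {u - r..u + r}" "\<bar>h (u + v i z)\<bar> \<le> \<rho>" using range[OF iz] by auto
      have "\<bar>e' * h (u + v i z)\<bar> \<le> 1 * \<rho>" unfolding abs_mult using e' m by (intro mult_mono) auto
      then have w: "e' * h (u + v i z) \<in> {-\<rho>..\<rho>}" by auto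
      have 1: "\<bar>\<beta>' (u + v i z) * v' i z\<bar> \<le> Cb * \<epsilon>"
        unfolding abs_mult using Cb(3)[OF m(1)] s Cb(1) by (intro mult_mono) auto
      have "\<bar>\<beta>' (q (e' * h (u + v i z))) * (q' (e' * h (u + v i z)) * (e' * (h' (u + v i z) * v' i z)))\<bar>
          \<le> Cb * (Cq * (1 * (Ch * \<epsilon>)))"
        unfolding abs_mult
        using Cb(3)[OF qr[OF w]] Cq(3)[OF w] Ch(3)[OF m(1)] s e' Cb(1) Cq(1) Ch(1) e(1)
        by (intro mult_mono mult_nonneg_nonneg) auto
      then show ?thesis using 1 eD
          abs_triangle_ineq4[of "\<beta>' (u + v i z) * v' i z"
            "\<beta>' (q (e' * h (u + v i z))) * (q' (e' * h (u + v i z)) * (e' * (h' (u + v i z) * v' i z)))"]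
        by (simp add: D_def algebra_simps)
    qed
    show "side_global P N L k f g u r \<rho> (deriv g u) h h' q q' \<beta> \<beta>' T v v' M M0 \<pi>"
      by (intro side_global.intro side.intro side_axioms.intro side_global_axioms.intro;
          fact weights_axioms k f r neg h \<beta> q qr hu qh ode d_deriv d_UB d_uc d_bound d_M0_le d_M0_nonneg d_M_le
            range jac d_pi_T d_pi_id d_pi_lip d_convex)
  qed
qed

lemma norm_data_halfline:
  assumes k: "2 \<le> k" and H: "H = {0<..} \<or> H = {..<0}" and B: "BU k H v"
  shows "norm_data k H v"
proof -
  have o: "open H" using H by auto
  have "1 \<in> H \<or> - 1 \<in> H" using H by auto
  then have ne: "H \<noteq> {}" by auto
  obtain K where W: "WB k (\<lambda>_. K) H v" using B unfolding BU_def by auto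
  note nd = nondegenerate_open[OF o]
  show ?thesis
  proof
    show "\<exists>s. (s = 1 \<or> s = -1) \<and> (\<forall>r\<ge>0. x + s * r \<in> H)" if "x \<in> H" for x
      using H
    proof
      assume "H = {0<..}" then show ?thesis using that by (intro exI[of _ 1]) auto
    next
      assume "H = {..<0}" then show ?thesis using that by (intro exI[of _ "-1"]) auto
    qed
    show "(nderiv H l v has_real_derivative nderiv H (Suc l) v y) (at y)" if "l < k" "y \<in> H" for l y
      using nderiv_has_derivative[OF nd W that] at_within_open[OF that(2) o] by simp
    show "continuous_on H (nderiv H l v)" if "l \<le> k" for l by (rule nderiv_continuous[OF nd W that])
    show "\<exists>K. \<forall>l\<le>k. \<forall>y\<in>H. \<bar>nderiv H l v y\<bar> \<le> K"
      by (intro exI[of _ K] allI impI ballI) (rule nderiv_bound[OF nd W])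
  qed (use k o ne in auto)
qed

lemma nderiv_open_subset: "open H \<Longrightarrow> open S \<Longrightarrow> H \<subseteq> S \<Longrightarrow> x \<in> H \<Longrightarrow> nderiv H l v x = nderiv S l v x"
  unfolding nderiv_def by (rule iter_pderiv_open_subset)

lemma norm_data_punctured:
  assumes p: "norm_data k {0<..} v" and m: "norm_data k {..<0} v"
  shows "norm_data k (- {0}) v"
proof -
  interpret p: norm_data k "{0<..}" v by (rule p)
  interpret m: norm_data k "{..<0}" v by (rule m)
  have eqp: "nderiv {0<..} l v y = nderiv (- {0}) l v y" if "0 < y" for l y
    by (rule nderiv_open_subset) (use that in auto)
  have eqm: "nderiv {..<0} l v y = nderiv (- {0}) l v y" if "y < 0" for l y
    by (rule nderiv_open_subset) (use that in auto)
  have der: "(nderiv (- {0}) l v has_real_derivative nderiv (- {0}) (Suc l) v y) (at y)" if l: "l < k" and y: "y \<noteq> 0" for l y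
  proof (cases "0 < y")
    case True
    have "(nderiv {0<..} l v has_real_derivative nderiv (- {0}) (Suc l) v y) (at y)"
      using p.d[OF l, of y] eqp[OF True] True by simp
    then show ?thesis
      by (rule has_field_derivative_transform_within_open[where S="{0<..}"]) (use True eqp in auto)
  next
    case False
    then have y0: "y < 0" using y by simp
    have "(nderiv {..<0} l v has_real_derivative nderiv (- {0}) (Suc l) v y) (at y)"
      using m.d[OF l, of y] eqm[OF y0] y0 by simp
    then show ?thesis
      by (rule has_field_derivative_transform_within_open[where S="{..<0}"]) (use y0 eqm in auto)
  qed
  show ?thesis
  proof
    show "2 \<le> k" by (rule p.k2)
    show "open (- {0::real})" by auto
    show "- {0::real} \<noteq> {}" using zero_neq_one by blast
    show "\<exists>s. (s = 1 \<or> s = -1) \<and> (\<forall>r\<ge>0. x + s * r \<in> - {0})" if "x \<in> - {0}" for x :: real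
    proof (cases "0 < x")
      case True then show ?thesis by (intro exI[of _ 1]) auto
    next
      case False then show ?thesis using that by (intro exI[of _ "-1"]) auto
    qed
    show "(nderiv (- {0}) l v has_real_derivative nderiv (- {0}) (Suc l) v y) (at y)" if "l < k" "y \<in> - {0}" for l y
      using der that by simp
    show "continuous_on (- {0}) (nderiv (- {0}) l v)" if l: "l \<le> k" for l
    proof -
      have "continuous_on {0<..} (nderiv (- {0}) l v)"
        by (rule continuous_on_eq[OF p.c[OF l]]) (simp add: eqp)
      moreover have "continuous_on {..<0} (nderiv (- {0}) l v)"
        by (rule continuous_on_eq[OF m.c[OF l]]) (simp add: eqm)
      ultimately have "continuous_on ({0<..} \<union> {..<0}) (nderiv (- {0}) l v)"
        by (intro continuous_on_open_Un) auto
      moreover have "{0<..} \<union> {..<0} = - {0::real}" by auto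
      ultimately show ?thesis by simp
    qed
    show "\<exists>K. \<forall>l\<le>k. \<forall>y\<in>- {0}. \<bar>nderiv (- {0}) l v y\<bar> \<le> K"
    proof -
      obtain K1 where K1: "\<forall>l\<le>k. \<forall>y\<in>{0<..}. \<bar>nderiv {0<..} l v y\<bar> \<le> K1" using p.b by blast
      obtain K2 where K2: "\<forall>l\<le>k. \<forall>y\<in>{..<0}. \<bar>nderiv {..<0} l v y\<bar> \<le> K2" using m.b by blast
      have "\<bar>nderiv (- {0}) l v y\<bar> \<le> max K1 K2" if "l \<le> k" "y \<in> - {0}" for l y
      proof (cases "0 < y")
        case True
        then have "\<bar>nderiv {0<..} l v y\<bar> \<le> K1" using K1 that by simp
        then show ?thesis using eqp[OF True] by simp
      next
        case False
        then have y0: "y < 0" using that by simp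
        then have "\<bar>nderiv {..<0} l v y\<bar> \<le> K2" using K2 that by simp
        then show ?thesis using eqm[OF y0] by simp
      qed
      then show ?thesis by (intro exI[of _ "max K1 K2"]) simp
    qed
  qed
qed

lemma dnorm_subset:
  assumes "norm_data k H v" "norm_data k S v" "H \<subseteq> S"
  shows "dnorm k H v l \<le> dnorm k S v l"
proof (cases "l \<le> k")
  case True
  interpret H: norm_data k H v by fact
  interpret S: norm_data k S v by fact
  show ?thesis
  proof (rule H.dnorm_le[OF True])
    fix x assume x: "x \<in> H"
    have "\<bar>nderiv S l v x\<bar> \<le> dnorm k S v l" by (rule S.dnorm_ge[OF True]) (use x assms(3) in auto)
    then show "\<bar>nderiv H l v x\<bar> \<le> dnorm k S v l"
      using nderiv_open_subset[OF H.S(1) S.S(1) assms(3) x] by simp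
  qed
qed (simp add: dnorm_def)

lemma snorm_mono: "norm_data k S v \<Longrightarrow> j \<le> j' \<Longrightarrow> snorm k S v j \<le> snorm k S v j'"
  by (rule lift_Suc_mono_le[of "snorm k S v"]) (auto intro: norm_data.snorm_Suc)

text \<open>
\<open>w\<close> is the extension of \<open>v\<close> to the closed half-line, \<open>w'\<close> its derivative; the bounds are the norms of
\<open>v\<close> on the open half-line.
\<close>

definition extends :: "nat \<Rightarrow> real set \<Rightarrow> (real \<Rightarrow> real) \<Rightarrow> (real \<Rightarrow> real) \<Rightarrow> (real \<Rightarrow> real) \<Rightarrow> bool" where
  "extends k H v w w' \<longleftrightarrow> (\<forall>x\<in>H. w x = v x) \<and>
     (\<forall>z\<in>insert 0 H. (w has_real_derivative w' z) (at z within insert 0 H)) \<and>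
     WB (k - 1) (\<lambda>j. dnorm k H v (Suc j)) (insert 0 H) w' \<and>
     uniformly_continuous_on (insert 0 H) w \<and> (\<forall>z\<in>insert 0 H. \<bar>w z\<bar> \<le> dnorm k H v 0)"

lemma extends_exists:
  assumes k: "2 \<le> k" and H: "H = {0<..} \<or> H = {..<0}" and B: "BU k H v"
  shows "\<exists>w w'. extends k H v w w'"
proof -
  have o: "open H" "convex H" "0 \<notin> H" "closure H = insert 0 H" using H by auto
  interpret norm_data k H v by (rule norm_data_halfline[OF k H B])
  obtain K where W: "WB k (\<lambda>_. K) H v" using B unfolding BU_def by auto
  note nd = nondegenerate_open[OF o(1)]
  have rep: "\<exists>l. bs = replicate l 1 \<and> length bs = l" if "set bs \<subseteq> Basis" for bs :: "real list"
  proof (intro exI conjI)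
    show "bs = replicate (length bs) 1" by (rule replicate_eqI) (use that in auto)
  qed simp
  have WD: "WB k (dnorm k H v) H v"
  proof (rule WB_of_iter_pderiv)
    fix bs :: "real list" assume b: "set bs \<subseteq> Basis"
    { assume l: "length bs < k"
      have "WB (Suc (k - Suc (length bs))) (\<lambda>l. K) H (iter_pderiv H bs v)"
        using WB_iter_pderiv[OF nd W b] l by (simp add: Suc_diff_Suc)
      then show "iter_pderiv H bs v differentiable_on H" by (rule WB_imp_differentiable) }
    { assume l: "length bs \<le> k"
      show "uniformly_continuous_on H (iter_pderiv H bs v)"
        using WB_uc[OF WB_iter_pderiv[OF nd W b l]] . }
    { fix x assume l: "length bs \<le> k" and x: "x \<in> H"
      obtain l' where "bs = replicate l' 1" "length bs = l'" using rep[OF b] by auto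
      then show "\<bar>iter_pderiv H bs v x\<bar> \<le> dnorm k H v (length bs)"
        using dnorm_ge[OF l x] by (simp add: nderiv_def) }
  qed
  obtain w where w: "\<forall>x\<in>H. w x = v x" "WB k (dnorm k H v) (insert 0 H) w"
    using WB_extend_0[OF o WD] by auto
  have "k = Suc (k - 1)" using k by simp
  then have w2: "WB (Suc (k - 1)) (dnorm k H v) (insert 0 H) w" using w(2) by simp
  obtain w' where w': "\<And>x. x \<in> insert 0 H \<Longrightarrow> (w has_real_derivative w' x) (at x within insert 0 H)"
    "WB (k - 1) (\<lambda>j. dnorm k H v (Suc j)) (insert 0 H) w'" by (rule WB_1D_SucE[OF w2]) (rule that)
  have "extends k H v w w'" unfolding extends_def
    by (intro conjI ballI w(1) w' WB_uc[OF w(2)] WB_bound[OF w(2)])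
  then show ?thesis by blast
qed

text \<open>
The half-line \<open>H\<close> carries the data, the larger set \<open>S\<close> provides the weights. Both choices \<open>S = H\<close> and
\<open>S = - {0}\<close> occur: the first for the decay of the solution, the second for the shock.
\<close>

lemma side_data_intro:
  fixes P :: "'i set" and w :: "'i \<Rightarrow> real \<Rightarrow> real"
  assumes k: "2 \<le> k" and S: "\<And>i. i \<in> P \<Longrightarrow> norm_data k S (w i)" and H: "\<And>i. i \<in> P \<Longrightarrow> norm_data k H (w i)"
    and HS: "H \<subseteq> S" and ext: "\<And>i. i \<in> P \<Longrightarrow> extends k H (w i) (v i) (v' i)"
    and small: "\<And>i. i \<in> P \<Longrightarrow> dnorm k S (w i) 0 \<le> \<epsilon>" "\<And>i. i \<in> P \<Longrightarrow> dnorm k S (w i) 1 \<le> \<epsilon>"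
    and e: "\<epsilon> \<le> 1 / 2" "\<epsilon> \<le> \<epsilon>'"
    and pi: "\<And>z. \<pi> z \<in> insert 0 H" "\<And>z. z \<in> insert 0 H \<Longrightarrow> \<pi> z = z" "\<And>z z'. \<bar>\<pi> z - \<pi> z'\<bar> \<le> \<bar>z - z'\<bar>"
    and conv: "convex (insert 0 H)"
  shows "side_data P (\<lambda>i. weight k (snorm k S (w i))) ((16 ^ k) ^ k) k \<epsilon>' (insert 0 H) v v'
    (\<lambda>i. snorm k S (w i) 1) (\<lambda>i. dnorm k S (w i) 0) \<pi>"
proof -
  interpret weights P "\<lambda>i. weight k (snorm k S (w i))" "(16 ^ k) ^ k"
  proof
    show "(1::real) \<le> (16 ^ k) ^ k" by (intro one_le_power) auto
  qed (rule norm_data.weight_props[OF S]; assumption)+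
  have sn1: "snorm k S (w i) 1 = dnorm k S (w i) 0 + dnorm k S (w i) 1" for i by (simp add: snorm_def)
  have dd: "dnorm k H (w i) l \<le> dnorm k S (w i) l" if "i \<in> P" for i l
    by (rule dnorm_subset[OF H[OF that] S[OF that] HS])
  note ext_conj = ext[unfolded extends_def, THEN conjunct2]
  have E1: "\<forall>z\<in>insert 0 H. (v i has_real_derivative v' i z) (at z within insert 0 H)" if "i \<in> P" for i
    by (rule ext_conj[OF that, THEN conjunct1])
  have E2: "WB (k - 1) (\<lambda>j. dnorm k H (w i) (Suc j)) (insert 0 H) (v' i)" if "i \<in> P" for i
    by (rule ext_conj[OF that, THEN conjunct2, THEN conjunct1])
  have E3: "uniformly_continuous_on (insert 0 H) (v i)" if "i \<in> P" for i
    by (rule ext_conj[OF that, THEN conjunct2, THEN conjunct2, THEN conjunct1])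
  have E4: "\<forall>z\<in>insert 0 H. \<bar>v i z\<bar> \<le> dnorm k H (w i) 0" if "i \<in> P" for i
    by (rule ext_conj[OF that, THEN conjunct2, THEN conjunct2, THEN conjunct2])
  show ?thesis
  proof
    show "UB (k - 1) (\<lambda>i. snorm k S (w i) 1) (\<lambda>_. insert 0 H) v'"
    proof (rule UB_I[of 1])
      fix i assume i: "i \<in> P"
      show "0 \<le> snorm k S (w i) 1" by (rule norm_data.snorm_nonneg[OF S[OF i]])
      show "WB (k - 1) (\<lambda>j. 1 * (snorm k S (w i) 1 * weight k (snorm k S (w i)) j)) (insert 0 H) (v' i)"
      proof (rule WB_mono[OF E2[OF i]])
        fix j assume "j \<le> k - 1"
        then have "j < k" using k by simp
        from order_trans[OF dd[OF i] norm_data.dnorm_Suc_le[OF S[OF i] this]]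
        show "dnorm k H (w i) (Suc j) \<le> 1 * (snorm k S (w i) 1 * weight k (snorm k S (w i)) j)" by simp
      qed
    qed simp
  next
    fix i assume i: "i \<in> P"
    show "uniformly_continuous_on (insert 0 H) (v i)" by (rule E3[OF i])
    show "dnorm k S (w i) 0 \<le> snorm k S (w i) 1" "0 \<le> dnorm k S (w i) 0"
      unfolding sn1 using norm_data.dnorm_nonneg[OF S[OF i], of 0] norm_data.dnorm_nonneg[OF S[OF i], of 1]
      by simp_all
    show "snorm k S (w i) 1 \<le> 1" unfolding sn1 using small[OF i] e(1) by linarith
    fix z assume z: "z \<in> insert 0 H"
    show "(v i has_real_derivative v' i z) (at z within insert 0 H)" by (rule bspec[OF E1[OF i] z])
    show b: "\<bar>v i z\<bar> \<le> dnorm k S (w i) 0" using bspec[OF E4[OF i] z] dd[OF i, of 0] by linarith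
    show "\<bar>v i z\<bar> \<le> \<epsilon>'" using b small(1)[OF i] e(2) by linarith
    have "\<bar>v' i z\<bar> \<le> dnorm k H (w i) (Suc 0)" by (rule WB_bound[OF E2[OF i] z])
    then show "\<bar>v' i z\<bar> \<le> \<epsilon>'" using dd[OF i, of 1] small(2)[OF i] e(2) by simp
  qed (fact pi conv)+
qed

lemma Wkinf_norm_le:
  assumes H: "open H" and W: "WB k N H F" and j: "j \<le> k" and B: "\<And>l. l \<le> j \<Longrightarrow> N l \<le> B"
  shows "Wkinf_norm j H F \<le> ereal ((real j + 1) * B)"
proof -
  note nd = nondegenerate_open[OF H]
  have "Linf_norm H (nderiv H l F) \<le> ereal B" if l: "l \<le> j" for l
  proof (rule Linf_norm_le[OF H nderiv_continuous[OF nd W]])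
    show "l \<le> k" using l j by simp
    show "\<bar>nderiv H l F x\<bar> \<le> B" if "x \<in> H" for x
      using nderiv_bound[OF nd W _ that, of l] B[OF l] l j by simp
  qed
  then have "Wkinf_norm j H F \<le> (\<Sum>l\<le>j. ereal B)"
    unfolding Wkinf_norm_def by (intro sum_mono) simp
  also have "\<dots> = ereal ((real j + 1) * B)" by (simp add: algebra_simps)
  finally show ?thesis .
qed

text \<open>
For the weights built from the norms of the data the product \<open>M * N (l - 1)\<close> is the norm of order \<open>l\<close>,
which turns the weighted estimate into one that is linear in the data.
\<close>

lemma (in side_region) Wkinf_decay:
  assumes H: "open H" and w0: "\<And>i. i \<in> P \<Longrightarrow> norm_data k H (w0 i)"
    and N: "N = (\<lambda>i. weight k (snorm k H (w0 i)))"
    and M: "M = (\<lambda>i. snorm k H (w0 i) 1)" "M0 = (\<lambda>i. dnorm k H (w0 i) 0)"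
  obtains c where "c \<ge> 0" "\<And>i t s j F. i \<in> P \<Longrightarrow> 0 \<le> t \<Longrightarrow> \<forall>y\<in>H. (t, y + s) \<in> C i \<Longrightarrow>
     \<forall>y\<in>H. F y = sol i (t, y + s) - u \<Longrightarrow> j \<le> k \<Longrightarrow>
     Wkinf_norm j H F \<le> Wkinf_norm j H (w0 i) * ereal (c * exp (lam * t))"
proof -
  obtain c where c: "c \<ge> 0" "\<And>i t s. i \<in> P \<Longrightarrow> 0 \<le> t \<Longrightarrow> (\<And>y. y \<in> H \<Longrightarrow> (t, y + s) \<in> C i) \<Longrightarrow>
     WB k (\<lambda>j. c * E t * (if j = 0 then M0 i else M i * N i (j - 1))) H (\<lambda>y. sol i (t, y + s) - u)"
  proof (rule slice_estimate[OF H])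
    fix c assume c: "0 \<le> c" and est: "\<And>i t s. i \<in> P \<Longrightarrow> 0 \<le> t \<Longrightarrow> (\<And>y. y \<in> H \<Longrightarrow> (t, y + s) \<in> C i) \<Longrightarrow>
      WB k (\<lambda>j. c * E t * (if j = 0 then M0 i else M i * N i (j - 1))) H (\<lambda>y. sol i (t, y + s) - u)"
    show thesis
    proof (rule that[OF c])
      fix i and t s :: real assume i: "i \<in> P" and t: "0 \<le> t" and HC: "\<And>y. y \<in> H \<Longrightarrow> (t, y + s) \<in> C i"
      show "WB k (\<lambda>j. c * E t * (if j = 0 then M0 i else M i * N i (j - 1))) H (\<lambda>y. sol i (t, y + s) - u)"
        by (rule est[OF i t HC])
    qed
  qed
  show ?thesis
  proof (rule that[of "(real k + 1) * c"])
    fix i and t s :: real and j and F :: "real \<Rightarrow> real"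
    assume i: "i \<in> P" and t: "0 \<le> t" and HC: "\<forall>y\<in>H. (t, y + s) \<in> C i"
      and F: "\<forall>y\<in>H. F y = sol i (t, y + s) - u" and j: "j \<le> k"
    interpret nd: norm_data k H "w0 i" by (rule w0[OF i])
    have W: "WB k (\<lambda>j. c * E t * (if j = 0 then M0 i else M i * N i (j - 1))) H F"
      by (rule WB_cong[OF c(2)[OF i t bspec[OF HC]]]) (use F in simp_all)
    have cE: "0 \<le> c * E t" using c(1) E_range[OF t] by simp
    have sj: "0 \<le> snorm k H (w0 i) j" by (rule nd.snorm_nonneg)
    have "c * E t * (if l = 0 then M0 i else M i * N i (l - 1)) \<le> c * E t * snorm k H (w0 i) j" if l: "l \<le> j" for l
    proof (rule mult_left_mono[OF _ cE])
      show "(if l = 0 then M0 i else M i * N i (l - 1)) \<le> snorm k H (w0 i) j"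
      proof (cases l)
        case 0
        then show ?thesis using nd.dnorm_le_snorm[of 0 j] by (simp add: M)
      next
        case (Suc l')
        have "snorm k H (w0 i) 1 * weight k (snorm k H (w0 i)) l' \<le> snorm k H (w0 i) (Suc l')"
          by (rule nd.snorm_1_weight) (use Suc l j in simp)
        also have "\<dots> \<le> snorm k H (w0 i) j" by (rule snorm_mono[OF w0[OF i]]) (use Suc l in simp)
        finally show ?thesis using Suc by (simp add: M N)
      qed
    qed
    from Wkinf_norm_le[OF H W j this]
    have "Wkinf_norm j H F \<le> ereal ((real j + 1) * (c * E t * snorm k H (w0 i) j))" .
    also have "\<dots> \<le> ereal ((real k + 1) * (c * E t * snorm k H (w0 i) j))"
      using j cE sj by (simp add: mult_right_mono)
    also have "\<dots> = Wkinf_norm j H (w0 i) * ereal ((real k + 1) * c * exp (lam * t))"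
      using nd.Wkinf_eq[OF j] by (simp add: E_def algebra_simps)
    finally show "Wkinf_norm j H F \<le> Wkinf_norm j H (w0 i) * ereal ((real k + 1) * c * exp (lam * t))" .
  qed (use c(1) in simp)
qed

theorem proposition2p5:
  fixes k :: nat and f g :: "real \<Rightarrow> real" and \<sigma> um up :: real
  assumes k: "k \<ge> 2"
    and f: "Ck_on (k + 1) UNIV f"
    and g: "Ck_on k UNIV g"
    and "up \<noteq> um"
    and equilibrium: "g up = 0" "g um = 0"
    and Rankine_Hugoniot: "f up - f um = \<sigma> * (up - um)"
    and Oleinik: "strict_Oleinik f \<sigma> um up"
    and spectral_stability: "deriv g up < 0" "deriv g um < 0"
  shows "\<exists>\<epsilon>>0. \<exists>C>0. \<forall>(\<psi>0::real) (v0::real \<Rightarrow> real).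
    BUC k (- {0}) v0 \<and>
    Linf_norm (- {0}) v0 \<le> ereal \<epsilon> \<and>
    Linf_norm (- {0}) (nderiv (- {0}) 1 v0) \<le> ereal \<epsilon> \<longrightarrow>
    (\<exists>(\<psi>::real \<Rightarrow> real) (u::real \<times> real \<Rightarrow> real).
      Ck_on (k + 1) {0..} \<psi> \<and>
      BUC k (Omega \<psi>) u \<and>
      \<psi> 0 = \<psi>0 \<and>
      (\<forall>x. x \<noteq> \<psi>0 \<longrightarrow> u (0, x) = shock_profile um up (x - \<psi>0) + v0 (x - \<psi>0)) \<and>
      entropy_solution f g (\<lambda>x. shock_profile um up (x - \<psi>0) + v0 (x - \<psi>0)) u \<and>
      (\<forall>t\<ge>0. \<forall>j\<le>k.
        Wkinf_norm j {0<..} (\<lambda>x. u (t, x + \<psi> t) - up)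
          \<le> Wkinf_norm j {0<..} v0 * ereal (C * exp (deriv g up * t)) \<and>
        Wkinf_norm j {..<0} (\<lambda>x. u (t, x + \<psi> t) - um)
          \<le> Wkinf_norm j {..<0} v0 * ereal (C * exp (deriv g um * t)) \<and>
        ereal \<bar>nderiv {0..} j (\<lambda>s. nderiv {0..} 1 \<psi> s - \<sigma>) t\<bar>
          \<le> Wkinf_norm j (- {0}) v0
             * ereal (C * exp (max (deriv g up) (deriv g um) * t))))"
proof -
  let ?R = "- {0::real}" and ?L = "((16::real) ^ k) ^ k"
  have fd: "\<And>x. (f has_real_derivative deriv f x) (at x)" and f'c: "continuous_on UNIV (deriv f)"
    using Ck_on_Suc_UNIV[of k f] f Ck_on_continuous by auto
  obtain \<delta>1 where d1: "0 < \<delta>1" "\<And>a b \<kappa>. \<bar>a - up\<bar> \<le> \<delta>1 \<Longrightarrow> \<bar>b - um\<bar> \<le> \<delta>1 \<Longrightarrow>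
      b \<le> \<kappa> \<and> \<kappa> \<le> a \<or> a \<le> \<kappa> \<and> \<kappa> \<le> b \<Longrightarrow> 0 \<le> (f \<kappa> - f b - (f a - f b) / (a - b) * (\<kappa> - b)) * (a - b)"
    by (rule Oleinik_perturbation[OF fd f'c \<open>up \<noteq> um\<close> Rankine_Hugoniot Oleinik]) (rule that)
  have lax: "deriv f up < \<sigma>" "\<sigma> < deriv f um" using Oleinik by (auto simp: strict_Oleinik_def)
  obtain \<delta>2 where d2: "0 < \<delta>2" "\<delta>2 \<le> \<bar>up - um\<bar> / 4"
    "\<And>a a' b b'. \<bar>a - up\<bar> \<le> \<delta>2 \<Longrightarrow> \<bar>a' - up\<bar> \<le> \<delta>2 \<Longrightarrow> \<bar>b - um\<bar> \<le> \<delta>2 \<Longrightarrow> \<bar>b' - um\<bar> \<le> \<delta>2 \<Longrightarrow>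
       deriv f a' < (f a - f b) / (a - b) \<and> (f a - f b) / (a - b) < deriv f b'"
    by (rule Lax_perturbation[OF fd f'c \<open>up \<noteq> um\<close> Rankine_Hugoniot lax]) (rule that)
  define r0 where "r0 = min \<delta>1 \<delta>2"
  have r0: "0 < r0" "r0 \<le> \<delta>1" "r0 \<le> \<delta>2" using d1 d2 by (auto simp: r0_def)
  obtain rp \<rho>p hp hp' qp qp' \<beta>p \<beta>p' \<epsilon>p where rp: "0 < rp" "rp \<le> r0" "0 < \<epsilon>p"
    and SGp: "\<And>(P::(real \<times> (real \<Rightarrow> real)) set) N L T v v' M M0 \<pi>. side_data P N L k \<epsilon>p T v v' M M0 \<pi> \<Longrightarrow>
        side_global P N L k f g up rp \<rho>p (deriv g up) hp hp' qp qp' \<beta>p \<beta>p' T v v' M M0 \<pi>"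
    by (rule side_construction[OF k f g equilibrium(1) spectral_stability(1) r0(1)]) (rule that)
  obtain rm \<rho>m hm hm' qm qm' \<beta>m \<beta>m' \<epsilon>m where rm: "0 < rm" "rm \<le> r0" "0 < \<epsilon>m"
    and SGm: "\<And>(P::(real \<times> (real \<Rightarrow> real)) set) N L T v v' M M0 \<pi>. side_data P N L k \<epsilon>m T v v' M M0 \<pi> \<Longrightarrow>
        side_global P N L k f g um rm \<rho>m (deriv g um) hm hm' qm qm' \<beta>m \<beta>m' T v v' M M0 \<pi>"
    by (rule side_construction[OF k f g equilibrium(2) spectral_stability(2) r0(1)]) (rule that)
  define \<epsilon> where "\<epsilon> = min (1 / 2) (min \<epsilon>p \<epsilon>m)"
  have e: "0 < \<epsilon>" "\<epsilon> \<le> 1 / 2" "\<epsilon> \<le> \<epsilon>p" "\<epsilon> \<le> \<epsilon>m" using rp rm by (auto simp: \<epsilon>_def)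
  \<comment> \<open>All admissible data at once: constants obtained for the family are uniform.\<close>
  define P where "P = {i :: real \<times> (real \<Rightarrow> real). BUC k ?R (snd i) \<and> Linf_norm ?R (snd i) \<le> ereal \<epsilon> \<and>
      Linf_norm ?R (nderiv ?R 1 (snd i)) \<le> ereal \<epsilon>}"
  have Pd: "BUC k ?R (snd i)" "Linf_norm ?R (snd i) \<le> ereal \<epsilon>" "Linf_norm ?R (nderiv ?R 1 (snd i)) \<le> ereal \<epsilon>"
    if "i \<in> P" for i using that by (auto simp: P_def)
  have BUp: "BU k {0<..} (snd i)" if "i \<in> P" for i
    by (rule BUC_imp_BU[OF Pd(1)[OF that]]) (simp add: components_real_minus_0)
  have BUm: "BU k {..<0} (snd i)" if "i \<in> P" for i
    by (rule BUC_imp_BU[OF Pd(1)[OF that]]) (simp add: components_real_minus_0)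
  have ndp: "norm_data k {0<..} (snd i)" if "i \<in> P" for i by (rule norm_data_halfline[OF k _ BUp[OF that]]) simp
  have ndm: "norm_data k {..<0} (snd i)" if "i \<in> P" for i by (rule norm_data_halfline[OF k _ BUm[OF that]]) simp
  have nd: "norm_data k ?R (snd i)" if "i \<in> P" for i by (rule norm_data_punctured[OF ndp[OF that] ndm[OF that]])
  have small: "dnorm k ?R (snd i) 0 \<le> \<epsilon>" "dnorm k ?R (snd i) 1 \<le> \<epsilon>" if "i \<in> P" for i
    using norm_data.Linf_eq[OF nd[OF that], of 0] norm_data.Linf_eq[OF nd[OF that], of 1] Pd(2,3)[OF that] k
    by (simp_all add: nderiv_def)
  have "\<exists>w. extends k {0<..} (snd i) (fst w) (snd w)" if "i \<in> P" for i
    using extends_exists[OF k _ BUp[OF that]] by simp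
  then have "\<forall>i\<in>P. \<exists>w. extends k {0<..} (snd i) (fst w) (snd w)" by (rule ballI)
  from bchoice[OF this] obtain wp where wp: "\<forall>i\<in>P. extends k {0<..} (snd i) (fst (wp i)) (snd (wp i))" ..
  have "\<exists>w. extends k {..<0} (snd i) (fst w) (snd w)" if "i \<in> P" for i
    using extends_exists[OF k _ BUm[OF that]] by simp
  then have "\<forall>i\<in>P. \<exists>w. extends k {..<0} (snd i) (fst w) (snd w)" by (rule ballI)
  from bchoice[OF this] obtain wm where wm: "\<forall>i\<in>P. extends k {..<0} (snd i) (fst (wm i)) (snd (wm i))" ..
  define vp where "vp = (\<lambda>i. fst (wp i))"
  define vp' where "vp' = (\<lambda>i. snd (wp i))"
  define vm where "vm = (\<lambda>i. fst (wm i))"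
  define vm' where "vm' = (\<lambda>i. snd (wm i))"
  have exp: "extends k {0<..} (snd i) (vp i) (vp' i)" if "i \<in> P" for i
    unfolding vp_def vp'_def by (rule bspec[OF wp that])
  have exm: "extends k {..<0} (snd i) (vm i) (vm' i)" if "i \<in> P" for i
    unfolding vm_def vm'_def by (rule bspec[OF wm that])
  have Tp: "insert 0 {0<..} = {0::real..}" and Tm: "insert 0 {..<0} = {..0::real}" by auto
  have smallS: "dnorm k S (snd i) 0 \<le> \<epsilon>" "dnorm k S (snd i) 1 \<le> \<epsilon>" if "norm_data k S (snd i)" "S \<subseteq> ?R" "i \<in> P" for S i
    using dnorm_subset[OF that(1) nd[OF that(3)] that(2), of 0] dnorm_subset[OF that(1) nd[OF that(3)] that(2), of 1]
      small[OF that(3)] by simp_all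
  have sdp: "side_data P (\<lambda>i. weight k (snorm k S (snd i))) ?L k \<epsilon>p {0..} vp vp'
      (\<lambda>i. snorm k S (snd i) 1) (\<lambda>i. dnorm k S (snd i) 0) (max 0)"
    if ndS: "\<And>i. i \<in> P \<Longrightarrow> norm_data k S (snd i)" and S: "S \<subseteq> ?R" "{0<..} \<subseteq> S" for S
    by (rule side_data_intro[OF k ndS ndp S(2) exp smallS[OF ndS S(1)] e(2,3), unfolded Tp]) auto
  have sdm: "side_data P (\<lambda>i. weight k (snorm k S (snd i))) ?L k \<epsilon>m {..0} vm vm'
      (\<lambda>i. snorm k S (snd i) 1) (\<lambda>i. dnorm k S (snd i) 0) (min 0)"
    if ndS: "\<And>i. i \<in> P \<Longrightarrow> norm_data k S (snd i)" and S: "S \<subseteq> ?R" "{..<0} \<subseteq> S" for S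
    by (rule side_data_intro[OF k ndS ndm S(2) exm smallS[OF ndS S(1)] e(2,4), unfolded Tm]) auto
  have sub: "{0<..} \<subseteq> ?R" "{..<0} \<subseteq> ?R" by auto
  define c0 where "c0 = \<bar>up - um\<bar> / 2"
  define sg where "sg = sgn (up - um)"
  have c0: "0 < c0" and sg: "sg = 1 \<or> sg = - 1" using \<open>up \<noteq> um\<close> by (auto simp: c0_def sg_def sgn_if)
  have Jp: "\<bar>a - up\<bar> \<le> \<delta>1" "\<bar>a - up\<bar> \<le> \<delta>2" if "a \<in> {up - rp..up + rp}" for a
    using that rp r0 by auto
  have Jm: "\<bar>b - um\<bar> \<le> \<delta>1" "\<bar>b - um\<bar> \<le> \<delta>2" if "b \<in> {um - rm..um + rm}" for b
    using that rm r0 by auto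
  have sep: "c0 \<le> sg * (a - b)" if "a \<in> {up - rp..up + rp}" "b \<in> {um - rm..um + rm}" for a b
    using Jp(2)[OF that(1)] Jm(2)[OF that(2)] d2(2) \<open>up \<noteq> um\<close>
    by (cases "um < up") (auto simp: c0_def sg_def abs_le_iff)
  have Lax: "deriv f a' < (f a - f b) / (a - b) \<and> (f a - f b) / (a - b) < deriv f b'"
    if "a \<in> {up - rp..up + rp}" "a' \<in> {up - rp..up + rp}" "b \<in> {um - rm..um + rm}" "b' \<in> {um - rm..um + rm}"
    for a a' b b' by (rule d2(3)[OF Jp(2)[OF that(1)] Jp(2)[OF that(2)] Jm(2)[OF that(3)] Jm(2)[OF that(4)]])
  have Ol: "0 \<le> (f \<kappa> - f b - (f a - f b) / (a - b) * (\<kappa> - b)) * (a - b)"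
    if "a \<in> {up - rp..up + rp}" "b \<in> {um - rm..um + rm}" "b \<le> \<kappa> \<and> \<kappa> \<le> a \<or> a \<le> \<kappa> \<and> \<kappa> \<le> b" for a b \<kappa>
    by (rule d1(2)[OF Jp(1)[OF that(1)] Jm(1)[OF that(2)] that(3)])
  interpret ts: two_sides P "\<lambda>i. weight k (snorm k ?R (snd i))" ?L k f g up rp \<rho>p "deriv g up" hp hp' qp qp' \<beta>p \<beta>p' vp vp'
    "\<lambda>i. snorm k ?R (snd i) 1" "\<lambda>i. dnorm k ?R (snd i) 0" fst um rm \<rho>m "deriv g um" hm hm' qm qm' \<beta>m \<beta>m' vm vm' \<sigma> c0 sg
    by (rule two_sides.intro, rule SGp[OF sdp[OF nd order_refl sub(1)]], assumption,
        rule SGm[OF sdm[OF nd order_refl sub(2)]], assumption,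
        (rule two_sides_axioms.intro; fact g sg c0 sep Lax Ol Rankine_Hugoniot))
  \<comment> \<open>The solution does not depend on the weights, so the estimates may be repeated with those of one half-line.\<close>
  interpret gp: side_global P "\<lambda>i. weight k (snorm k {0<..} (snd i))" ?L k f g up rp \<rho>p "deriv g up" hp hp' qp qp' \<beta>p \<beta>p' "{0..}" vp vp'
    "\<lambda>i. snorm k {0<..} (snd i) 1" "\<lambda>i. dnorm k {0<..} (snd i) 0" "max 0" fst
    by (rule SGp[OF sdp[OF ndp sub(1) order_refl]])
  interpret gm: side_global P "\<lambda>i. weight k (snorm k {..<0} (snd i))" ?L k f g um rm \<rho>m "deriv g um" hm hm' qm qm' \<beta>m \<beta>m' "{..0}" vm vm'
    "\<lambda>i. snorm k {..<0} (snd i) 1" "\<lambda>i. dnorm k {..<0} (snd i) 0" "min 0" fst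
    by (rule SGm[OF sdm[OF ndm sub(2) order_refl]])
  interpret rp: side_region P "\<lambda>i. weight k (snorm k {0<..} (snd i))" ?L k f g up rp \<rho>p "deriv g up" hp hp' qp qp' \<beta>p \<beta>p' "{0..}" vp vp'
    "\<lambda>i. snorm k {0<..} (snd i) 1" "\<lambda>i. dnorm k {0<..} (snd i) 0" "max 0" fst "\<lambda>i. upper (ts.\<psi> i)"
    by unfold_locales (rule ts.rr.C_Dom)
  interpret rm: side_region P "\<lambda>i. weight k (snorm k {..<0} (snd i))" ?L k f g um rm \<rho>m "deriv g um" hm hm' qm qm' \<beta>m \<beta>m' "{..0}" vm vm'
    "\<lambda>i. snorm k {..<0} (snd i) 1" "\<lambda>i. dnorm k {..<0} (snd i) 0" "min 0" fst "\<lambda>i. lower (ts.\<psi> i)"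
    by unfold_locales (rule ts.lr.C_Dom)
  obtain c1 where c1: "0 \<le> c1" "\<And>i t s j F. i \<in> P \<Longrightarrow> 0 \<le> t \<Longrightarrow> \<forall>y\<in>{0<..}. (t, y + s) \<in> upper (ts.\<psi> i) \<Longrightarrow>
     \<forall>y\<in>{0<..}. F y = ts.rt.sol i (t, y + s) - up \<Longrightarrow> j \<le> k \<Longrightarrow>
     Wkinf_norm j {0<..} F \<le> Wkinf_norm j {0<..} (snd i) * ereal (c1 * exp (deriv g up * t))"
    by (rule rp.Wkinf_decay[OF open_greaterThan ndp refl refl refl]) (assumption, rule that)
  obtain c2 where c2: "0 \<le> c2" "\<And>i t s j F. i \<in> P \<Longrightarrow> 0 \<le> t \<Longrightarrow> \<forall>y\<in>{..<0}. (t, y + s) \<in> lower (ts.\<psi> i) \<Longrightarrow>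
     \<forall>y\<in>{..<0}. F y = ts.lf.sol i (t, y + s) - um \<Longrightarrow> j \<le> k \<Longrightarrow>
     Wkinf_norm j {..<0} F \<le> Wkinf_norm j {..<0} (snd i) * ereal (c2 * exp (deriv g um * t))"
    by (rule rm.Wkinf_decay[OF open_lessThan ndm refl refl refl]) (assumption, rule that)
  obtain c3 where c3: "c3 \<ge> 0" "\<And>i t. i \<in> P \<Longrightarrow> 0 \<le> t \<Longrightarrow>
      \<bar>ts.\<psi>' i t - \<sigma>\<bar> \<le> c3 * exp (ts.lmax * t) * dnorm k ?R (snd i) 0"
    by (rule ts.psi'_decay_0) (rule that)
  obtain c4 where c4: "c4 \<ge> 0" "\<And>i t j. i \<in> P \<Longrightarrow> 0 \<le> t \<Longrightarrow> j < k \<Longrightarrow>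
      \<bar>nderiv {0..} (Suc j) (\<lambda>s. ts.\<psi>' i s - \<sigma>) t\<bar>
        \<le> c4 * exp (ts.lmax * t) * (snorm k ?R (snd i) 1 * weight k (snorm k ?R (snd i)) j)"
    by (rule ts.psi'_decay_Suc) (rule that)
  define C where "C = 1 + c1 + c2 + c3 + c4"
  have C: "0 < C" "c1 \<le> C" "c2 \<le> C" "c3 \<le> C" "c4 \<le> C" using c1(1) c2(1) c3(1) c4(1) by (auto simp: C_def)
  have lm: "ts.lmax = max (deriv g up) (deriv g um)" by (rule ts.lmax_def)
  have main: "\<exists>(\<psi>::real \<Rightarrow> real) (u::real \<times> real \<Rightarrow> real).
      Ck_on (k + 1) {0..} \<psi> \<and>
      BUC k (Omega \<psi>) u \<and>
      \<psi> 0 = \<psi>0 \<and>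
      (\<forall>x. x \<noteq> \<psi>0 \<longrightarrow> u (0, x) = shock_profile um up (x - \<psi>0) + v0 (x - \<psi>0)) \<and>
      entropy_solution f g (\<lambda>x. shock_profile um up (x - \<psi>0) + v0 (x - \<psi>0)) u \<and>
      (\<forall>t\<ge>0. \<forall>j\<le>k.
        Wkinf_norm j {0<..} (\<lambda>x. u (t, x + \<psi> t) - up)
          \<le> Wkinf_norm j {0<..} v0 * ereal (C * exp (deriv g up * t)) \<and>
        Wkinf_norm j {..<0} (\<lambda>x. u (t, x + \<psi> t) - um)
          \<le> Wkinf_norm j {..<0} v0 * ereal (C * exp (deriv g um * t)) \<and>
        ereal \<bar>nderiv {0..} j (\<lambda>s. nderiv {0..} 1 \<psi> s - \<sigma>) t\<bar>
          \<le> Wkinf_norm j (- {0}) v0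
             * ereal (C * exp (max (deriv g up) (deriv g um) * t)))"
    if hyp: "BUC k ?R v0 \<and> Linf_norm ?R v0 \<le> ereal \<epsilon> \<and> Linf_norm ?R (nderiv ?R 1 v0) \<le> ereal \<epsilon>" for \<psi>0 v0
  proof -
    define i where "i = (\<psi>0, v0)"
    have iP: "i \<in> P" and i12: "fst i = \<psi>0" "snd i = v0" using hyp by (auto simp: i_def P_def)
    have p0: "ts.\<psi> i 0 = \<psi>0" using ts.psi_0[OF iP] i12 by simp
    have u0: "ts.usol i (0, x) = shock_profile um up (x - \<psi>0) + v0 (x - \<psi>0)" if x: "x \<noteq> \<psi>0" for x
    proof (cases "\<psi>0 < x")
      case True
      have "vp i (x - \<psi>0) = v0 (x - \<psi>0)"
        using exp[OF iP, unfolded extends_def, THEN conjunct1] True i12 by simp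
      moreover have "ts.rt.sol i (0, x) = up + vp i (x - fst i)"
        by (rule ts.rt.sol_0[OF iP]) (use True i12 in simp)
      ultimately show ?thesis using True p0 i12 by (simp add: ts.usol_def shock_profile_def)
    next
      case False
      then have x': "x < \<psi>0" using x by simp
      have "vm i (x - \<psi>0) = v0 (x - \<psi>0)"
        using exm[OF iP, unfolded extends_def, THEN conjunct1] x' i12 by simp
      moreover have "ts.lf.sol i (0, x) = um + vm i (x - fst i)"
        by (rule ts.lf.sol_0[OF iP]) (use x' i12 in simp)
      ultimately show ?thesis using x' p0 i12 by (simp add: ts.usol_def shock_profile_def)
    qed
    have nonneg: "0 \<le> Wkinf_norm j S v0" if "norm_data k S (snd i)" "j \<le> k" for j S
      using norm_data.Wkinf_eq[OF that] norm_data.snorm_nonneg[OF that(1)] i12 by simp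
    have weaken: "W * ereal (c * exp z) \<le> W * ereal (C * exp z)" if "0 \<le> W" "c \<le> C" for W :: ereal and c z
      using that by (intro ereal_mult_left_mono) (auto intro: mult_right_mono)
    have right: "Wkinf_norm j {0<..} (\<lambda>x. ts.usol i (t, x + ts.\<psi> i t) - up)
        \<le> Wkinf_norm j {0<..} v0 * ereal (C * exp (deriv g up * t))" if t: "0 \<le> t" and j: "j \<le> k" for t j
    proof -
      have "Wkinf_norm j {0<..} (\<lambda>x. ts.usol i (t, x + ts.\<psi> i t) - up)
        \<le> Wkinf_norm j {0<..} (snd i) * ereal (c1 * exp (deriv g up * t))"
        by (rule c1(2)[OF iP t _ _ j, of "ts.\<psi> i t"]) (use t in \<open>auto simp: upper_def ts.usol_def\<close>)
      also have "\<dots> \<le> Wkinf_norm j {0<..} v0 * ereal (C * exp (deriv g up * t))"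
        unfolding i12 by (rule weaken[OF nonneg[OF ndp[OF iP] j] C(2)])
      finally show ?thesis .
    qed
    have left: "Wkinf_norm j {..<0} (\<lambda>x. ts.usol i (t, x + ts.\<psi> i t) - um)
        \<le> Wkinf_norm j {..<0} v0 * ereal (C * exp (deriv g um * t))" if t: "0 \<le> t" and j: "j \<le> k" for t j
    proof -
      have "Wkinf_norm j {..<0} (\<lambda>x. ts.usol i (t, x + ts.\<psi> i t) - um)
        \<le> Wkinf_norm j {..<0} (snd i) * ereal (c2 * exp (deriv g um * t))"
        by (rule c2(2)[OF iP t _ _ j, of "ts.\<psi> i t"]) (use t in \<open>auto simp: lower_def ts.usol_def\<close>)
      also have "\<dots> \<le> Wkinf_norm j {..<0} v0 * ereal (C * exp (deriv g um * t))"
        unfolding i12 by (rule weaken[OF nonneg[OF ndm[OF iP] j] C(3)])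
      finally show ?thesis .
    qed
    have shock: "ereal \<bar>nderiv {0..} j (\<lambda>s. nderiv {0..} 1 (ts.\<psi> i) s - \<sigma>) t\<bar>
          \<le> Wkinf_norm j ?R v0 * ereal (C * exp (max (deriv g up) (deriv g um) * t))" if t: "0 \<le> t" and j: "j \<le> k" for t j
    proof -
      let ?e = "exp (ts.lmax * t)" and ?s = "snorm k ?R (snd i) j"
      have s0: "0 \<le> ?s" by (rule norm_data.snorm_nonneg[OF nd[OF iP]])
      have up: "c * ?e * y \<le> C * ?e * ?s" if "c \<le> C" "0 \<le> c" "y \<le> ?s" "0 \<le> y" for c y
        using that C(1) by (intro mult_mono mult_right_mono) auto
      have "\<bar>nderiv {0..} j (\<lambda>s. ts.\<psi>' i s - \<sigma>) t\<bar> \<le> C * ?e * ?s"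
      proof (cases j)
        case 0
        have "\<bar>ts.\<psi>' i t - \<sigma>\<bar> \<le> c3 * ?e * dnorm k ?R (snd i) 0" by (rule c3(2)[OF iP t])
        also have "\<dots> \<le> C * ?e * ?s"
          by (rule up[OF C(4) c3(1)])
            (use norm_data.dnorm_le_snorm[OF nd[OF iP], of 0 j] norm_data.dnorm_nonneg[OF nd[OF iP]] in auto)
        finally show ?thesis using 0 by (simp add: nderiv_def)
      next
        case (Suc j')
        have j': "j' < k" using Suc j by simp
        have "\<bar>nderiv {0..} (Suc j') (\<lambda>s. ts.\<psi>' i s - \<sigma>) t\<bar>
            \<le> c4 * ?e * (snorm k ?R (snd i) 1 * weight k (snorm k ?R (snd i)) j')" by (rule c4(2)[OF iP t j'])
        also have "\<dots> \<le> C * ?e * ?s"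
        proof (rule up[OF C(5) c4(1)])
          show "snorm k ?R (snd i) 1 * weight k (snorm k ?R (snd i)) j' \<le> ?s"
            unfolding Suc by (rule norm_data.snorm_1_weight[OF nd[OF iP] j'])
          show "0 \<le> snorm k ?R (snd i) 1 * weight k (snorm k ?R (snd i)) j'"
            using norm_data.snorm_nonneg[OF nd[OF iP], of 1] norm_data.weight_props(2)[OF nd[OF iP], of j'] by simp
        qed
        finally show ?thesis unfolding Suc .
      qed
      then show ?thesis
        using ts.nderiv_psi[OF iP t, of j] norm_data.Wkinf_eq[OF nd[OF iP] j] i12 by (simp add: lm algebra_simps)
    qed
    show ?thesis
      by (intro exI[of _ "ts.\<psi> i"] exI[of _ "ts.usol i"] conjI allI impI ts.psi_Ck[OF iP] ts.usol_BUC[OF iP] p0 u0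
          ts.usol_entropy[OF iP] u0[symmetric] right left shock) (simp_all add: i12)
  qed
  show ?thesis
  proof (rule exI[of _ \<epsilon>], rule conjI[OF e(1)], rule exI[of _ C], rule conjI[OF C(1)], intro allI, rule impI)
  qed (rule main)
qed

end
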